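(* Let $\{X^{(x)}=(X,\mathbb{P}_x),\ x\in\mathbb{R}^\ast\}$ be a family of real-valued self-similar Markov processes of index $\alpha>0$, killed at the first hitting time of zero, such that $\mathbb{P}_x(H_1<\infty)=1$ for all $x\in\mathbb{R}^\ast$. For $n\ge0$ let $$\mathcal{X}^{(n)}_t=\frac{X_{H_n+|X_{H_n}|^{\alpha}t}}{|X_{H_n}|},\quad 0\le t<|X_{H_n}|^{-\alpha}(H_{n+1}-H_n),\qquad J_n=\frac{X_{H_{n+1}}}{X_{H_{n+1}-}}.$$ Then: (i) The paths between sign changes $(\mathcal{X}^{(n)},\ n\ge0)$ are independent under $\mathbb{P}_x$, for every $x\in\mathbb{R}^\ast$. Furthermore, for all $n\ge0$, the law of $$\big(\mathcal{X}^{(n)}_t,\ 0\le t<|X_{H_n}|^{-\alpha}(H_{n+1}-H_n)\big)\ \text{ under }\mathbb{P}_x$$ equals the law of $(X_t,\ 0\le t<H_1)$ under $\mathbb{P}_{\operatorname{sgn}(x)(-1)^n}$. Hence they are (up to sign, exponentials of) time-changed Lévy processes killed at an exponential time: for every $x\in\mathbb{R}^\ast$ and $n\geq 0$ there is a Lévy process $\xi$ killed at an independent exponential time $\zeta$ such that $\mathcal{X}^{(n)}$ under $\mathbb{P}_x$ has the same law as $\big(\operatorname{sgn}(x)(-1)^n\exp\{\xi_{\tau(t)}\},\ 0\le t<\int_0^{\zeta}e^{\alpha\xi_s}\,\mathrm{d}s\big)$, where $\tau(t)=\inf\{u>0:\int_0^ue^{\alpha\xi_s}\,\mathrm{d}s>t\}$.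 (ii) The random variables $J_n$, $n\ge0$, are independent under $\mathbb{P}_x$, for every $x\in\mathbb{R}^\ast$, and for every $n\ge0$ the law of $J_n$ under $\mathbb{P}_x$ equals the law of $J_0$ under $\mathbb{P}_{\operatorname{sgn}(x)(-1)^n}$. (iii) For every $n\ge0$, the process $\mathcal{X}^{(n)}$ and the random variable $J_n$ are independent under $\mathbb{P}_x$, for every $x\in\mathbb{R}^\ast$.
   Context: Notation: $\mathbb{R}^\ast=\mathbb{R}\setminus\{0\}$; $\operatorname{sgn}$ is the sign function; $\inf\emptyset=\infty$. A family of real-valued self-similar Markov processes of index $\alpha>0$ is a càdlàg strong Markov family $\{X^{(x)}=(X,\mathbb{P}_x)\}$ with state space $\mathbb{R}$ (with $\mathbb{P}_x$ the law of the process started at $x$) such that for every $c>0$ and every $x$, the law of $(cX_{c^{-\alpha}t},t\ge0)$ under $\mathbb{P}_x$ equals the law of $(X_t,t\ge0)$ under $\mathbb{P}_{cx}$. The process is killed (absorbed at $0$) at $T=\inf\{t>0:X_t=0\}$. The successive times of change of sign are $H_0=0$ and $H_n=\inf\{t>H_{n-1}:X_tX_{t-}<0\}$ for $n\ge1$. *)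

theory Defs
  imports "HOL-Probability.Probability"
begin

section \<open>Trajectories\<close>

text \<open>A process indexed by \<open>t \<ge> 0\<close> is a function \<open>X :: real \<Rightarrow> 'w \<Rightarrow> real\<close>; its values at
  negative times are never used. A law of a process is a measure on the product space below.\<close>

abbreviation traj_space :: "(real \<Rightarrow> 'b::topological_space) measure" where
  "traj_space \<equiv> PiM {0..} (\<lambda>_. borel)"

definition traj :: "(real \<Rightarrow> 'w \<Rightarrow> 'b) \<Rightarrow> 'w \<Rightarrow> real \<Rightarrow> 'b" where
  "traj X \<omega> = (\<lambda>t\<in>{0..}. X t \<omega>)"

text \<open>A path \<open>(f t, 0 \<le> t < life)\<close> with a random lifetime is encoded as an element of
  \<^typ>\<open>real \<Rightarrow> ereal\<close>, with \<open>\<infinity>\<close> as the cemetery point.\<close>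

definition killed_traj :: "ennreal \<Rightarrow> (real \<Rightarrow> real) \<Rightarrow> real \<Rightarrow> ereal" where
  "killed_traj life f = (\<lambda>t\<in>{0..}. if ennreal t < life then ereal (f t) else \<infinity>)"

definition cadlag :: "(real \<Rightarrow> real) \<Rightarrow> bool" where
  "cadlag f \<longleftrightarrow> (\<forall>t\<ge>0. (f \<longlongrightarrow> f t) (at_right t)) \<and> (\<forall>t>0. \<exists>l. (f \<longlongrightarrow> l) (at_left t))"

text \<open>The filter is restricted to \<open>{0..<t}\<close> so that no value at a negative time enters when
  \<open>t = 0\<close> (where the result is an irrelevant constant).\<close>

definition left_lim :: "(real \<Rightarrow> real) \<Rightarrow> real \<Rightarrow> real" where
  "left_lim f t = Lim (at t within {0..<t}) f"

section \<open>Laws and independence\<close>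

definition same_law :: "'a measure \<Rightarrow> ('a \<Rightarrow> 'c) \<Rightarrow> 'b measure \<Rightarrow> ('b \<Rightarrow> 'c) \<Rightarrow> 'c measure \<Rightarrow> bool" where
  "same_law M X N Y S \<longleftrightarrow> X \<in> measurable M S \<and> Y \<in> measurable N S \<and> distr M S X = distr N S Y"

text \<open>\<^const>\<open>prob_space.indep_var\<close> forces both variables to have the same type.\<close>

definition indep_rv ::
  "'a measure \<Rightarrow> 'b measure \<Rightarrow> ('a \<Rightarrow> 'b) \<Rightarrow> 'c measure \<Rightarrow> ('a \<Rightarrow> 'c) \<Rightarrow> bool" where
  "indep_rv M S X T Y \<longleftrightarrow> X \<in> measurable M S \<and> Y \<in> measurable M T \<and>
     prob_space.indep_set M {X -` A \<inter> space M |A. A \<in> sets S} {Y -` B \<inter> space M |B. B \<in> sets T}"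

section \<open>Real self-similar Markov processes\<close>

text \<open>The time index of the filtration is \<^typ>\<open>ennreal\<close>, so that stopping times may be infinite.
  The filtration is arbitrary; in particular it may be the natural one. The last assumption is
  \<open>P x (X (\<tau> + _) \<in> B | F \<tau>) = P (X \<tau>) (X \<in> B)\<close> on \<open>{\<tau> < \<infinity>}\<close>, with the conditional
  probability given by its integrals over the events \<open>A\<close> prior to \<open>\<tau>\<close>.\<close>

locale strong_markov_family = filtration "space M" F
  for M :: "'w measure" and F :: "ennreal \<Rightarrow> 'w measure" +
  fixes P :: "real \<Rightarrow> 'w measure" and X :: "real \<Rightarrow> 'w \<Rightarrow> real"
  assumes subalg: "\<And>t. subalgebra M (F t)"
    and prob: "\<And>x. prob_space (P x)"
    and sets_P: "\<And>x. sets (P x) = sets M"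
    and adapted: "\<And>t. 0 \<le> t \<Longrightarrow> X t \<in> borel_measurable (F (ennreal t))"
    and cadlag_paths: "\<And>\<omega>. \<omega> \<in> space M \<Longrightarrow> cadlag (\<lambda>t. X t \<omega>)"
    and start: "\<And>x. AE \<omega> in P x. X 0 \<omega> = x"
    and kernel: "(\<lambda>y. distr (P y) traj_space (traj X)) \<in> borel \<rightarrow>\<^sub>M prob_algebra traj_space"
    and strong_markov: "\<And>x \<tau> A B. stopping_time F \<tau> \<Longrightarrow> A \<in> sets (pre_sigma \<tau>) \<Longrightarrow>
      B \<in> sets traj_space \<Longrightarrow>
      emeasure (P x) {\<omega>\<in>A. \<tau> \<omega> < \<infinity> \<and> traj (\<lambda>t. X (enn2real (\<tau> \<omega>) + t)) \<omega> \<in> B} =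
      (\<integral>\<^sup>+\<omega>\<in>{\<omega>\<in>A. \<tau> \<omega> < \<infinity>}.
         emeasure (P (X (enn2real (\<tau> \<omega>)) \<omega>)) {\<omega>'\<in>space M. traj X \<omega>' \<in> B} \<partial>P x)"

locale real_ssmp_family = strong_markov_family M F P X
  for M :: "'w measure" and F P X +
  fixes \<alpha> :: real
  assumes index_pos: "0 < \<alpha>"
    and self_similar: "\<And>c x. 0 < c \<Longrightarrow>
      same_law (P x) (traj (\<lambda>t \<omega>. c * X (c powr (-\<alpha>) * t) \<omega>)) (P (c * x)) (traj X) traj_space"

definition zero_hitting_time :: "(real \<Rightarrow> 'w \<Rightarrow> real) \<Rightarrow> 'w \<Rightarrow> ennreal" where
  "zero_hitting_time X \<omega> = Inf {ennreal t |t. 0 < t \<and> X t \<omega> = 0}"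

definition killed_at_zero :: "'w measure \<Rightarrow> (real \<Rightarrow> 'w \<Rightarrow> real) \<Rightarrow> bool" where
  "killed_at_zero M X \<longleftrightarrow>
     (\<forall>\<omega>\<in>space M. \<forall>t\<ge>0. zero_hitting_time X \<omega> \<le> ennreal t \<longrightarrow> X t \<omega> = 0)"

section \<open>Sign changes\<close>

fun sign_change_time :: "(real \<Rightarrow> 'w \<Rightarrow> real) \<Rightarrow> nat \<Rightarrow> 'w \<Rightarrow> ennreal" where
  "sign_change_time X 0 \<omega> = 0"
| "sign_change_time X (Suc n) \<omega> =
     Inf {ennreal t |t. 0 \<le> t \<and> sign_change_time X n \<omega> < ennreal t \<and>
                        X t \<omega> * left_lim (\<lambda>s. X s \<omega>) t < 0}"

text \<open>In the next three definitions \<^const>\<open>enn2real\<close> sends an infinite time to \<open>0\<close>.\<close>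

definition at_sign_change :: "(real \<Rightarrow> 'w \<Rightarrow> real) \<Rightarrow> nat \<Rightarrow> 'w \<Rightarrow> real" where
  "at_sign_change X n \<omega> = X (enn2real (sign_change_time X n \<omega>)) \<omega>"

definition piece :: "real \<Rightarrow> (real \<Rightarrow> 'w \<Rightarrow> real) \<Rightarrow> nat \<Rightarrow> 'w \<Rightarrow> real \<Rightarrow> ereal" where
  "piece \<alpha> X n \<omega> =
     killed_traj
       (ennreal (\<bar>at_sign_change X n \<omega>\<bar> powr (-\<alpha>)) *
          (sign_change_time X (Suc n) \<omega> - sign_change_time X n \<omega>))
       (\<lambda>t. X (enn2real (sign_change_time X n \<omega>) + \<bar>at_sign_change X n \<omega>\<bar> powr \<alpha> * t) \<omega>
              / \<bar>at_sign_change X n \<omega>\<bar>)"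

definition jump_ratio :: "(real \<Rightarrow> 'w \<Rightarrow> real) \<Rightarrow> nat \<Rightarrow> 'w \<Rightarrow> real" where
  "jump_ratio X n \<omega> = at_sign_change X (Suc n) \<omega> /
     left_lim (\<lambda>s. X s \<omega>) (enn2real (sign_change_time X (Suc n) \<omega>))"

section \<open>Levy processes and the Lamperti time change\<close>

definition levy_process :: "'a measure \<Rightarrow> (real \<Rightarrow> 'a \<Rightarrow> real) \<Rightarrow> bool" where
  "levy_process N \<xi> \<longleftrightarrow> prob_space N \<and>
     (\<forall>t\<ge>0. \<xi> t \<in> borel_measurable N) \<and>
     (\<forall>\<omega>\<in>space N. cadlag (\<lambda>t. \<xi> t \<omega>)) \<and>
     (AE \<omega> in N. \<xi> 0 \<omega> = 0) \<and>
     (\<forall>(s :: nat \<Rightarrow> real) n. 0 \<le> s 0 \<and> mono s \<longrightarrow>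
        prob_space.indep_vars N (\<lambda>_. borel) (\<lambda>i \<omega>. \<xi> (s (Suc i)) \<omega> - \<xi> (s i) \<omega>) {..<n}) \<and>
     (\<forall>s\<ge>0. \<forall>t\<ge>0. distr N borel (\<lambda>\<omega>. \<xi> (s + t) \<omega> - \<xi> s \<omega>) = distr N borel (\<xi> t))"

definition independent_exponential_time ::
  "'a measure \<Rightarrow> (real \<Rightarrow> 'a \<Rightarrow> real) \<Rightarrow> ('a \<Rightarrow> real) \<Rightarrow> bool" where
  "independent_exponential_time N \<xi> \<zeta> \<longleftrightarrow>
     (\<exists>q>0. distributed N lborel \<zeta> (\<lambda>t. ennreal (exponential_density q t))) \<and>
     indep_rv N traj_space (traj \<xi>) borel \<zeta>"

definition exp_functional :: "real \<Rightarrow> (real \<Rightarrow> real) \<Rightarrow> real \<Rightarrow> real" where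
  "exp_functional \<alpha> f u = (LBINT s:{0..u}. exp (\<alpha> * f s))"

definition lamperti_clock :: "real \<Rightarrow> (real \<Rightarrow> real) \<Rightarrow> real \<Rightarrow> real" where
  "lamperti_clock \<alpha> f t = Inf {u. 0 < u \<and> t < exp_functional \<alpha> f u}"

text \<open>For \<open>t < exp_functional \<alpha> (\<lambda>s. \<xi> s \<omega>) (\<zeta> \<omega>)\<close> the clock is less than \<open>\<zeta> \<omega>\<close>, so only the
  values of \<open>\<xi>\<close> before the killing time \<open>\<zeta>\<close> enter.\<close>

definition lamperti_traj ::
  "real \<Rightarrow> real \<Rightarrow> (real \<Rightarrow> 'a \<Rightarrow> real) \<Rightarrow> ('a \<Rightarrow> real) \<Rightarrow> 'a \<Rightarrow> real \<Rightarrow> ereal" where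
  "lamperti_traj \<alpha> \<epsilon> \<xi> \<zeta> \<omega> =
     killed_traj (ennreal (exp_functional \<alpha> (\<lambda>s. \<xi> s \<omega>) (\<zeta> \<omega>)))
       (\<lambda>t. \<epsilon> * exp (\<xi> (lamperti_clock \<alpha> (\<lambda>s. \<xi> s \<omega>) t) \<omega>))"

end

theory Submission
  imports Defs
begin

text \<open>
The whole statement reduces to one property of the process. Rescale the path after a stopping time
\<open>\<tau>\<close> to \<open>t \<mapsto> X (\<tau> + \<bar>X \<tau>\<bar>\<^sup>\<alpha> t) / \<bar>X \<tau>\<bar>\<close>. By the strong Markov property and self-similarity
this path, given the past, has the law of \<open>X\<close> started from the sign of \<open>X \<tau>\<close>. Hence, as soon as that
sign is known in advance, it is independent of the past (\<open>strong_markov_rescaled\<close>). Four kinds of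
times are used.

\<^item> At the first sign change the sign is the opposite of the initial one. The rescaled paths between
  sign changes therefore form a chain in which every step starts afresh from the other sign, and
  any functional of the single steps is an independent sequence (\<open>next_path_indep\<close>, \<open>chain_prob\<close>).
  This gives the independence and the laws of the pieces and of the jump ratios.

\<^item> At a fixed time \<open>t\<close> before the first sign change the rescaled path has the same jump ratio as the
  original one. So the jump ratio is independent of each event that the path is alive at \<open>t\<close> and has
  visited given sets up to \<open>t\<close>. These events generate the first piece, so a piece is independent of
  the jump that ends it (\<open>alive_exit_ratio_indep\<close>, \<open>killed_pair_law_eqI\<close>).

\<^item> At the time \<open>A s\<close> when \<open>\<integral> \<bar>X u\<bar>\<^sup>-\<^sup>\<alpha> du\<close> reaches \<open>s\<close>, the process \<open>ln \<bar>X (A (s + r))\<bar> - ln \<bar>X (A s)\<bar>\<close>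
  is the same functional of the rescaled path as \<open>ln \<bar>X (A r)\<bar>\<close> is of \<open>X\<close>. Its increments are thus
  stationary and independent while it is alive, and the time change can be undone
  (\<open>log_path_increments\<close>, \<open>lamperti_traj_levy_path\<close>).

\<^item> At dyadic times, to show that almost surely the path does not creep up to zero before its first
  sign change. If it did, then at zero it would have to jump away, since it must change sign later. But
  seen from a point close to zero, in rescaled units, this jump is huge, while its law in rescaled
  units does not depend on the point (\<open>creeping_from_le\<close>, \<open>creeping_null\<close>). Hence the piece
  ends at a finite time, away from zero, and its logarithm has a finite lifetime.

It remains to exhibit a Levy process that lives forever. Survival is memoryless, so the lifetime is
exponential. Independent copies of the process on the unit interval, conditioned to survive it, are glued
end to end, and an independent copy of the lifetime is added. The result has the same law up to
its lifetime as the killed process, by comparison of the events that generate that law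
(\<open>levy_process_extension\<close>, \<open>killed_pair_extension\<close>).

All this takes place on the space of right-continuous paths with left limits. There evaluation is
jointly measurable in the path and the time, which makes all functionals of paths measurable, and
stopping times can be recognised by looking at stopped paths.
\<close>

section \<open>The space of right-continuous paths with left limits\<close>

definition path_space :: "(real \<Rightarrow> real) measure" where
  "path_space = restrict_space traj_space {f. cadlag f}"

lemma space_path_space: "space path_space = {f. f \<in> extensional {0..} \<and> cadlag f}"
  by (auto simp: path_space_def space_restrict_space space_PiM PiE_def Pi_def)

lemma path_spaceD: "f \<in> space path_space \<Longrightarrow> cadlag f"
  by (simp add: space_path_space)

lemma measurable_path_space_coord [measurable]: "(\<lambda>f. f t) \<in> borel_measurable path_space"
proof (cases "0 \<le> t")
  case True
  then show ?thesis unfolding path_space_def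
    by (intro measurable_restrict_space1 measurable_component_singleton) auto
next
  case False
  have "(\<lambda>f. f t) \<in> borel_measurable path_space \<longleftrightarrow> (\<lambda>f. undefined :: real) \<in> borel_measurable path_space"
    by (rule measurable_cong) (use False in \<open>auto simp: space_path_space extensional_def\<close>)
  then show ?thesis by simp
qed

lemma cadlag_right: "cadlag f \<Longrightarrow> 0 \<le> t \<Longrightarrow> (f \<longlongrightarrow> f t) (at_right t)"
  by (simp add: cadlag_def)

lemma at_left_within_nonneg: "0 < t \<Longrightarrow> at t within {0..<t} = at_left (t::real)"
  by (rule at_within_nhd[of _ "{0<..}"]) auto

lemma cadlag_left:
  assumes "cadlag f" "0 < t"
  shows "(f \<longlongrightarrow> left_lim f t) (at_left t)"
proof -
  obtain l where l: "(f \<longlongrightarrow> l) (at_left t)" using assms by (auto simp: cadlag_def)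
  have "left_lim f t = l"
    unfolding left_lim_def at_left_within_nonneg[OF assms(2)]
    by (rule tendsto_Lim) (use l in auto)
  then show ?thesis using l by simp
qed

lemma left_lim_unique: "0 < t \<Longrightarrow> (f \<longlongrightarrow> l) (at_left t) \<Longrightarrow> left_lim f t = l"
  unfolding left_lim_def at_left_within_nonneg by (rule tendsto_Lim) auto

lemma left_lim_cong:
  assumes "\<And>s. 0 \<le> s \<Longrightarrow> s < t \<Longrightarrow> f s = g s"
  shows "left_lim f t = left_lim g t"
proof -
  have "(f \<longlongrightarrow> l) (at t within {0..<t}) \<longleftrightarrow> (g \<longlongrightarrow> l) (at t within {0..<t})" for l
    by (rule Lim_cong_within) (use assms in auto)
  then show ?thesis unfolding left_lim_def t2_space_class.Lim_def by simp
qed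

lemma cadlag_cong:
  assumes "\<And>s. 0 \<le> s \<Longrightarrow> f s = g s" "cadlag f"
  shows "cadlag g"
  unfolding cadlag_def
proof (intro conjI allI impI)
  fix t :: real assume t: "0 \<le> t"
  have "(f \<longlongrightarrow> f t) (at_right t)" using t assms by (simp add: cadlag_def)
  moreover have "\<forall>\<^sub>F s in at_right t. f s = g s"
    using t assms(1) by (auto intro!: eventually_at_rightI[of t "t+1"])
  ultimately show "(g \<longlongrightarrow> g t) (at_right t)" using t assms(1)
    by (metis (mono_tags, lifting) tendsto_cong)
next
  fix t :: real assume t: "0 < t"
  then obtain l where "(f \<longlongrightarrow> l) (at_left t)" using assms by (auto simp: cadlag_def)
  moreover have "\<forall>\<^sub>F s in at_left t. f s = g s"
    using t assms(1) by (auto intro!: eventually_at_leftI[of 0 t])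
  ultimately show "\<exists>l. (g \<longlongrightarrow> l) (at_left t)"
    by (metis (mono_tags, lifting) tendsto_cong)
qed

lemma cadlag_restrict: "cadlag f \<Longrightarrow> cadlag (restrict f {0..})"
  by (erule cadlag_cong[rotated]) auto

lemma filterlim_affine_at_right:
  "0 < c \<Longrightarrow> filterlim (\<lambda>t. h + c * t) (at_right (h + c * t)) (at_right (t::real))"
  by (rule filterlim_at_withinI) (auto intro!: tendsto_eq_intros eventually_at_rightI[of t "t+1"])

lemma filterlim_affine_at_left:
  "0 < c \<Longrightarrow> filterlim (\<lambda>t. h + c * t) (at_left (h + c * t)) (at_left (t::real))"
  by (rule filterlim_at_withinI) (auto intro!: tendsto_eq_intros eventually_at_leftI[of "t-1" t])

lemma cadlag_affine:
  assumes "cadlag f" "0 \<le> h" "0 \<le> c"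
  shows "cadlag (\<lambda>t. f (h + c * t) / k)"
proof (cases "c = 0")
  case True
  then show ?thesis by (auto simp: cadlag_def)
next
  case False
  then have c: "0 < c" using assms by simp
  show ?thesis unfolding cadlag_def divide_inverse
  proof (intro conjI allI impI)
    fix t :: real assume t: "0 \<le> t"
    have "((\<lambda>t. f (h + c * t)) \<longlongrightarrow> f (h + c * t)) (at_right t)"
      using cadlag_right[OF assms(1), of "h + c * t"] filterlim_affine_at_right[OF c, of h t] t assms
      by (auto intro: filterlim_compose)
    then show "((\<lambda>t. f (h + c * t) * inverse k) \<longlongrightarrow> f (h + c * t) * inverse k) (at_right t)"
      by (rule tendsto_mult_right)
  next
    fix t :: real assume t: "0 < t"
    then have "0 < h + c * t" using assms c by (simp add: add_nonneg_pos)
    then have "((\<lambda>t. f (h + c * t)) \<longlongrightarrow> left_lim f (h + c * t)) (at_left t)"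
      using cadlag_left[OF assms(1), of "h + c * t"] filterlim_affine_at_left[OF c, of h t]
      by (auto intro: filterlim_compose)
    then show "\<exists>l. ((\<lambda>t. f (h + c * t) * inverse k) \<longlongrightarrow> l) (at_left t)"
      by (intro exI[of _ "left_lim f (h + c * t) * inverse k"] tendsto_mult_right)
  qed
qed

lemma left_lim_affine:
  assumes "cadlag f" "0 \<le> h" "0 < c" "0 < t"
  shows "left_lim (\<lambda>t. f (h + c * t) / k) t = left_lim f (h + c * t) / k"
proof (rule left_lim_unique[OF assms(4)])
  have "0 < h + c * t" using assms by (simp add: add_nonneg_pos)
  then have "((\<lambda>t. f (h + c * t)) \<longlongrightarrow> left_lim f (h + c * t)) (at_left t)"
    using cadlag_left[OF assms(1), of "h + c * t"] filterlim_affine_at_left[OF assms(3), of h t]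
    by (auto intro: filterlim_compose)
  then show "((\<lambda>t. f (h + c * t) / k) \<longlongrightarrow> left_lim f (h + c * t) / k) (at_left t)"
    unfolding divide_inverse by (rule tendsto_mult_right)
qed

text \<open>One-sided limits bound the path near every single time, and compactness of an interval turns this
  into a bound on the interval.\<close>

lemma cadlag_locally_bounded:
  assumes "cadlag f" "0 \<le> t"
  shows "\<exists>e>0. \<exists>B. \<forall>s\<in>{0..} \<inter> {t-e<..<t+e}. \<bar>f s\<bar> \<le> B"
proof -
  have "\<forall>\<^sub>F s in at_right t. \<bar>f s - f t\<bar> < 1"
    using tendstoD[OF cadlag_right[OF assms], of 1] by (simp add: dist_real_def)
  then obtain b where b: "b > t" "\<And>s. t < s \<Longrightarrow> s < b \<Longrightarrow> \<bar>f s - f t\<bar> < 1"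
    by (auto simp: eventually_at_right[of t "t+1"])
  show ?thesis
  proof (cases "t = 0")
    case True
    have "\<bar>f s\<bar> \<le> \<bar>f t\<bar> + 1" if "s \<in> {0..} \<inter> {t - (b - t)<..<t + (b - t)}" for s
      using b(2)[of s] True that by (cases "s = t") auto
    then show ?thesis using b(1) by (intro exI[of _ "b - t"]) (blast intro: diff_gt_0_iff_gt[THEN iffD2])
  next
    case False
    then have t: "0 < t" using assms by simp
    have "\<forall>\<^sub>F s in at_left t. \<bar>f s - left_lim f t\<bar> < 1"
      using tendstoD[OF cadlag_left[OF assms(1) t], of 1] by (simp add: dist_real_def)
    then obtain a where a: "a < t" "\<And>s. a < s \<Longrightarrow> s < t \<Longrightarrow> \<bar>f s - left_lim f t\<bar> < 1"
      by (auto simp: eventually_at_left[of "t-1" t])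
    have "\<bar>f s\<bar> \<le> \<bar>f t\<bar> + \<bar>left_lim f t\<bar> + 1"
      if "s \<in> {0..} \<inter> {t - min (b - t) (t - a)<..<t + min (b - t) (t - a)}" for s
    proof -
      have "a < s" "s < b" using that by auto
      then show ?thesis using b(2)[of s] a(2)[of s] by (cases s t rule: linorder_cases) auto
    qed
    moreover have "0 < min (b - t) (t - a)" using a(1) b(1) by simp
    ultimately show ?thesis by blast
  qed
qed

lemma cadlag_bounded:
  assumes "cadlag f"
  shows "\<exists>B. \<forall>s\<in>{0..u}. \<bar>f s\<bar> \<le> B"
proof -
  have "\<forall>t\<in>{0..u}. \<exists>eB. fst eB > 0 \<and> (\<forall>s\<in>{0..} \<inter> {t - fst eB<..<t+fst eB}. \<bar>f s\<bar> \<le> snd eB)"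
    using cadlag_locally_bounded[OF assms] by fastforce
  then obtain eB where eB: "\<And>t. t \<in> {0..u} \<Longrightarrow> fst (eB t) > 0"
    "\<And>t s. t \<in> {0..u} \<Longrightarrow> s \<in> {0..} \<inter> {t - fst (eB t)<..<t + fst (eB t)} \<Longrightarrow> \<bar>f s\<bar> \<le> snd (eB t)"
    by metis
  obtain C where C: "C \<subseteq> {0..u}" "finite C" "{0..u} \<subseteq> (\<Union>t\<in>C. {t - fst (eB t)<..<t + fst (eB t)})"
  proof (rule compactE_image[of "{0..u}" "{0..u}" "\<lambda>t. {t - fst (eB t)<..<t + fst (eB t)}"])
    show "{0..u} \<subseteq> (\<Union>t\<in>{0..u}. {t - fst (eB t)<..<t + fst (eB t)})" using eB(1) by force
  qed (auto simp: compact_Icc)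
  have "\<forall>s\<in>{0..u}. \<bar>f s\<bar> \<le> (\<Sum>t\<in>C. \<bar>snd (eB t)\<bar>)"
  proof
    fix s assume s: "s \<in> {0..u}"
    then obtain t where t: "t \<in> C" "s \<in> {t - fst (eB t)<..<t + fst (eB t)}" using C by auto
    then have "\<bar>f s\<bar> \<le> \<bar>snd (eB t)\<bar>" using eB(2)[of t s] s C by force
    also have "\<dots> \<le> (\<Sum>t\<in>C. \<bar>snd (eB t)\<bar>)" using t C by (intro member_le_sum) auto
    finally show "\<bar>f s\<bar> \<le> (\<Sum>t\<in>C. \<bar>snd (eB t)\<bar>)" .
  qed
  then show ?thesis by blast
qed

lemma filterlim_dyadic_above:
  "filterlim (\<lambda>n. real_of_int (\<lfloor>t * 2 ^ n\<rfloor> + 1) / 2 ^ n) (at_right t) sequentially"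
proof (rule filterlim_at_withinI)
  have *: "t < real_of_int (\<lfloor>t * 2 ^ n\<rfloor> + 1) / 2 ^ n" for n
    by (simp add: less_divide_eq) 
  then show "\<forall>\<^sub>F n in sequentially. real_of_int (\<lfloor>t * 2 ^ n\<rfloor> + 1) / 2 ^ n \<in> {t<..} - {t}"
    by (auto intro!: always_eventually simp del: of_int_add)
  have **: "real_of_int (\<lfloor>t * 2 ^ n\<rfloor> + 1) / 2 ^ n \<le> t + (1/2)^n" for n
  proof -
    have "real_of_int (\<lfloor>t * 2 ^ n\<rfloor> + 1) / 2 ^ n \<le> (t * 2 ^ n + 1) / 2 ^ n"
      by (intro divide_right_mono) (simp_all add: of_int_floor_le)
    also have "\<dots> = t + (1/2)^n" by (simp add: field_simps)
    finally show ?thesis .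
  qed
  have lim: "(\<lambda>n. t + (1/2)^n) \<longlonglongrightarrow> t + 0"
    by (intro tendsto_add tendsto_const LIMSEQ_power_zero) simp
  show "(\<lambda>n. real_of_int (\<lfloor>t * 2 ^ n\<rfloor> + 1) / 2 ^ n) \<longlonglongrightarrow> t"
    by (rule tendsto_sandwich[OF always_eventually always_eventually tendsto_const])
       (use * ** less_imp_le lim in auto)
qed

text \<open>Right-continuity makes evaluation jointly measurable in the path and the time: the value at
  \<open>t\<close> is the limit of the values at the dyadic times just above \<open>t\<close>.\<close>

lemma measurable_path_eval:
  assumes \<phi> [measurable]: "\<phi> \<in> M \<rightarrow>\<^sub>M path_space" and \<tau> [measurable]: "\<tau> \<in> borel_measurable M"
  shows "(\<lambda>x. \<phi> x (\<tau> x)) \<in> borel_measurable M"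
proof -
  let ?d = "\<lambda>n x. real_of_int (\<lfloor>\<tau> x * 2 ^ n\<rfloor> + 1) / 2 ^ n"
  let ?g = "\<lambda>x. if 0 \<le> \<tau> x then lim (\<lambda>n. \<phi> x (?d n x)) else undefined"
  have "(\<lambda>x. \<phi> x (?d n x)) \<in> borel_measurable M" for n
    by (rule measurable_compose_countable[where f="\<lambda>i x. \<phi> x (real_of_int (i + 1) / 2 ^ n)"
          and g="\<lambda>x. \<lfloor>\<tau> x * 2 ^ n\<rfloor>"]) (auto intro: measurable_compose[OF \<phi>])
  then have "?g \<in> borel_measurable M" by measurable
  also have "?this \<longleftrightarrow> ?thesis"
  proof (rule measurable_cong)
    fix x assume x: "x \<in> space M"
    then have f: "\<phi> x \<in> space path_space" by (rule measurable_space[OF \<phi>])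
    show "?g x = \<phi> x (\<tau> x)"
    proof (cases "0 \<le> \<tau> x")
      case True
      have "(\<lambda>n. \<phi> x (?d n x)) \<longlonglongrightarrow> \<phi> x (\<tau> x)"
        by (rule filterlim_compose[OF cadlag_right filterlim_dyadic_above])
           (use f True in \<open>auto simp: space_path_space\<close>)
      then show ?thesis using True by (simp add: limI)
    next
      case False
      then show ?thesis using f by (auto simp: space_path_space extensional_def)
    qed
  qed
  finally show ?thesis .
qed

lemma measurable_path_evalI:
  assumes "\<tau> \<in> borel_measurable path_space"
  shows "(\<lambda>f. f (\<tau> f)) \<in> borel_measurable path_space"
  by (rule measurable_path_eval[of "\<lambda>f. f", OF _ assms]) simp

lemma measurable_into_path_space:
  assumes "\<And>t. 0 \<le> t \<Longrightarrow> (\<lambda>x. e x t) \<in> borel_measurable M"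
    and "\<And>x. x \<in> space M \<Longrightarrow> cadlag (e x)"
  shows "(\<lambda>x. restrict (e x) {0..}) \<in> M \<rightarrow>\<^sub>M path_space"
  unfolding path_space_def
  by (rule measurable_restrict_space2)
     (use assms in \<open>auto intro!: measurable_restrict cadlag_restrict simp: space_PiM\<close>)

lemma measurable_left_lim:
  assumes \<phi> [measurable]: "\<phi> \<in> M \<rightarrow>\<^sub>M path_space" and \<tau> [measurable]: "\<tau> \<in> borel_measurable M"
  shows "(\<lambda>x. left_lim (\<phi> x) (\<tau> x)) \<in> borel_measurable M"
proof -
  let ?g = "\<lambda>x. if 0 < \<tau> x then lim (\<lambda>n. \<phi> x (\<tau> x * (1 - (1/2) ^ Suc n))) else left_lim undefined 0"
  have "(\<lambda>x. \<phi> x (\<tau> x * (1 - (1/2) ^ Suc n))) \<in> borel_measurable M" for n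
    by (rule measurable_path_eval) auto
  then have "?g \<in> borel_measurable M" by measurable
  also have "?this \<longleftrightarrow> ?thesis"
  proof (rule measurable_cong)
    fix x assume x: "x \<in> space M"
    then have f: "cadlag (\<phi> x)" using measurable_space[OF \<phi>] path_spaceD by auto
    show "?g x = left_lim (\<phi> x) (\<tau> x)"
    proof (cases "0 < \<tau> x")
      case True
      have lim: "(\<lambda>n. \<tau> x * (1 - (1/2) ^ Suc n)) \<longlonglongrightarrow> \<tau> x * (1 - 0)"
        by (intro tendsto_mult tendsto_diff tendsto_const LIMSEQ_Suc LIMSEQ_power_zero) simp
      have "filterlim (\<lambda>n. \<tau> x * (1 - (1/2) ^ Suc n)) (at_left (\<tau> x)) sequentially"
        by (rule filterlim_at_withinI) (use lim True in \<open>auto intro!: always_eventually\<close>)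
      then have "(\<lambda>n. \<phi> x (\<tau> x * (1 - (1/2) ^ Suc n))) \<longlonglongrightarrow> left_lim (\<phi> x) (\<tau> x)"
        by (rule filterlim_compose[OF cadlag_left[OF f True]])
      then show ?thesis using True by (simp add: limI)
    next
      case False
      then have "{0..<\<tau> x} = {}" by auto
      then show ?thesis using False by (simp add: left_lim_def t2_space_class.Lim_def)
    qed
  qed
  finally show ?thesis .
qed

section \<open>Stopped and rescaled paths\<close>

definition stopped_path :: "real \<Rightarrow> (real \<Rightarrow> real) \<Rightarrow> real \<Rightarrow> real" where
  "stopped_path t f = (\<lambda>s\<in>{0..}. f (min s t))"

lemma stopped_path_eq: "0 \<le> s \<Longrightarrow> s \<le> t \<Longrightarrow> stopped_path t f s = f s"
  by (simp add: stopped_path_def min_def)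

lemma stopped_path_stopped_path: "0 \<le> u \<Longrightarrow> u \<le> t \<Longrightarrow> stopped_path u (stopped_path t f) = stopped_path u f"
  by (auto simp: stopped_path_def fun_eq_iff min_def)

lemma cadlag_stopped_path:
  assumes f: "cadlag f" and t: "0 \<le> t"
  shows "cadlag (stopped_path t f)"
  unfolding stopped_path_def
proof (rule cadlag_restrict, unfold cadlag_def, intro conjI allI impI)
  fix s :: real assume s: "0 \<le> s"
  show "((\<lambda>s. f (min s t)) \<longlongrightarrow> f (min s t)) (at_right s)"
  proof (cases "s < t")
    case True
    then have "\<forall>\<^sub>F r in at_right s. f (min r t) = f r" by (auto intro!: eventually_at_rightI[of s t])
    then show ?thesis using cadlag_right[OF f s] True by (simp add: tendsto_cong)
  next
    case False
    then have "\<forall>\<^sub>F r in at_right s. f (min r t) = f t" by (auto intro!: eventually_at_rightI[of s "s+1"])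
    then show ?thesis using False by (simp add: tendsto_eventually)
  qed
next
  fix s :: real assume s: "0 < s"
  show "\<exists>l. ((\<lambda>s. f (min s t)) \<longlongrightarrow> l) (at_left s)"
  proof (cases "s \<le> t")
    case True
    then have "\<forall>\<^sub>F r in at_left s. f (min r t) = f r" by (auto intro!: eventually_at_leftI[of 0 s] s)
    then show ?thesis using cadlag_left[OF f s] True by (auto simp: tendsto_cong)
  next
    case False
    then have "\<forall>\<^sub>F r in at_left s. f (min r t) = f t" by (auto intro!: eventually_at_leftI[of t s])
    then show ?thesis using False by (auto intro: tendsto_eventually)
  qed
qed

lemma stopped_path_in: "f \<in> space path_space \<Longrightarrow> 0 \<le> t \<Longrightarrow> stopped_path t f \<in> space path_space"
  by (auto simp: space_path_space cadlag_stopped_path) (auto simp: stopped_path_def)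

definition rescaled_shift :: "real \<Rightarrow> (real \<Rightarrow> real) \<Rightarrow> real \<Rightarrow> real \<Rightarrow> real" where
  "rescaled_shift \<alpha> f h = (\<lambda>t\<in>{0..}. f (h + \<bar>f h\<bar> powr \<alpha> * t) / \<bar>f h\<bar>)"

lemma rescaled_shift_eq: "0 \<le> t \<Longrightarrow> rescaled_shift \<alpha> f h t = f (h + \<bar>f h\<bar> powr \<alpha> * t) / \<bar>f h\<bar>"
  by (simp add: rescaled_shift_def)

lemma rescaled_shift_0: "rescaled_shift \<alpha> f h 0 = sgn (f h)"
  by (simp add: rescaled_shift_def sgn_real_def)

lemma cadlag_rescaled_shift: "cadlag f \<Longrightarrow> 0 \<le> h \<Longrightarrow> cadlag (rescaled_shift \<alpha> f h)"
  unfolding rescaled_shift_def by (intro cadlag_restrict cadlag_affine) auto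

lemma rescaled_shift_in: "f \<in> space path_space \<Longrightarrow> 0 \<le> h \<Longrightarrow> rescaled_shift \<alpha> f h \<in> space path_space"
  by (auto simp: space_path_space cadlag_rescaled_shift) (auto simp: rescaled_shift_def)

text \<open>Rescaled shifts compose: the inner scaling cancels, because the time and the space factor of the
  outer one are computed from the rescaled value.\<close>

lemma rescaled_shift_rescaled_shift:
  assumes "f h \<noteq> 0" "0 \<le> u"
  shows "rescaled_shift \<alpha> (rescaled_shift \<alpha> f h) u = rescaled_shift \<alpha> f (h + \<bar>f h\<bar> powr \<alpha> * u)"
proof
  fix t
  let ?c = "\<bar>f h\<bar> powr \<alpha>" and ?v = "f (h + \<bar>f h\<bar> powr \<alpha> * u)"
  show "rescaled_shift \<alpha> (rescaled_shift \<alpha> f h) u t = rescaled_shift \<alpha> f (h + ?c * u) t"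
  proof (cases "0 \<le> t")
    case True
    have *: "?c * \<bar>?v / \<bar>f h\<bar>\<bar> powr \<alpha> = \<bar>?v\<bar> powr \<alpha>"
      using assms(1) by (simp add: powr_divide)
    have "h + ?c * (u + \<bar>?v / \<bar>f h\<bar>\<bar> powr \<alpha> * t) = h + ?c * u + (?c * \<bar>?v / \<bar>f h\<bar>\<bar> powr \<alpha>) * t"
      by (simp add: algebra_simps)
    also have "\<dots> = h + ?c * u + \<bar>?v\<bar> powr \<alpha> * t" unfolding * ..
    finally have "f (h + ?c * (u + \<bar>?v / \<bar>f h\<bar>\<bar> powr \<alpha> * t)) = f (h + ?c * u + \<bar>?v\<bar> powr \<alpha> * t)"
      by (rule arg_cong)
    moreover have "0 \<le> u + \<bar>?v / \<bar>f h\<bar>\<bar> powr \<alpha> * t" using assms True by simp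
    ultimately show ?thesis using True assms by (simp add: rescaled_shift_eq)
  qed (simp add: rescaled_shift_def)
qed

lemma measurable_rescaled_shift:
  assumes \<tau> [measurable]: "\<tau> \<in> borel_measurable path_space"
    and \<tau>0: "\<And>f. f \<in> space path_space \<Longrightarrow> 0 \<le> \<tau> f"
  shows "(\<lambda>f. rescaled_shift \<alpha> f (\<tau> f)) \<in> path_space \<rightarrow>\<^sub>M path_space"
  unfolding rescaled_shift_def
proof (rule measurable_into_path_space)
  fix t :: real assume "0 \<le> t"
  have [measurable]: "(\<lambda>f. f (\<tau> f)) \<in> borel_measurable path_space"
    by (rule measurable_path_evalI) simp
  have [measurable]: "(\<lambda>f. f (\<tau> f + \<bar>f (\<tau> f)\<bar> powr \<alpha> * t)) \<in> borel_measurable path_space"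
    by (rule measurable_path_evalI) measurable
  show "(\<lambda>f. f (\<tau> f + \<bar>f (\<tau> f)\<bar> powr \<alpha> * t) / \<bar>f (\<tau> f)\<bar>) \<in> borel_measurable path_space"
    by measurable
qed (use \<tau>0 in \<open>auto intro!: cadlag_affine simp: path_spaceD\<close>)

section \<open>The time of leaving the half-line of the starting point\<close>

text \<open>Coming arbitrarily close to zero counts as leaving the half-line, even if the path then jumps back.
  So the event \<open>t < exit_time f\<close> depends on the path up to time \<open>t\<close> only, and \<open>exit_time\<close> is a stopping time
  without any right-continuity of the filtration. If \<open>f 0 = 0\<close> then it is \<open>0\<close>.\<close>

definition exit_time :: "(real \<Rightarrow> real) \<Rightarrow> ennreal" where
  "exit_time f = Inf {ennreal t |t. 0 \<le> t \<and> \<not> (\<exists>c>0. \<forall>s\<in>{0..t}. c \<le> f 0 * f s)}"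

lemma less_exit_time_iff:
  assumes "cadlag f" "0 \<le> t"
  shows "ennreal t < exit_time f \<longleftrightarrow> (\<exists>c>0. \<forall>s\<in>{0..t}. c \<le> f 0 * f s)"
proof
  assume "ennreal t < exit_time f"
  then show "\<exists>c>0. \<forall>s\<in>{0..t}. c \<le> f 0 * f s"
    unfolding exit_time_def using assms(2) by (intro ccontr[of "\<exists>c>0. \<forall>s\<in>{0..t}. c \<le> f 0 * f s"]) (auto simp: not_le[symmetric] intro!: Inf_lower)
next
  assume "\<exists>c>0. \<forall>s\<in>{0..t}. c \<le> f 0 * f s"
  then obtain c where c: "c > 0" "\<And>s. s \<in> {0..t} \<Longrightarrow> c \<le> f 0 * f s" by auto
  have "((\<lambda>s. f 0 * f s) \<longlongrightarrow> f 0 * f t) (at_right t)"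
    by (intro tendsto_mult_left cadlag_right assms)
  then have "\<forall>\<^sub>F s in at_right t. c / 2 < f 0 * f s"
    by (rule order_tendstoD) (use c(1) c(2)[of t] assms in auto)
  then obtain b where b: "b > t" "\<And>s. t < s \<Longrightarrow> s < b \<Longrightarrow> c / 2 < f 0 * f s"
    by (auto simp: eventually_at_right[of t "t+1"])
  have "ennreal t < ennreal b" using b assms by (simp add: ennreal_lessI)
  also have "\<dots> \<le> exit_time f" unfolding exit_time_def
  proof (rule Inf_greatest, safe)
    fix r assume r: "0 \<le> r" "\<not> (\<exists>c>0. \<forall>s\<in>{0..r}. c \<le> f 0 * f s)"
    show "ennreal b \<le> ennreal r"
    proof (rule ennreal_leI, rule ccontr)
      assume "\<not> b \<le> r"
      then have "c / 2 \<le> f 0 * f s" if "s \<in> {0..r}" for s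
        using c(2)[of s] c(1) b(2)[of s] that by (cases "s \<le> t") auto
      with r c(1) show False by (metis half_gt_zero)
    qed
  qed
  finally show "ennreal t < exit_time f" .
qed

lemma less_exit_time_pos:
  assumes "cadlag f" "0 \<le> s" "ennreal s < exit_time f"
  shows "0 < f 0 * f s"
  using assms less_exit_time_iff[OF assms(1,2)] by force

lemma exit_time_stopped_path_iff:
  assumes "cadlag f" "0 \<le> s" "s \<le> t"
  shows "ennreal s < exit_time (stopped_path t f) \<longleftrightarrow> ennreal s < exit_time f"
  using assms by (simp add: less_exit_time_iff cadlag_stopped_path stopped_path_eq)

lemma measurable_exit_time [measurable]: "exit_time \<in> borel_measurable path_space"
proof (rule borel_measurableI_greater)
  fix y :: ennreal
  show "{f \<in> space path_space. y < exit_time f} \<in> sets path_space"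
  proof (cases y)
    case (real t)
    let ?Q = "insert t (\<rat> \<inter> {0..t})"
    have cQ: "countable ?Q" using countable_rat by (auto intro: countable_Int1)
    have "{f \<in> space path_space. y < exit_time f} =
      {f \<in> space path_space. \<exists>k::nat. \<forall>q\<in>?Q. 1 / real (Suc k) \<le> f 0 * f q}" (is "?L = ?R")
    proof (intro equalityI subsetI; clarsimp simp: real)
      fix f assume f: "f \<in> space path_space" "ennreal t < exit_time f"
      then obtain c where c: "c > 0" "\<forall>s\<in>{0..t}. c \<le> f 0 * f s"
        using less_exit_time_iff[OF path_spaceD real(1)] by blast
      obtain k where "1 / real (Suc k) < c" using c(1) nat_approx_posE by blast
      then show "\<exists>k. 1 / (1 + real k) \<le> f 0 * f t \<and> (\<forall>q\<in>\<rat> \<inter> {0..t}. 1 / (1 + real k) \<le> f 0 * f q)"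
        using c real(1) by (intro exI[of _ k]) (force intro: order_trans[OF less_imp_le])
    next
      fix f k assume f: "f \<in> space path_space" "1 / (1 + real k) \<le> f 0 * f t"
        "\<forall>q\<in>\<rat> \<inter> {0..t}. 1 / (1 + real k) \<le> f 0 * f q"
      have cad: "cadlag f" using f(1) by (rule path_spaceD)
      have "1 / (1 + real k) \<le> f 0 * f s" if s: "s \<in> {0..t}" for s
      proof (cases "s = t")
        case False
        let ?d = "\<lambda>n. real_of_int (\<lfloor>s * 2 ^ n\<rfloor> + 1) / 2 ^ n"
        have "(\<lambda>n. f 0 * f (?d n)) \<longlonglongrightarrow> f 0 * f s"
          by (intro tendsto_mult_left filterlim_compose[OF cadlag_right[OF cad] filterlim_dyadic_above])
             (use s in auto)
        moreover have "\<forall>\<^sub>F n in sequentially. ?d n < t"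
        proof -
          have "\<forall>\<^sub>F r in at_right s. r < t" using s False by (auto intro!: eventually_at_rightI[of s t])
          then show ?thesis by (rule eventually_compose_filterlim[OF _ filterlim_dyadic_above])
        qed
        then have "\<forall>\<^sub>F n in sequentially. 1 / (1 + real k) \<le> f 0 * f (?d n)"
        proof eventually_elim
          case (elim n)
          have "0 \<le> \<lfloor>s * 2 ^ n\<rfloor>" using s by simp
          then have "0 \<le> ?d n" by simp
          moreover have "?d n \<in> \<rat>" by (intro Rats_divide Rats_of_int Rats_power Rats_number_of)
          ultimately show ?case using f(3) elim by auto
        qed
        ultimately show ?thesis by (rule tendsto_lowerbound) simp
      qed (use f in simp)
      then show "ennreal t < exit_time f"
        by (subst less_exit_time_iff[OF cad real(1)]) (auto intro!: exI[of _ "1 / (1 + real k)"])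
    qed
    also have "?R \<in> sets path_space"
      using cQ by (intro sets.sets_Collect_countable_Ex sets.sets_Collect_countable_Ball) measurable
    finally show ?thesis .
  qed simp
qed

section \<open>The strong Markov property on path space\<close>

text \<open>Stopping times and the events of their past are described by Galmarino's test: whether \<open>\<tau> \<le> t\<close>
  can be read off the path stopped at \<open>t\<close>. Because the stopped path is measurable with respect to
  everything that has happened up to \<open>t\<close>, such a \<open>\<tau>\<close> is a stopping time of every filtration to which the
  process is adapted.\<close>

definition path_stopping_time :: "((real \<Rightarrow> real) \<Rightarrow> ennreal) \<Rightarrow> bool" where
  "path_stopping_time \<tau> \<longleftrightarrow> \<tau> \<in> borel_measurable path_space \<and>
     (\<forall>f\<in>space path_space. \<forall>t\<ge>0. \<tau> f \<le> ennreal t \<longleftrightarrow> \<tau> (stopped_path t f) \<le> ennreal t)"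

definition prior_event :: "((real \<Rightarrow> real) \<Rightarrow> ennreal) \<Rightarrow> (real \<Rightarrow> real) set \<Rightarrow> bool" where
  "prior_event \<tau> A \<longleftrightarrow> A \<in> sets path_space \<and>
     (\<forall>f\<in>space path_space. \<forall>t\<ge>0. \<tau> f \<le> ennreal t \<longrightarrow> (f \<in> A \<longleftrightarrow> stopped_path t f \<in> A))"

lemma path_stopping_time_stopped_path:
  assumes \<tau>: "path_stopping_time \<tau>" and f: "f \<in> space path_space" and t: "0 \<le> t" "\<tau> f \<le> ennreal t"
  shows "\<tau> (stopped_path t f) = \<tau> f"
proof -
  let ?g = "stopped_path t f"
  have g: "?g \<in> space path_space" using f t by (simp add: stopped_path_in)
  have le: "\<tau> ?g \<le> ennreal t" using \<tau> f t by (auto simp: path_stopping_time_def)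
  have *: "\<tau> ?g \<le> ennreal u \<longleftrightarrow> \<tau> f \<le> ennreal u" if u: "0 \<le> u" "u \<le> t" for u
  proof -
    have "\<tau> ?g \<le> ennreal u \<longleftrightarrow> \<tau> (stopped_path u ?g) \<le> ennreal u"
      using \<tau> g u by (auto simp: path_stopping_time_def)
    also have "stopped_path u ?g = stopped_path u f" using u by (rule stopped_path_stopped_path)
    finally show ?thesis using \<tau> f u by (auto simp: path_stopping_time_def)
  qed
  obtain a where a: "0 \<le> a" "\<tau> ?g = ennreal a" using le by (cases "\<tau> ?g") (auto simp: top_unique)
  obtain b where b: "0 \<le> b" "\<tau> f = ennreal b" using t by (cases "\<tau> f") (auto simp: top_unique)
  have "a \<le> t" "b \<le> t" using le t a b by (auto simp: ennreal_le_iff)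
  then show ?thesis using *[of a] *[of b] a b by (auto simp: ennreal_le_iff)
qed

lemma path_stopping_time_const: "path_stopping_time (\<lambda>_. c)"
  by (simp add: path_stopping_time_def)

lemma path_stopping_time_exit_time: "path_stopping_time exit_time"
  using exit_time_stopped_path_iff[OF path_spaceD _ order_refl]
  by (auto simp: path_stopping_time_def not_less[symmetric])

lemma sets_path_spaceE:
  assumes "B \<in> sets path_space"
  obtains C where "C \<in> sets traj_space" "B = {f. cadlag f} \<inter> C"
  using assms by (auto simp: path_space_def sets_restrict_space)

context real_ssmp_family
begin

abbreviation "rshift \<equiv> rescaled_shift \<alpha>"

definition law :: "real \<Rightarrow> (real \<Rightarrow> real) measure" where
  "law x = distr (P x) path_space (traj X)"

lemma space_P: "space (P x) = space M"
  using sets_P by (rule sets_eq_imp_space_eq)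

lemma X_measurable_F: "0 \<le> s \<Longrightarrow> ennreal s \<le> t \<Longrightarrow> X s \<in> borel_measurable (F t)"
  using measurable_mono[OF order_refl refl sets_F_mono[of "ennreal s" t]] adapted[of s] space_F by auto

lemma X_measurable_M: "0 \<le> s \<Longrightarrow> X s \<in> borel_measurable M"
  using measurable_from_subalg[OF subalg adapted] by blast

lemma traj_in: "\<omega> \<in> space M \<Longrightarrow> traj X \<omega> \<in> space path_space"
  using cadlag_paths by (auto simp: space_path_space traj_def intro: cadlag_restrict)

lemma traj_eq: "0 \<le> t \<Longrightarrow> traj X \<omega> t = X t \<omega>"
  by (simp add: traj_def)

lemma traj_measurable_M [measurable]: "traj X \<in> M \<rightarrow>\<^sub>M path_space"
  unfolding traj_def
  by (rule measurable_into_path_space) (auto intro: X_measurable_M cadlag_paths)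

lemma traj_measurable_P [measurable]: "traj X \<in> P x \<rightarrow>\<^sub>M path_space"
  using traj_measurable_M measurable_cong_sets[OF sets_P refl] by blast

lemma prob_space_law: "prob_space (law x)"
  unfolding law_def using prob by (intro prob_space.prob_space_distr) auto

lemma sets_law [measurable_cong]: "sets (law x) = sets path_space"
  by (simp add: law_def)

lemma space_law: "space (law x) = space path_space"
  by (simp add: law_def)

lemma emeasure_law:
  "A \<in> sets path_space \<Longrightarrow> emeasure (law x) A = emeasure (P x) {\<omega>\<in>space M. traj X \<omega> \<in> A}"
  unfolding law_def by (subst emeasure_distr) (auto simp: space_P vimage_def Int_def conj_commute)

lemma AE_law_start: "AE f in law x. f 0 = x"
  unfolding law_def by (subst AE_distr_iff) (use start in \<open>auto simp: traj_def\<close>)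

lemma stopped_traj_measurable_F:
  assumes "0 \<le> t" "ennreal t \<le> r"
  shows "(\<lambda>\<omega>. stopped_path t (traj X \<omega>)) \<in> F r \<rightarrow>\<^sub>M path_space"
proof -
  have "(\<lambda>\<omega>. \<lambda>s\<in>{0..}. X (min s t) \<omega>) \<in> F r \<rightarrow>\<^sub>M path_space"
  proof (rule measurable_into_path_space)
    fix s :: real assume "0 \<le> s"
    then show "X (min s t) \<in> borel_measurable (F r)"
      using assms by (intro X_measurable_F) (auto intro: order_trans[OF ennreal_leI[of "min s t" t]])
  next
    fix \<omega> assume "\<omega> \<in> space (F r)"
    then have "cadlag (stopped_path t (\<lambda>t. X t \<omega>))"
      using cadlag_stopped_path[OF cadlag_paths assms(1)] space_F by auto
    then show "cadlag (\<lambda>s. X (min s t) \<omega>)"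
      by (rule cadlag_cong[rotated]) (simp add: stopped_path_def)
  qed
  also have "(\<lambda>\<omega>. \<lambda>s\<in>{0..}. X (min s t) \<omega>) = (\<lambda>\<omega>. stopped_path t (traj X \<omega>))"
    using assms by (auto simp: stopped_path_def traj_def fun_eq_iff)
  finally show ?thesis .
qed

lemma traj_measurable_F_top: "traj X \<in> F \<top> \<rightarrow>\<^sub>M path_space"
  unfolding traj_def
  by (rule measurable_into_path_space) (auto intro: X_measurable_F cadlag_paths simp: space_F)

lemma stopping_time_path_stopping_time:
  assumes \<tau>: "path_stopping_time \<tau>"
  shows "stopping_time F (\<lambda>\<omega>. \<tau> (traj X \<omega>))"
proof
  fix t :: ennreal
  have [measurable]: "\<tau> \<in> borel_measurable path_space" using \<tau> by (simp add: path_stopping_time_def)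
  show "Measurable.pred (F t) (\<lambda>\<omega>. \<tau> (traj X \<omega>) \<le> t)"
  proof (cases t)
    case (real r)
    note [measurable] = stopped_traj_measurable_F[OF real(1) order_refl]
    have "Measurable.pred (F (ennreal r)) (\<lambda>\<omega>. \<tau> (stopped_path r (traj X \<omega>)) \<le> ennreal r)"
      by measurable
    also have "?this \<longleftrightarrow> Measurable.pred (F (ennreal r)) (\<lambda>\<omega>. \<tau> (traj X \<omega>) \<le> ennreal r)"
      by (rule measurable_cong)
         (use \<tau> traj_in real in \<open>auto simp: space_F path_stopping_time_def\<close>)
    finally show ?thesis using real by simp
  qed simp
qed

lemma prior_event_in_pre_sigma:
  assumes \<tau>: "path_stopping_time \<tau>" and A: "prior_event \<tau> A"
  shows "{\<omega>\<in>space M. traj X \<omega> \<in> A} \<in> sets (pre_sigma (\<lambda>\<omega>. \<tau> (traj X \<omega>)))"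
proof (rule sets_pre_sigmaI[OF stopping_time_path_stopping_time[OF \<tau>]])
  fix t :: ennreal
  have [measurable]: "\<tau> \<in> borel_measurable path_space" "A \<in> sets path_space"
    using \<tau> A by (auto simp: path_stopping_time_def prior_event_def)
  show "{\<omega> \<in> {\<omega> \<in> space M. traj X \<omega> \<in> A}. \<tau> (traj X \<omega>) \<le> t} \<in> sets (F t)"
  proof (cases t)
    case (real r)
    note [measurable] = stopped_traj_measurable_F[OF real(1) order_refl]
    have "{\<omega> \<in> {\<omega> \<in> space M. traj X \<omega> \<in> A}. \<tau> (traj X \<omega>) \<le> ennreal r} =
       {\<omega> \<in> space (F (ennreal r)). stopped_path r (traj X \<omega>) \<in> A \<and>
          \<tau> (stopped_path r (traj X \<omega>)) \<le> ennreal r}"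
      using \<tau> A traj_in real unfolding prior_event_def path_stopping_time_def space_F by blast
    also have "\<dots> \<in> sets (F (ennreal r))" by measurable
    finally show ?thesis using real by simp
  next
    case top
    note [measurable] = traj_measurable_F_top
    have "{\<omega> \<in> {\<omega> \<in> space M. traj X \<omega> \<in> A}. \<tau> (traj X \<omega>) \<le> t} = {\<omega>\<in>space (F \<top>). traj X \<omega> \<in> A}"
      using top by (auto simp: space_F)
    also have "\<dots> \<in> sets (F \<top>)" by measurable
    finally show ?thesis using top by simp
  qed
qed

text \<open>Self-similarity removes the dependence on the modulus of the starting point once the path is
  rescaled to start from \<open>1\<close> or \<open>-1\<close>.\<close>

lemma law_rescaled:
  assumes y: "y \<noteq> 0" and B: "B \<in> sets path_space"
  shows "emeasure (law y) {f\<in>space path_space. rshift f 0 \<in> B} = emeasure (law (sgn y)) B"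
proof -
  have [measurable]: "(\<lambda>f. rshift f 0) \<in> path_space \<rightarrow>\<^sub>M path_space"
    by (rule measurable_rescaled_shift) auto
  note [measurable] = B
  let ?c = "1 / \<bar>y\<bar>"
  let ?Z = "traj (\<lambda>t \<omega>. ?c * X (?c powr (-\<alpha>) * t) \<omega>)"
  have c: "?c powr (-\<alpha>) = \<bar>y\<bar> powr \<alpha>" "?c * y = sgn y"
    using y by (auto simp: powr_divide powr_minus_divide sgn_real_def)
  have ss: "same_law (P y) ?Z (P (sgn y)) (traj X) traj_space"
    using self_similar[of ?c y] y unfolding c(2) by simp
  obtain C where C: "C \<in> sets traj_space" "B = {f. cadlag f} \<inter> C" using B by (rule sets_path_spaceE)
  have "emeasure (law y) {f\<in>space path_space. rshift f 0 \<in> B} =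
      emeasure (P y) {\<omega>\<in>space M. rshift (traj X \<omega>) 0 \<in> B}"
    using traj_in by (subst emeasure_law) (auto intro!: arg_cong2[where f=emeasure])
  also have "\<dots> = emeasure (P y) (?Z -` C \<inter> space (P y))"
  proof (rule emeasure_eq_AE)
    show "AE \<omega> in P y. \<omega> \<in> {\<omega> \<in> space M. rshift (traj X \<omega>) 0 \<in> B} \<longleftrightarrow> \<omega> \<in> ?Z -` C \<inter> space (P y)"
      using start[of y] AE_space
    proof eventually_elim
      case (elim \<omega>)
      have "rshift (traj X \<omega>) 0 = ?Z \<omega>"
        unfolding rescaled_shift_def c using elim by (auto simp: traj_def fun_eq_iff)
      moreover have "rshift (traj X \<omega>) 0 \<in> space path_space"
        using elim by (intro rescaled_shift_in traj_in) (auto simp: space_P)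
      ultimately show ?case using elim C path_spaceD by (auto simp: space_P)
    qed
    show "{\<omega> \<in> space M. rshift (traj X \<omega>) 0 \<in> B} \<in> sets (P y)"
      unfolding space_P[of y, symmetric] by measurable
    show "?Z -` C \<inter> space (P y) \<in> sets (P y)"
      using ss C unfolding same_law_def by (auto intro: measurable_sets)
  qed
  also have "\<dots> = emeasure (distr (P y) traj_space ?Z) C"
    using ss C unfolding same_law_def by (subst emeasure_distr) auto
  also have "\<dots> = emeasure (distr (P (sgn y)) traj_space (traj X)) C"
    using ss unfolding same_law_def by simp
  also have "\<dots> = emeasure (P (sgn y)) {\<omega>\<in>space M. traj X \<omega> \<in> C}"
    using ss C unfolding same_law_def
    by (subst emeasure_distr) (auto simp: space_P vimage_def Int_def conj_commute)
  also have "\<dots> = emeasure (law (sgn y)) B"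
    unfolding emeasure_law[OF B] using C path_spaceD[OF traj_in]
    by (auto intro!: arg_cong2[where f=emeasure])
  finally show ?thesis .
qed

text \<open>The form of the strong Markov property used throughout: the rescaled path after a stopping
  time is independent of the past, with a law that depends on the past only through the sign of the
  current position.\<close>

lemma strong_markov_rescaled:
  assumes \<tau>: "path_stopping_time \<tau>" and A: "prior_event \<tau> A" and B: "B \<in> sets path_space"
    and fin: "\<And>f. f \<in> A \<Longrightarrow> \<tau> f < \<infinity>"
    and sgn: "\<And>f. f \<in> A \<Longrightarrow> sgn (f (enn2real (\<tau> f))) = \<epsilon>" and \<epsilon>: "\<epsilon> \<noteq> 0"
  shows "emeasure (law x) {f\<in>A. rshift f (enn2real (\<tau> f)) \<in> B} = emeasure (law x) A * emeasure (law \<epsilon>) B"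
proof -
  have [measurable]: "\<tau> \<in> borel_measurable path_space" "A \<in> sets path_space"
    using \<tau> A by (auto simp: path_stopping_time_def prior_event_def)
  note [measurable] = B
  have [measurable]: "(\<lambda>f. rshift f (enn2real (\<tau> f))) \<in> path_space \<rightarrow>\<^sub>M path_space"
    "(\<lambda>f. rshift f 0) \<in> path_space \<rightarrow>\<^sub>M path_space"
    by (rule measurable_rescaled_shift; simp)+
  define B0 where "B0 = {f\<in>space path_space. rshift f 0 \<in> B}"
  have B0 [measurable]: "B0 \<in> sets path_space" unfolding B0_def by measurable
  obtain C where C: "C \<in> sets traj_space" "B0 = {f. cadlag f} \<inter> C" using B0 by (rule sets_path_spaceE)
  have A_sub: "A \<subseteq> space path_space" by (rule sets.sets_into_space) measurable
  let ?\<tau> = "\<lambda>\<omega>. \<tau> (traj X \<omega>)"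
  let ?A = "{\<omega>\<in>space M. traj X \<omega> \<in> A}"
  have shift: "traj (\<lambda>t. X (enn2real (?\<tau> \<omega>) + t)) \<omega> \<in> C \<longleftrightarrow> rshift (traj X \<omega>) (enn2real (?\<tau> \<omega>)) \<in> B"
    if \<omega>: "\<omega> \<in> space M" for \<omega>
  proof -
    let ?g = "traj (\<lambda>t. X (enn2real (?\<tau> \<omega>) + t)) \<omega>"
    have "cadlag (\<lambda>t. X (enn2real (?\<tau> \<omega>) + 1 * t) \<omega> / 1)"
      by (rule cadlag_affine[OF cadlag_paths[OF \<omega>]]) auto
    then have "?g \<in> space path_space"
      by (auto simp: space_path_space traj_def intro: cadlag_restrict)
    moreover from this have "?g \<in> C \<longleftrightarrow> ?g \<in> B0" using C path_spaceD by auto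
    moreover have "rshift ?g 0 = rshift (traj X \<omega>) (enn2real (?\<tau> \<omega>))"
      by (auto simp: rescaled_shift_def traj_def fun_eq_iff)
    ultimately show ?thesis unfolding B0_def by simp
  qed
  have inner: "emeasure (P y) {\<omega>'\<in>space M. traj X \<omega>' \<in> C} = emeasure (law \<epsilon>) B" if y: "sgn y = \<epsilon>" for y
  proof -
    have "y \<noteq> 0" using y \<epsilon> by auto
    have "emeasure (P y) {\<omega>'\<in>space M. traj X \<omega>' \<in> C} = emeasure (law y) B0"
      unfolding emeasure_law[OF B0] using C path_spaceD[OF traj_in]
      by (auto intro!: arg_cong2[where f=emeasure])
    also have "\<dots> = emeasure (law \<epsilon>) B"
      unfolding B0_def y[symmetric] by (rule law_rescaled[OF \<open>y \<noteq> 0\<close> B])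
    finally show ?thesis .
  qed
  have A_M: "?A \<in> sets (P x)" unfolding space_P[of x, symmetric] by measurable
  have "emeasure (law x) {f\<in>A. rshift f (enn2real (\<tau> f)) \<in> B} =
      emeasure (P x) {\<omega>\<in>?A. ?\<tau> \<omega> < \<infinity> \<and> traj (\<lambda>t. X (enn2real (?\<tau> \<omega>) + t)) \<omega> \<in> C}"
    using fin shift A_sub by (subst emeasure_law) (auto intro!: arg_cong2[where f=emeasure])
  also have "\<dots> = (\<integral>\<^sup>+\<omega>\<in>{\<omega>\<in>?A. ?\<tau> \<omega> < \<infinity>}.
         emeasure (P (X (enn2real (?\<tau> \<omega>)) \<omega>)) {\<omega>'\<in>space M. traj X \<omega>' \<in> C} \<partial>P x)"
    by (rule strong_markov[OF stopping_time_path_stopping_time[OF \<tau>] prior_event_in_pre_sigma[OF \<tau> A] C(1)])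
  also have "\<dots> = (\<integral>\<^sup>+\<omega>. emeasure (law \<epsilon>) B * indicator ?A \<omega> \<partial>P x)"
  proof (rule nn_integral_cong)
    fix \<omega> assume "\<omega> \<in> space (P x)"
    show "emeasure (P (X (enn2real (?\<tau> \<omega>)) \<omega>)) {\<omega>'\<in>space M. traj X \<omega>' \<in> C} *
      indicator {\<omega>\<in>?A. ?\<tau> \<omega> < \<infinity>} \<omega> = emeasure (law \<epsilon>) B * indicator ?A \<omega>"
      using inner[OF sgn[of "traj X \<omega>", unfolded traj_eq[OF enn2real_nonneg]]] fin[of "traj X \<omega>"]
      by (auto simp: indicator_def)
  qed
  also have "\<dots> = emeasure (law \<epsilon>) B * emeasure (P x) ?A"
    using A_M by (simp add: nn_integral_cmult)
  also have "emeasure (P x) ?A = emeasure (law x) A" by (simp add: emeasure_law)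
  finally show ?thesis by (simp add: mult.commute)
qed

end

section \<open>Paths that leave their half-line by a jump across zero\<close>

lemma ennreal_eq_by_less:
  fixes x y :: ennreal
  assumes "\<And>r. 0 \<le> r \<Longrightarrow> ennreal r < x \<longleftrightarrow> ennreal r < y"
  shows "x = y"
proof (rule antisym)
  show "x \<le> y"
  proof (rule dense_ge, rule ccontr)
    fix z assume "y < z" "\<not> x \<le> z"
    then show False using assms[of "enn2real z"] by (cases z) (auto simp: not_le)
  qed
  show "y \<le> x"
  proof (rule dense_ge, rule ccontr)
    fix z assume "x < z" "\<not> y \<le> z"
    then show False using assms[of "enn2real z"] by (cases z) (auto simp: not_le)
  qed
qed

lemma less_exit_time_rescaled_shift:
  assumes f: "cadlag f" and t: "0 \<le> t" "ennreal t < exit_time f" and u: "0 \<le> u"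
  shows "ennreal u < exit_time (rescaled_shift \<alpha> f t) \<longleftrightarrow> ennreal (t + \<bar>f t\<bar> powr \<alpha> * u) < exit_time f"
proof -
  let ?Z = "rescaled_shift \<alpha> f t" and ?a = "\<bar>f t\<bar> powr \<alpha>"
  have pos: "0 < f 0 * f t" using less_exit_time_pos[OF f t] .
  then have nz: "f t \<noteq> 0" "f 0 \<noteq> 0" by auto
  then have a: "0 < ?a" by simp
  have Z: "?Z 0 * ?Z s = f 0 * f (t + ?a * s) / (\<bar>f 0\<bar> * \<bar>f t\<bar>)" if "0 \<le> s" for s
    using pos nz that
    by (auto simp: rescaled_shift_eq sgn_real_def zero_less_mult_iff abs_if field_simps)
  have iffZ: "ennreal u < exit_time ?Z \<longleftrightarrow> (\<exists>c>0. \<forall>s\<in>{0..u}. c \<le> ?Z 0 * ?Z s)"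
    by (rule less_exit_time_iff[OF cadlag_rescaled_shift[OF f t(1)] u])
  have iff: "ennreal (t + ?a * u) < exit_time f \<longleftrightarrow> (\<exists>c>0. \<forall>s\<in>{0..t + ?a * u}. c \<le> f 0 * f s)"
    by (rule less_exit_time_iff[OF f]) (use t u in auto)
  show ?thesis unfolding iff iffZ
  proof
    assume "\<exists>c>0. \<forall>s\<in>{0..u}. c \<le> ?Z 0 * ?Z s"
    then obtain c where c: "c > 0" "\<And>s. s \<in> {0..u} \<Longrightarrow> c \<le> ?Z 0 * ?Z s" by auto
    obtain d where d: "d > 0" "\<And>s. s \<in> {0..t} \<Longrightarrow> d \<le> f 0 * f s"
      using less_exit_time_iff[OF f t(1)] t(2) by auto
    show "\<exists>c>0. \<forall>s\<in>{0..t + ?a * u}. c \<le> f 0 * f s"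
    proof (intro exI[of _ "min d (c * (\<bar>f 0\<bar> * \<bar>f t\<bar>))"] conjI ballI)
      fix s assume s: "s \<in> {0..t + ?a * u}"
      show "min d (c * (\<bar>f 0\<bar> * \<bar>f t\<bar>)) \<le> f 0 * f s"
      proof (cases "s \<le> t")
        case True then show ?thesis using d(2)[of s] s by auto
      next
        case False
        let ?r = "(s - t) / ?a"
        have r: "?r \<in> {0..u}" "t + ?a * ?r = s" using False s a by (auto simp: field_simps)
        then have "c \<le> f 0 * f s / (\<bar>f 0\<bar> * \<bar>f t\<bar>)" using c(2)[OF r(1)] Z[of ?r] by auto
        then have "c * (\<bar>f 0\<bar> * \<bar>f t\<bar>) \<le> f 0 * f s" using nz by (simp add: pos_le_divide_eq)
        then show ?thesis by simp
      qed
    qed (use c d nz in auto)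
  next
    assume "\<exists>c>0. \<forall>s\<in>{0..t + ?a * u}. c \<le> f 0 * f s"
    then obtain c where c: "c > 0" "\<And>s. s \<in> {0..t + ?a * u} \<Longrightarrow> c \<le> f 0 * f s" by auto
    show "\<exists>c>0. \<forall>s\<in>{0..u}. c \<le> ?Z 0 * ?Z s"
    proof (intro exI[of _ "c / (\<bar>f 0\<bar> * \<bar>f t\<bar>)"] conjI ballI)
      fix s assume s: "s \<in> {0..u}"
      then have "c \<le> f 0 * f (t + ?a * s)" using a t by (intro c(2)) auto
      then show "c / (\<bar>f 0\<bar> * \<bar>f t\<bar>) \<le> ?Z 0 * ?Z s" using Z[of s] s nz by (auto intro: divide_right_mono)
    qed (use c nz in auto)
  qed
qed

lemma exit_time_rescaled_shift:
  assumes f: "cadlag f" and t: "0 \<le> t" "ennreal t < exit_time f"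
  shows "exit_time f = ennreal t + ennreal (\<bar>f t\<bar> powr \<alpha>) * exit_time (rescaled_shift \<alpha> f t)"
proof (rule ennreal_eq_by_less)
  fix r :: real assume r: "0 \<le> r"
  let ?e = "exit_time (rescaled_shift \<alpha> f t)" and ?a = "\<bar>f t\<bar> powr \<alpha>"
  have a: "0 < ?a" using less_exit_time_pos[OF f t] by auto
  show "ennreal r < exit_time f \<longleftrightarrow> ennreal r < ennreal t + ennreal ?a * ?e"
  proof (cases "r < t")
    case True
    then have "ennreal r < ennreal t" using r by (simp add: ennreal_lessI)
    moreover have "ennreal t \<le> ennreal t + ennreal ?a * ?e" by simp
    ultimately show ?thesis using t by (meson less_le_trans less_trans)
  next
    case False
    define u where "u = (r - t) / ?a"
    have u: "0 \<le> u" "r = t + ?a * u" using False a by (auto simp: u_def)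
    have "ennreal r < ennreal t + ennreal ?a * ?e \<longleftrightarrow> ennreal u < ?e"
    proof (cases ?e)
      case (real e)
      then have "ennreal t + ennreal ?a * ?e = ennreal (t + ?a * e)"
        using t a by (simp add: ennreal_mult[symmetric])
      then show ?thesis using real u a t r by (auto simp: ennreal_less_iff)
    next
      case top
      then show ?thesis using a by (simp add: ennreal_mult_top)
    qed
    then show ?thesis unfolding less_exit_time_rescaled_shift[OF f t u(1), of \<alpha>] u(2) by simp
  qed
qed

definition good_path :: "(real \<Rightarrow> real) \<Rightarrow> bool" where
  "good_path f \<longleftrightarrow> exit_time f < \<infinity> \<and> 0 < f 0 * left_lim f (enn2real (exit_time f)) \<and>
     f 0 * f (enn2real (exit_time f)) < 0"

text \<open>The alternative to be excluded: the path creeps up to zero and then jumps away from it. The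
  strong Markov property alone allows this; self-similarity excludes it.\<close>

definition creeping_path :: "(real \<Rightarrow> real) \<Rightarrow> bool" where
  "creeping_path f \<longleftrightarrow> f 0 \<noteq> 0 \<and> exit_time f < \<infinity> \<and> left_lim f (enn2real (exit_time f)) = 0 \<and>
     f (enn2real (exit_time f)) \<noteq> 0"

lemma exit_time_pos: "cadlag f \<Longrightarrow> f 0 \<noteq> 0 \<Longrightarrow> 0 < exit_time f"
  using less_exit_time_iff[of f 0] by (auto intro!: exI[of _ "f 0 * f 0"] simp: zero_less_mult_iff)

lemma real_exit_time_pos:
  assumes "cadlag f" "f 0 \<noteq> 0" "exit_time f < \<infinity>"
  shows "0 < enn2real (exit_time f)"
  using exit_time_pos[OF assms(1,2)] assms(3) by (simp add: enn2real_positive_iff)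

lemma good_pathD:
  assumes "good_path f" "cadlag f"
  shows "f 0 \<noteq> 0" "exit_time f = ennreal (enn2real (exit_time f))" "0 < enn2real (exit_time f)"
    "f (enn2real (exit_time f)) \<noteq> 0" "sgn (f (enn2real (exit_time f))) = - sgn (f 0)"
    "0 < f 0 * left_lim f (enn2real (exit_time f))" "f 0 * f (enn2real (exit_time f)) < 0"
proof -
  show *: "f 0 \<noteq> 0" using assms by (auto simp: good_path_def)
  show "exit_time f = ennreal (enn2real (exit_time f))" using assms by (simp add: good_path_def)
  show "0 < enn2real (exit_time f)" using assms * by (intro real_exit_time_pos) (auto simp: good_path_def)
  show "f (enn2real (exit_time f)) \<noteq> 0" "sgn (f (enn2real (exit_time f))) = - sgn (f 0)"
    "0 < f 0 * left_lim f (enn2real (exit_time f))" "f 0 * f (enn2real (exit_time f)) < 0"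
    using assms by (auto simp: good_path_def sgn_real_def mult_less_0_iff)
qed

lemma measurable_real_exit_time [measurable]: "(\<lambda>f. enn2real (exit_time f)) \<in> borel_measurable path_space"
  by measurable

lemma measurable_at_exit [measurable]:
  "(\<lambda>f. f (enn2real (exit_time f))) \<in> borel_measurable path_space"
  "(\<lambda>f. left_lim f (enn2real (exit_time f))) \<in> borel_measurable path_space"
  by (auto intro!: measurable_path_evalI measurable_left_lim)

lemma measurable_good_path [measurable]: "Measurable.pred path_space good_path"
  unfolding good_path_def by measurable

lemma measurable_creeping_path [measurable]: "Measurable.pred path_space creeping_path"
  unfolding creeping_path_def by measurable

lemma left_lim_before_exit:
  assumes f: "cadlag f" and t: "0 < t" "ennreal t \<le> exit_time f"
  shows "0 \<le> f 0 * left_lim f t"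
proof (rule tendsto_lowerbound)
  show "((\<lambda>s. f 0 * f s) \<longlongrightarrow> f 0 * left_lim f t) (at_left t)"
    by (intro tendsto_mult_left cadlag_left f t)
  have "0 \<le> f 0 * f s" if "s \<in> {0<..<t}" for s
  proof -
    have "ennreal s < ennreal t" using that t by (auto simp: ennreal_less_iff)
    then show ?thesis using less_exit_time_pos[OF f, of s] that t by (auto intro: less_imp_le less_le_trans)
  qed
  then show "\<forall>\<^sub>F s in at_left t. 0 \<le> f 0 * f s" using t by (intro eventually_at_leftI[of 0 t]) auto
qed simp

text \<open>Before the exit all values have the sign of \<open>f 0\<close>, and so have the left limits in the weak sense.\<close>

lemma sign_change_not_before_exit:
  assumes f: "cadlag f" and t: "0 < t" "f t * left_lim f t < 0"
  shows "exit_time f \<le> ennreal t"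
proof (rule ccontr)
  assume "\<not> exit_time f \<le> ennreal t"
  then have *: "ennreal t < exit_time f" by simp
  have "0 < f 0 * f t" using t by (intro less_exit_time_pos f *) auto
  moreover have "0 \<le> f 0 * left_lim f t" using t * by (intro left_lim_before_exit f) auto
  ultimately have "0 \<le> (f 0 * f t) * (f 0 * left_lim f t)" by simp
  also have "\<dots> = (f 0 * f 0) * (f t * left_lim f t)" by (simp add: mult_ac)
  finally have "0 \<le> (f 0 * f 0) * (f t * left_lim f t)" .
  moreover have "0 < f 0 * f 0" using \<open>0 < f 0 * f t\<close> by (auto simp: zero_less_mult_iff)
  ultimately have "0 \<le> f t * left_lim f t" by (simp add: zero_le_mult_iff[of "f 0 * f 0"])
  then show False using t by simp
qed

text \<open>At the exit the left limit is either nonzero, and then the path has jumped across zero, or it is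
  zero. The value at the exit cannot be zero, since the path would be absorbed and never change sign.\<close>

lemma good_or_creeping:
  assumes f: "cadlag f" "f 0 \<noteq> 0" and t: "0 < t" "f t * left_lim f t < 0"
    and absorbed: "\<And>s u. 0 < s \<Longrightarrow> s \<le> u \<Longrightarrow> f s = 0 \<Longrightarrow> f u = 0"
  shows "good_path f \<or> creeping_path f"
proof -
  have le: "exit_time f \<le> ennreal t" using sign_change_not_before_exit[OF f(1) t] .
  then obtain e where e: "0 \<le> e" "exit_time f = ennreal e"
    by (cases "exit_time f") (auto simp: top_unique)
  have e_pos: "0 < e" using exit_time_pos[OF f] e by simp
  have et: "e \<le> t" using le e t by (simp add: ennreal_le_iff)
  have nz: "f e \<noteq> 0" using absorbed[OF e_pos et] t by auto
  have ge: "0 \<le> f 0 * left_lim f e" by (rule left_lim_before_exit[OF f(1) e_pos]) (simp add: e)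
  show ?thesis
  proof (cases "f 0 * left_lim f e = 0")
    case True
    then show ?thesis using nz e f by (simp add: creeping_path_def)
  next
    case False
    then have L: "0 < f 0 * left_lim f e" using ge by linarith
    have "((\<lambda>s. f 0 * f s) \<longlongrightarrow> f 0 * left_lim f e) (at_left e)"
      by (intro tendsto_mult_left cadlag_left f e_pos)
    then have "\<forall>\<^sub>F s in at_left e. f 0 * left_lim f e / 2 < f 0 * f s"
      by (rule order_tendstoD) (use L in auto)
    then obtain b where b: "b < e" "\<And>s. b < s \<Longrightarrow> s < e \<Longrightarrow> f 0 * left_lim f e / 2 < f 0 * f s"
      by (auto simp: eventually_at_left[of "e-1" e])
    define u where "u = max 0 ((b + e) / 2)"
    have u: "0 \<le> u" "b < u" "u < e" using b e_pos by (auto simp: u_def less_max_iff_disj)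
    have "ennreal u < exit_time f" using u e by (simp add: ennreal_less_iff)
    then obtain c where c: "c > 0" "\<And>s. s \<in> {0..u} \<Longrightarrow> c \<le> f 0 * f s"
      using less_exit_time_iff[OF f(1) u(1)] by auto
    have "f 0 * f e \<le> 0"
    proof (rule ccontr)
      assume pos: "\<not> f 0 * f e \<le> 0"
      let ?d = "min (min c (f 0 * left_lim f e / 2)) (f 0 * f e)"
      have "\<forall>s\<in>{0..e}. ?d \<le> f 0 * f s"
      proof
        fix s assume "s \<in> {0..e}"
        then show "?d \<le> f 0 * f s" using c(2)[of s] b(2)[of s] u
          by (cases "s \<le> u"; cases "s = e") auto
      qed
      moreover have "?d > 0" using c L pos by auto
      ultimately have "ennreal e < exit_time f" using less_exit_time_iff[OF f(1) e(1)] by blast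
      then show False using e by simp
    qed
    then have "f 0 * f e < 0" using nz f by (simp add: order_less_le)
    then show ?thesis using L e by (simp add: good_path_def)
  qed
qed

lemma good_path_stopped_path:
  assumes f: "f \<in> space path_space" and t: "0 \<le> t" "exit_time f \<le> ennreal t"
  shows "exit_time (stopped_path t f) = exit_time f"
    "stopped_path t f (enn2real (exit_time f)) = f (enn2real (exit_time f))"
    "left_lim (stopped_path t f) (enn2real (exit_time f)) = left_lim f (enn2real (exit_time f))"
    "stopped_path t f 0 = f 0"
    "good_path (stopped_path t f) \<longleftrightarrow> good_path f"
proof -
  show e: "exit_time (stopped_path t f) = exit_time f"
    by (rule path_stopping_time_stopped_path[OF path_stopping_time_exit_time f t])
  have le: "enn2real (exit_time f) \<le> t" using t by (simp add: enn2real_leI)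
  show a: "stopped_path t f (enn2real (exit_time f)) = f (enn2real (exit_time f))"
    using le by (simp add: stopped_path_eq)
  show b: "left_lim (stopped_path t f) (enn2real (exit_time f)) = left_lim f (enn2real (exit_time f))"
    by (rule left_lim_cong) (use le in \<open>auto simp: stopped_path_eq\<close>)
  show c: "stopped_path t f 0 = f 0" using t by (simp add: stopped_path_eq)
  show "good_path (stopped_path t f) \<longleftrightarrow> good_path f"
    unfolding good_path_def e a b c ..
qed

context real_ssmp_family
begin

section \<open>Almost every path leaves its half-line by a jump across zero\<close>

definition creeping_from :: "real \<Rightarrow> real \<Rightarrow> (real \<Rightarrow> real) set" where
  "creeping_from \<epsilon> y = {f\<in>space path_space. f 0 = \<epsilon> \<and> creeping_path f \<and> y < \<bar>f (enn2real (exit_time f))\<bar>}"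

lemma sets_creeping_from [measurable]: "creeping_from \<epsilon> y \<in> sets path_space"
  unfolding creeping_from_def by measurable

lemma creeping_from_rshift:
  assumes f: "f \<in> creeping_from \<epsilon> y" and \<epsilon>: "\<bar>\<epsilon>\<bar> = 1" and t: "0 \<le> t" "ennreal t < exit_time f" "\<bar>f t\<bar> < c"
    and y: "0 < y"
  shows "sgn (f t) = \<epsilon> \<and> rshift f t \<in> creeping_from \<epsilon> (y / c)"
proof -
  let ?Z = "rshift f t" and ?a = "\<bar>f t\<bar> powr \<alpha>" and ?e = "enn2real (exit_time f)"
  have fS: "f \<in> space path_space" and f0: "f 0 = \<epsilon>" and cr: "creeping_path f" "y < \<bar>f ?e\<bar>"
    using f by (auto simp: creeping_from_def)
  have cad: "cadlag f" using fS by (rule path_spaceD)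
  have pos: "0 < f 0 * f t" by (rule less_exit_time_pos[OF cad t(1,2)])
  then have sg: "sgn (f t) = \<epsilon>" using \<epsilon> f0 by (auto simp: sgn_real_def zero_less_mult_iff abs_if split: if_splits)
  have nz: "f t \<noteq> 0" using pos by auto
  then have a: "0 < ?a" by simp
  have ZS: "?Z \<in> space path_space" using fS t by (intro rescaled_shift_in)
  have Z0: "?Z 0 = \<epsilon>" by (simp add: rescaled_shift_0 sg)
  have ee: "exit_time f = ennreal t + ennreal ?a * exit_time ?Z"
    by (rule exit_time_rescaled_shift[OF cad t(1,2)])
  have fin: "exit_time f < \<infinity>" using cr by (simp add: creeping_path_def)
  have Zfin: "exit_time ?Z < \<infinity>"
    using fin a unfolding ee by (auto simp: less_top[symmetric] ennreal_mult_eq_top_iff)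
  define z where "z = enn2real (exit_time ?Z)"
  have z: "exit_time ?Z = ennreal z" "0 \<le> z" using Zfin by (auto simp: z_def)
  have z_pos: "0 < z"
    unfolding z_def using Zfin Z0 \<epsilon> path_spaceD[OF ZS] by (intro real_exit_time_pos) auto
  have e: "?e = t + ?a * z"
    using t(1) z a by (simp add: ee ennreal_mult[symmetric] ennreal_plus[symmetric] del: ennreal_plus)
  have Ze: "?Z z = f ?e / \<bar>f t\<bar>" using z by (simp add: rescaled_shift_eq e)
  have "left_lim ?Z z = left_lim (\<lambda>s. f (t + ?a * s) / \<bar>f t\<bar>) z"
    by (rule left_lim_cong) (simp add: rescaled_shift_eq)
  also have "\<dots> = left_lim f ?e / \<bar>f t\<bar>"
    unfolding e by (rule left_lim_affine[OF cad t(1) a z_pos])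
  also have "\<dots> = 0" using cr by (simp add: creeping_path_def)
  finally have Zl: "left_lim ?Z z = 0" .
  have cpos: "0 < c" using t by linarith
  have "y / c < \<bar>f ?e\<bar> / \<bar>f t\<bar>"
  proof -
    have "y / c \<le> y / \<bar>f t\<bar>" using t y nz by (intro divide_left_mono) auto
    also have "\<dots> < \<bar>f ?e\<bar> / \<bar>f t\<bar>" using cr nz by (intro divide_strict_right_mono) auto
    finally show ?thesis .
  qed
  moreover have "f ?e \<noteq> 0" using cr by (simp add: creeping_path_def)
  ultimately show ?thesis
    using ZS Z0 \<epsilon> Zfin Zl nz z_pos Ze sg
    by (auto simp: creeping_from_def creeping_path_def z_def[symmetric] abs_divide)
qed

text \<open>Seen from a time before the exit at which \<open>\<bar>X\<bar> < c\<close>, the jump away from zero is larger than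
  \<open>y / c\<close> in rescaled units. The time is taken as the first dyadic one of its level, so that the
  Markov property applies.\<close>

lemma creeping_from_le:
  assumes \<epsilon>: "\<bar>\<epsilon>\<bar> = 1" and y: "0 < y" and c: "0 < c"
  shows "emeasure (law \<epsilon>) (creeping_from \<epsilon> y) \<le> emeasure (law \<epsilon>) (creeping_from \<epsilon> (y / c))"
proof -
  interpret prob_space "law \<epsilon>" by (rule prob_space_law)
  define d :: "nat \<Rightarrow> nat \<Rightarrow> real" where "d n j = real j / 2 ^ n" for n j
  define B where "B n = {f\<in>creeping_from \<epsilon> y. \<exists>j. ennreal (d n j) < exit_time f \<and> \<bar>f (d n j)\<bar> < c}" for n
  have d0: "0 \<le> d n j" for n j by (simp add: d_def)
  have B_sets: "B n \<in> sets path_space" for n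
  proof -
    have "B n = creeping_from \<epsilon> y \<inter>
      {f\<in>space path_space. \<exists>j. ennreal (d n j) < exit_time f \<and> \<bar>f (d n j)\<bar> < c}"
      by (auto simp: B_def creeping_from_def)
    also have "\<dots> \<in> sets path_space" by measurable
    finally show ?thesis .
  qed
  have le: "emeasure (law \<epsilon>) (B n) \<le> emeasure (law \<epsilon>) (creeping_from \<epsilon> (y / c))" for n
  proof -
    \<comment> \<open>\<open>A j\<close>: the grid time \<open>d n j\<close> is the first one at which the path is below \<open>c\<close> in modulus.\<close>
    define A where "A j = {f\<in>space path_space. \<bar>f (d n j)\<bar> < c \<and> sgn (f (d n j)) = \<epsilon> \<and>
       (\<forall>i\<in>{..<j}. \<not> \<bar>f (d n i)\<bar> < c)}" for j
    let ?E = "\<lambda>j. {f\<in>A j. rshift f (d n j) \<in> creeping_from \<epsilon> (y / c)}"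
    have A_sets [measurable]: "A j \<in> sets path_space" for j unfolding A_def by measurable
    have [measurable]: "(\<lambda>f. rshift f (d n j)) \<in> path_space \<rightarrow>\<^sub>M path_space" for j
      by (rule measurable_rescaled_shift) (auto simp: d0)
    have E_sets [measurable]: "?E j \<in> sets path_space" for j
    proof -
      have "?E j = A j \<inter> {f\<in>space path_space. rshift f (d n j) \<in> creeping_from \<epsilon> (y / c)}"
        by (auto simp: A_def)
      also have "\<dots> \<in> sets path_space" by measurable
      finally show ?thesis .
    qed
    have sub: "B n \<subseteq> (\<Union>j. ?E j)"
    proof
      fix f assume f: "f \<in> B n"
      then obtain k where k: "ennreal (d n k) < exit_time f" "\<bar>f (d n k)\<bar> < c" by (auto simp: B_def)
      define j where "j = (LEAST j. \<bar>f (d n j)\<bar> < c)"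
      have j: "\<bar>f (d n j)\<bar> < c" unfolding j_def by (rule LeastI[of _ k]) (rule k)
      have min: "\<not> \<bar>f (d n i)\<bar> < c" if "i < j" for i using that not_less_Least unfolding j_def by blast
      have "j \<le> k" unfolding j_def by (rule Least_le) (rule k)
      then have "d n j \<le> d n k" by (simp add: d_def divide_right_mono)
      then have "ennreal (d n j) < exit_time f" using k by (meson ennreal_leI le_less_trans)
      then have "sgn (f (d n j)) = \<epsilon> \<and> rshift f (d n j) \<in> creeping_from \<epsilon> (y / c)"
        using f j by (intro creeping_from_rshift[OF _ \<epsilon> d0 _ _ y]) (auto simp: B_def)
      then have "f \<in> ?E j" using f j min by (auto simp: A_def B_def creeping_from_def)
      then show "f \<in> (\<Union>j. ?E j)" by blast
    qed
    have E: "emeasure (law \<epsilon>) (?E j) = emeasure (law \<epsilon>) (A j) * emeasure (law \<epsilon>) (creeping_from \<epsilon> (y / c))" for j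
    proof -
      have prior: "prior_event (\<lambda>_. ennreal (d n j)) (A j)"
        unfolding prior_event_def
      proof (intro conjI ballI allI impI)
        fix f t assume f: "f \<in> space path_space" and t: "0 \<le> t" "ennreal (d n j) \<le> ennreal t"
        have "d n i \<le> t" if "i \<le> j" for i
        proof -
          have "d n i \<le> d n j" using that by (simp add: d_def divide_right_mono)
          also have "\<dots> \<le> t" using t by (simp add: ennreal_le_iff)
          finally show ?thesis .
        qed
        then have "stopped_path t f (d n i) = f (d n i)" if "i \<le> j" for i
          using that by (intro stopped_path_eq d0)
        then show "f \<in> A j \<longleftrightarrow> stopped_path t f \<in> A j"
          using f stopped_path_in[OF f t(1)] by (simp add: A_def)
      qed (rule A_sets)
      have "emeasure (law \<epsilon>) {f\<in>A j. rshift f (enn2real (ennreal (d n j))) \<in> creeping_from \<epsilon> (y / c)} =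
        emeasure (law \<epsilon>) (A j) * emeasure (law \<epsilon>) (creeping_from \<epsilon> (y / c))"
        by (rule strong_markov_rescaled[OF path_stopping_time_const prior sets_creeping_from])
           (use \<epsilon> in \<open>auto simp: A_def d0\<close>)
      then show ?thesis by (simp add: d0)
    qed
    have disj: "disjoint_family A"
      unfolding disjoint_family_on_def
    proof (intro ballI impI)
      fix i j :: nat assume "i \<noteq> j"
      then show "A i \<inter> A j = {}" by (cases i j rule: linorder_cases) (auto simp: A_def)
    qed
    have "emeasure (law \<epsilon>) (B n) \<le> emeasure (law \<epsilon>) (\<Union>j. ?E j)"
      by (rule emeasure_mono[OF sub]) (intro sets.countable_UN'' E_sets[folded sets_law[of \<epsilon>]] countableI_type)
    also have "\<dots> \<le> (\<Sum>j. emeasure (law \<epsilon>) (?E j))"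
      by (rule emeasure_subadditive_countably) (unfold sets_law, blast intro: E_sets)
    also have "\<dots> = (\<Sum>j. emeasure (law \<epsilon>) (A j)) * emeasure (law \<epsilon>) (creeping_from \<epsilon> (y / c))"
      unfolding E by (rule ennreal_suminf_multc)
    also have "(\<Sum>j. emeasure (law \<epsilon>) (A j)) = emeasure (law \<epsilon>) (\<Union>j. A j)"
      by (rule suminf_emeasure[OF _ disj]) (unfold sets_law, blast intro: A_sets)
    also have "\<dots> * emeasure (law \<epsilon>) (creeping_from \<epsilon> (y / c)) \<le> 1 * emeasure (law \<epsilon>) (creeping_from \<epsilon> (y / c))"
      by (rule mult_right_mono[OF emeasure_le_1]) simp
    finally show ?thesis by simp
  qed
  have inc: "incseq B"
  proof (rule incseq_SucI, rule subsetI)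
    fix n f assume "f \<in> B n"
    then obtain j where j: "f \<in> creeping_from \<epsilon> y" "ennreal (d n j) < exit_time f" "\<bar>f (d n j)\<bar> < c"
      by (auto simp: B_def)
    moreover have "d n j = d (Suc n) (2 * j)" by (simp add: d_def)
    ultimately show "f \<in> B (Suc n)" unfolding B_def by auto
  qed
  have UN: "(\<Union>n. B n) = creeping_from \<epsilon> y"
  proof (intro equalityI subsetI)
    fix f assume f: "f \<in> creeping_from \<epsilon> y"
    let ?e = "enn2real (exit_time f)"
    have cad: "cadlag f" and fin: "exit_time f = ennreal ?e" and l: "left_lim f ?e = 0" and e: "0 < ?e"
    proof -
      have *: "f \<in> space path_space" "f 0 \<noteq> 0" "exit_time f < \<infinity>" "left_lim f ?e = 0"
        using f by (simp_all add: creeping_from_def creeping_path_def)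
      then show "cadlag f" "exit_time f = ennreal ?e" "left_lim f ?e = 0" by (simp_all add: path_spaceD)
      show "0 < ?e" using * by (intro real_exit_time_pos path_spaceD)
    qed
    have "(f \<longlongrightarrow> 0) (at_left ?e)" using cadlag_left[OF cad e] l by simp
    then have "\<forall>\<^sub>F s in at_left ?e. \<bar>f s\<bar> < c"
      using tendstoD[of f 0 _ c] c by (simp add: dist_real_def)
    then obtain b where b: "b < ?e" "\<And>s. b < s \<Longrightarrow> s < ?e \<Longrightarrow> \<bar>f s\<bar> < c"
      by (auto simp: eventually_at_left[of "?e-1" ?e])
    define t where "t = max 0 b"
    have t: "0 \<le> t" "b \<le> t" "t < ?e" using b e by (auto simp: t_def)
    have "\<forall>\<^sub>F r in at_right t. t < r \<and> r < ?e" using t by (intro eventually_at_rightI[of t ?e]) auto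
    then have "\<forall>\<^sub>F n in sequentially. t < real_of_int (\<lfloor>t * 2 ^ n\<rfloor> + 1) / 2 ^ n \<and>
        real_of_int (\<lfloor>t * 2 ^ n\<rfloor> + 1) / 2 ^ n < ?e"
      by (rule eventually_compose_filterlim[OF _ filterlim_dyadic_above])
    then obtain n where n: "t < real_of_int (\<lfloor>t * 2 ^ n\<rfloor> + 1) / 2 ^ n"
        "real_of_int (\<lfloor>t * 2 ^ n\<rfloor> + 1) / 2 ^ n < ?e"
      using eventually_happens'[OF sequentially_bot] by blast
    define j where "j = nat (\<lfloor>t * 2 ^ n\<rfloor> + 1)"
    have "0 \<le> \<lfloor>t * 2 ^ n\<rfloor>" using t by simp
    then have dj: "d n j = real_of_int (\<lfloor>t * 2 ^ n\<rfloor> + 1) / 2 ^ n" by (simp add: d_def j_def)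
    have j: "b < d n j" "d n j < ?e" using n t unfolding dj by linarith+
    have "ennreal (d n j) < ennreal ?e" using j d0 by (simp add: ennreal_less_iff)
    then have "ennreal (d n j) < exit_time f" using fin by simp
    then have "f \<in> B n" using f j b(2)[of "d n j"] by (auto simp: B_def)
    then show "f \<in> (\<Union>n. B n)" by blast
  qed (auto simp: B_def)
  have "(\<lambda>n. emeasure (law \<epsilon>) (B n)) \<longlonglongrightarrow> emeasure (law \<epsilon>) (\<Union>n. B n)"
    by (rule Lim_emeasure_incseq[OF _ inc]) (unfold sets_law, blast intro: B_sets)
  then show ?thesis unfolding UN by (rule tendsto_upperbound) (use le in auto)
qed

text \<open>The probability of a jump away from zero of size larger than \<open>y\<close> is at most that of one larger than
  \<open>k y\<close>, for every \<open>k\<close>, hence zero.\<close>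

lemma creeping_null:
  assumes \<epsilon>: "\<bar>\<epsilon>\<bar> = 1"
  shows "AE f in law \<epsilon>. \<not> creeping_path f"
proof -
  interpret prob_space "law \<epsilon>" by (rule prob_space_law)
  have null: "emeasure (law \<epsilon>) (creeping_from \<epsilon> y) = 0" if y: "0 < y" for y
  proof -
    let ?C = "\<lambda>k::nat. creeping_from \<epsilon> (y * real (Suc k))"
    have "decseq ?C"
    proof (rule decseq_SucI, rule subsetI)
      fix k f assume "f \<in> ?C (Suc k)"
      moreover have "y * real (Suc k) \<le> y * real (Suc (Suc k))" using y by simp
      ultimately show "f \<in> ?C k" unfolding creeping_from_def by auto
    qed
    then have "(\<lambda>k. emeasure (law \<epsilon>) (?C k)) \<longlonglongrightarrow> emeasure (law \<epsilon>) (\<Inter>k. ?C k)"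
      by (intro Lim_emeasure_decseq) (auto simp: sets_law)
    moreover have "(\<Inter>k. ?C k) = {}"
    proof (rule equals0I)
      fix f assume f: "f \<in> (\<Inter>k. ?C k)"
      obtain k where "\<bar>f (enn2real (exit_time f))\<bar> / y < real k" using reals_Archimedean2 by blast
      then have "\<bar>f (enn2real (exit_time f))\<bar> < y * real (Suc k)"
        using y by (simp add: field_simps)
      moreover have "f \<in> ?C k" using f by blast
      ultimately show False unfolding creeping_from_def by auto
    qed
    moreover have "emeasure (law \<epsilon>) (creeping_from \<epsilon> y) \<le> emeasure (law \<epsilon>) (?C k)" for k
      using creeping_from_le[OF \<epsilon> y, of "1 / real (Suc k)"] by simp
    ultimately have "emeasure (law \<epsilon>) (creeping_from \<epsilon> y) \<le> 0"
      by (intro tendsto_lowerbound[where F=sequentially and f="\<lambda>k. emeasure (law \<epsilon>) (?C k)"]) auto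
    then show ?thesis by simp
  qed
  have "AE f in law \<epsilon>. f \<notin> creeping_from \<epsilon> (1 / real (Suc k))" for k
    by (rule AE_not_in) (use null[of "1 / real (Suc k)"] in \<open>auto simp: null_sets_def sets_law\<close>)
  then have "AE f in law \<epsilon>. \<forall>k. f \<notin> creeping_from \<epsilon> (1 / real (Suc k))" by (subst AE_all_countable) auto
  then show ?thesis using AE_law_start[of \<epsilon>] AE_space
  proof eventually_elim
    case (elim f)
    show ?case
    proof
      assume cr: "creeping_path f"
      then have "0 < \<bar>f (enn2real (exit_time f))\<bar>" by (simp add: creeping_path_def)
      then obtain k where "1 / real (Suc k) < \<bar>f (enn2real (exit_time f))\<bar>" using nat_approx_posE by blast
      then have "f \<in> creeping_from \<epsilon> (1 / real (Suc k))"
        using elim cr by (auto simp: creeping_from_def space_law)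
      then show False using elim by blast
    qed
  qed
qed

end

section \<open>Measurability of the sign changes\<close>

abbreviation (input) coord :: "real \<Rightarrow> (real \<Rightarrow> real) \<Rightarrow> real" where
  "coord t f \<equiv> f t"

lemma cadlag_oscillation:
  assumes f: "cadlag f" and s: "0 \<le> s" and \<eta>: "0 < \<eta>"
  obtains \<delta> where "\<delta> > 0" "\<And>u. s \<le> u \<Longrightarrow> u < s + \<delta> \<Longrightarrow> \<bar>f u - f s\<bar> < \<eta>"
    "\<And>u. 0 \<le> u \<Longrightarrow> s - \<delta> < u \<Longrightarrow> u < s \<Longrightarrow> \<bar>f u - left_lim f s\<bar> < \<eta>"
proof -
  have "\<forall>\<^sub>F u in at_right s. \<bar>f u - f s\<bar> < \<eta>"
    using tendstoD[OF cadlag_right[OF f s] \<eta>] by (simp add: dist_real_def)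
  then obtain b where b: "b > s" "\<And>u. s < u \<Longrightarrow> u < b \<Longrightarrow> \<bar>f u - f s\<bar> < \<eta>"
    by (auto simp: eventually_at_right[of s "s+1"])
  have right: "\<bar>f u - f s\<bar> < \<eta>" if "s \<le> u" "u < b" for u
    using b(2)[of u] that \<eta> by (cases "u = s") auto
  show thesis
  proof (cases "s = 0")
    case True
    then show thesis using b(1) right by (intro that[of "b - s"]) auto
  next
    case False
    then have "0 < s" using s by simp
    then have "\<forall>\<^sub>F u in at_left s. \<bar>f u - left_lim f s\<bar> < \<eta>"
      using tendstoD[OF cadlag_left[OF f] \<eta>] by (simp add: dist_real_def)
    then obtain a where a: "a < s" "\<And>u. a < u \<Longrightarrow> u < s \<Longrightarrow> \<bar>f u - left_lim f s\<bar> < \<eta>"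
      by (auto simp: eventually_at_left[of "s-1" s])
    show thesis
    proof (rule that[of "min (b - s) (s - a)"])
      show "0 < min (b - s) (s - a)" using a(1) b(1) by simp
      show "\<bar>f u - f s\<bar> < \<eta>" if "s \<le> u" "u < s + min (b - s) (s - a)" for u
        using that by (intro right) auto
      show "\<bar>f u - left_lim f s\<bar> < \<eta>" if "s - min (b - s) (s - a) < u" "u < s" for u
        using that by (intro a(2)) auto
    qed
  qed
qed

lemma same_sign_if_close: "\<bar>u - x\<bar> < \<eta> \<Longrightarrow> \<eta> \<le> \<bar>x\<bar> \<Longrightarrow> 0 < u * (x::real)"
  by (cases "0 \<le> x") (auto simp: zero_less_mult_iff)

lemma opposite_sign_cong: "x * y < 0 \<Longrightarrow> 0 < u * x \<Longrightarrow> 0 < v * y \<Longrightarrow> u * v < (0::real)"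
  by (auto simp: zero_less_mult_iff mult_less_0_iff)

lemma abs_diff_opposite_sign: "x * y < 0 \<Longrightarrow> \<bar>x - y\<bar> = \<bar>x\<bar> + \<bar>y\<bar>" for x y :: real
  by (auto simp: mult_less_0_iff)

text \<open>A jump across zero is visible at rational times: these come arbitrarily close together while
  the values have opposite signs and stay away from zero. Conversely such pairs of times accumulate
  at some point, and by the one-sided limits there they must eventually lie on both sides of it.\<close>

lemma sign_change_between_iff:
  assumes f: "cadlag f" and a: "0 \<le> a"
  shows "(\<exists>s. a < s \<and> s < t \<and> f s * left_lim f s < 0) \<longleftrightarrow>
    (\<exists>(k::nat) (b::rat). of_rat b < t \<and> (\<forall>m::nat. \<exists>(p::rat) (q::rat). a < of_rat p \<and> p < q \<and> q < b \<and>
       of_rat q - of_rat p < 1 / real (Suc m) \<and> f (of_rat p) * f (of_rat q) < 0 \<and>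
       1 / real (Suc k) < \<bar>f (of_rat p)\<bar> \<and> 1 / real (Suc k) < \<bar>f (of_rat q)\<bar>))"
    (is "?L \<longleftrightarrow> ?R")
proof
  assume ?L
  then obtain s where s: "a < s" "s < t" "f s * left_lim f s < 0" by blast
  then have "0 < min \<bar>f s\<bar> \<bar>left_lim f s\<bar>" by auto
  then obtain k where k: "1 / real (Suc k) < min \<bar>f s\<bar> \<bar>left_lim f s\<bar>" using nat_approx_posE by blast
  define \<eta> where "\<eta> = min \<bar>f s\<bar> \<bar>left_lim f s\<bar> - 1 / real (Suc k)"
  have s0: "0 \<le> s" using s a by simp
  have \<eta>: "0 < \<eta>" using k by (simp add: \<eta>_def)
  obtain \<delta> where \<delta>: "\<delta> > 0" "\<And>u. s \<le> u \<Longrightarrow> u < s + \<delta> \<Longrightarrow> \<bar>f u - f s\<bar> < \<eta>"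
    "\<And>u. 0 \<le> u \<Longrightarrow> s - \<delta> < u \<Longrightarrow> u < s \<Longrightarrow> \<bar>f u - left_lim f s\<bar> < \<eta>"
    using cadlag_oscillation[OF f s0 \<eta>] by blast
  obtain b :: rat where b: "s < of_rat b" "of_rat b < t" using of_rat_dense[OF s(2)] by blast
  show ?R
  proof (rule exI[of _ k], rule exI[of _ b], intro conjI allI, rule b(2))
    fix m
    let ?h = "min \<delta> (1 / (2 * real (Suc m)))"
    have h: "0 < ?h" using \<delta> by simp
    have "max a (s - ?h) < s" using s h by simp
    then obtain p :: rat where p: "max a (s - ?h) < of_rat p" "of_rat p < s" using of_rat_dense by blast
    have "s < min (of_rat b) (s + ?h)" using b h by simp
    then obtain q :: rat where q: "s < of_rat q" "of_rat q < min (of_rat b) (s + ?h)" using of_rat_dense by blast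
    have 1: "\<bar>f (of_rat p) - left_lim f s\<bar> < \<eta>" using p a by (intro \<delta>(3); linarith)
    have 2: "\<bar>f (of_rat q) - f s\<bar> < \<eta>" using q by (intro \<delta>(2)) auto
    have 3: "0 < 1 / real (Suc k)" by simp
    have big: "1 / real (Suc k) < \<bar>f (of_rat p)\<bar>" "1 / real (Suc k) < \<bar>f (of_rat q)\<bar>"
      using 1 2 unfolding \<eta>_def by linarith+
    have \<eta>_le: "\<eta> \<le> \<bar>f s\<bar>" "\<eta> \<le> \<bar>left_lim f s\<bar>" using 3 unfolding \<eta>_def by linarith+
    have "f (of_rat q) * f (of_rat p) < 0"
      by (rule opposite_sign_cong[OF s(3) same_sign_if_close[OF 2 \<eta>_le(1)] same_sign_if_close[OF 1 \<eta>_le(2)]])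
    then have "f (of_rat p) * f (of_rat q) < 0" by (simp only: mult.commute)
    moreover have "p < q" "q < b"
      using p q by (simp_all add: of_rat_less[where 'a=real, symmetric])
    moreover have "of_rat q - of_rat p < 1 / real (Suc m)"
    proof -
      have half: "1 / (2 * x) + 1 / (2 * x) = 1 / x" for x :: real by (cases "x = 0") (simp_all add: field_simps)
      have "of_rat q - of_rat p < 1 / (2 * real (Suc m)) + 1 / (2 * real (Suc m))" using p q by linarith
      then show ?thesis unfolding half .
    qed
    ultimately show "\<exists>p q. a < of_rat p \<and> p < q \<and> q < b \<and> of_rat q - of_rat p < 1 / real (Suc m) \<and>
      f (of_rat p) * f (of_rat q) < 0 \<and> 1 / real (Suc k) < \<bar>f (of_rat p)\<bar> \<and> 1 / real (Suc k) < \<bar>f (of_rat q)\<bar>"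
      using big p(1) by (intro exI[of _ p] exI[of _ q]) (simp only: max_less_iff_conj simp_thms)
  qed
next
  assume ?R
  then obtain k b where b: "of_rat b < t" and
    "\<forall>m::nat. \<exists>(p::rat) (q::rat). a < of_rat p \<and> p < q \<and> q < b \<and>
       of_rat q - of_rat p < 1 / real (Suc m) \<and> f (of_rat p) * f (of_rat q) < 0 \<and>
       1 / real (Suc k) < \<bar>f (of_rat p)\<bar> \<and> 1 / real (Suc k) < \<bar>f (of_rat q)\<bar>" by blast
  then obtain p q :: "nat \<Rightarrow> rat" where "\<forall>m. a < of_rat (p m) \<and> p m < q m \<and> q m < b \<and>
       of_rat (q m) - of_rat (p m) < 1 / real (Suc m) \<and> f (of_rat (p m)) * f (of_rat (q m)) < 0 \<and>
       1 / real (Suc k) < \<bar>f (of_rat (p m))\<bar> \<and> 1 / real (Suc k) < \<bar>f (of_rat (q m))\<bar>"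
    by metis
  then have pq: "a < of_rat (p m)" "of_rat (p m) < (of_rat (q m) :: real)" "of_rat (q m) < (of_rat b :: real)"
       "of_rat (q m) - of_rat (p m) < 1 / real (Suc m)" "f (of_rat (p m)) * f (of_rat (q m)) < 0"
       "1 / real (Suc k) < \<bar>f (of_rat (p m))\<bar>" "1 / real (Suc k) < \<bar>f (of_rat (q m))\<bar>" for m
    by (auto simp: of_rat_less)
  have "\<forall>m. (of_rat (p m) :: real) \<in> {a..of_rat b}" 
  proof
    fix m
    show "(of_rat (p m) :: real) \<in> {a..of_rat b}" using pq(1,2,3)[of m] by simp
  qed
  then obtain s r where s: "s \<in> {a..of_rat b}" and r: "strict_mono r" "((\<lambda>m. of_rat (p m)) \<circ> r) \<longlonglongrightarrow> s"
    using seq_compactE[OF compact_imp_seq_compact[OF compact_Icc[of a "of_rat b"]]] by metis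
  define \<eta> where "\<eta> = 1 / real (Suc k)"
  have s0: "0 \<le> s" using s a by simp
  have \<eta>: "0 < \<eta>" by (simp add: \<eta>_def)
  obtain \<delta> where \<delta>: "\<delta> > 0" "\<And>u. s \<le> u \<Longrightarrow> u < s + \<delta> \<Longrightarrow> \<bar>f u - f s\<bar> < \<eta>"
    "\<And>u. 0 \<le> u \<Longrightarrow> s - \<delta> < u \<Longrightarrow> u < s \<Longrightarrow> \<bar>f u - left_lim f s\<bar> < \<eta>"
    using cadlag_oscillation[OF f s0 \<eta>] by blast
  obtain N where N: "1 / real (Suc N) < \<delta> / 2" using nat_approx_posE[of "\<delta>/2"] \<delta> by auto
  have "\<forall>\<^sub>F m in sequentially. \<bar>of_rat (p (r m)) - s\<bar> < \<delta> / 2"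
    using tendstoD[OF r(2), of "\<delta>/2"] \<delta> by (simp add: dist_real_def)
  then obtain N' where "\<And>m. N' \<le> m \<Longrightarrow> \<bar>of_rat (p (r m)) - s\<bar> < \<delta> / 2"
    by (auto simp: eventually_sequentially)
  then have m: "N \<le> max N N'" "\<bar>of_rat (p (r (max N N'))) - s\<bar> < \<delta> / 2" by auto
  define m where "m = max N N'"
  note m = m[folded m_def]
  define P Q where "P = (of_rat (p (r m)) :: real)" and "Q = (of_rat (q (r m)) :: real)"
  have "N \<le> r m" using m(1) seq_suble[OF r(1), of m] by simp
  then have rm: "1 / real (Suc (r m)) \<le> 1 / real (Suc N)" by (intro divide_left_mono) auto
  have PQ: "a < P" "P < Q" "\<bar>P - s\<bar> < \<delta> / 2" "\<bar>Q - s\<bar> < \<delta>"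
    "f P * f Q < 0" "\<eta> < \<bar>f P\<bar>" "\<eta> < \<bar>f Q\<bar>"
    subgoal using pq(1)[of "r m"] by (simp add: P_def)
    subgoal using pq(2)[of "r m"] by (simp add: P_def Q_def)
    subgoal using m(2) by (simp add: P_def)
    subgoal using pq(2,4)[of "r m"] N m(2) rm unfolding Q_def by linarith
    subgoal using pq(5)[of "r m"] by (simp add: P_def Q_def)
    subgoal using pq(6)[of "r m"] by (simp add: P_def \<eta>_def)
    subgoal using pq(7)[of "r m"] by (simp add: Q_def \<eta>_def)
    done
  have PQ2: "2 * \<eta> < \<bar>f P - f Q\<bar>" using PQ(6,7) unfolding abs_diff_opposite_sign[OF PQ(5)] by linarith
  have "P < s"
  proof (rule ccontr)
    assume "\<not> P < s"
    then have "\<bar>f P - f s\<bar> < \<eta>" "\<bar>f Q - f s\<bar> < \<eta>" using PQ \<delta>(1) by (auto intro!: \<delta>(2))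
    then show False using PQ2 by linarith
  qed
  then have 1: "\<bar>f P - left_lim f s\<bar> < \<eta>" using PQ a \<delta>(1) by (intro \<delta>(3)) auto
  have "s \<le> Q"
  proof (rule ccontr)
    assume "\<not> s \<le> Q"
    then have "\<bar>f Q - left_lim f s\<bar> < \<eta>" using PQ a by (intro \<delta>(3)) auto
    then show False using 1 PQ2 by linarith
  qed
  then have 2: "\<bar>f Q - f s\<bar> < \<eta>" using PQ by (intro \<delta>(2)) auto
  have "\<bar>left_lim f s - f P\<bar> < \<eta>" "\<bar>f s - f Q\<bar> < \<eta>" using 1 2 by linarith+
  then have "left_lim f s * f s < 0"
    by (intro opposite_sign_cong[OF PQ(5)] same_sign_if_close) (use PQ(6,7) in auto)
  then have "f s * left_lim f s < 0" by (simp only: mult.commute)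
  moreover have "a < s" "s < t" using \<open>P < s\<close> PQ(1) s b by auto
  ultimately show ?L by blast
qed

text \<open>Rational times \<open>a\<close> and \<open>b\<close> separate the next sign change from the previous one and from the bound.
  This holds for all paths, including those along which sign changes accumulate, as the measurability
  of the sign change times is needed off null sets too.\<close>

lemma sign_change_time_Suc_less_iff:
  assumes f: "cadlag f"
  shows "sign_change_time coord (Suc n) f < y \<longleftrightarrow>
    (\<exists>(a::rat) (b::rat). 0 \<le> a \<and> 0 \<le> b \<and> sign_change_time coord n f < ennreal (of_rat a) \<and> ennreal (of_rat b) < y \<and>
       (\<exists>s. of_rat a < s \<and> s < of_rat b \<and> f s * left_lim f s < 0))"
    (is "?L \<longleftrightarrow> ?R")
proof
  assume ?L
  then obtain t where t: "0 \<le> t" "sign_change_time coord n f < ennreal t" "f t * left_lim f t < 0" "ennreal t < y"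
    by (auto simp: Inf_less_iff)
  obtain h where h: "0 \<le> h" "sign_change_time coord n f = ennreal h"
    using t(2) by (cases "sign_change_time coord n f") auto
  have "h < t" using t h by (simp add: ennreal_less_iff)
  then obtain a :: rat where a: "h < of_rat a" "of_rat a < t" using of_rat_dense by blast
  have "\<exists>b::rat. t < of_rat b \<and> ennreal (of_rat b) < y"
  proof (cases y)
    case (real r)
    then have "t < r" using t by (simp add: ennreal_less_iff)
    then obtain b :: rat where b: "t < of_rat b" "of_rat b < r" using of_rat_dense by blast
    then have "0 \<le> (of_rat b :: real)" using t by linarith
    then show ?thesis using b real by (auto simp: ennreal_less_iff intro!: exI[of _ b])
  next
    case top
    then show ?thesis using of_rat_dense[of t "t+1"] by auto
  qed
  then obtain b :: rat where b: "t < of_rat b" "ennreal (of_rat b) < y" by blast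
  have "0 \<le> (of_rat a :: real)" "0 \<le> (of_rat b :: real)" using a b h t by linarith+
  then show ?R using a b h t
    by (intro exI[of _ a] exI[of _ b]) (auto simp: ennreal_less_iff)
next
  assume ?R
  then obtain a b :: rat and s where *: "0 \<le> a" "0 \<le> b" "sign_change_time coord n f < ennreal (of_rat a)"
    "ennreal (of_rat b) < y" "of_rat a < s" "s < of_rat b" "f s * left_lim f s < 0" by blast
  have s: "0 \<le> s" using *(1,5) by (metis less_imp_le order_trans zero_le_of_rat_iff)
  have "sign_change_time coord (Suc n) f \<le> ennreal s"
    using * s by (auto intro!: Inf_lower elim!: less_le_trans simp: ennreal_leI less_imp_le)
  also have "\<dots> \<le> ennreal (of_rat b)" using * by (intro ennreal_leI) simp
  also have "\<dots> < y" by fact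
  finally show ?L .
qed

lemma measurable_sign_change_time [measurable]: "sign_change_time coord n \<in> borel_measurable path_space"
proof (induction n)
  case 0
  have "sign_change_time coord 0 = (\<lambda>_. 0)" by auto
  then show ?case by simp
next
  case (Suc n)
  note [measurable] = Suc
  show ?case
  proof (rule borel_measurableI_less)
    fix y :: ennreal
    have "{f\<in>space path_space. sign_change_time coord (Suc n) f < y} = {f\<in>space path_space.
      \<exists>(a::rat) (b::rat). 0 \<le> a \<and> 0 \<le> b \<and> sign_change_time coord n f < ennreal (of_rat a) \<and> ennreal (of_rat b) < y \<and>
       (\<exists>(k::nat) (b'::rat). of_rat b' < (of_rat b :: real) \<and> (\<forall>m::nat. \<exists>(p::rat) (q::rat). (of_rat a :: real) < of_rat p \<and> p < q \<and> q < b' \<and>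
       (of_rat q :: real) - of_rat p < 1 / real (Suc m) \<and> f (of_rat p) * f (of_rat q) < 0 \<and>
       1 / real (Suc k) < \<bar>f (of_rat p)\<bar> \<and> 1 / real (Suc k) < \<bar>f (of_rat q)\<bar>))}"
      using sign_change_between_iff[OF path_spaceD]
      by (intro Collect_cong conj_cong refl)
         (simp only: sign_change_time_Suc_less_iff[OF path_spaceD] sign_change_between_iff[OF path_spaceD] zero_le_of_rat_iff
           cong: conj_cong)
    also have "\<dots> \<in> sets path_space" by measurable
    finally show "{f\<in>space path_space. sign_change_time coord (Suc n) f < y} \<in> sets path_space" .
  qed
qed

lemma measurable_at_sign_change [measurable]: "at_sign_change coord n \<in> borel_measurable path_space"
  unfolding at_sign_change_def by (rule measurable_path_evalI) measurable

lemma measurable_killed_traj: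
  assumes [measurable]: "life \<in> borel_measurable M" "\<And>t. 0 \<le> t \<Longrightarrow> (\<lambda>x. e x t) \<in> borel_measurable M"
  shows "(\<lambda>x. killed_traj (life x) (e x)) \<in> M \<rightarrow>\<^sub>M traj_space"
  unfolding killed_traj_def by (rule measurable_restrict) measurable

lemma measurable_piece: "piece \<alpha> coord n \<in> path_space \<rightarrow>\<^sub>M traj_space"
  unfolding piece_def
proof (rule measurable_killed_traj)
  show "(\<lambda>f. f (enn2real (sign_change_time coord n f) + \<bar>at_sign_change coord n f\<bar> powr \<alpha> * t) /
    \<bar>at_sign_change coord n f\<bar>) \<in> borel_measurable path_space" for t
    by (rule borel_measurable_divide[OF measurable_path_evalI]) measurable
qed measurable

lemma measurable_jump_ratio: "jump_ratio coord n \<in> borel_measurable path_space"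
  unfolding jump_ratio_def by (rule borel_measurable_divide[OF _ measurable_left_lim]) measurable

section \<open>Rescaled paths after the sign changes\<close>

definition pre_exit_path :: "(real \<Rightarrow> real) \<Rightarrow> real \<Rightarrow> ereal" where
  "pre_exit_path f = killed_traj (exit_time f) f"

definition exit_ratio :: "(real \<Rightarrow> real) \<Rightarrow> real" where
  "exit_ratio f = f (enn2real (exit_time f)) / left_lim f (enn2real (exit_time f))"

lemma measurable_pre_exit_path [measurable]: "pre_exit_path \<in> path_space \<rightarrow>\<^sub>M traj_space"
  unfolding pre_exit_path_def by (rule measurable_killed_traj) measurable

lemma measurable_exit_ratio [measurable]: "exit_ratio \<in> borel_measurable path_space"
  unfolding exit_ratio_def by measurable

text \<open>The sign changes of \<open>f\<close> after \<open>h\<close> correspond to those of the rescaled path, and the first sign change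
  of a good path is its exit.\<close>

lemma sign_change_time_rescaled:
  assumes f: "cadlag f" and h: "0 \<le> h" "sign_change_time coord n f = ennreal h" "f h \<noteq> 0"
    and good: "good_path (rescaled_shift \<alpha> f h)"
  shows "sign_change_time coord (Suc n) f =
    ennreal (h + \<bar>f h\<bar> powr \<alpha> * enn2real (exit_time (rescaled_shift \<alpha> f h)))"
proof -
  let ?Z = "rescaled_shift \<alpha> f h" and ?a = "\<bar>f h\<bar> powr \<alpha>"
  define e where "e = enn2real (exit_time ?Z)"
  have Z: "cadlag ?Z" using f h by (intro cadlag_rescaled_shift)
  have a: "0 < ?a" using h by simp
  have e: "0 < e" "exit_time ?Z = ennreal e" unfolding e_def by (rule good_pathD(3)[OF good Z], rule good_pathD(2)[OF good Z])
  have chg: "?Z u * left_lim ?Z u < 0 \<longleftrightarrow> f (h + ?a * u) * left_lim f (h + ?a * u) < 0" if u: "0 < u" for u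
  proof -
    have "left_lim ?Z u = left_lim (\<lambda>t. f (h + ?a * t) / \<bar>f h\<bar>) u"
      by (rule left_lim_cong) (simp add: rescaled_shift_eq)
    also have "\<dots> = left_lim f (h + ?a * u) / \<bar>f h\<bar>" by (rule left_lim_affine[OF f h(1) a u])
    finally have "?Z u * left_lim ?Z u = f (h + ?a * u) * left_lim f (h + ?a * u) / (\<bar>f h\<bar> * \<bar>f h\<bar>)"
      using u by (simp add: rescaled_shift_eq)
    moreover have "0 < \<bar>f h\<bar> * \<bar>f h\<bar>" using h(3) by (intro mult_pos_pos) auto
    ultimately show ?thesis by (metis divide_less_0_iff order_less_asym)
  qed
  have at_e: "?Z e * left_lim ?Z e < 0"
    using good_pathD(6,7)[OF good Z] unfolding e_def[symmetric] mult_less_0_iff zero_less_mult_iff by linarith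
  show ?thesis unfolding sign_change_time.simps e_def[symmetric]
  proof (rule antisym)
    show "Inf {ennreal t |t. 0 \<le> t \<and> sign_change_time coord n f < ennreal t \<and> f t * left_lim (\<lambda>s. f s) t < 0}
      \<le> ennreal (h + ?a * e)"
      using chg[OF e(1)] at_e h(1,2) a e(1)
      by (intro Inf_lower CollectI exI[of _ "h + ?a * e"]) (simp add: ennreal_less_iff)
    show "ennreal (h + ?a * e) \<le>
      Inf {ennreal t |t. 0 \<le> t \<and> sign_change_time coord n f < ennreal t \<and> f t * left_lim (\<lambda>s. f s) t < 0}"
    proof (rule Inf_greatest, safe)
      fix t assume t: "0 \<le> t" "sign_change_time coord n f < ennreal t" "f t * left_lim (\<lambda>s. f s) t < 0"
      then have "h < t" using h by (simp add: ennreal_less_iff)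
      define u where "u = (t - h) / ?a"
      have u: "0 < u" "t = h + ?a * u" using \<open>h < t\<close> a by (auto simp: u_def)
      have "ennreal e \<le> ennreal u" unfolding e(2)[symmetric]
        using chg[OF u(1)] t u by (intro sign_change_not_before_exit[OF Z]) auto
      then have "e \<le> u" using u by (simp add: ennreal_le_iff)
      then show "ennreal (h + ?a * e) \<le> ennreal t" unfolding u(2) using a by (intro ennreal_leI) simp
    qed
  qed
qed

text \<open>The path seen from its \<open>n\<close>-th sign change, rescaled to start from \<open>1\<close> or \<open>-1\<close>, is obtained
  by iterating one and the same map.\<close>

definition next_path :: "real \<Rightarrow> (real \<Rightarrow> real) \<Rightarrow> real \<Rightarrow> real" where
  "next_path \<alpha> f = rescaled_shift \<alpha> f (enn2real (exit_time f))"

definition nth_path :: "real \<Rightarrow> nat \<Rightarrow> (real \<Rightarrow> real) \<Rightarrow> real \<Rightarrow> real" where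
  "nth_path \<alpha> n f = (next_path \<alpha> ^^ n) (rescaled_shift \<alpha> f 0)"

lemma nth_path_0: "nth_path \<alpha> 0 f = rescaled_shift \<alpha> f 0"
  by (simp add: nth_path_def)

lemma nth_path_Suc: "nth_path \<alpha> (Suc n) f = next_path \<alpha> (nth_path \<alpha> n f)"
  by (simp add: nth_path_def)

lemma measurable_next_path [measurable]: "next_path \<alpha> \<in> path_space \<rightarrow>\<^sub>M path_space"
  unfolding next_path_def by (rule measurable_rescaled_shift) auto

lemma measurable_nth_path [measurable]: "nth_path \<alpha> n \<in> path_space \<rightarrow>\<^sub>M path_space"
proof (induction n)
  case 0
  have "(\<lambda>f. rescaled_shift \<alpha> f 0) \<in> path_space \<rightarrow>\<^sub>M path_space"
    by (rule measurable_rescaled_shift) auto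
  then show ?case by (simp add: nth_path_0[abs_def])
next
  case (Suc n)
  note [measurable] = Suc
  show ?case unfolding nth_path_Suc[abs_def] by measurable
qed

lemma nth_path_at_sign_change:
  assumes f: "f \<in> space path_space" and good: "\<And>k. good_path (nth_path \<alpha> k f)"
  shows "\<exists>h\<ge>0. sign_change_time coord n f = ennreal h \<and> f h \<noteq> 0 \<and> rescaled_shift \<alpha> f h = nth_path \<alpha> n f"
proof (induction n)
  case 0
  have "rescaled_shift \<alpha> f 0 0 \<noteq> 0"
    using good[of 0] unfolding nth_path_0 good_path_def by auto
  then show ?case by (auto intro!: exI[of _ 0] simp: rescaled_shift_0 nth_path_0)
next
  case (Suc n)
  then obtain h where h: "0 \<le> h" "sign_change_time coord n f = ennreal h" "f h \<noteq> 0"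
    "rescaled_shift \<alpha> f h = nth_path \<alpha> n f" by blast
  let ?Z = "rescaled_shift \<alpha> f h" and ?a = "\<bar>f h\<bar> powr \<alpha>"
  let ?e = "enn2real (exit_time ?Z)"
  have gZ: "good_path ?Z" using good h by simp
  have nz: "?Z ?e \<noteq> 0" using gZ unfolding good_path_def by auto
  show ?case
  proof (intro exI[of _ "h + ?a * ?e"] conjI)
    show "sign_change_time coord (Suc n) f = ennreal (h + ?a * ?e)"
      by (rule sign_change_time_rescaled[OF path_spaceD[OF f] h(1,2,3) gZ])
    show "f (h + ?a * ?e) \<noteq> 0" using nz by (simp add: rescaled_shift_eq)
    show "rescaled_shift \<alpha> f (h + ?a * ?e) = nth_path \<alpha> (Suc n) f"
      unfolding nth_path_Suc next_path_def h(4)[symmetric]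
      by (rule rescaled_shift_rescaled_shift[symmetric]) (use h(3) in auto)
  qed (use h in auto)
qed

lemma piece_jump_ratio_eq:
  assumes f: "f \<in> space path_space" and good: "\<And>k. good_path (nth_path \<alpha> k f)"
  shows "piece \<alpha> coord n f = pre_exit_path (nth_path \<alpha> n f)"
    "jump_ratio coord n f = exit_ratio (nth_path \<alpha> n f)"
proof -
  have cad: "cadlag f" using f by (rule path_spaceD)
  obtain h where h: "0 \<le> h" "sign_change_time coord n f = ennreal h" "f h \<noteq> 0"
    "rescaled_shift \<alpha> f h = nth_path \<alpha> n f" using nth_path_at_sign_change[OF f good] by blast
  let ?Z = "rescaled_shift \<alpha> f h" and ?a = "\<bar>f h\<bar> powr \<alpha>"
  define e where "e = enn2real (exit_time ?Z)"
  have gZ: "good_path ?Z" using good h by simp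
  have Z: "cadlag ?Z" using cad h by (intro cadlag_rescaled_shift)
  have a: "0 < ?a" using h by simp
  have e: "0 < e" "exit_time ?Z = ennreal e" unfolding e_def by (rule good_pathD(3)[OF gZ Z], rule good_pathD(2)[OF gZ Z])
  have nxt: "sign_change_time coord (Suc n) f = ennreal (h + ?a * e)"
    unfolding e_def by (rule sign_change_time_rescaled[OF cad h(1,2,3) gZ])
  have "ennreal (h + ?a * e) - ennreal h = ennreal (?a * e)"
    using h(1) by (subst ennreal_minus) auto
  then have "ennreal (\<bar>f h\<bar> powr - \<alpha>) * (ennreal (h + ?a * e) - ennreal h) = ennreal (\<bar>f h\<bar> powr - \<alpha> * (?a * e))"
    using a e(1) by (simp add: ennreal_mult)
  also have "\<bar>f h\<bar> powr - \<alpha> * (?a * e) = e" using h(3) by (simp add: powr_minus)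
  finally have life: "ennreal (\<bar>f h\<bar> powr - \<alpha>) * (ennreal (h + ?a * e) - ennreal h) = ennreal e" .
  show "piece \<alpha> coord n f = pre_exit_path (nth_path \<alpha> n f)"
    unfolding piece_def pre_exit_path_def h(4)[symmetric] at_sign_change_def nxt h(2) e(2)
      enn2real_ennreal[OF h(1)] life
    by (auto simp: killed_traj_def rescaled_shift_eq fun_eq_iff)
  have "left_lim ?Z e = left_lim (\<lambda>t. f (h + ?a * t) / \<bar>f h\<bar>) e"
    by (rule left_lim_cong) (simp add: rescaled_shift_eq)
  also have "\<dots> = left_lim f (h + ?a * e) / \<bar>f h\<bar>" by (rule left_lim_affine[OF cad h(1) a e(1)])
  finally have "exit_ratio ?Z = f (h + ?a * e) / left_lim f (h + ?a * e)"
    using h(3) e(1) unfolding exit_ratio_def e_def[symmetric] by (simp add: rescaled_shift_eq)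
  moreover have "enn2real (ennreal (h + ?a * e)) = h + ?a * e" using h(1) e(1) a by (intro enn2real_ennreal) simp
  ultimately show "jump_ratio coord n f = exit_ratio (nth_path \<alpha> n f)"
    unfolding jump_ratio_def at_sign_change_def nxt h(4)[symmetric] by simp
qed

section \<open>The law of a killed path\<close>

abbreviation killed_space :: "((real \<Rightarrow> real) \<times> real) measure" where
  "killed_space \<equiv> traj_space \<Otimes>\<^sub>M borel"

text \<open>Real components instead of a cemetery state, so that the Lamperti transform applies to the pair
  directly. Negative lifetimes count as \<open>0\<close>.\<close>

definition killed_pair :: "(real \<Rightarrow> 'a \<Rightarrow> real) \<Rightarrow> ('a \<Rightarrow> real) \<Rightarrow> 'a \<Rightarrow> (real \<Rightarrow> real) \<times> real" where
  "killed_pair Y \<zeta> x = ((\<lambda>t\<in>{0..}. if t < \<zeta> x then Y t x else 0), max 0 (\<zeta> x))"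

lemma measurable_killed_pair:
  assumes [measurable]: "\<And>t. 0 \<le> t \<Longrightarrow> Y t \<in> borel_measurable M" "\<zeta> \<in> borel_measurable M"
  shows "killed_pair Y \<zeta> \<in> M \<rightarrow>\<^sub>M killed_space"
  unfolding killed_pair_def by (intro measurable_Pair measurable_restrict) measurable

definition alive_events :: "((real \<Rightarrow> real) \<times> real) set set" where
  "alive_events = {{p\<in>space killed_space. t < snd p \<and> (\<forall>s\<in>S. fst p s \<in> B s)} |t S B.
     0 \<le> t \<and> finite S \<and> S \<subseteq> {0..t} \<and> (\<forall>s. B s \<in> sets borel)}"

lemma Int_stable_alive_events: "Int_stable (insert (space killed_space) alive_events)"
proof (rule Int_stableI)
  fix a b assume ab: "a \<in> insert (space killed_space) alive_events" "b \<in> insert (space killed_space) alive_events"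
  have sub: "c \<subseteq> space killed_space" if "c \<in> alive_events" for c
    using that by (auto simp: alive_events_def)
  show "a \<inter> b \<in> insert (space killed_space) alive_events"
  proof (cases "a = space killed_space \<or> b = space killed_space")
    case True
    then show ?thesis using ab sub by (auto simp: Int_absorb1 Int_absorb2)
  next
    case False
    then obtain t S B t' S' B' where *: "a = {p\<in>space killed_space. t < snd p \<and> (\<forall>s\<in>S. fst p s \<in> B s)}"
      "0 \<le> t" "finite S" "S \<subseteq> {0..t}" "\<forall>s. B s \<in> sets borel"
      "b = {p\<in>space killed_space. t' < snd p \<and> (\<forall>s\<in>S'. fst p s \<in> B' s)}"
      "0 \<le> t'" "finite S'" "S' \<subseteq> {0..t'}" "\<forall>s. B' s \<in> sets borel"
      using ab unfolding alive_events_def by blast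
    let ?B = "\<lambda>s. (if s \<in> S then B s else UNIV) \<inter> (if s \<in> S' then B' s else UNIV)"
    have "a \<inter> b = {p\<in>space killed_space. max t t' < snd p \<and> (\<forall>s\<in>S \<union> S'. fst p s \<in> ?B s)}"
      unfolding *(1,6) by (auto split: if_splits)
    moreover have "S \<union> S' \<subseteq> {0..max t t'}" using *(4,9) by (auto simp: le_max_iff_disj)
    moreover have "\<forall>s. ?B s \<in> sets borel" using *(5,10) by auto
    moreover have "0 \<le> max t t'" "finite (S \<union> S')" using *(2,3,8) by auto
    ultimately show ?thesis unfolding alive_events_def
      by (intro insertI2 CollectI exI[of _ "max t t'"] exI[of _ "S \<union> S'"] exI[of _ ?B] conjI)
  qed
qed

text \<open>The events that the path is still alive and has visited given sets determine the law: they
  generate everything that does not look at the path after its death.\<close>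

lemma killed_pair_law_eqI:
  assumes "prob_space M" "prob_space N"
    and Y: "\<And>t. 0 \<le> t \<Longrightarrow> Y t \<in> borel_measurable M" and Z: "\<And>t. 0 \<le> t \<Longrightarrow> Z t \<in> borel_measurable N"
    and \<zeta>: "\<zeta> \<in> borel_measurable M" and \<eta>: "\<eta> \<in> borel_measurable N"
    and eq: "\<And>t S B. 0 \<le> t \<Longrightarrow> finite S \<Longrightarrow> S \<subseteq> {0..t} \<Longrightarrow> (\<And>s. B s \<in> sets borel) \<Longrightarrow>
      emeasure M {x\<in>space M. t < \<zeta> x \<and> (\<forall>s\<in>S. Y s x \<in> B s)} =
      emeasure N {x\<in>space N. t < \<eta> x \<and> (\<forall>s\<in>S. Z s x \<in> B s)}"
  shows "distr M killed_space (killed_pair Y \<zeta>) = distr N killed_space (killed_pair Z \<eta>)"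
proof -
  interpret M: prob_space M by fact
  interpret N: prob_space N by fact
  note m1 = measurable_killed_pair[OF Y \<zeta>] and m2 = measurable_killed_pair[OF Z \<eta>]
  let ?\<Omega> = "space killed_space" and ?G = "insert (space killed_space) alive_events"
  \<comment> \<open>On the whole product space the events in \<open>?G\<close> generate a strictly smaller algebra, since they do not
    see the path after its lifetime.\<close>
  define T where "T = sigma ?\<Omega> ?G"
  have G_sets: "?G \<subseteq> sets killed_space"
  proof
    fix a assume "a \<in> ?G"
    then show "a \<in> sets killed_space"
    proof (rule insertE)
      assume "a \<in> alive_events"
      then obtain t S B where *: "a = {p\<in>?\<Omega>. t < snd p \<and> (\<forall>s\<in>S. fst p s \<in> B s)}"
        "0 \<le> t" "finite S" "S \<subseteq> {0..t}" "\<forall>s. B s \<in> sets borel" unfolding alive_events_def by blast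
      have "{p\<in>?\<Omega>. fst p s \<in> B s} \<in> sets killed_space" if "s \<in> S" for s
      proof -
        have "(\<lambda>p. fst p s) \<in> killed_space \<rightarrow>\<^sub>M borel"
          using that *(4) by (intro measurable_compose[OF measurable_fst] measurable_component_singleton) auto
        from measurable_sets[OF this *(5)[rule_format, of s]] show ?thesis
          by (simp add: vimage_def Int_def conj_commute)
      qed
      moreover have "{p\<in>?\<Omega>. t < snd p} \<in> sets killed_space" by measurable
      ultimately show ?thesis unfolding *(1) using *(3)
        by (intro sets.sets_Collect_conj sets.sets_Collect_finite_All)
    qed auto
  qed
  then have G_Pow: "?G \<subseteq> Pow ?\<Omega>" using sets.space_closed by blast
  have sets_T: "sets T = sigma_sets ?\<Omega> ?G" and space_T: "space T = ?\<Omega>"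
    unfolding T_def using G_Pow by (auto simp: space_measure_of_conv)
  have T_sub: "sets T \<subseteq> sets killed_space"
    unfolding sets_T using G_sets by (rule sets.sigma_sets_subset)
  have m1T: "killed_pair Y \<zeta> \<in> M \<rightarrow>\<^sub>M T" and m2T: "killed_pair Z \<eta> \<in> N \<rightarrow>\<^sub>M T"
    using m1 m2 T_sub space_T unfolding measurable_def by auto
  have eqT: "distr M T (killed_pair Y \<zeta>) = distr N T (killed_pair Z \<eta>)"
  proof (rule measure_eqI_generator_eq[OF Int_stable_alive_events G_Pow])
    have full: "emeasure (distr M T (killed_pair Y \<zeta>)) ?\<Omega> = 1" "emeasure (distr N T (killed_pair Z \<eta>)) ?\<Omega> = 1"
      using prob_space.emeasure_space_1[OF M.prob_space_distr[OF m1T]]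
        prob_space.emeasure_space_1[OF N.prob_space_distr[OF m2T]] by (simp_all only: space_distr space_T)
    show "range (\<lambda>_::nat. ?\<Omega>) \<subseteq> ?G" "(\<Union>i::nat. ?\<Omega>) = ?\<Omega>" by auto
    show "emeasure (distr M T (killed_pair Y \<zeta>)) ?\<Omega> \<noteq> \<infinity>" using full by simp
    fix a assume "a \<in> ?G"
    then show "emeasure (distr M T (killed_pair Y \<zeta>)) a = emeasure (distr N T (killed_pair Z \<eta>)) a"
    proof (rule insertE)
      assume a: "a \<in> alive_events"
      then obtain t S B where *: "a = {p\<in>?\<Omega>. t < snd p \<and> (\<forall>s\<in>S. fst p s \<in> B s)}"
        "0 \<le> t" "finite S" "S \<subseteq> {0..t}" "\<forall>s. B s \<in> sets borel" unfolding alive_events_def by blast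
      have aT: "a \<in> sets T" unfolding sets_T using a by (intro sigma_sets.Basic) auto
      have in_a: "killed_pair V \<theta> x \<in> a \<longleftrightarrow> t < \<theta> x \<and> (\<forall>s\<in>S. V s x \<in> B s)"
        if "killed_pair V \<theta> x \<in> space killed_space" for V :: "real \<Rightarrow> 'z \<Rightarrow> real" and \<theta> and x :: 'z
      proof -
        have "fst (killed_pair V \<theta> x) s = V s x" if "s \<in> S" "t < \<theta> x" for s
          using that *(4) by (auto simp: killed_pair_def)
        moreover have "t < snd (killed_pair V \<theta> x) \<longleftrightarrow> t < \<theta> x" using *(2) by (auto simp: killed_pair_def)
        ultimately show ?thesis using that unfolding *(1) by auto
      qed
      have "killed_pair Y \<zeta> -` a \<inter> space M = {x\<in>space M. t < \<zeta> x \<and> (\<forall>s\<in>S. Y s x \<in> B s)}"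
      proof (rule set_eqI)
        fix x
        show "x \<in> killed_pair Y \<zeta> -` a \<inter> space M \<longleftrightarrow> x \<in> {x\<in>space M. t < \<zeta> x \<and> (\<forall>s\<in>S. Y s x \<in> B s)}"
        proof (cases "x \<in> space M")
          case True
          show ?thesis using in_a[OF measurable_space[OF m1 True]] True by simp
        qed simp
      qed
      moreover have "killed_pair Z \<eta> -` a \<inter> space N = {x\<in>space N. t < \<eta> x \<and> (\<forall>s\<in>S. Z s x \<in> B s)}"
      proof (rule set_eqI)
        fix x
        show "x \<in> killed_pair Z \<eta> -` a \<inter> space N \<longleftrightarrow> x \<in> {x\<in>space N. t < \<eta> x \<and> (\<forall>s\<in>S. Z s x \<in> B s)}"
        proof (cases "x \<in> space N")
          case True
          show ?thesis using in_a[OF measurable_space[OF m2 True]] True by simp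
        qed simp
      qed
      ultimately show ?thesis using eq[OF *(2,3,4)] *(5) aT m1T m2T by (simp add: emeasure_distr)
    qed (use full in simp)
  qed (simp_all add: sets_T)
  \<comment> \<open>Freezing is measurable with respect to the smaller algebra and does not change frozen paths.\<close>
  define \<rho> :: "(real \<Rightarrow> real) \<times> real \<Rightarrow> _" where
    "\<rho> p = ((\<lambda>t\<in>{0..}. if t < snd p then fst p t else 0), max 0 (snd p))" for p
  have alive: "{p\<in>?\<Omega>. t < snd p \<and> (\<forall>s\<in>S. fst p s \<in> B)} \<in> sets T" if "0 \<le> t" "finite S" "S \<subseteq> {0..t}" "B \<in> sets borel" for t S B
    unfolding sets_T alive_events_def using that
    by (intro sigma_sets.Basic insertI2 CollectI exI[of _ t] exI[of _ S] exI[of _ "\<lambda>_. B"]) auto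
  have \<rho>: "\<rho> \<in> T \<rightarrow>\<^sub>M killed_space"
    unfolding \<rho>_def
  proof (intro measurable_Pair measurable_restrict)
    show "(\<lambda>p. max 0 (snd p)) \<in> borel_measurable T"
    proof (rule borel_measurableI_greater)
      fix t :: real
      show "{p \<in> space T. t < max 0 (snd p)} \<in> sets T"
      proof (cases "0 \<le> t")
        case True
        then have "{p \<in> space T. t < max 0 (snd p)} = {p\<in>?\<Omega>. t < snd p \<and> (\<forall>s\<in>{}. fst p s \<in> UNIV)}"
          by (auto simp: space_T)
        then show ?thesis using alive[OF True, of "{}" UNIV] by simp
      next
        case False
        then have "{p \<in> space T. t < max 0 (snd p)} = space T" by auto
        then show ?thesis by simp
      qed
    qed
    fix t :: real assume "t \<in> {0..}"
    then have t: "0 \<le> t" by simp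
    show "(\<lambda>p. if t < snd p then fst p t else 0) \<in> borel_measurable T"
    proof (rule measurableI)
      fix B :: "real set" assume B: "B \<in> sets borel"
      have "(\<lambda>p. if t < snd p then fst p t else 0) -` B \<inter> space T =
        {p\<in>?\<Omega>. t < snd p \<and> (\<forall>s\<in>{t}. fst p s \<in> B)} \<union>
        (if 0 \<in> B then space T - {p\<in>?\<Omega>. t < snd p \<and> (\<forall>s\<in>{}. fst p s \<in> UNIV)} else {})"
        (is "?L = ?R")
      proof (rule set_eqI)
        fix p show "p \<in> ?L \<longleftrightarrow> p \<in> ?R" by (cases "t < snd p") (simp_all add: space_T conj_commute)
      qed
      also have "\<dots> \<in> sets T" using alive[OF t, of "{t}" B] alive[OF t, of "{}" UNIV] t B
        by (intro sets.Un) (auto intro!: sets.compl_sets)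
      finally show "(\<lambda>p. if t < snd p then fst p t else 0) -` B \<inter> space T \<in> sets T" .
    qed auto
  qed
  have \<rho>1: "\<rho> (killed_pair Y \<zeta> x) = killed_pair Y \<zeta> x" for x
    by (auto simp: \<rho>_def killed_pair_def fun_eq_iff)
  have \<rho>2: "\<rho> (killed_pair Z \<eta> x) = killed_pair Z \<eta> x" for x
    by (auto simp: \<rho>_def killed_pair_def fun_eq_iff)
  have "distr M killed_space (killed_pair Y \<zeta>) = distr (distr M T (killed_pair Y \<zeta>)) killed_space \<rho>"
    by (subst distr_distr[OF \<rho> m1T]) (simp add: comp_def \<rho>1)
  also have "\<dots> = distr (distr N T (killed_pair Z \<eta>)) killed_space \<rho>" unfolding eqT ..
  also have "\<dots> = distr N killed_space (killed_pair Z \<eta>)"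
    by (subst distr_distr[OF \<rho> m2T]) (simp add: comp_def \<rho>2)
  finally show ?thesis .
qed

text \<open>Independence of a sequence only has to be checked on initial segments: the remaining indices
  below the maximum of a finite set are filled up with the whole space.\<close>

lemma (in prob_space) indep_vars_nat_if:
  assumes rv: "\<And>i. Y i \<in> M \<rightarrow>\<^sub>M N"
    and prod: "\<And>n C. (\<And>i. C i \<in> sets N) \<Longrightarrow>
      prob {x\<in>space M. \<forall>i<n. Y i x \<in> C i} = (\<Prod>i<n. prob {x\<in>space M. Y i x \<in> C i})"
  shows "indep_vars (\<lambda>_. N) Y (UNIV :: nat set)"
  unfolding indep_vars_def2
proof (intro conjI ballI rv indep_setsI)
  fix i :: nat show "{Y i -` A \<inter> space M |A. A \<in> sets N} \<subseteq> events"
    using rv by (auto intro: measurable_sets)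
next
  fix A J assume J: "J \<noteq> {}" "finite J" "\<forall>j\<in>J. A j \<in> {Y j -` B \<inter> space M |B. B \<in> sets N}"
  then obtain B where B: "\<And>j. j \<in> J \<Longrightarrow> B j \<in> sets N" "\<And>j. j \<in> J \<Longrightarrow> A j = Y j -` B j \<inter> space M"
    by (auto simp: Ball_def) metis
  define C where "C j = (if j \<in> J then B j else space N)" for j
  define n where "n = Suc (Max J)"
  have Jn: "J \<subseteq> {..<n}" using J(2) by (auto simp: n_def less_Suc_eq_le)
  have C: "C j \<in> sets N" for j by (simp add: C_def B)
  have full: "{x\<in>space M. Y j x \<in> C j} = space M" if "j \<notin> J" for j
    using that measurable_space[OF rv] by (auto simp: C_def)
  have inJ: "{x\<in>space M. Y j x \<in> C j} = A j" if "j \<in> J" for j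
    using that B by (auto simp: C_def)
  have "(\<Inter>j\<in>J. A j) = {x\<in>space M. \<forall>i<n. Y i x \<in> C i}"
  proof (intro equalityI subsetI)
    fix x assume x: "x \<in> (\<Inter>j\<in>J. A j)"
    then have xM: "x \<in> space M" using J(1) B(2) by blast
    have "Y i x \<in> C i" for i using x inJ[of i] full[of i] xM by (cases "i \<in> J") blast+
    then show "x \<in> {x\<in>space M. \<forall>i<n. Y i x \<in> C i}" using xM by simp
  next
    fix x assume x: "x \<in> {x\<in>space M. \<forall>i<n. Y i x \<in> C i}"
    then show "x \<in> (\<Inter>j\<in>J. A j)" using inJ Jn by blast
  qed
  then have "prob (\<Inter>j\<in>J. A j) = (\<Prod>i<n. prob {x\<in>space M. Y i x \<in> C i})" using prod[OF C] by simp
  also have "\<dots> = (\<Prod>i\<in>J. prob {x\<in>space M. Y i x \<in> C i})"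
    by (rule prod.mono_neutral_right) (use Jn full prob_space in auto)
  also have "\<dots> = (\<Prod>j\<in>J. prob (A j))" by (rule prod.cong) (use inJ in auto)
  finally show "prob (\<Inter>j\<in>J. A j) = (\<Prod>j\<in>J. prob (A j))" .
qed

section \<open>Independence of the pieces and of the jump ratios\<close>

locale sign_changing_ssmp = real_ssmp_family +
  assumes killed: "killed_at_zero M X"
    and changes_sign: "\<And>x. x \<noteq> 0 \<Longrightarrow> measure (P x) {\<omega>\<in>space (P x). sign_change_time X 1 \<omega> < \<infinity>} = 1"
begin

lemma left_lim_traj: "left_lim (\<lambda>s. traj X \<omega> s) t = left_lim (\<lambda>s. X s \<omega>) t"
  by (rule left_lim_cong) (simp add: traj_eq)

lemma sign_change_time_traj: "sign_change_time coord n (traj X \<omega>) = sign_change_time X n \<omega>"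
proof (induction n)
  case (Suc n)
  show ?case unfolding sign_change_time.simps Suc left_lim_traj
    by (intro arg_cong[where f=Inf] Collect_cong ex_cong1) (auto simp: traj_eq)
qed simp

lemma at_sign_change_traj: "at_sign_change coord n (traj X \<omega>) = at_sign_change X n \<omega>"
  by (simp add: at_sign_change_def sign_change_time_traj traj_eq)

lemma piece_traj: "piece \<alpha> coord n (traj X \<omega>) = piece \<alpha> X n \<omega>"
  unfolding piece_def sign_change_time_traj at_sign_change_traj
  by (auto simp: killed_traj_def traj_eq fun_eq_iff)

lemma jump_ratio_traj: "jump_ratio coord n (traj X \<omega>) = jump_ratio X n \<omega>"
  unfolding jump_ratio_def sign_change_time_traj at_sign_change_traj left_lim_traj ..

lemma traj_absorbed:
  assumes "\<omega> \<in> space M" "0 < s" "s \<le> u" "traj X \<omega> s = 0"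
  shows "traj X \<omega> u = 0"
proof -
  have "zero_hitting_time X \<omega> \<le> ennreal s"
    unfolding zero_hitting_time_def using assms by (intro Inf_lower) (auto simp: traj_eq)
  also have "\<dots> \<le> ennreal u" using assms by (intro ennreal_leI)
  finally show ?thesis using killed assms by (auto simp: killed_at_zero_def traj_eq)
qed

text \<open>A path that changes sign is good or creeping, and creeping paths form a null set.\<close>

lemma AE_good:
  assumes \<epsilon>: "\<bar>\<epsilon>\<bar> = 1"
  shows "AE f in law \<epsilon>. good_path f"
proof -
  interpret prob_space "P \<epsilon>" by (rule prob)
  have "AE \<omega> in P \<epsilon>. \<omega> \<in> {\<omega>\<in>space (P \<epsilon>). sign_change_time X 1 \<omega> < \<infinity>}"
    by (rule AE_prob_1) (use changes_sign \<epsilon> in auto)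
  moreover have "AE \<omega> in P \<epsilon>. \<not> creeping_path (traj X \<omega>)"
    using creeping_null[OF \<epsilon>] unfolding law_def by (subst (asm) AE_distr_iff) auto
  ultimately have "AE \<omega> in P \<epsilon>. good_path (traj X \<omega>)" using start
  proof eventually_elim
    case (elim \<omega>)
    then have \<omega>: "\<omega> \<in> space M" and x: "traj X \<omega> 0 \<noteq> 0" using \<epsilon> by (auto simp: space_P traj_eq)
    have cad: "cadlag (traj X \<omega>)" using traj_in[OF \<omega>] by (rule path_spaceD)
    have "sign_change_time coord (Suc 0) (traj X \<omega>) < \<infinity>" using elim by (simp add: sign_change_time_traj del: sign_change_time.simps)
    then obtain t where "0 < t" "traj X \<omega> t * left_lim (traj X \<omega>) t < 0"
      by (auto simp: Inf_less_iff)
    from good_or_creeping[OF cad x this] traj_absorbed[OF \<omega>] elim show ?case by blast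
  qed
  then show ?thesis unfolding law_def by (subst AE_distr_iff) auto
qed

text \<open>The strong Markov property at the first sign change: the next rescaled path is independent of
  everything up to and including the change, and is a fresh copy started from the opposite sign.\<close>

lemma next_path_indep:
  assumes \<epsilon>: "\<bar>\<epsilon>\<bar> = 1" and C: "prior_event exit_time C" and B: "B \<in> sets path_space"
  shows "emeasure (law \<epsilon>) {f\<in>C. next_path \<alpha> f \<in> B} = emeasure (law \<epsilon>) C * emeasure (law (-\<epsilon>)) B"
proof -
  have C_sets [measurable]: "C \<in> sets path_space" using C by (simp add: prior_event_def)
  note [measurable] = B
  define A where "A = {f\<in>space path_space. f \<in> C \<and> good_path f \<and> f 0 = \<epsilon>}"
  have A_sets [measurable]: "A \<in> sets path_space" unfolding A_def by measurable
  have C_sub: "C \<subseteq> space path_space" by (rule sets.sets_into_space) measurable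
  have sub_sets: "{f\<in>D. next_path \<alpha> f \<in> B} \<in> sets path_space" if [measurable]: "D \<in> sets path_space" for D
  proof -
    have "{f\<in>D. next_path \<alpha> f \<in> B} = {f\<in>space path_space. f \<in> D \<and> next_path \<alpha> f \<in> B}"
      using sets.sets_into_space[OF that] by auto
    then show ?thesis by simp
  qed
  have prior: "prior_event exit_time A"
    unfolding prior_event_def
  proof (intro conjI ballI allI impI A_sets)
    fix f t assume f: "f \<in> space path_space" "0 \<le> t" "exit_time f \<le> ennreal t"
    then have "f \<in> C \<longleftrightarrow> stopped_path t f \<in> C" using C by (auto simp: prior_event_def)
    then show "f \<in> A \<longleftrightarrow> stopped_path t f \<in> A"
      using f stopped_path_in[OF f(1,2)] good_path_stopped_path(4,5)[OF f] by (simp add: A_def)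
  qed
  have AE: "AE f in law \<epsilon>. good_path f \<and> f 0 = \<epsilon> \<and> f \<in> space path_space"
    using AE_good[OF \<epsilon>] AE_law_start[of \<epsilon>] AE_space by eventually_elim (simp add: space_law)
  have "emeasure (law \<epsilon>) {f\<in>C. next_path \<alpha> f \<in> B} = emeasure (law \<epsilon>) {f\<in>A. next_path \<alpha> f \<in> B}"
    by (rule emeasure_eq_AE) (use AE in \<open>auto simp: A_def sets_law intro!: sub_sets elim: eventually_mono\<close>)
  also have "\<dots> = emeasure (law \<epsilon>) A * emeasure (law (-\<epsilon>)) B"
    unfolding next_path_def
  proof (rule strong_markov_rescaled[OF path_stopping_time_exit_time prior B])
    fix f assume f: "f \<in> A"
    show "exit_time f < \<infinity>" using f by (simp add: A_def good_path_def)
    show "sgn (f (enn2real (exit_time f))) = - \<epsilon>"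
      using good_pathD(5)[of f] f \<epsilon> by (auto simp: A_def path_spaceD sgn_real_def abs_if split: if_splits)
  qed (use \<epsilon> in auto)
  also have "emeasure (law \<epsilon>) A = emeasure (law \<epsilon>) C"
    by (rule emeasure_eq_AE) (use AE in \<open>auto simp: A_def sets_law elim: eventually_mono\<close>)
  finally show ?thesis .
qed

lemma next_path_law:
  assumes \<epsilon>: "\<bar>\<epsilon>\<bar> = 1" and B: "B \<in> sets path_space"
  shows "emeasure (law \<epsilon>) {f\<in>space path_space. next_path \<alpha> f \<in> B} = emeasure (law (-\<epsilon>)) B"
proof -
  have "prior_event exit_time (space path_space)"
    by (auto simp: prior_event_def stopped_path_in)
  from next_path_indep[OF \<epsilon> this B] show ?thesis
    using prob_space.emeasure_space_1[OF prob_space_law[of \<epsilon>]] by (simp add: space_law)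
qed

lemma nth_path_law:
  assumes x: "x \<noteq> 0" and B: "B \<in> sets path_space"
  shows "emeasure (law x) {f\<in>space path_space. nth_path \<alpha> n f \<in> B} = emeasure (law (sgn x * (-1) ^ n)) B"
  using B
proof (induction n arbitrary: B)
  case 0
  then show ?case using law_rescaled[OF x] by (simp add: nth_path_0)
next
  case (Suc n)
  note [measurable] = Suc.prems
  let ?\<epsilon> = "sgn x * (-1) ^ n"
  have \<epsilon>: "\<bar>?\<epsilon>\<bar> = 1" using x by (simp add: abs_mult)
  have "{f\<in>space path_space. nth_path \<alpha> (Suc n) f \<in> B} =
    {f\<in>space path_space. nth_path \<alpha> n f \<in> {g\<in>space path_space. next_path \<alpha> g \<in> B}}"
    using measurable_space[OF measurable_nth_path] by (auto simp: nth_path_Suc)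
  then have "emeasure (law x) {f\<in>space path_space. nth_path \<alpha> (Suc n) f \<in> B} =
    emeasure (law ?\<epsilon>) {g\<in>space path_space. next_path \<alpha> g \<in> B}"
    using Suc.IH[of "{g\<in>space path_space. next_path \<alpha> g \<in> B}"] by simp
  also have "\<dots> = emeasure (law (- ?\<epsilon>)) B" by (rule next_path_law[OF \<epsilon> Suc.prems])
  finally show ?case by simp
qed

lemma AE_nth_path_good:
  assumes x: "x \<noteq> 0"
  shows "AE f in law x. \<forall>n. good_path (nth_path \<alpha> n f)"
proof (subst AE_all_countable, rule allI)
  fix n
  let ?\<epsilon> = "sgn x * (-1) ^ n"
  have \<epsilon>: "\<bar>?\<epsilon>\<bar> = 1" using x by (simp add: abs_mult)
  have "emeasure (law x) {f\<in>space path_space. nth_path \<alpha> n f \<in> {g\<in>space path_space. \<not> good_path g}} =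
    emeasure (law ?\<epsilon>) {g\<in>space path_space. \<not> good_path g}"
    by (rule nth_path_law[OF x]) measurable
  also have "\<dots> = 0"
    using AE_good[OF \<epsilon>] by (subst (asm) AE_iff_measurable[OF _ refl]) (auto simp: space_law sets_law)
  finally show "AE f in law x. good_path (nth_path \<alpha> n f)"
    using measurable_space[OF measurable_nth_path]
    by (subst AE_iff_measurable[OF _ refl]) (auto simp: space_law sets_law cong: conj_cong)
qed

text \<open>The first factor is split off by independence of the next path; the others are obtained from the
  induction hypothesis for the opposite sign.\<close>

lemma chain_prob:
  assumes info [measurable]: "info \<in> path_space \<rightarrow>\<^sub>M N"
    and inv: "\<And>f t. f \<in> space path_space \<Longrightarrow> 0 \<le> t \<Longrightarrow> exit_time f \<le> ennreal t \<Longrightarrow> info (stopped_path t f) = info f"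
    and \<epsilon>: "\<bar>\<epsilon>\<bar> = 1" and C: "\<And>i. C i \<in> sets N"
  shows "emeasure (law \<epsilon>) {f\<in>space path_space. \<forall>i<n. info ((next_path \<alpha> ^^ i) f) \<in> C i} =
    (\<Prod>i<n. emeasure (law (\<epsilon> * (-1) ^ i)) {f\<in>space path_space. info f \<in> C i})"
  using \<epsilon> C
proof (induction n arbitrary: \<epsilon> C)
  case 0
  then show ?case using prob_space.emeasure_space_1[OF prob_space_law[of \<epsilon>]] by (simp add: space_law)
next
  case (Suc n)
  have iter [measurable]: "(next_path \<alpha> ^^ i) \<in> path_space \<rightarrow>\<^sub>M path_space" for i
    by (induction i) (auto intro: measurable_comp)
  have C [measurable]: "C i \<in> sets N" for i by (rule Suc.prems)
  define E where "E = {f\<in>space path_space. info f \<in> C 0}"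
  define B where "B = {f\<in>space path_space. \<forall>i<n. info ((next_path \<alpha> ^^ i) f) \<in> C (Suc i)}"
  have [measurable]: "E \<in> sets path_space" unfolding E_def by measurable
  have [measurable]: "B \<in> sets path_space" unfolding B_def by measurable
  have prior: "prior_event exit_time E"
    using inv by (auto simp: prior_event_def E_def stopped_path_in) 
  have "{f\<in>space path_space. \<forall>i<Suc n. info ((next_path \<alpha> ^^ i) f) \<in> C i} = {f\<in>E. next_path \<alpha> f \<in> B}"
    using measurable_space[OF measurable_next_path]
    by (auto simp: E_def B_def All_less_Suc2 funpow_Suc_right simp del: funpow.simps)
  then have "emeasure (law \<epsilon>) {f\<in>space path_space. \<forall>i<Suc n. info ((next_path \<alpha> ^^ i) f) \<in> C i} =
    emeasure (law \<epsilon>) E * emeasure (law (-\<epsilon>)) B"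
    using next_path_indep[OF Suc.prems(1) prior, of B] by simp
  also have "emeasure (law (-\<epsilon>)) B =
    (\<Prod>i<n. emeasure (law (- \<epsilon> * (-1) ^ i)) {f\<in>space path_space. info f \<in> C (Suc i)})"
    unfolding B_def by (rule Suc.IH) (use Suc.prems in auto)
  finally show ?case unfolding prod.lessThan_Suc_shift by (simp add: E_def)
qed

lemma measure_traj_eq:
  assumes "AE \<omega> in P x. Q \<omega> \<longleftrightarrow> R (traj X \<omega>)" "{\<omega>\<in>space (P x). Q \<omega>} \<in> sets (P x)" "Measurable.pred path_space R"
  shows "emeasure (P x) {\<omega>\<in>space (P x). Q \<omega>} = emeasure (law x) {f\<in>space path_space. R f}"
proof -
  note [measurable] = assms(3)
  have "emeasure (law x) {f\<in>space path_space. R f} = emeasure (P x) {\<omega>\<in>space M. traj X \<omega> \<in> {f\<in>space path_space. R f}}"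
    by (rule emeasure_law) measurable
  also have "{\<omega>\<in>space M. traj X \<omega> \<in> {f\<in>space path_space. R f}} = {\<omega>\<in>space (P x). R (traj X \<omega>)}"
    using traj_in by (auto simp: space_P)
  also have "emeasure (P x) \<dots> = emeasure (P x) {\<omega>\<in>space (P x). Q \<omega>}"
    by (rule emeasure_eq_AE) (use assms in \<open>auto elim: eventually_mono\<close>)
  finally show ?thesis by simp
qed

text \<open>The process enters only through variables that agree almost surely with functionals of the rescaled
  paths; they are measurable on the whole space, the identification holds on good paths.\<close>

lemma functional_law:
  assumes x: "x \<noteq> 0" and info [measurable]: "info \<in> path_space \<rightarrow>\<^sub>M N"
    and Y [measurable]: "Y \<in> P x \<rightarrow>\<^sub>M N" and eq: "AE \<omega> in P x. Y \<omega> = info (nth_path \<alpha> n (traj X \<omega>))"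
    and C [measurable]: "C \<in> sets N"
  shows "emeasure (P x) {\<omega>\<in>space (P x). Y \<omega> \<in> C} =
    emeasure (law (sgn x * (-1) ^ n)) {f\<in>space path_space. info f \<in> C}"
proof -
  have "emeasure (P x) {\<omega>\<in>space (P x). Y \<omega> \<in> C} = emeasure (law x) {f\<in>space path_space. info (nth_path \<alpha> n f) \<in> C}"
    by (rule measure_traj_eq) (use eq in \<open>auto elim: eventually_mono\<close>)
  also have "{f\<in>space path_space. info (nth_path \<alpha> n f) \<in> C} =
     {f\<in>space path_space. nth_path \<alpha> n f \<in> {g\<in>space path_space. info g \<in> C}}"
    using measurable_space[OF measurable_nth_path] by auto
  also have "emeasure (law x) \<dots> = emeasure (law (sgn x * (-1) ^ n)) {f\<in>space path_space. info f \<in> C}"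
    by (rule nth_path_law[OF x]) measurable
  finally show ?thesis .
qed

lemma functional_indep:
  assumes x: "x \<noteq> 0" and info [measurable]: "info \<in> path_space \<rightarrow>\<^sub>M N"
    and inv: "\<And>f t. f \<in> space path_space \<Longrightarrow> 0 \<le> t \<Longrightarrow> exit_time f \<le> ennreal t \<Longrightarrow> info (stopped_path t f) = info f"
    and Y [measurable]: "\<And>n. Y n \<in> P x \<rightarrow>\<^sub>M N"
    and eq: "\<And>n. AE \<omega> in P x. Y n \<omega> = info (nth_path \<alpha> n (traj X \<omega>))"
  shows "prob_space.indep_vars (P x) (\<lambda>_. N) Y UNIV"
proof -
  interpret prob_space "P x" by (rule prob)
  have iter [measurable]: "(next_path \<alpha> ^^ i) \<in> path_space \<rightarrow>\<^sub>M path_space" for i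
    by (induction i) (auto intro: measurable_comp)
  have \<epsilon>: "\<bar>sgn x\<bar> = 1" using x by simp
  show ?thesis
  proof (rule indep_vars_nat_if)
    fix n and C :: "nat \<Rightarrow> _" assume C: "\<And>i. C i \<in> sets N"
    note [measurable] = C
    let ?B = "{f\<in>space path_space. \<forall>i<n. info ((next_path \<alpha> ^^ i) f) \<in> C i}"
    have AE: "AE \<omega> in P x. \<forall>n. Y n \<omega> = info (nth_path \<alpha> n (traj X \<omega>))"
      using eq by (subst AE_all_countable) auto
    have "emeasure (P x) {\<omega>\<in>space (P x). \<forall>i<n. Y i \<omega> \<in> C i} =
        emeasure (law x) {f\<in>space path_space. \<forall>i<n. info (nth_path \<alpha> i f) \<in> C i}"
    proof (rule measure_traj_eq)
      show "AE \<omega> in P x. (\<forall>i<n. Y i \<omega> \<in> C i) \<longleftrightarrow> (\<forall>i<n. info (nth_path \<alpha> i (traj X \<omega>)) \<in> C i)"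
        using AE by eventually_elim simp
    qed measurable
    also have "{f\<in>space path_space. \<forall>i<n. info (nth_path \<alpha> i f) \<in> C i} = {f\<in>space path_space. nth_path \<alpha> 0 f \<in> ?B}"
      using measurable_space[OF measurable_nth_path[of \<alpha> 0]] by (auto simp: nth_path_def)
    also have "emeasure (law x) \<dots> = emeasure (law (sgn x * (-1) ^ 0)) ?B"
      by (rule nth_path_law[OF x]) measurable
    also have "sgn x * (-1) ^ 0 = sgn x" by simp
    also have "emeasure (law (sgn x)) ?B =
        (\<Prod>i<n. emeasure (law (sgn x * (-1) ^ i)) {f\<in>space path_space. info f \<in> C i})"
      by (rule chain_prob[OF info inv \<epsilon> C])
    also have "\<dots> = (\<Prod>i<n. emeasure (P x) {\<omega>\<in>space (P x). Y i \<omega> \<in> C i})"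
      by (rule prod.cong[OF refl], rule functional_law[OF x info Y eq C, symmetric])
    finally show "prob {\<omega>\<in>space (P x). \<forall>i<n. Y i \<omega> \<in> C i} = (\<Prod>i<n. prob {\<omega>\<in>space (P x). Y i \<omega> \<in> C i})"
      unfolding emeasure_eq_measure prod_ennreal[OF measure_nonneg]
      by (subst (asm) ennreal_inj) (auto intro!: prod_nonneg)
  qed (rule Y)
qed

end

section \<open>Exponential functionals of bounded functions\<close>

lemma exp_bounds:
  fixes c x G :: real
  assumes "\<bar>x\<bar> \<le> G"
  shows "exp (- (\<bar>c\<bar> * G)) \<le> exp (c * x) \<and> exp (c * x) \<le> exp (\<bar>c\<bar> * G)"
proof -
  have "\<bar>c * x\<bar> \<le> \<bar>c\<bar> * G" using assms by (simp add: abs_mult mult_left_mono)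
  then show ?thesis by (simp add: abs_le_iff)
qed

lemma set_integrable_exp_bounded:
  fixes g :: "real \<Rightarrow> real"
  assumes [measurable]: "g \<in> borel_measurable borel" and G: "\<And>s. s \<in> {0..b} \<Longrightarrow> \<bar>g s\<bar> \<le> G"
    and A: "A \<in> sets borel" "A \<subseteq> {0..b}"
  shows "set_integrable lborel A (\<lambda>s. exp (c * g s))"
proof (rule set_integrable_subset)
  have "set_integrable lborel {0..b} (\<lambda>_. exp (\<bar>c\<bar> * G))"
    by (auto simp: set_integrable_def emeasure_lborel_Icc_eq intro!: integrable_real_indicator)
  then show "set_integrable lborel {0..b} (\<lambda>s. exp (c * g s))"
  proof (rule set_integrable_bound)
    show "AE s in lborel. s \<in> {0..b} \<longrightarrow> norm (exp (c * g s)) \<le> norm (exp (\<bar>c\<bar> * G))"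
    proof (intro AE_I2 impI)
      fix s assume "s \<in> {0..b}"
      then show "norm (exp (c * g s)) \<le> norm (exp (\<bar>c\<bar> * G))" using exp_bounds[OF G, of s c] by simp
    qed
  qed (simp add: set_borel_measurable_def)
qed (use A in auto)

lemma exp_functional_diff:
  assumes [measurable]: "g \<in> borel_measurable borel" and G: "\<And>s. s \<in> {0..b} \<Longrightarrow> \<bar>g s\<bar> \<le> G"
    and ab: "0 \<le> a" "a \<le> b"
  shows "exp_functional c g b - exp_functional c g a = (LBINT s:{a<..b}. exp (c * g s))"
proof -
  have "(LBINT s:{0..a} \<union> {a<..b}. exp (c * g s)) = (LBINT s:{0..a}. exp (c * g s)) + (LBINT s:{a<..b}. exp (c * g s))"
    by (intro set_integral_Un set_integrable_exp_bounded[where b=b and G=G] assms G) (use ab in auto)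
  moreover have "{0..a} \<union> {a<..b} = {0..b}" using ab by auto
  ultimately show ?thesis by (simp add: exp_functional_def)
qed

lemma exp_functional_increment:
  assumes g [measurable]: "g \<in> borel_measurable borel" and G: "\<And>s. s \<in> {0..b} \<Longrightarrow> \<bar>g s\<bar> \<le> G"
    and ab: "0 \<le> a" "a \<le> b" and lohi: "\<And>s. a < s \<Longrightarrow> s \<le> b \<Longrightarrow> lo \<le> exp (c * g s) \<and> exp (c * g s) \<le> hi"
  shows "lo * (b - a) \<le> exp_functional c g b - exp_functional c g a"
    "exp_functional c g b - exp_functional c g a \<le> hi * (b - a)"
proof -
  have int: "set_integrable lborel {a<..b} (\<lambda>s. exp (c * g s))"
    by (rule set_integrable_exp_bounded[OF g G]) (use ab in auto)
  have cint: "set_integrable lborel {a<..b} (\<lambda>_. k)" "(LBINT s:{a<..b}. k) = k * (b - a)" for k :: real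
    using ab by (auto simp: set_integrable_def set_lebesgue_integral_def intro!: integrable_real_indicator)
  have "(LBINT s:{a<..b}. lo) \<le> (LBINT s:{a<..b}. exp (c * g s))"
    by (rule set_integral_mono[OF cint(1) int]) (use lohi in auto)
  then show "lo * (b - a) \<le> exp_functional c g b - exp_functional c g a"
    using exp_functional_diff[OF g G ab, of c] by (simp only: cint(2))
  have "(LBINT s:{a<..b}. exp (c * g s)) \<le> (LBINT s:{a<..b}. hi)"
    by (rule set_integral_mono[OF int cint(1)]) (use lohi in auto)
  then show "exp_functional c g b - exp_functional c g a \<le> hi * (b - a)"
    using exp_functional_diff[OF g G ab, of c] by (simp only: cint(2))
qed

lemma exp_functional_0: "exp_functional c g 0 = 0"
proof -
  have "(LBINT s:{0..0}. exp (c * g s)) = (LBINT s:{0..0::real}. exp (c * g 0))"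
    by (rule set_lebesgue_integral_cong) auto
  also have "\<dots> = 0" by (simp add: set_lebesgue_integral_def)
  finally show ?thesis by (simp add: exp_functional_def)
qed

lemma exp_functional_cong:
  assumes "\<And>s. 0 \<le> s \<Longrightarrow> s \<le> u \<Longrightarrow> g s = g' s"
  shows "exp_functional c g u = exp_functional c g' u"
  unfolding exp_functional_def by (rule set_lebesgue_integral_cong) (use assms in auto)

lemma exp_functional_max_0: "exp_functional c g (max 0 u) = exp_functional c g u"
proof (cases "u \<le> 0")
  case True
  have "exp_functional c g u = 0"
  proof (cases "u = 0")
    case False
    then have "{0..u} = {}" using True by auto
    then show ?thesis by (simp add: exp_functional_def set_lebesgue_integral_def)
  qed (simp add: exp_functional_0)
  then show ?thesis using True by (simp add: exp_functional_0)
qed simp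

lemma exp_functional_lipschitz:
  assumes g: "g \<in> borel_measurable borel" and G: "\<And>s. s \<in> {0..b} \<Longrightarrow> \<bar>g s\<bar> \<le> G" and ab: "0 \<le> a" "a \<le> b"
  shows "exp (- (\<bar>c\<bar> * G)) * (b - a) \<le> exp_functional c g b - exp_functional c g a"
    "exp_functional c g b - exp_functional c g a \<le> exp (\<bar>c\<bar> * G) * (b - a)"
  using exp_functional_increment[OF g G ab, of "exp (- (\<bar>c\<bar> * G))" c "exp (\<bar>c\<bar> * G)"] exp_bounds[OF G] ab
  by auto

lemma exp_functional_strict_mono:
  assumes g: "g \<in> borel_measurable borel" and G: "\<And>s. s \<in> {0..b} \<Longrightarrow> \<bar>g s\<bar> \<le> G" and ab: "0 \<le> a" "a < b"
  shows "exp_functional c g a < exp_functional c g b"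
proof -
  have "0 < exp (- (\<bar>c\<bar> * G)) * (b - a)" using ab by simp
  also have "\<dots> \<le> exp_functional c g b - exp_functional c g a"
    by (rule exp_functional_lipschitz(1)[OF g G]) (use ab in auto)
  finally show ?thesis by simp
qed

lemma exp_functional_continuous:
  assumes g: "g \<in> borel_measurable borel" and G: "\<And>s. s \<in> {0..h} \<Longrightarrow> \<bar>g s\<bar> \<le> G"
  shows "continuous_on {0..h} (exp_functional c g)"
proof -
  have *: "dist (exp_functional c g x) (exp_functional c g y) \<le> exp (\<bar>c\<bar> * G) * dist x y"
    if "x \<in> {0..h}" "y \<in> {0..h}" for x y
    using that
  proof (induction x y rule: linorder_wlog)
    case (le a b)
    have G': "\<And>s. s \<in> {0..b} \<Longrightarrow> \<bar>g s\<bar> \<le> G" using G le by auto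
    have "0 \<le> exp (- (\<bar>c\<bar> * G)) * (b - a)" using le by simp
    moreover have ab: "0 \<le> a" "a \<le> b" using le by auto
    note L = exp_functional_lipschitz[OF g G' ab, of c]
    ultimately have "exp_functional c g a \<le> exp_functional c g b" by linarith
    then show ?case using L(2) ab by (simp add: dist_real_def)
  next
    case (sym a b)
    then show ?case by (simp add: dist_commute)
  qed
  have "(exp (\<bar>c\<bar> * G))-lipschitz_on {0..h} (exp_functional c g)"
    by (rule lipschitz_onI) (use * in auto)
  then show ?thesis by (rule lipschitz_on_continuous_on)
qed

lemma exp_functional_right_derivative:
  assumes g: "g \<in> borel_measurable borel" and G: "\<And>s. s \<in> {0..h} \<Longrightarrow> \<bar>g s\<bar> \<le> G"
    and t: "0 \<le> t" "t < h" and lim: "(g \<longlongrightarrow> g t) (at_right t)"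
  shows "(exp_functional c g has_real_derivative exp (c * g t)) (at_right t)"
  unfolding has_field_derivative_iff
proof (rule tendstoI)
  fix e :: real assume e: "0 < e"
  have "((\<lambda>s. exp (c * g s)) \<longlongrightarrow> exp (c * g t)) (at_right t)"
    by (intro tendsto_exp tendsto_mult_left lim)
  then have "\<forall>\<^sub>F s in at_right t. dist (exp (c * g s)) (exp (c * g t)) < e / 2" using e by (intro tendstoD) auto
  then obtain b where b: "t < b" "\<And>s. t < s \<Longrightarrow> s < b \<Longrightarrow> dist (exp (c * g s)) (exp (c * g t)) < e / 2"
    by (auto simp: eventually_at_right[of t "t+1"])
  have "dist ((exp_functional c g y - exp_functional c g t) / (y - t)) (exp (c * g t)) < e"
    if y: "t < y" "y < min b h" for y
  proof -
    have G': "\<And>s. s \<in> {0..y} \<Longrightarrow> \<bar>g s\<bar> \<le> G" using G y by auto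
    have *: "exp (c * g t) - e / 2 \<le> exp (c * g s) \<and> exp (c * g s) \<le> exp (c * g t) + e / 2" if "t < s" "s \<le> y" for s
    proof -
      have "\<bar>exp (c * g s) - exp (c * g t)\<bar> < e / 2" using b(2)[of s] that y by (simp add: dist_real_def)
      then show ?thesis by linarith
    qed
    have ty: "t \<le> y" using y by simp
    note inc = exp_functional_increment[OF g G' t(1) ty *]
    have "exp (c * g t) - e / 2 \<le> (exp_functional c g y - exp_functional c g t) / (y - t)"
      "(exp_functional c g y - exp_functional c g t) / (y - t) \<le> exp (c * g t) + e / 2"
      using inc y by (simp_all add: pos_le_divide_eq pos_divide_le_eq)
    then show ?thesis using e by (auto simp: dist_real_def)
  qed
  then show "\<forall>\<^sub>F y in at_right t. dist ((exp_functional c g y - exp_functional c g t) / (y - t)) (exp (c * g t)) < e"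
    using b(1) t by (intro eventually_at_rightI[of t "min b h"]) auto
qed

text \<open>For every slope \<open>e > 0\<close> the set of times up to which \<open>\<bar>f s - f a\<bar> \<le> e (s - a)\<close> holds is a closed interval
  by continuity, and the right derivative lets it be prolonged at each of its points but \<open>b\<close>.\<close>

lemma constant_if_right_derivative_zero:
  fixes f :: "real \<Rightarrow> real"
  assumes ab: "a \<le> b" and cont: "continuous_on {a..b} f"
    and deriv: "\<And>t. a \<le> t \<Longrightarrow> t < b \<Longrightarrow> (f has_real_derivative 0) (at_right t)"
  shows "f b = f a"
proof -
  have bound: "\<bar>f b - f a\<bar> \<le> e * (b - a)" if e: "0 < e" for e
  proof -
    define S where "S = {t\<in>{a..b}. \<forall>s\<in>{a..t}. \<bar>f s - f a\<bar> \<le> e * (s - a)}"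
    have aS: "a \<in> S" using ab by (auto simp: S_def)
    have bdd: "bdd_above S" by (auto simp: S_def bdd_above_def)
    define c where "c = Sup S"
    have c: "a \<le> c" "c \<le> b" unfolding c_def
      using aS bdd by (auto intro!: cSup_upper cSup_least simp: S_def)
    have below: "\<bar>f s - f a\<bar> \<le> e * (s - a)" if as: "a \<le> s" and sc: "s < c" for s
    proof -
      obtain t where "t \<in> S" "s < t" using sc less_cSup_iff[OF _ bdd, of s] aS unfolding c_def by blast
      then show ?thesis using as by (auto simp: S_def)
    qed
    have at_c: "\<bar>f c - f a\<bar> \<le> e * (c - a)"
    proof (cases "c = a")
      case False
      then have ac: "a < c" using c by simp
      have "((\<lambda>s. \<bar>f s - f a\<bar>) \<longlongrightarrow> \<bar>f c - f a\<bar>) (at_left c)"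
      proof (intro tendsto_rabs tendsto_diff tendsto_const)
        have "continuous (at c within {a..b}) f" using cont c by (simp add: continuous_on_eq_continuous_within)
        then have "continuous (at c within {a..c}) f" by (rule continuous_within_subset) (use c in auto)
        then show "(f \<longlongrightarrow> f c) (at_left c)" using ac by (simp add: continuous_within at_within_Icc_at_left)
      qed
      moreover have "((\<lambda>s. e * (s - a)) \<longlongrightarrow> e * (c - a)) (at_left c)" by (intro tendsto_intros)
      moreover have "\<forall>\<^sub>F s in at_left c. \<bar>f s - f a\<bar> \<le> e * (s - a)"
        using ac below by (intro eventually_at_leftI[of a c]) auto
      ultimately show ?thesis by (intro tendsto_le[where F="at_left c"]) auto
    qed simp
    have "c = b"
    proof (rule ccontr)
      assume "c \<noteq> b"
      then have cb: "c < b" using c by simp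
      have "((\<lambda>y. (f y - f c) / (y - c)) \<longlongrightarrow> 0) (at_right c)"
        using deriv[OF c(1) cb] by (simp add: has_field_derivative_iff)
      then have "\<forall>\<^sub>F y in at_right c. dist ((f y - f c) / (y - c)) 0 < e" using e by (intro tendstoD)
      then obtain d where d: "c < d" "\<And>y. c < y \<Longrightarrow> y < d \<Longrightarrow> dist ((f y - f c) / (y - c)) 0 < e"
        by (auto simp: eventually_at_right[of c "c+1"])
      define u where "u = (c + min d b) / 2"
      have u: "c < u" "u < d" "u < b" using d cb by (auto simp: u_def)
      have "u \<in> S" unfolding S_def
      proof (intro CollectI conjI ballI)
        show "u \<in> {a..b}" using c u by auto
        fix s assume s: "s \<in> {a..u}"
        show "\<bar>f s - f a\<bar> \<le> e * (s - a)"
        proof (cases "s \<le> c")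
          case True then show ?thesis using below[of s] at_c s by (cases "s = c") auto
        next
          case False
          then have sc: "c < s" by simp
          then have "\<bar>f s - f c\<bar> / (s - c) < e" using d(2)[of s] s u by (auto simp: dist_real_def abs_divide)
          then have "\<bar>f s - f c\<bar> \<le> e * (s - c)" using sc by (simp add: pos_divide_less_eq less_imp_le)
          moreover have "\<bar>f s - f a\<bar> \<le> \<bar>f s - f c\<bar> + \<bar>f c - f a\<bar>" by simp
          moreover have "e * (s - c) + e * (c - a) = e * (s - a)" by (simp add: algebra_simps)
          ultimately show ?thesis using at_c by linarith
        qed
      qed
      then have "u \<le> c" unfolding c_def using bdd by (rule cSup_upper)
      then show False using u by simp
    qed
    then show ?thesis using at_c by simp
  qed
  have "\<bar>f b - f a\<bar> \<le> 0"
  proof (rule field_le_epsilon)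
    fix e :: real assume e: "0 < e"
    have "\<bar>f b - f a\<bar> \<le> (e / (b - a + 1)) * (b - a)" using bound[of "e / (b - a + 1)"] e ab by simp
    also have "\<dots> \<le> e" using e ab by (simp add: field_simps)
    finally show "\<bar>f b - f a\<bar> \<le> 0 + e" by simp
  qed
  then show ?thesis by simp
qed

text \<open>The time change by \<open>exp_functional c g\<close> is undone by the one with \<open>-c\<close>: where both sides
  are differentiable from the right their derivatives are reciprocal, and right-continuity of
  \<open>g\<close> gives one-sided derivatives everywhere.\<close>

lemma exp_functional_inverse:
  assumes g: "g \<in> borel_measurable borel" and G: "\<And>s. s \<in> {0..h} \<Longrightarrow> \<bar>g s\<bar> \<le> G"
    and right: "\<And>t. 0 \<le> t \<Longrightarrow> t < h \<Longrightarrow> (g \<longlongrightarrow> g t) (at_right t)"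
    and \<xi>: "\<xi> \<in> borel_measurable borel" and G': "\<And>s. s \<in> {0..exp_functional c g h} \<Longrightarrow> \<bar>\<xi> s\<bar> \<le> G'"
    and eq: "\<And>t. 0 \<le> t \<Longrightarrow> t < h \<Longrightarrow> \<xi> (exp_functional c g t) = g t"
    and t: "0 \<le> t" "t \<le> h"
  shows "exp_functional (- c) \<xi> (exp_functional c g t) = t"
proof -
  let ?I = "exp_functional c g" and ?J = "exp_functional (- c) \<xi>"
  have mono: "?I x < ?I y" if "0 \<le> x" "x < y" "y \<le> h" for x y
    by (rule exp_functional_strict_mono[OF g G]) (use that in auto)
  have contI: "continuous_on {0..h} ?I" by (rule exp_functional_continuous[OF g G])
  have I_range: "?I x \<in> {0..?I h}" if "x \<in> {0..h}" for x
    using mono[of 0 x] mono[of x h] that exp_functional_0[of c g]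
    by (cases "x = 0"; cases "x = h") (auto intro: less_imp_le)
  have contJ: "continuous_on {0..?I h} ?J" by (rule exp_functional_continuous[OF \<xi> G'])
  have cont: "continuous_on {0..t} (\<lambda>x. ?J (?I x) - x)"
    by (intro continuous_on_diff continuous_on_id continuous_on_compose2[OF contJ continuous_on_subset[OF contI]])
       (use I_range t in auto)
  have deriv: "((\<lambda>x. ?J (?I x) - x) has_real_derivative 0) (at_right x)" if x: "0 \<le> x" "x < t" for x
  proof -
    have xh: "x < h" using x t by simp
    have I': "(?I has_real_derivative exp (c * g x)) (at_right x)"
      by (rule exp_functional_right_derivative[OF g G x(1) xh right[OF x(1) xh]])
    have lim: "(\<xi> \<longlongrightarrow> \<xi> (?I x)) (at_right (?I x))"
    proof (rule tendstoI)
      fix e :: real assume "0 < e"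
      then have "\<forall>\<^sub>F u in at_right x. dist (g u) (g x) < e" by (rule tendstoD[OF right[OF x(1) xh]])
      then obtain b where b: "x < b" "\<And>u. x < u \<Longrightarrow> u < b \<Longrightarrow> dist (g u) (g x) < e"
        by (auto simp: eventually_at_right[of x "x+1"])
      define d where "d = (x + min b h) / 2"
      have d: "x < d" "d < b" "d < h" using b xh by (auto simp: d_def)
      have "dist (\<xi> s) (\<xi> (?I x)) < e" if s: "?I x < s" "s < ?I d" for s
      proof -
        have "\<exists>u\<ge>x. u \<le> d \<and> ?I u = s"
          by (rule IVT') (use s d x in \<open>auto intro: continuous_on_subset[OF contI]\<close>)
        then obtain u where u: "x \<le> u" "u \<le> d" "?I u = s" by blast
        then have "x < u" using s by (cases "u = x") auto
        then have "dist (g u) (g x) < e" using b(2) u d by simp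
        then show ?thesis using eq[of u] eq[of x] u d x xh by simp
      qed
      moreover have "?I x < ?I d" using mono[of x d] d x by simp
      ultimately show "\<forall>\<^sub>F s in at_right (?I x). dist (\<xi> s) (\<xi> (?I x)) < e"
        by (intro eventually_at_rightI[of "?I x" "?I d"]) auto
    qed
    have "(?J has_real_derivative exp (- c * \<xi> (?I x))) (at_right (?I x))"
      by (rule exp_functional_right_derivative[OF \<xi> G' _ _ lim])
         (use I_range[of x] mono[of x h] x xh in auto)
    then have J': "(?J has_real_derivative exp (- c * g x)) (at_right (?I x))"
      using eq[OF x(1) xh] by simp
    have "(?J has_real_derivative exp (- c * g x)) (at (?I x) within ?I ` {x<..<h})"
      by (rule has_field_derivative_subset[OF J']) (use mono x in auto)
    then have "(?J \<circ> ?I has_real_derivative exp (- c * g x) * exp (c * g x)) (at x within {x<..<h})"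
      by (rule DERIV_image_chain) (rule has_field_derivative_subset[OF I'], auto)
    also have "exp (- c * g x) * exp (c * g x) = 1" by (simp add: exp_add[symmetric])
    also have "at x within {x<..<h} = at_right x" 
      by (rule at_within_nhd[of _ "{..<h}"]) (use xh in auto)
    finally have "((\<lambda>x. (?J \<circ> ?I) x - x) has_real_derivative 1 - 1) (at_right x)"
      by (intro DERIV_diff DERIV_ident)
    then show ?thesis by (simp add: comp_def)
  qed
  have "(\<lambda>x. ?J (?I x) - x) t = (\<lambda>x. ?J (?I x) - x) 0"
    by (rule constant_if_right_derivative_zero[OF t(1) cont deriv])
  then show ?thesis by (simp add: exp_functional_0)
qed

lemma measurable_exp_functional:
  assumes [measurable]: "(\<lambda>p. e (fst p) (snd p)) \<in> borel_measurable (M \<Otimes>\<^sub>M borel)" "T \<in> borel_measurable M"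
  shows "(\<lambda>x. exp_functional c (e x) (T x)) \<in> borel_measurable M"
proof -
  have "(\<lambda>x. \<integral>s. (if 0 \<le> s \<and> s \<le> T x then exp (c * e x s) else 0) \<partial>lborel) \<in> borel_measurable M"
  proof (rule lborel.borel_measurable_lebesgue_integral)
    have "(\<lambda>p. if 0 \<le> snd p \<and> snd p \<le> T (fst p) then exp (c * e (fst p) (snd p)) else 0)
        \<in> borel_measurable (M \<Otimes>\<^sub>M borel)" by measurable
    then show "(\<lambda>(x, s). if 0 \<le> s \<and> s \<le> T x then exp (c * e x s) else 0) \<in> borel_measurable (M \<Otimes>\<^sub>M lborel)"
      by (simp add: case_prod_beta')
  qed
  also have "(\<lambda>x. \<integral>s. (if 0 \<le> s \<and> s \<le> T x then exp (c * e x s) else 0) \<partial>lborel) = (\<lambda>x. exp_functional c (e x) (T x))"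
    unfolding exp_functional_def set_lebesgue_integral_def
    by (intro ext Bochner_Integration.integral_cong) (auto simp: indicator_def)
  finally show ?thesis .
qed

section \<open>The Lamperti clock of a path\<close>

text \<open>Lamperti's additive functional \<open>\<integral> \<bar>f u\<bar>\<^sup>-\<^sup>\<alpha> du\<close>. It is written as an exponential functional of \<open>ln \<bar>f\<bar>\<close>, so
  that it and the functional of the Levy process that inverts it are instances of one and the same
  construction, with \<open>-\<alpha>\<close> and \<open>\<alpha>\<close>.\<close>

definition clock :: "real \<Rightarrow> (real \<Rightarrow> real) \<Rightarrow> real \<Rightarrow> real" where
  "clock \<alpha> f t = exp_functional (- \<alpha>) (\<lambda>u. ln \<bar>f u\<bar>) t"

lemma clock_0: "clock \<alpha> f 0 = 0"
  by (simp add: clock_def exp_functional_0)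

lemma measurable_path_real: "f \<in> space path_space \<Longrightarrow> f \<in> borel_measurable borel"
  using measurable_path_eval[of "\<lambda>_. f" borel "\<lambda>t. t"] by simp

lemma measurable_ln_path: "f \<in> space path_space \<Longrightarrow> (\<lambda>u. ln \<bar>f u\<bar>) \<in> borel_measurable borel"
  using measurable_path_real by measurable

lemma measurable_clock [measurable (raw)]:
  assumes [measurable]: "\<phi> \<in> M \<rightarrow>\<^sub>M path_space" "T \<in> borel_measurable M"
  shows "(\<lambda>x. clock \<alpha> (\<phi> x) (T x)) \<in> borel_measurable M"
  unfolding clock_def
proof (rule measurable_exp_functional)
  have [measurable]: "(\<lambda>p. \<phi> (fst p) (snd p)) \<in> borel_measurable (M \<Otimes>\<^sub>M borel)"
    by (rule measurable_path_eval) measurable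
  show "(\<lambda>p. ln \<bar>\<phi> (fst p) (snd p)\<bar>) \<in> borel_measurable (M \<Otimes>\<^sub>M borel)" by measurable
qed measurable

lemma clock_stopped_path: "0 \<le> u \<Longrightarrow> u \<le> t \<Longrightarrow> clock \<alpha> (stopped_path t f) u = clock \<alpha> f u"
  unfolding clock_def by (rule exp_functional_cong) (simp add: stopped_path_eq)

text \<open>The logarithm is continuous away from zero, so only zeros of the path and of its left limits could
  do harm.\<close>

lemma cadlag_ln_abs:
  assumes p: "cadlag p" and nz: "\<And>t. 0 \<le> t \<Longrightarrow> p t \<noteq> 0" "\<And>t. 0 < t \<Longrightarrow> left_lim p t \<noteq> 0"
  shows "cadlag (\<lambda>t. ln \<bar>p t\<bar>)"
  unfolding cadlag_def
proof (intro conjI allI impI)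
  fix t :: real assume t: "0 \<le> t"
  show "((\<lambda>t. ln \<bar>p t\<bar>) \<longlongrightarrow> ln \<bar>p t\<bar>) (at_right t)"
    by (intro tendsto_ln tendsto_rabs cadlag_right[OF p t]) (use nz t in auto)
next
  fix t :: real assume t: "0 < t"
  have "((\<lambda>t. ln \<bar>p t\<bar>) \<longlongrightarrow> ln \<bar>left_lim p t\<bar>) (at_left t)"
    by (intro tendsto_ln tendsto_rabs cadlag_left[OF p t]) (use nz t in auto)
  then show "\<exists>l. ((\<lambda>t. ln \<bar>p t\<bar>) \<longlongrightarrow> l) (at_left t)" ..
qed

lemma left_lim_stopped_path:
  assumes f: "cadlag f" and s: "0 < s" and t: "0 \<le> t"
  shows "left_lim (stopped_path t f) s = (if s \<le> t then left_lim f s else f t)"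
proof (cases "s \<le> t")
  case True
  then show ?thesis by (auto intro!: left_lim_cong simp: stopped_path_eq)
next
  case False
  have "\<forall>\<^sub>F r in at_left s. stopped_path t f r = f t"
    using False t by (intro eventually_at_leftI[of t]) (auto simp: stopped_path_def min_def)
  then have "(stopped_path t f \<longlongrightarrow> f t) (at_left s)" by (rule tendsto_eventually)
  then show ?thesis using False left_lim_unique[OF s] by simp
qed

lemma left_lim_inside_nonzero:
  assumes f: "cadlag f" and t: "0 < s" "s \<le> t" "ennreal t < exit_time f"
  shows "left_lim f s \<noteq> 0"
proof -
  obtain c where c: "c > 0" "\<And>r. r \<in> {0..t} \<Longrightarrow> c \<le> f 0 * f r"
    using less_exit_time_iff[OF f, of t] t by auto
  have "c \<le> f 0 * left_lim f s"
  proof (rule tendsto_lowerbound)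
    show "((\<lambda>r. f 0 * f r) \<longlongrightarrow> f 0 * left_lim f s) (at_left s)"
      by (intro tendsto_mult_left cadlag_left f t)
    show "\<forall>\<^sub>F r in at_left s. c \<le> f 0 * f r" using c(2) t by (intro eventually_at_leftI[of 0 s]) auto
  qed simp
  then show ?thesis using c by auto
qed

lemma cadlag_ln_stopped_before_exit:
  assumes f: "cadlag f" and t: "0 \<le> t" "ennreal t < exit_time f"
  shows "cadlag (\<lambda>s. ln \<bar>stopped_path t f s\<bar>)"
proof (rule cadlag_ln_abs)
  have nz: "f s \<noteq> 0" if "0 \<le> s" "s \<le> t" for s
  proof -
    have "ennreal s < exit_time f" using that t by (meson ennreal_leI le_less_trans)
    then show ?thesis using less_exit_time_pos[OF f that(1)] by auto
  qed
  show "stopped_path t f s \<noteq> 0" if "0 \<le> s" for s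
    using nz[of "min s t"] that t by (simp add: stopped_path_def)
  show "left_lim (stopped_path t f) s \<noteq> 0" if "0 < s" for s
    unfolding left_lim_stopped_path[OF f that t(1)]
    using nz[of t] left_lim_inside_nonzero[OF f that _ t(2)] t by auto
qed (rule cadlag_stopped_path[OF f t(1)])

lemma cadlag_ln_stopped_good:
  assumes f: "cadlag f" and good: "good_path f"
  shows "cadlag (\<lambda>s. ln \<bar>stopped_path (enn2real (exit_time f)) f s\<bar>)"
proof (rule cadlag_ln_abs)
  define h where "h = enn2real (exit_time f)"
  have h: "exit_time f = ennreal h" "0 < h" "f h \<noteq> 0" "0 < f 0 * left_lim f h"
    unfolding h_def using good_pathD[OF good f] by auto
  have nz: "f s \<noteq> 0" if "0 \<le> s" "s \<le> h" for s
  proof (cases "s = h")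
    case False
    then have "ennreal s < exit_time f" using that h by (simp add: ennreal_less_iff)
    then show ?thesis using less_exit_time_pos[OF f that(1)] by auto
  qed (use h in simp)
  show "stopped_path (enn2real (exit_time f)) f s \<noteq> 0" if "0 \<le> s" for s
    using nz[of "min s h"] that h(2) unfolding h_def[symmetric] by (simp add: stopped_path_def)
  show "left_lim (stopped_path (enn2real (exit_time f)) f) s \<noteq> 0" if s: "0 < s" for s
  proof (cases "s < h")
    case True
    then have "left_lim f s \<noteq> 0" using h s by (intro left_lim_inside_nonzero[OF f s order_refl]) (simp add: ennreal_less_iff)
    then show ?thesis unfolding h_def[symmetric] using left_lim_stopped_path[OF f s, of h] True h by simp
  next
    case False
    then show ?thesis unfolding h_def[symmetric] using left_lim_stopped_path[OF f s, of h] h by (cases "s = h") auto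
  qed
qed (use cadlag_stopped_path[OF f] in auto)

lemma ln_bounded_before_exit:
  assumes f: "cadlag f" and t: "0 \<le> t" "ennreal t < exit_time f"
  shows "\<exists>G. \<forall>s\<in>{0..t}. \<bar>ln \<bar>f s\<bar>\<bar> \<le> G"
proof -
  obtain G where "\<forall>s\<in>{0..t}. \<bar>ln \<bar>stopped_path t f s\<bar>\<bar> \<le> G"
    using cadlag_bounded[OF cadlag_ln_stopped_before_exit[OF assms]] by blast
  then show ?thesis by (intro exI[of _ G]) (simp add: stopped_path_eq)
qed

lemma ln_bounded_good:
  assumes f: "cadlag f" and good: "good_path f"
  shows "\<exists>G. \<forall>s\<in>{0..enn2real (exit_time f)}. \<bar>ln \<bar>f s\<bar>\<bar> \<le> G"
proof -
  let ?h = "enn2real (exit_time f)"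
  obtain G where "\<forall>s\<in>{0..?h}. \<bar>ln \<bar>stopped_path ?h f s\<bar>\<bar> \<le> G"
    using cadlag_bounded[OF cadlag_ln_stopped_good[OF assms]] by blast
  then show ?thesis by (intro exI[of _ G]) (simp add: stopped_path_eq)
qed

lemma clock_strict_mono:
  assumes f: "f \<in> space path_space" and t: "0 \<le> s" "s < t" "ennreal t < exit_time f"
  shows "clock \<alpha> f s < clock \<alpha> f t"
proof -
  obtain G where G: "\<And>s. s \<in> {0..t} \<Longrightarrow> \<bar>ln \<bar>f s\<bar>\<bar> \<le> G"
    using ln_bounded_before_exit[OF path_spaceD[OF f] less_imp_le[OF le_less_trans[OF t(1,2)]] t(3)] by blast
  show ?thesis unfolding clock_def
    by (rule exp_functional_strict_mono[OF measurable_ln_path[OF f] G t(1,2)])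
qed

lemma clock_continuous:
  assumes f: "f \<in> space path_space" and t: "0 \<le> t" "ennreal t < exit_time f"
  shows "continuous_on {0..t} (clock \<alpha> f)"
proof -
  obtain G where G: "\<And>s. s \<in> {0..t} \<Longrightarrow> \<bar>ln \<bar>f s\<bar>\<bar> \<le> G"
    using ln_bounded_before_exit[OF path_spaceD[OF f] t] by blast
  show ?thesis unfolding clock_def[abs_def]
    by (rule exp_functional_continuous[OF measurable_ln_path[OF f] G])
qed

text \<open>Infinite if the clock does not reach \<open>s\<close> before the exit.\<close>

definition clock_hit :: "real \<Rightarrow> real \<Rightarrow> (real \<Rightarrow> real) \<Rightarrow> ennreal" where
  "clock_hit \<alpha> s f = Inf {ennreal u |u. 0 \<le> u \<and> ennreal u < exit_time f \<and> s \<le> clock \<alpha> f u}"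

lemma clock_hit_eqI:
  assumes f: "f \<in> space path_space" and u: "0 \<le> u" "ennreal u < exit_time f" "clock \<alpha> f u = s"
  shows "clock_hit \<alpha> s f = ennreal u"
  unfolding clock_hit_def
proof (rule antisym)
  show "Inf {ennreal u |u. 0 \<le> u \<and> ennreal u < exit_time f \<and> s \<le> clock \<alpha> f u} \<le> ennreal u"
    using u by (intro Inf_lower) auto
  show "ennreal u \<le> Inf {ennreal u |u. 0 \<le> u \<and> ennreal u < exit_time f \<and> s \<le> clock \<alpha> f u}"
  proof (rule Inf_greatest, safe)
    fix v assume v: "0 \<le> v" "ennreal v < exit_time f" "s \<le> clock \<alpha> f v"
    have "\<not> v < u"
    proof
      assume "v < u"
      from clock_strict_mono[OF f v(1) this u(2), of \<alpha>] v(3) u(3) show False by simp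
    qed
    then show "ennreal u \<le> ennreal v" by (intro ennreal_leI) simp
  qed
qed

lemma clock_hit_ex:
  assumes f: "f \<in> space path_space" and u: "0 \<le> u" "ennreal u < exit_time f" "0 \<le> s" "s \<le> clock \<alpha> f u"
  shows "\<exists>m. 0 \<le> m \<and> m \<le> u \<and> ennreal m < exit_time f \<and> clock \<alpha> f m = s \<and> clock_hit \<alpha> s f = ennreal m"
proof -
  have "\<exists>m\<ge>0. m \<le> u \<and> clock \<alpha> f m = s"
    by (rule IVT') (use u clock_0 clock_continuous[OF f u(1,2)] in auto)
  then obtain m where m: "0 \<le> m" "m \<le> u" "clock \<alpha> f m = s" by blast
  have "ennreal m < exit_time f" using m u by (meson ennreal_leI le_less_trans)
  then show ?thesis using m clock_hit_eqI[OF f] by blast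
qed

lemma clock_hit_finiteE:
  assumes f: "f \<in> space path_space" and s: "0 \<le> s" "clock_hit \<alpha> s f < \<infinity>"
  obtains m where "0 \<le> m" "ennreal m < exit_time f" "clock \<alpha> f m = s" "clock_hit \<alpha> s f = ennreal m"
proof -
  have "\<exists>u\<ge>0. ennreal u < exit_time f \<and> s \<le> clock \<alpha> f u"
    using s(2) unfolding clock_hit_def Inf_less_iff by auto
  then obtain u where u: "0 \<le> u" "ennreal u < exit_time f" "s \<le> clock \<alpha> f u" by blast
  from clock_hit_ex[OF f u(1,2) s(1) u(3)] show thesis using that by blast
qed

lemma clock_hit_le_iff:
  assumes f: "f \<in> space path_space" and s: "0 \<le> s" and t: "0 \<le> t"
  shows "clock_hit \<alpha> s f \<le> ennreal t \<longleftrightarrow> (\<exists>u\<in>{0..t}. ennreal u < exit_time f \<and> s \<le> clock \<alpha> f u)"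
proof
  assume le: "clock_hit \<alpha> s f \<le> ennreal t"
  then have "clock_hit \<alpha> s f < \<infinity>" by (simp add: le_less_trans)
  then obtain m where m: "0 \<le> m" "ennreal m < exit_time f" "clock \<alpha> f m = s" "clock_hit \<alpha> s f = ennreal m"
    by (rule clock_hit_finiteE[OF f s])
  then show "\<exists>u\<in>{0..t}. ennreal u < exit_time f \<and> s \<le> clock \<alpha> f u"
    using le t by (intro bexI[of _ m]) auto
next
  assume "\<exists>u\<in>{0..t}. ennreal u < exit_time f \<and> s \<le> clock \<alpha> f u"
  then obtain u where u: "0 \<le> u" "u \<le> t" "ennreal u < exit_time f" "s \<le> clock \<alpha> f u" by auto
  from clock_hit_ex[OF f u(1,3) s u(4)] u(2) show "clock_hit \<alpha> s f \<le> ennreal t"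
    by (auto intro: ennreal_leI)
qed

text \<open>The clock is strictly increasing before the exit, so it exceeds \<open>s\<close> at rational times just after
  reaching \<open>s\<close>.\<close>

lemma measurable_clock_hit [measurable]:
  assumes s: "0 \<le> s"
  shows "clock_hit \<alpha> s \<in> borel_measurable path_space"
proof (rule borel_measurableI_less)
  fix y :: ennreal
  have "{f\<in>space path_space. clock_hit \<alpha> s f < y} = {f\<in>space path_space. \<exists>q::rat. 0 \<le> q \<and>
    ennreal (of_rat q) < exit_time f \<and> s < clock \<alpha> f (of_rat q) \<and> ennreal (of_rat q) < y}"
  proof (intro Collect_cong conj_cong refl iffI)
    fix f assume f: "f \<in> space path_space" and "clock_hit \<alpha> s f < y"
    then have "clock_hit \<alpha> s f < \<infinity>" by (auto intro: less_le_trans)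
    then obtain m where m: "0 \<le> m" "ennreal m < exit_time f" "clock \<alpha> f m = s" "clock_hit \<alpha> s f = ennreal m"
      by (rule clock_hit_finiteE[OF f s])
    then have "ennreal m < min (exit_time f) y" using \<open>clock_hit \<alpha> s f < y\<close> by simp
    then obtain z where z: "ennreal m < z" "z < min (exit_time f) y" using dense by blast
    then obtain r where r: "z = ennreal r" "0 \<le> r" by (cases z) auto
    have "m < r" using z r m by (simp add: ennreal_less_iff)
    then obtain q :: rat where q: "m < of_rat q" "of_rat q < r" using of_rat_dense by blast
    have q0: "0 \<le> (of_rat q :: real)" using q m by linarith
    have "ennreal (of_rat q) < z" using q q0 r by (simp add: ennreal_less_iff)
    then have qe: "ennreal (of_rat q) < exit_time f" "ennreal (of_rat q) < y" using z by auto
    have "s < clock \<alpha> f (of_rat q)"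
      using clock_strict_mono[OF f m(1) q(1) qe(1), of \<alpha>] m(3) by simp
    then show "\<exists>q::rat. 0 \<le> q \<and> ennreal (of_rat q) < exit_time f \<and> s < clock \<alpha> f (of_rat q) \<and> ennreal (of_rat q) < y"
      using qe q0 by (intro exI[of _ q]) simp
  next
    fix f assume f: "f \<in> space path_space" and "\<exists>q::rat. 0 \<le> q \<and> ennreal (of_rat q) < exit_time f \<and> s < clock \<alpha> f (of_rat q) \<and> ennreal (of_rat q) < y"
    then obtain q :: rat where q: "0 \<le> q" "ennreal (of_rat q) < exit_time f" "s < clock \<alpha> f (of_rat q)" "ennreal (of_rat q) < y"
      by blast
    have "clock_hit \<alpha> s f \<le> ennreal (of_rat q)" unfolding clock_hit_def
      using q by (intro Inf_lower) auto
    also have "\<dots> < y" by fact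
    finally show "clock_hit \<alpha> s f < y" .
  qed
  also have "\<dots> \<in> sets path_space" by measurable
  finally show "{f\<in>space path_space. clock_hit \<alpha> s f < y} \<in> sets path_space" .
qed

lemma path_stopping_time_clock_hit:
  assumes s: "0 \<le> s"
  shows "path_stopping_time (clock_hit \<alpha> s)"
  unfolding path_stopping_time_def
proof (intro conjI ballI allI impI)
  fix f t assume f: "f \<in> space path_space" and t: "0 \<le> (t::real)"
  have "(\<exists>u\<in>{0..t}. ennreal u < exit_time f \<and> s \<le> clock \<alpha> f u) \<longleftrightarrow>
    (\<exists>u\<in>{0..t}. ennreal u < exit_time (stopped_path t f) \<and> s \<le> clock \<alpha> (stopped_path t f) u)"
    using exit_time_stopped_path_iff[OF path_spaceD[OF f], of _ t] clock_stopped_path[of _ t \<alpha> f] by auto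
  then show "clock_hit \<alpha> s f \<le> ennreal t \<longleftrightarrow> clock_hit \<alpha> s (stopped_path t f) \<le> ennreal t"
    using clock_hit_le_iff[OF f s t] clock_hit_le_iff[OF stopped_path_in[OF f t] s t] by blast
qed (use s in measurable)

text \<open>The clock of the rescaled path continues that of the original one: in the integral the time factor
  \<open>\<bar>f m\<bar>\<^sup>\<alpha>\<close> cancels against the space factor \<open>\<bar>f m\<bar>\<close> raised to the power \<open>-\<alpha>\<close>.\<close>

lemma clock_rescaled_shift:
  assumes f: "f \<in> space path_space" and m: "0 \<le> m" "ennreal m < exit_time f"
    and v: "0 \<le> v" "ennreal (m + \<bar>f m\<bar> powr \<alpha> * v) < exit_time f"
  shows "clock \<alpha> f (m + \<bar>f m\<bar> powr \<alpha> * v) = clock \<alpha> f m + clock \<alpha> (rescaled_shift \<alpha> f m) v"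
proof -
  let ?a = "\<bar>f m\<bar> powr \<alpha>" and ?Z = "rescaled_shift \<alpha> f m"
  have cad: "cadlag f" using f by (rule path_spaceD)
  have Z: "?Z \<in> space path_space" using f m by (intro rescaled_shift_in)
  have fm: "f m \<noteq> 0" using less_exit_time_pos[OF cad m] by auto
  then have a: "0 < ?a" by simp
  have vZ: "ennreal v < exit_time ?Z" using less_exit_time_rescaled_shift[OF cad m v(1)] v by blast
  have mv: "0 \<le> m + ?a * v" "m \<le> m + ?a * v" using m v by auto
  obtain G where G: "\<And>s. s \<in> {0..m + ?a * v} \<Longrightarrow> \<bar>ln \<bar>f s\<bar>\<bar> \<le> G"
    using ln_bounded_before_exit[OF cad mv(1) v(2)] by blast
  obtain G' where G': "\<And>s. s \<in> {0..v} \<Longrightarrow> \<bar>ln \<bar>?Z s\<bar>\<bar> \<le> G'"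
    using ln_bounded_before_exit[OF path_spaceD[OF Z] v(1) vZ] by blast
  have nz: "f (m + ?a * x) \<noteq> 0" if "0 < x" "x \<le> v" for x
  proof -
    have x: "0 \<le> m + ?a * x" "m + ?a * x \<le> m + ?a * v" using m a that by auto
    have "ennreal (m + ?a * x) < exit_time f" using x v by (meson ennreal_leI le_less_trans)
    then show ?thesis using less_exit_time_pos[OF cad x(1)] by auto
  qed
  have "clock \<alpha> f (m + ?a * v) - clock \<alpha> f m = (LBINT s:{m<..m + ?a * v}. exp (- \<alpha> * ln \<bar>f s\<bar>))"
    unfolding clock_def by (rule exp_functional_diff[OF measurable_ln_path[OF f] G m(1) mv(2)])
  also have "\<dots> = ?a * (\<integral>x. indicator {m<..m + ?a * v} (m + ?a * x) *\<^sub>R exp (- \<alpha> * ln \<bar>f (m + ?a * x)\<bar>) \<partial>lborel)"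
    unfolding set_lebesgue_integral_def using a by (subst lborel_integral_real_affine[of ?a _ m]) auto
  also have "\<dots> = (\<integral>x. ?a * (indicator {m<..m + ?a * v} (m + ?a * x) *\<^sub>R exp (- \<alpha> * ln \<bar>f (m + ?a * x)\<bar>)) \<partial>lborel)"
    by simp
  also have "\<dots> = (LBINT x:{0<..v}. exp (- \<alpha> * ln \<bar>?Z x\<bar>))"
    unfolding set_lebesgue_integral_def
  proof (rule Bochner_Integration.integral_cong[OF refl])
    fix x :: real
    have ind: "indicator {m<..m + ?a * v} (m + ?a * x) = (indicator {0<..v} x :: real)"
      using a by (auto simp: indicator_def zero_less_mult_iff)
    show "?a * (indicator {m<..m + ?a * v} (m + ?a * x) *\<^sub>R exp (- \<alpha> * ln \<bar>f (m + ?a * x)\<bar>)) =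
      indicator {0<..v} x *\<^sub>R exp (- \<alpha> * ln \<bar>?Z x\<bar>)"
    proof (cases "x \<in> {0<..v}")
      case True
      have lnZ: "ln \<bar>?Z x\<bar> = ln \<bar>f (m + ?a * x)\<bar> - ln \<bar>f m\<bar>"
        using True nz[of x] fm by (simp add: rescaled_shift_eq ln_div)
      have "exp (- \<alpha> * ln \<bar>?Z x\<bar>) = exp (\<alpha> * ln \<bar>f m\<bar>) * exp (- \<alpha> * ln \<bar>f (m + ?a * x)\<bar>)"
        unfolding lnZ exp_add[symmetric] by (rule arg_cong[where f=exp]) (simp add: right_diff_distrib)
      also have "exp (\<alpha> * ln \<bar>f m\<bar>) = ?a" using fm by (simp add: powr_def)
      finally show ?thesis using True by (simp add: ind)
    qed (simp add: ind)
  qed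
  also have "\<dots> = clock \<alpha> ?Z v - clock \<alpha> ?Z 0"
    unfolding clock_def by (rule exp_functional_diff[OF measurable_ln_path[OF Z] G' order_refl v(1), symmetric])
  finally show ?thesis by (simp add: clock_0)
qed

lemma clock_hit_add:
  assumes f: "f \<in> space path_space" and s: "0 \<le> s" "0 \<le> r"
    and m: "0 \<le> m" "ennreal m < exit_time f" "clock \<alpha> f m = s"
  shows "clock_hit \<alpha> (s + r) f = ennreal m + ennreal (\<bar>f m\<bar> powr \<alpha>) * clock_hit \<alpha> r (rescaled_shift \<alpha> f m)"
proof -
  let ?a = "\<bar>f m\<bar> powr \<alpha>" and ?Z = "rescaled_shift \<alpha> f m"
  have cad: "cadlag f" using f by (rule path_spaceD)
  have Z: "?Z \<in> space path_space" using f m by (intro rescaled_shift_in)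
  have a: "0 < ?a" using less_exit_time_pos[OF cad m(1,2)] by auto
  show ?thesis
  proof (cases "clock_hit \<alpha> r ?Z < \<infinity>")
    case True
    then obtain v where v: "0 \<le> v" "ennreal v < exit_time ?Z" "clock \<alpha> ?Z v = r" "clock_hit \<alpha> r ?Z = ennreal v"
      by (rule clock_hit_finiteE[OF Z s(2)])
    have ex: "ennreal (m + ?a * v) < exit_time f"
      using less_exit_time_rescaled_shift[OF cad m(1,2) v(1)] v by blast
    have "clock_hit \<alpha> (s + r) f = ennreal (m + ?a * v)"
      by (rule clock_hit_eqI[OF f _ ex]) (use clock_rescaled_shift[OF f m(1,2) v(1) ex] m v in auto)
    then show ?thesis using v m a by (simp add: ennreal_mult)
  next
    case False
    have "\<not> clock_hit \<alpha> (s + r) f < \<infinity>"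
    proof
      assume fin: "clock_hit \<alpha> (s + r) f < \<infinity>"
      have sr: "0 \<le> s + r" using s by simp
      obtain u where u: "0 \<le> u" "ennreal u < exit_time f" "clock \<alpha> f u = s + r"
        using fin by (rule clock_hit_finiteE[OF f sr])
      have "\<not> u < m"
      proof
        assume "u < m"
        from clock_strict_mono[OF f u(1) this m(2), of \<alpha>] u(3) m(3) s show False by simp
      qed
      define v where "v = (u - m) / ?a"
      have v: "0 \<le> v" "u = m + ?a * v" using \<open>\<not> u < m\<close> a by (auto simp: v_def)
      have "ennreal v < exit_time ?Z" using less_exit_time_rescaled_shift[OF cad m(1,2) v(1)] u(2) v(2) by simp
      moreover have "clock \<alpha> ?Z v = r" using clock_rescaled_shift[OF f m(1,2) v(1)] u v(2) m(3) by simp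
      ultimately have "clock_hit \<alpha> r ?Z = ennreal v" by (rule clock_hit_eqI[OF Z v(1)])
      then show False using False by simp
    qed
    then have "clock_hit \<alpha> (s + r) f = \<infinity>" "clock_hit \<alpha> r ?Z = \<infinity>" using False by (simp_all add: less_top[symmetric])
    then show ?thesis using a by (simp add: ennreal_mult_top)
  qed
qed

lemma clock_hit_mono: "s \<le> r \<Longrightarrow> clock_hit \<alpha> s f \<le> clock_hit \<alpha> r f"
  unfolding clock_hit_def by (rule Inf_superset_mono) auto

definition log_path :: "real \<Rightarrow> real \<Rightarrow> (real \<Rightarrow> real) \<Rightarrow> real" where
  "log_path \<alpha> s f = ln \<bar>f (enn2real (clock_hit \<alpha> s f))\<bar>"

lemma measurable_log_path [measurable]:
  assumes [measurable (raw)]: "0 \<le> s"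
  shows "log_path \<alpha> s \<in> borel_measurable path_space"
proof -
  have [measurable]: "clock_hit \<alpha> s \<in> borel_measurable path_space" by (rule measurable_clock_hit[OF assms])
  have [measurable]: "(\<lambda>f. f (enn2real (clock_hit \<alpha> s f))) \<in> borel_measurable path_space"
    by (rule measurable_path_evalI) measurable
  show ?thesis unfolding log_path_def[abs_def] by measurable
qed

text \<open>The logarithm turns the space factor \<open>\<bar>f m\<bar>\<close> of the rescaling into a shift.\<close>

lemma log_path_add:
  assumes f: "f \<in> space path_space" and s: "0 \<le> s" "0 \<le> r" and fin: "clock_hit \<alpha> s f < \<infinity>"
  defines "Z \<equiv> rescaled_shift \<alpha> f (enn2real (clock_hit \<alpha> s f))"
  shows "clock_hit \<alpha> (s + r) f < \<infinity> \<longleftrightarrow> clock_hit \<alpha> r Z < \<infinity>"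
    "clock_hit \<alpha> r Z < \<infinity> \<Longrightarrow> log_path \<alpha> (s + r) f = log_path \<alpha> s f + log_path \<alpha> r Z"
proof -
  obtain m where m: "0 \<le> m" "ennreal m < exit_time f" "clock \<alpha> f m = s" "clock_hit \<alpha> s f = ennreal m"
    using fin by (rule clock_hit_finiteE[OF f s(1)])
  let ?a = "\<bar>f m\<bar> powr \<alpha>"
  have Zeq: "Z = rescaled_shift \<alpha> f m" using m by (simp add: Z_def)
  have cad: "cadlag f" using f by (rule path_spaceD)
  have Z: "Z \<in> space path_space" unfolding Zeq using f m by (intro rescaled_shift_in)
  have fm: "f m \<noteq> 0" using less_exit_time_pos[OF cad m(1,2)] by auto
  then have a: "0 < ?a" by simp
  note add = clock_hit_add[OF f s m(1,2,3), folded Zeq]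
  show "clock_hit \<alpha> (s + r) f < \<infinity> \<longleftrightarrow> clock_hit \<alpha> r Z < \<infinity>"
    unfolding add using a by (auto simp: less_top[symmetric] ennreal_mult_eq_top_iff)
  assume "clock_hit \<alpha> r Z < \<infinity>"
  then obtain v where v: "0 \<le> v" "ennreal v < exit_time Z" "clock_hit \<alpha> r Z = ennreal v"
    by (rule clock_hit_finiteE[OF Z s(2)])
  have Zv: "Z v \<noteq> 0" using less_exit_time_pos[OF path_spaceD[OF Z] v(1,2)] by auto
  have "enn2real (clock_hit \<alpha> (s + r) f) = m + ?a * v"
    unfolding add v using m v a by (simp add: ennreal_mult[symmetric] ennreal_plus[symmetric] del: ennreal_plus)
  moreover have "f (m + ?a * v) = \<bar>f m\<bar> * Z v" using v fm by (simp add: Zeq rescaled_shift_eq)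
  ultimately show "log_path \<alpha> (s + r) f = log_path \<alpha> s f + log_path \<alpha> r Z"
    using m v fm Zv by (simp add: log_path_def abs_mult ln_mult)
qed

section \<open>Killed Levy processes\<close>

text \<open>The increments of a Levy process killed at an independent exponential time, taken together
  with the event of being alive at the last of the times, have product probabilities. Conversely
  this property makes it possible to continue the process beyond its lifetime.\<close>

locale killed_levy = prob_space K for K :: "'a measure" +
  fixes Y :: "real \<Rightarrow> 'a \<Rightarrow> real" and life :: "'a \<Rightarrow> real"
  assumes Y_measurable: "\<And>t. 0 \<le> t \<Longrightarrow> Y t \<in> borel_measurable K"
    and life_measurable [measurable]: "life \<in> borel_measurable K"
    and regular: "\<And>x. x \<in> space K \<Longrightarrow> 1 < life x \<Longrightarrow> cadlag (\<lambda>t. Y (min t 1) x)"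
    and Y_0: "AE x in K. Y 0 x = 0"
    and life_pos: "AE x in K. 0 < life x"
    and increments: "\<And>(s :: nat \<Rightarrow> real) n B. mono s \<Longrightarrow> s 0 = 0 \<Longrightarrow> (\<And>i. B i \<in> sets borel) \<Longrightarrow>
      prob {x\<in>space K. s n < life x \<and> (\<forall>i<n. Y (s (Suc i)) x - Y (s i) x \<in> B i)} =
      (\<Prod>i<n. prob {x\<in>space K. s (Suc i) - s i < life x \<and> Y (s (Suc i) - s i) x \<in> B i})"
begin

definition surv :: "real \<Rightarrow> real" where
  "surv t = prob {x\<in>space K. t < life x}"

lemma surv_antimono: "s \<le> t \<Longrightarrow> surv t \<le> surv s"
  unfolding surv_def by (intro finite_measure_mono) auto

lemma surv_0: "surv 0 = 1"
  unfolding surv_def using life_pos by (subst prob_eq_1) auto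

lemma surv_prod:
  assumes "mono s" "s 0 = 0"
  shows "surv (s n) = (\<Prod>i<n. surv (s (Suc i) - s i))"
  using increments[OF assms, of "\<lambda>_. UNIV" n] by (simp add: surv_def)

lemma surv_add:
  assumes "0 \<le> a" "0 \<le> b"
  shows "surv (a + b) = surv a * surv b"
proof -
  define s :: "nat \<Rightarrow> real" where "s i = (if i = 0 then 0 else if i = 1 then a else a + b)" for i
  have "mono s" unfolding mono_def s_def using assms by auto
  from surv_prod[OF this, of 2] show ?thesis by (simp add: s_def numeral_2_eq_2)
qed

lemma surv_mult: "0 \<le> a \<Longrightarrow> surv (real n * a) = surv a ^ n"
proof (induction n)
  case (Suc n)
  have "real (Suc n) * a = a + real n * a" by (simp add: distrib_right)
  then show ?case using Suc surv_add[of a "real n * a"] by simp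
qed (simp add: surv_0)

text \<open>Close to time \<open>0\<close> survival is likely, and a long time is a sum of many short ones.\<close>

lemma surv_pos: "0 < surv t"
proof -
  have "(\<lambda>n. prob {x\<in>space K. 1 / real (Suc n) < life x}) \<longlonglongrightarrow> prob (\<Union>n. {x\<in>space K. 1 / real (Suc n) < life x})"
  proof (rule finite_Lim_measure_incseq)
    show "incseq (\<lambda>n. {x\<in>space K. 1 / real (Suc n) < life x})"
    proof (rule incseq_SucI, safe)
      fix n x assume "1 / real (Suc n) < life x"
      moreover have "1 / real (Suc (Suc n)) \<le> 1 / real (Suc n)" by (intro divide_left_mono) auto
      ultimately show "1 / real (Suc (Suc n)) < life x" by linarith
    qed
  qed auto
  also have "(\<Union>n. {x\<in>space K. 1 / real (Suc n) < life x}) = {x\<in>space K. 0 < life x}"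
  proof (intro equalityI subsetI)
    fix x assume "x \<in> {x\<in>space K. 0 < life x}"
    then show "x \<in> (\<Union>n. {x\<in>space K. 1 / real (Suc n) < life x})" using nat_approx_posE[of "life x"] by blast
  next
    fix x assume "x \<in> (\<Union>n. {x\<in>space K. 1 / real (Suc n) < life x})"
    then obtain n where "x \<in> space K" "1 / real (Suc n) < life x" by blast
    moreover have "0 < 1 / real (Suc n)" by simp
    ultimately show "x \<in> {x\<in>space K. 0 < life x}" using less_trans by blast
  qed
  also have "prob \<dots> = 1" using surv_0 by (simp add: surv_def)
  finally have "(\<lambda>n. surv (1 / real (Suc n))) \<longlonglongrightarrow> 1" by (simp only: surv_def)
  then have "\<forall>\<^sub>F n in sequentially. 0 < surv (1 / real (Suc n))" by (rule order_tendstoD) simp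
  then obtain n where n: "0 < surv (1 / real (Suc n))" using eventually_happens'[OF sequentially_bot] by blast
  obtain m where m: "t * real (Suc n) \<le> real m" using real_arch_simple by blast
  have "0 < surv (1 / real (Suc n)) ^ m" using n by simp
  also have "\<dots> = surv (real m * (1 / real (Suc n)))" by (rule surv_mult[symmetric]) simp
  also have "\<dots> \<le> surv t" by (rule surv_antimono) (use m in \<open>simp add: pos_le_divide_eq\<close>)
  finally show ?thesis .
qed

text \<open>The survival function is multiplicative and decreasing. It is not constantly \<open>1\<close>, as lifetimes
  are finite; hence it is exponential.\<close>

lemma surv_exp: "\<exists>q>0. \<forall>t\<ge>0. surv t = exp (- t * q)"
proof -
  have lim: "(\<lambda>n. surv (real n)) \<longlonglongrightarrow> 0"
  proof -
    have "(\<lambda>n. prob {x\<in>space K. real n < life x}) \<longlonglongrightarrow> prob (\<Inter>n. {x\<in>space K. real n < life x})"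
    proof (rule finite_Lim_measure_decseq)
      show "decseq (\<lambda>n. {x\<in>space K. real n < life x})" by (rule decseq_SucI) auto
    qed auto
    moreover have "(\<Inter>n. {x\<in>space K. real n < life x}) = {}"
    proof (rule equals0I)
      fix x assume x: "x \<in> (\<Inter>n. {x\<in>space K. real n < life x})"
      obtain n where "life x \<le> real n" using real_arch_simple by blast
      moreover have "real n < life x" using x by blast
      ultimately show False by simp
    qed
    ultimately show ?thesis by (simp add: surv_def)
  qed
  define q where "q = - ln (surv 1)"
  have "surv 1 < 1"
  proof (rule ccontr)
    assume "\<not> surv 1 < 1"
    moreover have "surv 1 \<le> 1" by (simp add: surv_def)
    ultimately have "surv 1 = 1" by simp
    then have "surv (real n) = 1" for n using surv_mult[of 1 n] by simp
    then show False using lim by (simp add: LIMSEQ_const_iff)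
  qed
  then have q: "0 < q" unfolding q_def using surv_pos[of 1] by simp
  have h_mult: "ln (surv (real n * t)) = real n * ln (surv t)" if "0 \<le> t" for n t
    using surv_mult[OF that, of n] surv_pos[of t] by (simp add: ln_realpow)
  have "surv t = exp (- t * q)" if t: "0 \<le> t" for t
  proof -
    have bound: "real n * \<bar>- ln (surv t) - t * q\<bar> \<le> q" for n
    proof -
      \<comment> \<open>Compare \<open>n t\<close> with the neighbouring integers, where the logarithm of \<open>surv\<close> is known.\<close>
      define k where "k = nat \<lfloor>real n * t\<rfloor>"
      have k: "real k \<le> real n * t" "real n * t \<le> real (Suc k)"
        unfolding k_def using t by (simp_all, linarith)
      have "ln (surv (real (Suc k))) \<le> ln (surv (real n * t))"
        "ln (surv (real n * t)) \<le> ln (surv (real k))"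
        using surv_pos surv_antimono[OF k(1)] surv_antimono[OF k(2)] by simp_all
      then have "- (real (Suc k) * q) \<le> real n * ln (surv t)" "real n * ln (surv t) \<le> - (real k * q)"
        using h_mult[of 1 "Suc k"] h_mult[of 1 k] h_mult[OF t, of n] by (simp_all add: q_def)
      moreover have "real k * q \<le> real n * t * q" "real n * t * q \<le> real (Suc k) * q"
        using k q by (auto intro!: mult_right_mono)
      moreover have "real (Suc k) * q = real k * q + q" by (simp add: distrib_right)
      ultimately have "\<bar>- (real n * ln (surv t)) - real n * t * q\<bar> \<le> q" by linarith
      moreover have "- (real n * ln (surv t)) - real n * t * q = real n * (- ln (surv t) - t * q)"
        by (simp add: right_diff_distrib mult.assoc)
      ultimately show ?thesis by (simp only: abs_mult abs_of_nat)
    qed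
    have "\<bar>- ln (surv t) - t * q\<bar> = 0"
    proof (rule ccontr)
      assume "\<bar>- ln (surv t) - t * q\<bar> \<noteq> 0"
      then have "0 < \<bar>- ln (surv t) - t * q\<bar>" by simp
      then obtain n where "q < real n * \<bar>- ln (surv t) - t * q\<bar>" using reals_Archimedean3 by blast
      then show False using bound[of n] by simp
    qed
    then have "ln (surv t) = - t * q" by simp
    then show ?thesis using surv_pos[of t] by (metis exp_ln)
  qed
  then show ?thesis using q by blast
qed

section \<open>Conditioning on survival\<close>

definition cond_law :: "real \<Rightarrow> 'a measure" where
  "cond_law T = uniform_measure K {x\<in>space K. T < life x}"

lemma alive_emeasure: "emeasure K {x\<in>space K. T < life x} \<noteq> 0" "emeasure K {x\<in>space K. T < life x} \<noteq> \<infinity>"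
  using surv_pos[of T] by (auto simp: surv_def emeasure_eq_measure)

lemma sets_cond_law [measurable_cong]: "sets (cond_law T) = sets K"
  by (simp add: cond_law_def)

lemma space_cond_law: "space (cond_law T) = space K"
  by (simp add: cond_law_def)

lemma prob_space_cond_law: "prob_space (cond_law T)"
  unfolding cond_law_def by (rule prob_space_uniform_measure[OF alive_emeasure])

lemma measure_cond_law:
  assumes "A \<in> sets K"
  shows "measure (cond_law T) A = prob ({x\<in>space K. T < life x} \<inter> A) / surv T"
  unfolding cond_law_def surv_def by (rule measure_uniform_measure[OF alive_emeasure assms])

lemma AE_cond_law: "AE x in K. T < life x \<longrightarrow> P x \<Longrightarrow> AE x in cond_law T. P x"
  unfolding cond_law_def by (rule AE_uniform_measureI) (auto elim: eventually_mono)

definition incr_law :: "real \<Rightarrow> real measure" where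
  "incr_law d = distr (cond_law d) borel (Y d)"

lemma measurable_Y_cond_law: "0 \<le> t \<Longrightarrow> Y t \<in> borel_measurable (cond_law T)"
  using Y_measurable measurable_cong_sets[OF sets_cond_law refl] by blast

lemma real_distribution_incr_law: "0 \<le> d \<Longrightarrow> real_distribution (incr_law d)"
  unfolding incr_law_def
  by (intro prob_space.real_distribution_distr prob_space_cond_law measurable_Y_cond_law)

lemma measure_incr_law:
  assumes d: "0 \<le> d" and B [measurable]: "B \<in> sets borel"
  shows "measure (incr_law d) B = prob {x\<in>space K. d < life x \<and> Y d x \<in> B} / surv d"
proof -
  note [measurable] = Y_measurable[OF d]
  have "measure (incr_law d) B = measure (cond_law d) (Y d -` B \<inter> space K)"
    unfolding incr_law_def using measurable_Y_cond_law[OF d] by (simp add: measure_distr space_cond_law)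
  also have "\<dots> = prob ({x\<in>space K. d < life x} \<inter> (Y d -` B \<inter> space K)) / surv d"
    by (rule measure_cond_law) measurable
  also have "{x\<in>space K. d < life x} \<inter> (Y d -` B \<inter> space K) = {x\<in>space K. d < life x \<and> Y d x \<in> B}" by auto
  finally show ?thesis .
qed

text \<open>Dividing by the probability of survival until \<open>T\<close>, itself a product over the same time steps, turns the
  factors into conditional probabilities that no longer involve \<open>T\<close>.\<close>

lemma cond_law_increments:
  fixes s :: "nat \<Rightarrow> real"
  assumes s: "mono s" "0 \<le> s 0" "s n \<le> T" and B: "\<And>i. B i \<in> sets borel"
  shows "measure (cond_law T) {x\<in>space K. \<forall>i<n. Y (s (Suc i)) x - Y (s i) x \<in> B i} =
    (\<Prod>i<n. measure (incr_law (s (Suc i) - s i)) (B i))"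
proof -
  \<comment> \<open>Extend the times by \<open>0\<close> in front and by the conditioning time \<open>T\<close> at the end; the two additional
    increments are unconstrained and only contribute survival probabilities.\<close>
  define s' where "s' i = (if i = 0 then 0 else if i \<le> Suc n then s (i - 1) else T)" for i
  define B' where "B' i = (if 0 < i \<and> i \<le> n then B (i - 1) else UNIV)" for i
  have sn: "s i \<le> s j" if "i \<le> j" for i j using s(1) that by (simp add: monoD)
  have s0: "0 \<le> s i" for i using sn[of 0 i] s by simp
  have Ts: "s i \<le> T" if "i \<le> n" for i using sn[OF that] s by simp
  have "0 \<le> T" using s0[of n] s by linarith
  then have mono': "mono s'" unfolding mono_def s'_def using s0 Ts sn by auto
  have s': "s' 0 = 0" "s' (Suc 0) = s 0" "s' (Suc n) = s n" "s' (Suc (Suc n)) = T"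
    "\<And>i. i < n \<Longrightarrow> s' (Suc (Suc i)) = s (Suc i)" "\<And>i. i < n \<Longrightarrow> s' (Suc i) = s i"
    by (auto simp: s'_def)
  have prod_first_last: "(\<Prod>i<n + 2. g i) = g 0 * (\<Prod>i<n. g (Suc i)) * g (Suc n)" for g :: "nat \<Rightarrow> real"
    unfolding add_2_eq_Suc' by (subst prod.lessThan_Suc, subst prod.lessThan_Suc_shift) (simp add: mult_ac)
  have B'_sets: "B' i \<in> sets borel" for i using B by (simp add: B'_def)
  let ?A = "{x\<in>space K. \<forall>i<n. Y (s (Suc i)) x - Y (s i) x \<in> B i}"
  have [measurable]: "Y (s i) \<in> borel_measurable K" for i by (rule Y_measurable[OF s0])
  note [measurable] = B
  have A_sets: "?A \<in> sets K" by measurable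
  have "prob ({x\<in>space K. T < life x} \<inter> ?A) =
      prob {x\<in>space K. s' (n + 2) < life x \<and> (\<forall>i<n + 2. Y (s' (Suc i)) x - Y (s' i) x \<in> B' i)}"
  proof (rule arg_cong[where f=prob], rule set_eqI)
    fix x
    have "(\<forall>i<n + 2. Y (s' (Suc i)) x - Y (s' i) x \<in> B' i) \<longleftrightarrow> (\<forall>i<n. Y (s (Suc i)) x - Y (s i) x \<in> B i)"
    proof
      assume L: "\<forall>i<n + 2. Y (s' (Suc i)) x - Y (s' i) x \<in> B' i"
      show "\<forall>i<n. Y (s (Suc i)) x - Y (s i) x \<in> B i"
      proof (intro allI impI)
        fix i assume "i < n"
        then show "Y (s (Suc i)) x - Y (s i) x \<in> B i" using L[rule_format, of "Suc i"] by (simp add: s'_def B'_def)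
      qed
    next
      assume R: "\<forall>i<n. Y (s (Suc i)) x - Y (s i) x \<in> B i"
      show "\<forall>i<n + 2. Y (s' (Suc i)) x - Y (s' i) x \<in> B' i"
      proof (intro allI impI)
        fix i assume "i < n + 2"
        show "Y (s' (Suc i)) x - Y (s' i) x \<in> B' i"
        proof (cases "0 < i \<and> i \<le> n")
          case True
          then show ?thesis using R[rule_format, of "i - 1"] by (auto simp: s'_def B'_def)
        qed (auto simp: B'_def)
      qed
    qed
    moreover have "s' (n + 2) = T" by (simp add: s'_def)
    ultimately show "x \<in> {x\<in>space K. T < life x} \<inter> ?A \<longleftrightarrow>
      x \<in> {x\<in>space K. s' (n + 2) < life x \<and> (\<forall>i<n + 2. Y (s' (Suc i)) x - Y (s' i) x \<in> B' i)}" by auto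
  qed
  also have "\<dots> = (\<Prod>i<n + 2. prob {x\<in>space K. s' (Suc i) - s' i < life x \<and> Y (s' (Suc i) - s' i) x \<in> B' i})"
    by (rule increments[OF mono' _ B'_sets]) (simp add: s'_def)
  also have "\<dots> = surv (s 0) * (\<Prod>i<n. prob {x\<in>space K. s (Suc i) - s i < life x \<and> Y (s (Suc i) - s i) x \<in> B i}) * surv (T - s n)"
    unfolding prod_first_last by (simp add: s' B'_def surv_def)
  also have "(\<Prod>i<n. prob {x\<in>space K. s (Suc i) - s i < life x \<and> Y (s (Suc i) - s i) x \<in> B i}) =
    (\<Prod>i<n. measure (incr_law (s (Suc i) - s i)) (B i) * surv (s (Suc i) - s i))"
  proof (rule prod.cong[OF refl])
    fix i
    have "0 \<le> s (Suc i) - s i" using sn[of i "Suc i"] by simp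
    from measure_incr_law[OF this B, of i] surv_pos[of "s (Suc i) - s i"]
    show "prob {x\<in>space K. s (Suc i) - s i < life x \<and> Y (s (Suc i) - s i) x \<in> B i} =
      measure (incr_law (s (Suc i) - s i)) (B i) * surv (s (Suc i) - s i)" by simp
  qed
  also have "surv (s 0) * \<dots> * surv (T - s n) =
    (\<Prod>i<n. measure (incr_law (s (Suc i) - s i)) (B i)) * (surv (s 0) * (\<Prod>i<n. surv (s (Suc i) - s i)) * surv (T - s n))"
    by (simp add: prod.distrib mult_ac)
  also have "surv (s 0) * (\<Prod>i<n. surv (s (Suc i) - s i)) * surv (T - s n) = surv T"
  proof -
    have "surv (s' (n + 2)) = (\<Prod>i<n + 2. surv (s' (Suc i) - s' i))"
      by (rule surv_prod[OF mono']) (simp add: s'_def)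
    also have "\<dots> = surv (s 0) * (\<Prod>i<n. surv (s (Suc i) - s i)) * surv (T - s n)"
      unfolding prod_first_last by (simp add: s')
    finally show ?thesis by (simp add: s'_def)
  qed
  finally show ?thesis unfolding measure_cond_law[OF A_sets] using surv_pos[of T] by simp
qed

lemma cond_law_increment_law:
  assumes "0 \<le> a" "a \<le> b" "b \<le> T"
  shows "distr (cond_law T) borel (\<lambda>x. Y b x - Y a x) = incr_law (b - a)"
proof (rule measure_eqI)
  interpret Q: prob_space "cond_law T" by (rule prob_space_cond_law)
  interpret I: real_distribution "incr_law (b - a)" by (rule real_distribution_incr_law) (use assms in simp)
  have [measurable]: "Y a \<in> borel_measurable K" "Y b \<in> borel_measurable K" using assms by (auto intro: Y_measurable)
  show "sets (distr (cond_law T) borel (\<lambda>x. Y b x - Y a x)) = sets (incr_law (b - a))" by (simp add: incr_law_def)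
  fix B assume "B \<in> sets (distr (cond_law T) borel (\<lambda>x. Y b x - Y a x))"
  then have B [measurable]: "B \<in> sets borel" by simp
  define s where "s i = (if i = 0 then a else b)" for i :: nat
  have "mono s" unfolding mono_def s_def using assms by auto
  from cond_law_increments[OF this, of 1 T "\<lambda>_. B"] assms
  have "measure (cond_law T) {x\<in>space K. Y b x - Y a x \<in> B} = measure (incr_law (b - a)) B" by (simp add: s_def)
  moreover have "emeasure (distr (cond_law T) borel (\<lambda>x. Y b x - Y a x)) B = emeasure (cond_law T) {x\<in>space K. Y b x - Y a x \<in> B}"
    by (subst emeasure_distr) (auto intro!: arg_cong2[where f=emeasure] simp: space_cond_law)
  ultimately show "emeasure (distr (cond_law T) borel (\<lambda>x. Y b x - Y a x)) B = emeasure (incr_law (b - a)) B"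
    by (simp add: Q.emeasure_eq_measure I.emeasure_eq_measure)
qed

lemma cond_law_indep_increments:
  fixes s :: "nat \<Rightarrow> real"
  assumes s: "mono s" "0 \<le> s 0" "\<And>i. s i \<le> T"
  shows "prob_space.indep_vars (cond_law T) (\<lambda>_. borel) (\<lambda>i x. Y (s (Suc i)) x - Y (s i) x) UNIV"
proof -
  interpret Q: prob_space "cond_law T" by (rule prob_space_cond_law)
  have s0: "0 \<le> s i" for i using monoD[OF s(1), of 0 i] s(2) by simp
  have [measurable]: "Y (s i) \<in> borel_measurable K" for i by (rule Y_measurable[OF s0])
  show ?thesis
  proof (rule Q.indep_vars_nat_if)
    fix n and C :: "nat \<Rightarrow> real set" assume C: "\<And>i. C i \<in> sets borel"
    note [measurable] = C
    have "measure (incr_law (s (Suc i) - s i)) (C i) = Q.prob {x\<in>space (cond_law T). Y (s (Suc i)) x - Y (s i) x \<in> C i}" for i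
    proof -
      have "incr_law (s (Suc i) - s i) = distr (cond_law T) borel (\<lambda>x. Y (s (Suc i)) x - Y (s i) x)"
        by (rule cond_law_increment_law[symmetric]) (use s s0 monoD[OF s(1), of i "Suc i"] in auto)
      then show ?thesis by (simp add: measure_distr C vimage_def Int_def conj_commute)
    qed
    then show "Q.prob {x\<in>space (cond_law T). \<forall>i<n. Y (s (Suc i)) x - Y (s i) x \<in> C i} =
      (\<Prod>i<n. Q.prob {x\<in>space (cond_law T). Y (s (Suc i)) x - Y (s i) x \<in> C i})"
      using cond_law_increments[OF s(1,2,3) C, of n] by (simp add: space_cond_law)
  qed measurable
qed

text \<open>Cutting the interval \<open>[0, a + b]\<close> at \<open>a\<close>. Characteristic functions replace convolutions here.\<close>

lemma char_incr_law_add: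
  assumes ab: "0 \<le> a" "0 \<le> b"
  shows "char (incr_law (a + b)) u = char (incr_law a) u * char (incr_law b) u"
proof -
  interpret Q: prob_space "cond_law (a + b)" by (rule prob_space_cond_law)
  define s where "s i = (if i = 0 then 0 else if i = 1 then a else a + b)" for i :: nat
  have s: "mono s" "0 \<le> s 0" "\<And>i. s i \<le> a + b" unfolding mono_def s_def using ab by auto
  have "Q.indep_vars (\<lambda>_. borel) (\<lambda>i x. Y (s (Suc i)) x - Y (s i) x) {..<2}"
    by (rule Q.indep_vars_subset[OF cond_law_indep_increments[OF s]]) simp
  from Q.char_distr_sum[OF this, of u]
  have "char (distr (cond_law (a + b)) borel (\<lambda>x. Y (a + b) x - Y 0 x)) u =
    char (distr (cond_law (a + b)) borel (\<lambda>x. Y a x - Y 0 x)) u * char (distr (cond_law (a + b)) borel (\<lambda>x. Y (a + b) x - Y a x)) u"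
    by (simp add: s_def numeral_2_eq_2)
  then show ?thesis using ab by (simp add: cond_law_increment_law)
qed

lemma char_incr_law_0: "char (incr_law 0) u = 1"
proof -
  interpret Q: prob_space "cond_law 0" by (rule prob_space_cond_law)
  have "incr_law 0 = distr (cond_law 0) borel (\<lambda>_. 0)"
    unfolding incr_law_def
  proof (rule distr_cong_AE)
    show "AE x in cond_law 0. Y 0 x = 0" by (rule AE_cond_law) (use Y_0 in \<open>auto elim: eventually_mono\<close>)
  qed (auto intro: measurable_Y_cond_law)
  then have "char (incr_law 0) u = (CLINT x|distr (cond_law 0) borel (\<lambda>_. 0 :: real). iexp (u * x))"
    unfolding char_def by (rule arg_cong)
  also have "\<dots> = (CLINT x|cond_law 0. iexp (u * 0))" by (rule integral_distr) auto
  finally show ?thesis by (simp add: Q.prob_space)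
qed

lemma char_incr_law_sum:
  assumes "finite I" "\<And>i. i \<in> I \<Longrightarrow> 0 \<le> d i"
  shows "(\<Prod>i\<in>I. char (incr_law (d i)) u) = char (incr_law (\<Sum>i\<in>I. d i)) u"
  using assms by (induction I rule: finite_induct) (simp_all add: char_incr_law_0 char_incr_law_add sum_nonneg)

end

section \<open>Gluing independent unit segments\<close>

text \<open>Sequences that are independent in every coordinate of a product space form an independent double
  sequence: a finite set of indices is cut into its rows, whose events concern different coordinates.\<close>

lemma indep_vars_PiM_blocks:
  fixes v :: "nat \<Rightarrow> nat \<Rightarrow> 'a \<Rightarrow> 'b"
  assumes Q: "prob_space Q" and v: "\<And>m. prob_space.indep_vars Q (\<lambda>_. N) (v m) UNIV"
  shows "prob_space.indep_vars (PiM UNIV (\<lambda>_::nat. Q)) (\<lambda>_. N) (\<lambda>p w. v (fst p) (snd p) (w (fst p))) UNIV"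
proof -
  interpret Q: prob_space Q by fact
  interpret P: product_prob_space "\<lambda>_::nat. Q" UNIV by (rule product_prob_spaceI) (rule Q)
  let ?\<Omega> = "PiM UNIV (\<lambda>_::nat. Q)"
  have v_meas: "v m i \<in> Q \<rightarrow>\<^sub>M N" for m i using v[of m] by (simp add: Q.indep_vars_def)
  have rv: "(\<lambda>w. v m i (w m)) \<in> ?\<Omega> \<rightarrow>\<^sub>M N" for m i
    by (rule measurable_compose[OF _ v_meas], rule measurable_component_singleton) simp
  show ?thesis unfolding P.indep_vars_def2
  proof (intro conjI ballI P.indep_setsI)
    fix p :: "nat \<times> nat"
    show "(\<lambda>w. v (fst p) (snd p) (w (fst p))) \<in> ?\<Omega> \<rightarrow>\<^sub>M N" by (rule rv)
    then show "{(\<lambda>w. v (fst p) (snd p) (w (fst p))) -` A \<inter> space ?\<Omega> |A. A \<in> sets N} \<subseteq> P.events"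
      by (auto intro: measurable_sets)
  next
    fix A and J :: "(nat \<times> nat) set"
    assume J: "J \<noteq> {}" "finite J"
      "\<forall>p\<in>J. A p \<in> {(\<lambda>w. v (fst p) (snd p) (w (fst p))) -` B \<inter> space ?\<Omega> |B. B \<in> sets N}"
    then have "\<forall>p\<in>J. \<exists>B. B \<in> sets N \<and> A p = (\<lambda>w. v (fst p) (snd p) (w (fst p))) -` B \<inter> space ?\<Omega>" by blast
    then obtain B where B: "\<And>p. p \<in> J \<Longrightarrow> B p \<in> sets N"
      "\<And>p. p \<in> J \<Longrightarrow> A p = (\<lambda>w. v (fst p) (snd p) (w (fst p))) -` B p \<inter> space ?\<Omega>" by metis
    define M where "M = fst ` J"
    define I where "I m = {i. (m, i) \<in> J}" for m
    define D where "D m i = v m i -` B (m, i) \<inter> space Q" for m i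
    define E where "E m = (\<Inter>i\<in>I m. D m i)" for m
    have finM: "finite M" using J by (simp add: M_def)
    have "I m \<subseteq> snd ` J" for m unfolding I_def by force
    then have finI: "finite (I m)" for m using J(2) by (meson finite_imageI finite_subset)
    have I_ne: "I m \<noteq> {}" if "m \<in> M" for m using that by (auto simp: M_def I_def)
    have JS: "J = Sigma M I" unfolding M_def I_def by force
    have D_sets: "D m i \<in> sets Q" if "m \<in> M" "i \<in> I m" for m i
      unfolding D_def using that B(1)[of "(m, i)"] by (auto simp: I_def intro: measurable_sets[OF v_meas])
    have E_sets: "E m \<in> sets Q" if "m \<in> M" for m
      unfolding E_def using D_sets[OF that] I_ne[OF that] finI by (intro sets.finite_INT) auto
    have E_prob: "Q.prob (E m) = (\<Prod>i\<in>I m. Q.prob (D m i))" if "m \<in> M" for m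
      unfolding E_def D_def
      by (rule Q.indep_varsD[OF v I_ne[OF that] finI]) (use B(1) in \<open>auto simp: I_def\<close>)
    have A_prob: "P.prob (A (m, i)) = Q.prob (D m i)" if "m \<in> M" "i \<in> I m" for m i
    proof -
      have "A (m, i) = prod_emb UNIV (\<lambda>_. Q) {m} (Pi\<^sub>E {m} (\<lambda>m. D m i))"
        using B(2)[of "(m, i)"] that by (auto simp: I_def D_def prod_emb_def space_PiM PiE_iff)
      then show ?thesis using P.measure_PiM_emb[of "{m}" "\<lambda>m. D m i"] D_sets[OF that] by simp
    qed
    have "(\<Inter>p\<in>J. A p) = prod_emb UNIV (\<lambda>_. Q) M (Pi\<^sub>E M E)"
    proof (intro equalityI subsetI)
      fix w assume w: "w \<in> (\<Inter>p\<in>J. A p)"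
      obtain p where "p \<in> J" using J by blast
      then have "w \<in> space ?\<Omega>" using w B(2)[of p] by blast
      then have wQ: "w m \<in> space Q" for m by (auto simp: space_PiM)
      have "w m \<in> E m" if "m \<in> M" for m
        unfolding E_def D_def
      proof (rule INT_I, rule IntI, rule vimageI2)
        fix i assume "i \<in> I m"
        then have "(m, i) \<in> J" by (simp add: I_def)
        then have "w \<in> A (m, i)" using w by blast
        then show "v m i (w m) \<in> B (m, i)" using B(2)[OF \<open>(m, i) \<in> J\<close>] by simp
      qed (rule wQ)
      then show "w \<in> prod_emb UNIV (\<lambda>_. Q) M (Pi\<^sub>E M E)" using wQ by (auto simp: prod_emb_def)
    next
      fix w assume w: "w \<in> prod_emb UNIV (\<lambda>_. Q) M (Pi\<^sub>E M E)"
      then have wS: "w \<in> space ?\<Omega>" and wE: "\<And>m. m \<in> M \<Longrightarrow> w m \<in> E m"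
        by (auto simp: prod_emb_def space_PiM PiE_iff)
      show "w \<in> (\<Inter>p\<in>J. A p)"
      proof (rule INT_I)
        fix p assume p: "p \<in> J"
        then have "fst p \<in> M" "snd p \<in> I (fst p)" by (auto simp: M_def I_def)
        then have "w (fst p) \<in> D (fst p) (snd p)" using wE[of "fst p"] unfolding E_def by blast
        then show "w \<in> A p" using B(2)[OF p] wS by (simp add: D_def)
      qed
    qed
    then have "P.prob (\<Inter>p\<in>J. A p) = (\<Prod>m\<in>M. Q.prob (E m))"
      using P.measure_PiM_emb[of M E] finM E_sets by simp
    also have "\<dots> = (\<Prod>m\<in>M. \<Prod>i\<in>I m. P.prob (A (m, i)))"
      by (intro prod.cong refl) (simp add: E_prob A_prob)
    also have "\<dots> = (\<Prod>p\<in>J. P.prob (A p))"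
      unfolding JS by (subst prod.Sigma) (auto simp: finM finI)
    finally show "P.prob (\<Inter>p\<in>J. A p) = (\<Prod>p\<in>J. P.prob (A p))" .
  qed
qed

lemma cadlag_const: "cadlag (\<lambda>_. c)"
  by (auto simp: cadlag_def)

lemma cadlag_sum:
  assumes "finite I" "\<And>i. i \<in> I \<Longrightarrow> cadlag (f i)"
  shows "cadlag (\<lambda>t. \<Sum>i\<in>I. f i t)"
  unfolding cadlag_def
proof (intro conjI allI impI)
  fix t :: real assume "0 \<le> t"
  then show "((\<lambda>t. \<Sum>i\<in>I. f i t) \<longlongrightarrow> (\<Sum>i\<in>I. f i t)) (at_right t)"
    using assms by (intro tendsto_sum cadlag_right)
next
  fix t :: real assume "0 < t"
  then have "((\<lambda>t. \<Sum>i\<in>I. f i t) \<longlongrightarrow> (\<Sum>i\<in>I. left_lim (f i) t)) (at_left t)"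
    using assms by (intro tendsto_sum cadlag_left)
  then show "\<exists>l. ((\<lambda>t. \<Sum>i\<in>I. f i t) \<longlongrightarrow> l) (at_left t)" ..
qed

lemma cadlag_delay:
  assumes f: "cadlag f" and m: "0 \<le> m"
  shows "cadlag (\<lambda>t. f (max 0 (t - m)))"
  unfolding cadlag_def
proof (intro conjI allI impI)
  fix t :: real assume t: "0 \<le> t"
  show "((\<lambda>t. f (max 0 (t - m))) \<longlongrightarrow> f (max 0 (t - m))) (at_right t)"
  proof (cases "t < m")
    case True
    then have "\<forall>\<^sub>F r in at_right t. f (max 0 (r - m)) = f 0" by (intro eventually_at_rightI[of t m]) (auto simp: max_def)
    moreover have "f (max 0 (t - m)) = f 0" using True by simp
    ultimately show ?thesis by (simp only: tendsto_eventually)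
  next
    case False
    then have "(f \<longlongrightarrow> f (t - m)) (at_right (t - m))" by (intro cadlag_right f) simp
    moreover have "filterlim (\<lambda>r. r - m) (at_right (t - m)) (at_right t)"
      using filterlim_affine_at_right[of 1 "- m" t] by simp
    ultimately have "((\<lambda>r. f (r - m)) \<longlongrightarrow> f (t - m)) (at_right t)" by (rule filterlim_compose)
    moreover have "\<forall>\<^sub>F r in at_right t. f (r - m) = f (max 0 (r - m))"
      using False by (intro eventually_at_rightI[of t "t + 1"]) (auto simp: max_def)
    ultimately have "((\<lambda>r. f (max 0 (r - m))) \<longlongrightarrow> f (t - m)) (at_right t)" by (rule Lim_transform_eventually)
    moreover have "max 0 (t - m) = t - m" using False by simp
    ultimately show ?thesis by simp
  qed
next
  fix t :: real assume t: "0 < t"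
  show "\<exists>l. ((\<lambda>t. f (max 0 (t - m))) \<longlongrightarrow> l) (at_left t)"
  proof (cases "t \<le> m")
    case True
    then have "\<forall>\<^sub>F r in at_left t. f (max 0 (r - m)) = f 0" by (intro eventually_at_leftI[of 0 t] t) (auto simp: max_def)
    then show ?thesis by (auto intro: tendsto_eventually)
  next
    case False
    then have "(f \<longlongrightarrow> left_lim f (t - m)) (at_left (t - m))" by (intro cadlag_left f) simp
    moreover have "filterlim (\<lambda>r. r - m) (at_left (t - m)) (at_left t)"
      using filterlim_affine_at_left[of 1 "- m" t] by simp
    ultimately have "((\<lambda>r. f (r - m)) \<longlongrightarrow> left_lim f (t - m)) (at_left t)" by (rule filterlim_compose)
    moreover have "\<forall>\<^sub>F r in at_left t. f (r - m) = f (max 0 (r - m))"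
      using False by (intro eventually_at_leftI[of m]) (auto simp: max_def)
    ultimately have "((\<lambda>r. f (max 0 (r - m))) \<longlongrightarrow> left_lim f (t - m)) (at_left t)" by (rule Lim_transform_eventually)
    then show ?thesis ..
  qed
qed

lemma cadlag_diff_const:
  assumes f: "cadlag f"
  shows "cadlag (\<lambda>t. f t - c)"
  unfolding cadlag_def
proof (intro conjI allI impI)
  fix t :: real assume t: "0 \<le> t"
  show "((\<lambda>t. f t - c) \<longlongrightarrow> f t - c) (at_right t)"
    by (rule tendsto_diff[OF cadlag_right[OF f t] tendsto_const])
next
  fix t :: real assume t: "0 < t"
  show "\<exists>l. ((\<lambda>t. f t - c) \<longlongrightarrow> l) (at_left t)"
    by (rule exI, rule tendsto_diff[OF cadlag_left[OF f t] tendsto_const])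
qed

lemma cadlag_local:
  assumes "\<And>n::nat. \<exists>g. cadlag g \<and> (\<forall>t. 0 \<le> t \<and> t < real n \<longrightarrow> f t = g t)"
  shows "cadlag f"
  unfolding cadlag_def
proof (intro conjI allI impI)
  fix t :: real assume t: "0 \<le> t"
  obtain n where n: "t < real n" using reals_Archimedean2 by blast
  obtain g where g: "cadlag g" "\<And>s. 0 \<le> s \<Longrightarrow> s < real n \<Longrightarrow> f s = g s" using assms by blast
  have "\<forall>\<^sub>F s in at_right t. f s = g s" using n t g(2) by (intro eventually_at_rightI[of t "real n"]) auto
  then show "(f \<longlongrightarrow> f t) (at_right t)" using cadlag_right[OF g(1) t] g(2)[OF t n] by (simp add: tendsto_cong)
next
  fix t :: real assume t: "0 < t"
  obtain n where n: "t < real n" using reals_Archimedean2 by blast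
  obtain g where g: "cadlag g" "\<And>s. 0 \<le> s \<Longrightarrow> s < real n \<Longrightarrow> f s = g s" using assms by blast
  have "\<forall>\<^sub>F s in at_left t. f s = g s" using n t g(2) by (intro eventually_at_leftI[of 0 t]) auto
  then show "\<exists>l. (f \<longlongrightarrow> l) (at_left t)" using cadlag_left[OF g(1) t] by (auto simp: tendsto_cong)
qed

text \<open>The time that the interval \<open>[0, x]\<close> spends in the unit \<open>[m, m + 1]\<close>.\<close>

definition clamp :: "nat \<Rightarrow> real \<Rightarrow> real" where
  "clamp m x = max 0 (min 1 (x - real m))"

lemma clamp_range: "0 \<le> clamp m x" "clamp m x \<le> 1"
  by (auto simp: clamp_def)

lemma clamp_mono: "x \<le> y \<Longrightarrow> clamp m x \<le> clamp m y"
  by (auto simp: clamp_def)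

lemma sum_clamp: "0 \<le> x \<Longrightarrow> (\<Sum>m<N. clamp m x) = min x (real N)"
  by (induction N) (auto simp: clamp_def)

context killed_levy
begin

text \<open>The process on the unit interval, made to start from \<open>0\<close> exactly and set to \<open>0\<close> when it does not
  survive the interval, so that all its paths are right-continuous with left limits.\<close>

definition seg :: "real \<Rightarrow> 'a \<Rightarrow> real" where
  "seg t x = (if 1 < life x then Y (min t 1) x - Y 0 x else 0)"

definition units :: "(nat \<Rightarrow> 'a) measure" where
  "units = PiM UNIV (\<lambda>_. cond_law 1)"

definition glued :: "real \<Rightarrow> (nat \<Rightarrow> 'a) \<Rightarrow> real" where
  "glued x w = (\<Sum>m<nat \<lceil>x\<rceil>. seg (clamp m x) (w m))"

lemma seg_0: "seg 0 x = 0"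
  by (simp add: seg_def)

lemma seg_measurable [measurable]:
  assumes "0 \<le> t" shows "seg t \<in> borel_measurable K"
proof -
  have [measurable]: "Y (min t 1) \<in> borel_measurable K" "Y 0 \<in> borel_measurable K"
    using assms by (auto intro: Y_measurable)
  show ?thesis unfolding seg_def[abs_def] by measurable
qed

lemma seg_cadlag: "x \<in> space K \<Longrightarrow> cadlag (\<lambda>t. seg t x)"
proof (cases "1 < life x")
  case True
  assume "x \<in> space K"
  then have "cadlag (\<lambda>t. Y (min (0 + 1 * t) 1) x / 1)" using regular[of x] True
    by (intro cadlag_affine) auto
  then have c: "cadlag (\<lambda>t. Y (min t 1) x)" by simp
  then show ?thesis using True by (simp add: seg_def cadlag_diff_const)
qed (simp add: seg_def cadlag_const)

text \<open>Units that have not started by time \<open>x\<close> contribute \<open>0\<close>; a common range of summation is thus available for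
  all times up to \<open>N\<close>.\<close>

lemma glued_eq:
  assumes "x \<le> real N"
  shows "glued x w = (\<Sum>m<N. seg (clamp m x) (w m))"
  unfolding glued_def
proof (rule sum.mono_neutral_left)
  show "{..<nat \<lceil>x\<rceil>} \<subseteq> {..<N}" using assms by (auto simp: ceiling_le_iff)
  show "\<forall>m\<in>{..<N} - {..<nat \<lceil>x\<rceil>}. seg (clamp m x) (w m) = 0"
  proof
    fix m assume "m \<in> {..<N} - {..<nat \<lceil>x\<rceil>}"
    then have "x \<le> real m" by (simp add: not_less)
    then show "seg (clamp m x) (w m) = 0" by (simp add: clamp_def seg_0)
  qed
qed simp

lemma glued_0: "glued 0 w = 0"
  by (simp add: glued_def)

lemma prob_space_units: "prob_space units"
  unfolding units_def by (intro prob_space_PiM prob_space_cond_law)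

lemma units_component: "(\<lambda>w. w m) \<in> units \<rightarrow>\<^sub>M K"
proof -
  have "(\<lambda>w. w m) \<in> units \<rightarrow>\<^sub>M cond_law 1" unfolding units_def by (rule measurable_component_singleton) simp
  then show ?thesis using measurable_cong_sets[OF refl sets_cond_law] by blast
qed

lemma glued_measurable: "0 \<le> x \<Longrightarrow> glued x \<in> borel_measurable units"
  unfolding glued_def[abs_def]
  by (intro borel_measurable_sum measurable_compose[OF units_component seg_measurable] clamp_range)

lemma glued_cadlag:
  assumes w: "w \<in> space units"
  shows "cadlag (\<lambda>x. glued x w)"
proof (rule cadlag_local)
  fix n :: nat
  have wK: "w m \<in> space K" for m using w by (auto simp: units_def space_PiM space_cond_law)
  have "cadlag (\<lambda>x. \<Sum>m<n. seg (max 0 (x - real m)) (w m))"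
    by (intro cadlag_sum cadlag_delay[OF seg_cadlag[OF wK]]) auto
  moreover have "seg (max 0 (x - real m)) (w m) = seg (clamp m x) (w m)" for x m
    by (simp add: seg_def clamp_def min_def max_def)
  ultimately show "\<exists>g. cadlag g \<and> (\<forall>t. 0 \<le> t \<and> t < real n \<longrightarrow> glued t w = g t)"
    by (intro exI[of _ "\<lambda>x. \<Sum>m<n. seg (clamp m x) (w m)"]) (auto simp: glued_eq)
qed

lemma AE_seg: "AE x in cond_law 1. \<forall>t. 0 \<le> t \<and> t \<le> 1 \<longrightarrow> seg t x = Y t x - Y 0 x"
  by (rule AE_cond_law) (auto simp: seg_def)

lemma seg_increment_law:
  assumes ab: "0 \<le> a" "a \<le> b" "b \<le> 1"
  shows "distr (cond_law 1) borel (\<lambda>x. seg b x - seg a x) = incr_law (b - a)"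
proof -
  have [measurable]: "Y a \<in> borel_measurable K" "Y b \<in> borel_measurable K" using ab by (auto intro: Y_measurable)
  have [measurable]: "seg a \<in> borel_measurable K" "seg b \<in> borel_measurable K" using ab by (auto intro: seg_measurable)
  have "distr (cond_law 1) borel (\<lambda>x. seg b x - seg a x) = distr (cond_law 1) borel (\<lambda>x. Y b x - Y a x)"
  proof (rule distr_cong_AE)
    show "AE x in cond_law 1. seg b x - seg a x = Y b x - Y a x"
      using AE_seg by eventually_elim (use ab in auto)
  qed (auto simp: measurable_cong_sets[OF sets_cond_law refl])
  then show ?thesis using cond_law_increment_law[OF ab] by simp
qed

lemma seg_indep:
  fixes s :: "nat \<Rightarrow> real"
  assumes s: "mono s" "0 \<le> s 0" "\<And>i. s i \<le> 1"
  shows "prob_space.indep_vars (cond_law 1) (\<lambda>_. borel) (\<lambda>i x. seg (s (Suc i)) x - seg (s i) x) UNIV"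
proof -
  interpret Q: prob_space "cond_law 1" by (rule prob_space_cond_law)
  have s0: "0 \<le> s i" for i using monoD[OF s(1), of 0 i] s(2) by simp
  have [measurable]: "Y (s i) \<in> borel_measurable (cond_law 1)" for i by (rule measurable_Y_cond_law[OF s0])
  have [measurable]: "seg (s i) \<in> borel_measurable (cond_law 1)" for i
    using seg_measurable[OF s0] measurable_cong_sets[OF sets_cond_law refl] by blast
  have AE: "AE x in cond_law 1. \<forall>i. seg (s (Suc i)) x - seg (s i) x = Y (s (Suc i)) x - Y (s i) x"
    using AE_seg by eventually_elim (use s0 s(3) in auto)
  show ?thesis
  proof (rule Q.indep_vars_nat_if)
    fix n and C :: "nat \<Rightarrow> real set" assume C: "\<And>i. C i \<in> sets borel"
    note [measurable] = C
    have "Q.prob {x\<in>space (cond_law 1). \<forall>i<n. seg (s (Suc i)) x - seg (s i) x \<in> C i} =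
      Q.prob {x\<in>space (cond_law 1). \<forall>i<n. Y (s (Suc i)) x - Y (s i) x \<in> C i}"
    proof (rule measure_eq_AE)
      show "AE x in cond_law 1. x \<in> {x\<in>space (cond_law 1). \<forall>i<n. seg (s (Suc i)) x - seg (s i) x \<in> C i} \<longleftrightarrow>
        x \<in> {x\<in>space (cond_law 1). \<forall>i<n. Y (s (Suc i)) x - Y (s i) x \<in> C i}"
        using AE by eventually_elim simp
    qed measurable
    also have "\<dots> = (\<Prod>i<n. measure (incr_law (s (Suc i) - s i)) (C i))"
      using cond_law_increments[OF s C, of n] by (simp add: space_cond_law)
    also have "\<dots> = (\<Prod>i<n. Q.prob {x\<in>space (cond_law 1). seg (s (Suc i)) x - seg (s i) x \<in> C i})"
    proof (rule prod.cong[OF refl])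
      fix i
      have "incr_law (s (Suc i) - s i) = distr (cond_law 1) borel (\<lambda>x. seg (s (Suc i)) x - seg (s i) x)"
        by (rule seg_increment_law[symmetric]) (use s s0 monoD[OF s(1), of i "Suc i"] in auto)
      then show "measure (incr_law (s (Suc i) - s i)) (C i) =
          Q.prob {x\<in>space (cond_law 1). seg (s (Suc i)) x - seg (s i) x \<in> C i}"
        by (simp add: measure_distr C vimage_def Int_def conj_commute)
    qed
    finally show "Q.prob {x\<in>space (cond_law 1). \<forall>i<n. seg (s (Suc i)) x - seg (s i) x \<in> C i} =
      (\<Prod>i<n. Q.prob {x\<in>space (cond_law 1). seg (s (Suc i)) x - seg (s i) x \<in> C i})" .
  qed measurable
qed

text \<open>An increment of the glued process is a sum of increments over the units that it meets; all
  these contributions are independent.\<close>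

lemma contributions_indep:
  fixes s :: "nat \<Rightarrow> real"
  assumes s: "mono s"
  shows "prob_space.indep_vars units (\<lambda>_. borel)
    (\<lambda>p w. seg (clamp (fst p) (s (Suc (snd p)))) (w (fst p)) - seg (clamp (fst p) (s (snd p))) (w (fst p))) UNIV"
  unfolding units_def
proof (rule indep_vars_PiM_blocks[OF prob_space_cond_law])
  fix m
  show "prob_space.indep_vars (cond_law 1) (\<lambda>_. borel) (\<lambda>i x. seg (clamp m (s (Suc i))) x - seg (clamp m (s i)) x) UNIV"
    by (rule seg_indep[where s="\<lambda>i. clamp m (s i)"]) (use s in \<open>auto simp: clamp_range mono_def intro: clamp_mono\<close>)
qed

lemma glued_indep:
  fixes s :: "nat \<Rightarrow> real"
  assumes s: "mono s"
  shows "prob_space.indep_vars units (\<lambda>_. borel)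
    (\<lambda>i w. \<Sum>m<N. seg (clamp m (s (Suc i))) (w m) - seg (clamp m (s i)) (w m)) UNIV"
proof -
  interpret U: prob_space units by (rule prob_space_units)
  let ?X = "\<lambda>p w. seg (clamp (fst p) (s (Suc (snd p)))) (w (fst p)) - seg (clamp (fst p) (s (snd p))) (w (fst p))"
  let ?J = "\<lambda>i. (\<lambda>m. (m, i)) ` {..<N}"
  have "U.indep_vars (\<lambda>i. PiM (?J i) (\<lambda>_. borel)) (\<lambda>i w. restrict (\<lambda>p. ?X p w) (?J i)) (UNIV :: nat set)"
    by (rule U.indep_vars_restrict[OF contributions_indep[OF s]]) (auto simp: disjoint_family_on_def)
  then have "U.indep_vars (\<lambda>_. borel) (\<lambda>i w. \<Sum>m<N. restrict (\<lambda>p. ?X p w) (?J i) (m, i)) (UNIV :: nat set)"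
    by (rule U.indep_vars_compose2[where Y="\<lambda>i g. \<Sum>m<N. g (m, i)"])
       (auto intro!: borel_measurable_sum measurable_component_singleton)
  then show ?thesis by simp
qed

text \<open>The pieces of the interval in the various units have lengths adding up to \<open>y - x\<close>, and the
  increments over them are independent.\<close>

lemma glued_increment_law:
  assumes xy: "0 \<le> x" "x \<le> y"
  shows "distr units borel (\<lambda>w. glued y w - glued x w) = incr_law (y - x)"
proof (rule Levy_uniqueness)
  interpret U: prob_space units by (rule prob_space_units)
  have [measurable]: "glued x \<in> borel_measurable units" "glued y \<in> borel_measurable units"
    using xy by (auto intro: glued_measurable)
  show "real_distribution (distr units borel (\<lambda>w. glued y w - glued x w))"
    by (rule U.real_distribution_distr) measurable
  show "real_distribution (incr_law (y - x))" using xy by (intro real_distribution_incr_law) simp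
  obtain N where N: "y \<le> real N" using real_arch_simple by blast
  define s where "s i = (if i = 0 then x else y)" for i :: nat
  have s: "mono s" unfolding mono_def s_def using xy by auto
  let ?X = "\<lambda>p w. seg (clamp (fst p) (s (Suc (snd p)))) (w (fst p)) - seg (clamp (fst p) (s (snd p))) (w (fst p))"
  let ?J = "(\<lambda>m. (m, 0)) ` {..<N}"
  show "char (distr units borel (\<lambda>w. glued y w - glued x w)) = char (incr_law (y - x))"
  proof
    fix u
    have "glued y w - glued x w = (\<Sum>p\<in>?J. ?X p w)" for w
      using N xy by (simp add: glued_eq[of _ N] sum.reindex inj_on_def s_def sum_subtractf)
    then have "char (distr units borel (\<lambda>w. glued y w - glued x w)) u = char (distr units borel (\<lambda>w. \<Sum>p\<in>?J. ?X p w)) u"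
      by simp
    also have "\<dots> = (\<Prod>p\<in>?J. char (distr units borel (?X p)) u)"
      by (rule U.char_distr_sum[OF U.indep_vars_subset[OF contributions_indep[OF s]]]) simp
    also have "\<dots> = (\<Prod>m<N. char (distr units borel (?X (m, 0))) u)"
      by (simp add: prod.reindex inj_on_def)
    also have "\<dots> = (\<Prod>m<N. char (incr_law (clamp m y - clamp m x)) u)"
    proof (rule prod.cong[OF refl])
      fix m
      interpret P: product_prob_space "\<lambda>_::nat. cond_law 1" UNIV
        using prob_space_cond_law by (intro product_prob_spaceI) auto
      have [measurable]: "seg (clamp m y) \<in> borel_measurable (cond_law 1)" "seg (clamp m x) \<in> borel_measurable (cond_law 1)"
        using seg_measurable[OF clamp_range(1)] measurable_cong_sets[OF sets_cond_law refl] by blast+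
      have "distr units borel (?X (m, 0)) = distr (distr units (cond_law 1) (\<lambda>w. w m)) borel (\<lambda>z. seg (clamp m y) z - seg (clamp m x) z)"
        unfolding units_def by (subst distr_distr) (auto simp: comp_def s_def)
      also have "distr units (cond_law 1) (\<lambda>w. w m) = cond_law 1"
        unfolding units_def using P.PiM_component[of m] by simp
      also have "distr (cond_law 1) borel (\<lambda>z. seg (clamp m y) z - seg (clamp m x) z) = incr_law (clamp m y - clamp m x)"
        by (rule seg_increment_law) (use xy in \<open>auto simp: clamp_range intro: clamp_mono\<close>)
      finally show "char (distr units borel (?X (m, 0))) u = char (incr_law (clamp m y - clamp m x)) u" by simp
    qed
    also have "\<dots> = char (incr_law (\<Sum>m<N. clamp m y - clamp m x)) u"
      by (rule char_incr_law_sum) (use xy in \<open>auto intro: clamp_mono\<close>)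
    also have "(\<Sum>m<N. clamp m y - clamp m x) = y - x"
      using N xy by (simp add: sum_subtractf sum_clamp)
    finally show "char (distr units borel (\<lambda>w. glued y w - glued x w)) u = char (incr_law (y - x)) u" .
  qed
qed

lemma glued_product:
  fixes s :: "nat \<Rightarrow> real"
  assumes s: "mono s" "0 \<le> s 0" and C: "\<And>i. C i \<in> sets borel"
  shows "measure units {w\<in>space units. \<forall>i<n. glued (s (Suc i)) w - glued (s i) w \<in> C i} =
    (\<Prod>i<n. measure (incr_law (s (Suc i) - s i)) (C i))"
proof -
  interpret U: prob_space units by (rule prob_space_units)
  have s0: "0 \<le> s i" for i using monoD[OF s(1), of 0 i] s(2) by simp
  note [measurable] = C
  have [measurable]: "glued (s i) \<in> borel_measurable units" for i by (rule glued_measurable[OF s0])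
  obtain N where N: "s n \<le> real N" using real_arch_simple by blast
  let ?S = "\<lambda>i w. \<Sum>m<N. seg (clamp m (s (Suc i))) (w m) - seg (clamp m (s i)) (w m)"
  have S: "glued (s (Suc i)) w - glued (s i) w = ?S i w" if "i < n" for i w
  proof -
    have "s i \<le> real N" "s (Suc i) \<le> real N" using N monoD[OF s(1), of i n] monoD[OF s(1), of "Suc i" n] that by auto
    then show ?thesis by (simp add: glued_eq[of _ N] sum_subtractf)
  qed
  have law: "U.prob {w\<in>space units. glued (s (Suc i)) w - glued (s i) w \<in> C i} = measure (incr_law (s (Suc i) - s i)) (C i)" for i
  proof -
    have "incr_law (s (Suc i) - s i) = distr units borel (\<lambda>w. glued (s (Suc i)) w - glued (s i) w)"
      by (rule glued_increment_law[symmetric]) (use s s0 monoD[OF s(1), of i "Suc i"] in auto)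
    then show ?thesis by (simp add: measure_distr C vimage_def Int_def conj_commute)
  qed
  show ?thesis
  proof (cases "n = 0")
    case False
    have "U.prob (\<Inter>i\<in>{..<n}. ?S i -` C i \<inter> space units) = (\<Prod>i<n. U.prob (?S i -` C i \<inter> space units))"
      by (rule U.indep_varsD[OF glued_indep[OF s(1)]]) (use False C in auto)
    moreover have "(\<Inter>i\<in>{..<n}. ?S i -` C i \<inter> space units) =
      {w\<in>space units. \<forall>i<n. glued (s (Suc i)) w - glued (s i) w \<in> C i}"
      using False by (auto simp: S)
    moreover have "(\<Prod>i<n. U.prob (?S i -` C i \<inter> space units)) =
      (\<Prod>i<n. U.prob {w\<in>space units. glued (s (Suc i)) w - glued (s i) w \<in> C i})"
      by (intro prod.cong refl arg_cong[where f=U.prob]) (auto simp: S)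
    ultimately show ?thesis by (simp add: law)
  qed (simp add: U.prob_space)
qed

end

context killed_levy
begin

text \<open>The values at finitely many times are partial sums of increments, whose joint law is a product on
  either side.\<close>

lemma Y_law_eq_glued_law:
  assumes T: "0 \<le> T" and S: "finite S" "S \<subseteq> {0..T}" and B: "\<And>s. B s \<in> sets borel"
  shows "measure (cond_law T) {x\<in>space K. \<forall>s\<in>S. Y s x \<in> B s} = measure units {w\<in>space units. \<forall>s\<in>S. glued s w \<in> B s}"
proof -
  interpret Q: prob_space "cond_law T" by (rule prob_space_cond_law)
  interpret U: prob_space units by (rule prob_space_units)
  note [measurable] = B
  define L where "L = sorted_list_of_set S"
  have L: "set L = S" "sorted L" using S by (auto simp: L_def)
  define k where "k = length L"
  \<comment> \<open>The time \<open>0\<close>, followed by the elements of \<open>S\<close> in increasing order, and \<open>T\<close> from then on.\<close>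
  define s where "s i = (case i of 0 \<Rightarrow> 0 | Suc j \<Rightarrow> if j < k then L ! j else T)" for i
  have L_range: "0 \<le> L ! j" "L ! j \<le> T" if "j < k" for j
    using that L(1) S nth_mem[of j L] unfolding k_def by auto
  have s_mono: "mono s"
  proof (rule incseq_SucI)
    fix i
    show "s i \<le> s (Suc i)"
    proof (cases i)
      case 0
      then show ?thesis using L_range T by (simp add: s_def)
    next
      case (Suc j)
      then show ?thesis using L_range sorted_nth_mono[OF L(2), of j "Suc j"] by (auto simp: s_def k_def)
    qed
  qed
  have s0: "s 0 = 0" by (simp add: s_def)
  have s_range: "0 \<le> s i" "s i \<le> T" for i
    using monoD[OF s_mono, of 0 i] L_range T by (auto simp: s0 s_def split: nat.split)
  have S_eq: "(\<forall>r\<in>S. R r) \<longleftrightarrow> (\<forall>j<k. R (s (Suc j)))" for R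
    unfolding L(1)[symmetric] all_set_conv_all_nth k_def[symmetric] by (simp add: s_def)
  let ?I = "{..k}"
  let ?X = "\<lambda>i x. Y (s (Suc i)) x - Y (s i) x" and ?G = "\<lambda>i w. glued (s (Suc i)) w - glued (s i) w"
  have [measurable]: "Y (s i) \<in> borel_measurable (cond_law T)" for i by (rule measurable_Y_cond_law[OF s_range(1)])
  have [measurable]: "glued (s i) \<in> borel_measurable units" for i by (rule glued_measurable[OF s_range(1)])
  have indX: "Q.indep_vars (\<lambda>_. borel) ?X ?I"
    by (rule Q.indep_vars_subset[OF cond_law_indep_increments[OF s_mono]]) (use s0 s_range in auto)
  have incr: "0 \<le> s (Suc i) - s i" "s i \<le> s (Suc i)" for i using monoD[OF s_mono, of i "Suc i"] by auto
  have lawX: "distr (cond_law T) borel (?X i) = incr_law (s (Suc i) - s i)" for i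
    by (rule cond_law_increment_law) (use s_range incr in auto)
  have lawG: "distr units borel (?G i) = incr_law (s (Suc i) - s i)" for i
    by (rule glued_increment_law) (use s_range incr in auto)
  have "U.indep_vars (\<lambda>_. borel) ?G UNIV"
  proof (rule U.indep_vars_nat_if)
    fix n and C :: "nat \<Rightarrow> real set" assume C: "\<And>i. C i \<in> sets borel"
    have "measure (incr_law (s (Suc i) - s i)) (C i) = U.prob {w\<in>space units. ?G i w \<in> C i}" for i
      unfolding lawG[symmetric] by (simp add: measure_distr C vimage_def Int_def conj_commute)
    then show "U.prob {w\<in>space units. \<forall>i<n. ?G i w \<in> C i} = (\<Prod>i<n. U.prob {w\<in>space units. ?G i w \<in> C i})"
      using glued_product[OF s_mono _ C, of n] s0 by simp
  qed measurable
  then have indG: "U.indep_vars (\<lambda>_. borel) ?G ?I" by (rule U.indep_vars_subset) simp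
  have ne: "?I \<noteq> {}" by auto
  have "distr (cond_law T) (PiM ?I (\<lambda>_. borel)) (\<lambda>x. \<lambda>i\<in>?I. ?X i x) = PiM ?I (\<lambda>i. incr_law (s (Suc i) - s i))"
    using indX by (subst (asm) Q.indep_vars_iff_distr_eq_PiM'[OF ne]) (simp_all add: lawX)
  also have "\<dots> = distr units (PiM ?I (\<lambda>_. borel)) (\<lambda>w. \<lambda>i\<in>?I. ?G i w)"
    using indG by (subst (asm) U.indep_vars_iff_distr_eq_PiM'[OF ne]) (simp_all add: lawG)
  finally have eq: "distr (cond_law T) (PiM ?I (\<lambda>_. borel)) (\<lambda>x. \<lambda>i\<in>?I. ?X i x) =
    distr units (PiM ?I (\<lambda>_. borel)) (\<lambda>w. \<lambda>i\<in>?I. ?G i w)" .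
  define D where "D = {v\<in>space (PiM ?I (\<lambda>_. borel :: real measure)). \<forall>j<k. (\<Sum>i\<le>j. v i) \<in> B (s (Suc j))}"
  have D: "D \<in> sets (PiM ?I (\<lambda>_. borel))"
  proof -
    have "(\<lambda>v. \<Sum>i\<le>j. v i) \<in> borel_measurable (PiM ?I (\<lambda>_. borel :: real measure))" if "j < k" for j
      using that by (intro borel_measurable_sum measurable_component_singleton) auto
    from measurable_sets[OF this B] have
      "{v\<in>space (PiM ?I (\<lambda>_. borel)). (\<Sum>i\<le>j. v i) \<in> B (s (Suc j))} \<in> sets (PiM ?I (\<lambda>_. borel))" if "j < k" for j
      using that by (simp add: vimage_def Int_def conj_commute)
    then have "{v\<in>space (PiM ?I (\<lambda>_. borel)). \<forall>j\<in>{..<k}. (\<Sum>i\<le>j. v i) \<in> B (s (Suc j))} \<in> sets (PiM ?I (\<lambda>_. borel :: real measure))"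
      by (intro sets.sets_Collect_finite_All) auto
    then show ?thesis by (simp add: D_def Ball_def)
  qed
  have tele: "(\<Sum>i\<le>j. h (s (Suc i)) - h (s i)) = h (s (Suc j)) - h (s 0)" for h :: "real \<Rightarrow> real" and j
    by (induction j) auto
  have "measure (cond_law T) {x\<in>space K. \<forall>r\<in>S. Y r x \<in> B r} =
    measure (cond_law T) ((\<lambda>x. \<lambda>i\<in>?I. ?X i x) -` D \<inter> space (cond_law T))"
  proof (rule measure_eq_AE)
    have "AE x in cond_law T. Y 0 x = 0" by (rule AE_cond_law) (use Y_0 in \<open>auto elim: eventually_mono\<close>)
    then show "AE x in cond_law T. x \<in> {x\<in>space K. \<forall>r\<in>S. Y r x \<in> B r} \<longleftrightarrow> x \<in> (\<lambda>x. \<lambda>i\<in>?I. ?X i x) -` D \<inter> space (cond_law T)"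
    proof eventually_elim
      case (elim x)
      have "(\<Sum>i\<le>j. (\<lambda>i\<in>?I. ?X i x) i) = Y (s (Suc j)) x" if "j < k" for j
      proof -
        have "(\<Sum>i\<le>j. (\<lambda>i\<in>?I. ?X i x) i) = (\<Sum>i\<le>j. ?X i x)" using that by (intro sum.cong) auto
        then show ?thesis using tele[of "\<lambda>t. Y t x" j] elim by (simp add: s0)
      qed
      then show ?case by (auto simp: S_eq D_def space_cond_law space_PiM)
    qed
    show "{x\<in>space K. \<forall>r\<in>S. Y r x \<in> B r} \<in> sets (cond_law T)"
      unfolding S_eq space_cond_law[of T, symmetric] by measurable
    show "(\<lambda>x. \<lambda>i\<in>?I. ?X i x) -` D \<inter> space (cond_law T) \<in> sets (cond_law T)"
      by (rule measurable_sets[OF measurable_restrict D]) measurable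
  qed
  also have "\<dots> = measure (distr (cond_law T) (PiM ?I (\<lambda>_. borel)) (\<lambda>x. \<lambda>i\<in>?I. ?X i x)) D"
    by (rule measure_distr[OF _ D, symmetric]) (rule measurable_restrict, measurable)
  also have "\<dots> = measure units ((\<lambda>w. \<lambda>i\<in>?I. ?G i w) -` D \<inter> space units)"
    unfolding eq by (rule measure_distr[OF _ D]) (rule measurable_restrict, measurable)
  also have "(\<lambda>w. \<lambda>i\<in>?I. ?G i w) -` D \<inter> space units = {w\<in>space units. \<forall>r\<in>S. glued r w \<in> B r}"
  proof -
    have "(\<Sum>i\<le>j. (\<lambda>i\<in>?I. ?G i w) i) = glued (s (Suc j)) w" if "j < k" for j w
    proof -
      have "(\<Sum>i\<le>j. (\<lambda>i\<in>?I. ?G i w) i) = (\<Sum>i\<le>j. ?G i w)" using that by (intro sum.cong) auto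
      then show ?thesis using tele[of "\<lambda>t. glued t w" j] by (simp add: s0 glued_0)
    qed
    then show ?thesis by (auto simp: S_eq D_def space_PiM)
  qed
  finally show ?thesis .
qed

text \<open>The glued process and the lifetime become independent coordinates of a product space; the lifetime
  keeps the law that it has for the killed process.\<close>

definition ext_law :: "(real \<Rightarrow> real) measure" where
  "ext_law = distr units path_space (\<lambda>w. \<lambda>t\<in>{0..}. glued t w)"

definition extension :: "((real \<Rightarrow> real) \<times> real) measure" where
  "extension = ext_law \<Otimes>\<^sub>M distr K borel life"

lemma glued_path_measurable: "(\<lambda>w. \<lambda>t\<in>{0..}. glued t w) \<in> units \<rightarrow>\<^sub>M path_space"
  by (rule measurable_into_path_space) (auto intro: glued_measurable glued_cadlag)

lemma prob_space_ext_law: "prob_space ext_law"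
  unfolding ext_law_def by (rule prob_space.prob_space_distr[OF prob_space_units glued_path_measurable])

lemma sets_ext_law: "sets ext_law = sets path_space"
  by (simp add: ext_law_def)

lemma prob_space_life_law: "prob_space (distr K borel life)"
  by (rule prob_space_distr) measurable

lemma prob_space_extension: "prob_space extension"
  unfolding extension_def by (rule prob_space_pair[OF prob_space_ext_law prob_space_life_law])

lemma space_extension: "space extension = space path_space \<times> UNIV"
  by (simp add: extension_def ext_law_def space_pair_measure)

lemma extension_fst [measurable]: "fst \<in> extension \<rightarrow>\<^sub>M path_space"
proof -
  have "fst \<in> extension \<rightarrow>\<^sub>M ext_law" unfolding extension_def by (rule measurable_fst)
  then show ?thesis using measurable_cong_sets[OF refl sets_ext_law] by blast
qed

lemma extension_snd [measurable]: "snd \<in> borel_measurable extension"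
proof -
  have "snd \<in> extension \<rightarrow>\<^sub>M distr K borel life" unfolding extension_def by (rule measurable_snd)
  then show ?thesis by simp
qed

lemma measure_extension_times:
  assumes A: "A \<in> sets path_space" and B: "B \<in> sets borel"
  shows "measure extension (A \<times> B) = measure units {w\<in>space units. (\<lambda>t\<in>{0..}. glued t w) \<in> A} * prob {x\<in>space K. life x \<in> B}"
proof -
  interpret G: prob_space ext_law by (rule prob_space_ext_law)
  interpret L: prob_space "distr K borel life" by (rule prob_space_life_law)
  interpret E: prob_space extension by (rule prob_space_extension)
  have "emeasure extension (A \<times> B) = emeasure ext_law A * emeasure (distr K borel life) B"
    unfolding extension_def by (rule L.emeasure_pair_measure_Times) (use A B in \<open>simp_all add: sets_ext_law\<close>)
  then have "measure extension (A \<times> B) = measure ext_law A * measure (distr K borel life) B"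
    by (simp add: E.emeasure_eq_measure G.emeasure_eq_measure L.emeasure_eq_measure ennreal_mult[symmetric])
  also have "measure ext_law A = measure units {w\<in>space units. (\<lambda>t\<in>{0..}. glued t w) \<in> A}"
    unfolding ext_law_def by (subst measure_distr[OF glued_path_measurable A]) (simp add: vimage_def Int_def conj_commute)
  also have "measure (distr K borel life) B = prob {x\<in>space K. life x \<in> B}"
    by (subst measure_distr[OF life_measurable B]) (simp add: vimage_def Int_def conj_commute)
  finally show ?thesis .
qed

lemma measure_extension_fst:
  assumes A: "A \<in> sets path_space"
  shows "measure extension {p\<in>space extension. fst p \<in> A} = measure units {w\<in>space units. (\<lambda>t\<in>{0..}. glued t w) \<in> A}"
proof -
  have "{p\<in>space extension. fst p \<in> A} = A \<times> UNIV"
    using sets.sets_into_space[OF A] by (auto simp: space_extension)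
  then show ?thesis using measure_extension_times[OF A, of UNIV] by (simp add: prob_space)
qed

lemma distr_extension_fst:
  assumes h: "h \<in> borel_measurable path_space"
  shows "distr extension borel (\<lambda>p. h (fst p)) = distr units borel (\<lambda>w. h (\<lambda>t\<in>{0..}. glued t w))"
proof (rule measure_eqI)
  interpret E: prob_space extension by (rule prob_space_extension)
  interpret U: prob_space units by (rule prob_space_units)
  note [measurable] = h glued_path_measurable
  fix B assume "B \<in> sets (distr extension borel (\<lambda>p. h (fst p)))"
  then have B [measurable]: "B \<in> sets borel" by simp
  let ?A = "h -` B \<inter> space path_space"
  have A: "?A \<in> sets path_space" by (rule measurable_sets[OF h B])
  have "(\<lambda>p. h (fst p)) -` B \<inter> space extension = {p\<in>space extension. fst p \<in> ?A}"
    by (auto simp: space_extension)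
  moreover have "(\<lambda>w. h (\<lambda>t\<in>{0..}. glued t w)) -` B \<inter> space units = {w\<in>space units. (\<lambda>t\<in>{0..}. glued t w) \<in> ?A}"
    using measurable_space[OF glued_path_measurable] by auto
  ultimately have "measure extension ((\<lambda>p. h (fst p)) -` B \<inter> space extension) =
      measure units ((\<lambda>w. h (\<lambda>t\<in>{0..}. glued t w)) -` B \<inter> space units)"
    using measure_extension_fst[OF A] by simp
  then show "emeasure (distr extension borel (\<lambda>p. h (fst p))) B = emeasure (distr units borel (\<lambda>w. h (\<lambda>t\<in>{0..}. glued t w))) B"
    by (simp add: emeasure_distr E.emeasure_eq_measure U.emeasure_eq_measure)
qed simp

lemma levy_process_extension: "levy_process extension (\<lambda>t p. fst p t)"
  unfolding levy_process_def
proof (intro conjI allI impI ballI)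
  interpret E: prob_space extension by (rule prob_space_extension)
  interpret U: prob_space units by (rule prob_space_units)
  show "prob_space extension" by (rule prob_space_extension)
  show "(\<lambda>p. fst p t) \<in> borel_measurable extension" for t
    by (rule measurable_compose[OF extension_fst]) measurable
  show "cadlag (\<lambda>t. fst p t)" if "p \<in> space extension" for p
    using that by (auto simp: space_extension path_spaceD)
  have "measure extension {p\<in>space extension. fst p \<in> {f\<in>space path_space. f 0 = 0}} = 1"
    using measurable_space[OF glued_path_measurable]
    by (subst measure_extension_fst) (auto simp: glued_0 U.prob_space cong: conj_cong)
  then show "AE p in extension. fst p 0 = 0" using E.AE_prob_1 by (force elim: eventually_mono)
  have law: "distr extension borel (\<lambda>p. fst p (s + t) - fst p s) = incr_law t" if "0 \<le> s" "0 \<le> t" for s t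
  proof -
    have "distr extension borel (\<lambda>p. fst p (s + t) - fst p s) = distr units borel (\<lambda>w. glued (s + t) w - glued s w)"
      using distr_extension_fst[of "\<lambda>f. f (s + t) - f s"] that by simp
    also have "\<dots> = incr_law t" using glued_increment_law[of s "s + t"] that by simp
    finally show ?thesis .
  qed
  show "distr extension borel (\<lambda>p. fst p (s + t) - fst p s) = distr extension borel (\<lambda>p. fst p t)"
    if st: "0 \<le> s" "0 \<le> t" for s t
  proof -
    have "distr extension borel (\<lambda>p. fst p t) = distr units borel (\<lambda>w. glued t w)"
      using distr_extension_fst[of "\<lambda>f. f t"] that by simp
    also have "\<dots> = incr_law t" using glued_increment_law[of 0 t] that by (simp add: glued_0)
    finally show ?thesis using law[OF st] by simp
  qed
  fix s :: "nat \<Rightarrow> real" and n assume s: "0 \<le> s 0 \<and> mono s"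
  then have s0: "0 \<le> s i" for i using monoD[of s 0 i] by (meson order_trans zero_le)
  have incr: "s i \<le> s (Suc i)" for i using s monoD[of s i "Suc i"] by simp
  have coord_m [measurable]: "(\<lambda>p. fst p t) \<in> borel_measurable extension" for t
    by (rule measurable_compose[OF extension_fst]) measurable
  have "E.indep_vars (\<lambda>_. borel) (\<lambda>i p. fst p (s (Suc i)) - fst p (s i)) UNIV"
  proof (rule E.indep_vars_nat_if)
    fix n and C :: "nat \<Rightarrow> real set" assume C: "\<And>i. C i \<in> sets borel"
    note [measurable] = C
    have "E.prob {p\<in>space extension. \<forall>i<n. fst p (s (Suc i)) - fst p (s i) \<in> C i} =
      E.prob {p\<in>space extension. fst p \<in> {f\<in>space path_space. \<forall>i<n. f (s (Suc i)) - f (s i) \<in> C i}}"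
      by (rule arg_cong[where f=E.prob]) (auto simp: space_extension)
    also have "\<dots> = U.prob {w\<in>space units. \<forall>i<n. glued (s (Suc i)) w - glued (s i) w \<in> C i}"
      using s0 measurable_space[OF glued_path_measurable]
      by (subst measure_extension_fst) (auto cong: conj_cong)
    also have "\<dots> = (\<Prod>i<n. measure (incr_law (s (Suc i) - s i)) (C i))"
      by (rule glued_product) (use s C in auto)
    also have "\<dots> = (\<Prod>i<n. E.prob {p\<in>space extension. fst p (s (Suc i)) - fst p (s i) \<in> C i})"
    proof (rule prod.cong[OF refl])
      fix i
      have "distr extension borel (\<lambda>p. fst p (s (Suc i)) - fst p (s i)) = incr_law (s (Suc i) - s i)"
        using law[of "s i" "s (Suc i) - s i"] s0[of i] incr[of i] by simp
      then show "measure (incr_law (s (Suc i) - s i)) (C i) = E.prob {p\<in>space extension. fst p (s (Suc i)) - fst p (s i) \<in> C i}"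
        using measure_distr[of "\<lambda>p. fst p (s (Suc i)) - fst p (s i)" extension borel "C i"]
        by (simp add: C vimage_def Int_def conj_commute)
    qed
    finally show "E.prob {p\<in>space extension. \<forall>i<n. fst p (s (Suc i)) - fst p (s i) \<in> C i} =
      (\<Prod>i<n. E.prob {p\<in>space extension. fst p (s (Suc i)) - fst p (s i) \<in> C i})" .
  qed measurable
  then show "E.indep_vars (\<lambda>_. borel) (\<lambda>i p. fst p (s (Suc i)) - fst p (s i)) {..<n}"
    by (rule E.indep_vars_subset) simp
qed

lemma exponential_time_extension: "independent_exponential_time extension (\<lambda>t p. fst p t) snd"
proof -
  interpret E: prob_space extension by (rule prob_space_extension)
  interpret U: prob_space units by (rule prob_space_units)
  obtain q where q: "0 < q" "\<And>t. 0 \<le> t \<Longrightarrow> surv t = exp (- t * q)" using surv_exp by blast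
  have snd_prob: "E.prob {p\<in>space extension. snd p \<in> B} = prob {x\<in>space K. life x \<in> B}" if B: "B \<in> sets borel" for B
  proof -
    have "{p\<in>space extension. snd p \<in> B} = space path_space \<times> B" by (auto simp: space_extension)
    moreover have "{w\<in>space units. (\<lambda>t\<in>{0..}. glued t w) \<in> space path_space} = space units"
      using measurable_space[OF glued_path_measurable] by auto
    ultimately show ?thesis using measure_extension_times[OF sets.top B] by (simp add: U.prob_space)
  qed
  have "distributed extension lborel snd (exponential_density q)"
    unfolding E.exponential_distributed_iff[OF q(1)]
  proof (intro conjI allI impI extension_snd)
    fix a :: real assume a: "0 \<le> a"
    have "E.prob {p\<in>space extension. snd p \<le> a} = prob {x\<in>space K. life x \<le> a}"
      using snd_prob[of "{..a}"] by simp
    also have "\<dots> = prob (space K - {x\<in>space K. a < life x})" by (rule arg_cong[where f=prob]) auto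
    also have "\<dots> = 1 - surv a" by (simp add: prob_compl surv_def)
    finally show "E.prob {p\<in>space extension. snd p \<le> a} = 1 - exp (- a * q)" using q(2)[OF a] by simp
  qed
  moreover have "indep_rv extension traj_space (traj (\<lambda>t p. fst p t)) borel snd"
    unfolding indep_rv_def
  proof (intro conjI extension_snd)
    show traj_m: "traj (\<lambda>t p. fst p t) \<in> extension \<rightarrow>\<^sub>M traj_space"
      unfolding traj_def
      by (intro measurable_restrict measurable_compose[OF extension_fst]) measurable
    have traj_eq: "traj (\<lambda>t p. fst p t) p = fst p" if "p \<in> space extension" for p
      using that by (auto simp: traj_def space_extension space_path_space extensional_def fun_eq_iff)
    show "E.indep_set {traj (\<lambda>t p. fst p t) -` A \<inter> space extension |A. A \<in> sets traj_space}
        {snd -` B \<inter> space extension |B. B \<in> sets borel}"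
      unfolding E.indep_sets2_eq
    proof (intro conjI ballI subsetI)
      fix a assume "a \<in> {traj (\<lambda>t p. fst p t) -` A \<inter> space extension |A. A \<in> sets traj_space}"
      then show "a \<in> E.events" using measurable_sets[OF traj_m] by blast
    next
      fix b assume "b \<in> {snd -` B \<inter> space extension |B. B \<in> sets (borel :: real measure)}"
      then show "b \<in> E.events" using measurable_sets[OF extension_snd] by blast
    next
      fix a b assume "a \<in> {traj (\<lambda>t p. fst p t) -` A \<inter> space extension |A. A \<in> sets traj_space}"
        "b \<in> {snd -` B \<inter> space extension |B. B \<in> sets (borel :: real measure)}"
      then obtain A and B :: "real set" where A: "A \<in> sets traj_space" "a = traj (\<lambda>t p. fst p t) -` A \<inter> space extension"
        and B: "B \<in> sets borel" "b = snd -` B \<inter> space extension" by blast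
      define A' where "A' = A \<inter> space path_space"
      have A': "A' \<in> sets path_space"
        unfolding A'_def path_space_def sets_restrict_space space_restrict_space using A(1)
        by (auto simp: image_iff intro!: bexI[of _ A] dest: sets.sets_into_space)
      have "a = {p\<in>space extension. fst p \<in> A'}"
        unfolding A(2) A'_def using traj_eq by (auto simp: space_extension)
      moreover have "b = {p\<in>space extension. snd p \<in> B}" unfolding B(2) by auto
      moreover have "{p\<in>space extension. fst p \<in> A'} \<inter> {p\<in>space extension. snd p \<in> B} = A' \<times> B"
        by (auto simp: space_extension A'_def)
      ultimately show "E.prob (a \<inter> b) = E.prob a * E.prob b"
        using measure_extension_times[OF A' B(1)] measure_extension_fst[OF A'] snd_prob[OF B(1)] by simp
    qed
  qed
  ultimately show ?thesis unfolding independent_exponential_time_def using q(1) by auto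
qed

text \<open>The probability of being alive at \<open>t\<close> factors on both sides: by independence here, and by
  conditioning for the killed process.\<close>

lemma killed_pair_extension:
  "distr extension killed_space (killed_pair (\<lambda>t p. fst p t) snd) = distr K killed_space (killed_pair Y life)"
proof (rule killed_pair_law_eqI[OF prob_space_extension prob_space_axioms])
  interpret E: prob_space extension by (rule prob_space_extension)
  show "(\<lambda>p. fst p t) \<in> borel_measurable extension" for t
    by (rule measurable_compose[OF extension_fst]) measurable
  fix t :: real and S and B :: "real \<Rightarrow> real set" assume t: "0 \<le> t" and S: "finite S" "S \<subseteq> {0..t}" and B: "\<And>s. B s \<in> sets borel"
  let ?A = "{f\<in>space path_space. \<forall>s\<in>S. f s \<in> B s}"
  note [measurable] = B
  have A: "?A \<in> sets path_space"
  proof (intro sets.sets_Collect_finite_All S)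
    fix s show "{f \<in> space path_space. f s \<in> B s} \<in> sets path_space" by measurable
  qed
  have YA: "{x\<in>space K. \<forall>s\<in>S. Y s x \<in> B s} \<in> sets K"
  proof (intro sets.sets_Collect_finite_All S)
    fix s assume "s \<in> S"
    then have [measurable]: "Y s \<in> borel_measurable K" using S by (intro Y_measurable) auto
    show "{x \<in> space K. Y s x \<in> B s} \<in> sets K" by measurable
  qed
  have "E.prob {p\<in>space extension. t < snd p \<and> (\<forall>s\<in>S. fst p s \<in> B s)} = E.prob (?A \<times> {t<..})"
    by (rule arg_cong[where f=E.prob]) (auto simp: space_extension)
  also have "\<dots> = measure units {w\<in>space units. (\<lambda>t\<in>{0..}. glued t w) \<in> ?A} * surv t"
    by (subst measure_extension_times[OF A]) (simp_all add: surv_def)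
  also have "{w\<in>space units. (\<lambda>t\<in>{0..}. glued t w) \<in> ?A} = {w\<in>space units. \<forall>s\<in>S. glued s w \<in> B s}"
    using measurable_space[OF glued_path_measurable] S by (auto simp: subset_iff)
  also have "measure units \<dots> * surv t = prob ({x\<in>space K. t < life x} \<inter> {x\<in>space K. \<forall>s\<in>S. Y s x \<in> B s})"
    using Y_law_eq_glued_law[OF t S B] measure_cond_law[OF YA, of t] surv_pos[of t] by simp
  also have "{x\<in>space K. t < life x} \<inter> {x\<in>space K. \<forall>s\<in>S. Y s x \<in> B s} = {x\<in>space K. t < life x \<and> (\<forall>s\<in>S. Y s x \<in> B s)}"
    by auto
  finally show "emeasure extension {p\<in>space extension. t < snd p \<and> (\<forall>s\<in>S. fst p s \<in> B s)} =
    emeasure K {x\<in>space K. t < life x \<and> (\<forall>s\<in>S. Y s x \<in> B s)}"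
    by (simp add: E.emeasure_eq_measure emeasure_eq_measure)
qed (auto intro: Y_measurable)

end

section \<open>The Lamperti transform of a killed path\<close>

lemma exp_functional_cadlag_strict_mono:
  assumes f: "f \<in> space path_space" and ab: "0 \<le> a" "a < b"
  shows "exp_functional c f a < exp_functional c f b"
proof -
  obtain G where "\<forall>s\<in>{0..b}. \<bar>f s\<bar> \<le> G" using cadlag_bounded[OF path_spaceD[OF f]] by blast
  then show ?thesis by (intro exp_functional_strict_mono[OF measurable_path_real[OF f] _ ab]) blast
qed

text \<open>The exponential functional is strictly increasing, so the infimum in the clock is taken over an open
  half-line starting at the solution.\<close>

lemma lamperti_clock_eqI:
  assumes f: "f \<in> space path_space" and u: "0 \<le> u" "exp_functional \<alpha> f u = t"
  shows "lamperti_clock \<alpha> f t = u"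
proof -
  have "{v. 0 < v \<and> t < exp_functional \<alpha> f v} = {u<..}"
  proof (intro equalityI subsetI)
    fix v assume v: "v \<in> {v. 0 < v \<and> t < exp_functional \<alpha> f v}"
    show "v \<in> {u<..}"
    proof (rule ccontr)
      assume "v \<notin> {u<..}"
      then consider "v < u" | "v = u" by fastforce
      then show False
      proof cases
        case 1
        from exp_functional_cadlag_strict_mono[OF f _ 1, of \<alpha>] v u show False by auto
      qed (use v u in auto)
    qed
  next
    fix v assume "v \<in> {u<..}"
    then have "u < v" by simp
    from exp_functional_cadlag_strict_mono[OF f u(1) this, of \<alpha>] \<open>u < v\<close> u
    show "v \<in> {v. 0 < v \<and> t < exp_functional \<alpha> f v}" by auto
  qed
  then show ?thesis by (simp add: lamperti_clock_def)
qed

lemma lamperti_clock_cong: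
  assumes "\<And>s. 0 \<le> s \<Longrightarrow> g s = g' s"
  shows "lamperti_clock \<alpha> g t = lamperti_clock \<alpha> g' t"
proof -
  have "exp_functional \<alpha> g u = exp_functional \<alpha> g' u" for u
    by (rule exp_functional_cong) (use assms in auto)
  then show ?thesis by (simp add: lamperti_clock_def)
qed

lemma lamperti_clock_nonneg:
  assumes "0 < z" "t < exp_functional \<alpha> g z"
  shows "0 \<le> lamperti_clock \<alpha> g t"
  unfolding lamperti_clock_def by (rule cInf_greatest) (use assms in auto)

text \<open>When the functional never exceeds \<open>t\<close> the infimum is that of the empty set, some fixed number; this case
  is treated apart.\<close>

lemma measurable_lamperti_clock:
  assumes \<phi>: "\<phi> \<in> M \<rightarrow>\<^sub>M path_space"
  shows "(\<lambda>x. lamperti_clock \<alpha> (\<phi> x) t) \<in> borel_measurable M"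
proof (rule borel_measurableI_less)
  fix y :: real
  have [measurable]: "(\<lambda>p. \<phi> (fst p) (snd p)) \<in> borel_measurable (M \<Otimes>\<^sub>M borel)"
    by (rule measurable_path_eval) (use \<phi> in measurable)
  have [measurable]: "(\<lambda>x. exp_functional \<alpha> (\<phi> x) u) \<in> borel_measurable M" for u
    by (rule measurable_exp_functional) measurable
  let ?S = "\<lambda>x. {u. 0 < u \<and> t < exp_functional \<alpha> (\<phi> x) u}"
  let ?N = "\<lambda>x. \<exists>q::rat. 0 < q \<and> t < exp_functional \<alpha> (\<phi> x) (of_rat q)"
  have "{x\<in>space M. lamperti_clock \<alpha> (\<phi> x) t < y} =
    {x\<in>space M. (?N x \<and> (\<exists>q::rat. 0 < q \<and> of_rat q < y \<and> t < exp_functional \<alpha> (\<phi> x) (of_rat q)))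
      \<or> (\<not> ?N x \<and> Inf {} < y)}"
  proof (rule Collect_cong, rule conj_cong[OF refl])
    fix x assume "x \<in> space M"
    then have f: "\<phi> x \<in> space path_space" by (rule measurable_space[OF \<phi>])
    have above: "\<exists>q::rat. 0 < q \<and> of_rat q < b \<and> t < exp_functional \<alpha> (\<phi> x) (of_rat q)" if uS: "u \<in> ?S x" and ub: "u < b" for u b
    proof -
      obtain q :: rat where q: "u < of_rat q" "of_rat q < b" using of_rat_dense[OF ub] by blast
      have "0 < u" using uS by simp
      then have "0 < (of_rat q :: real)" using q(1) by linarith
      moreover have "t < exp_functional \<alpha> (\<phi> x) (of_rat q)"
        using exp_functional_cadlag_strict_mono[OF f _ q(1), of \<alpha>] uS by auto
      ultimately show ?thesis using q by auto
    qed
    have N_iff: "?N x \<longleftrightarrow> ?S x \<noteq> {}"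
    proof
      assume "?N x"
      then obtain q :: rat where "0 < q" "t < exp_functional \<alpha> (\<phi> x) (of_rat q)" by blast
      then have "of_rat q \<in> ?S x" by simp
      then show "?S x \<noteq> {}" by blast
    next
      assume "?S x \<noteq> {}"
      then obtain u where "u \<in> ?S x" by blast
      from above[OF this, of "u + 1"] show "?N x" by auto
    qed
    show "lamperti_clock \<alpha> (\<phi> x) t < y \<longleftrightarrow>
      (?N x \<and> (\<exists>q::rat. 0 < q \<and> of_rat q < y \<and> t < exp_functional \<alpha> (\<phi> x) (of_rat q))) \<or> (\<not> ?N x \<and> Inf {} < y)"
    proof (cases "?S x = {}")
      case True
      then have nN: "\<not> ?N x" using N_iff by blast
      show ?thesis unfolding lamperti_clock_def True using nN by blast
    next
      case False
      then have N: "?N x" using N_iff by blast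
      have "bdd_below (?S x)" by (rule bdd_belowI[of _ 0]) auto
      then have lt: "lamperti_clock \<alpha> (\<phi> x) t < y \<longleftrightarrow> (\<exists>u\<in>?S x. u < y)"
        unfolding lamperti_clock_def using False by (intro cInf_less_iff)
      have "(\<exists>u\<in>?S x. u < y) \<longleftrightarrow> (\<exists>q::rat. 0 < q \<and> of_rat q < y \<and> t < exp_functional \<alpha> (\<phi> x) (of_rat q))"
      proof
        assume "\<exists>u\<in>?S x. u < y"
        then show "\<exists>q::rat. 0 < q \<and> of_rat q < y \<and> t < exp_functional \<alpha> (\<phi> x) (of_rat q)" using above by blast
      next
        assume "\<exists>q::rat. 0 < q \<and> of_rat q < y \<and> t < exp_functional \<alpha> (\<phi> x) (of_rat q)"
        then obtain q :: rat where "0 < q" "of_rat q < y" "t < exp_functional \<alpha> (\<phi> x) (of_rat q)" by blast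
        then show "\<exists>u\<in>?S x. u < y" by (intro bexI[of _ "of_rat q"]) auto
      qed
      then show ?thesis using lt N by blast
    qed
  qed
  also have "\<dots> \<in> sets M" by measurable
  finally show "{x\<in>space M. lamperti_clock \<alpha> (\<phi> x) t < y} \<in> sets M" .
qed

text \<open>The path is evaluated at the clock only while \<open>t\<close> is below the lifetime, and then the clock is an infimum over
  a nonempty set of positive numbers. Replacing it by its maximum with \<open>0\<close> is harmless and avoids negative times.\<close>

lemma measurable_lamperti_traj:
  assumes \<phi>: "(\<lambda>x. \<lambda>t\<in>{0..}. \<xi> t x) \<in> M \<rightarrow>\<^sub>M path_space" and \<zeta> [measurable]: "\<zeta> \<in> borel_measurable M"
  shows "lamperti_traj \<alpha> \<epsilon> \<xi> \<zeta> \<in> M \<rightarrow>\<^sub>M traj_space"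
proof -
  let ?\<phi> = "\<lambda>x. \<lambda>t\<in>{0..}. \<xi> t x"
  have [measurable]: "(\<lambda>p. ?\<phi> (fst p) (snd p)) \<in> borel_measurable (M \<Otimes>\<^sub>M borel)"
    by (rule measurable_path_eval[OF measurable_compose[OF measurable_fst \<phi>] measurable_snd])
  have life: "exp_functional \<alpha> (\<lambda>s. \<xi> s x) u = exp_functional \<alpha> (?\<phi> x) u" for x u
    by (rule exp_functional_cong) simp
  have [measurable]: "(\<lambda>x. exp_functional \<alpha> (\<lambda>s. \<xi> s x) (\<zeta> x)) \<in> borel_measurable M"
    unfolding life by (rule measurable_exp_functional) measurable
  have "(\<lambda>x. lamperti_clock \<alpha> (?\<phi> x) t) \<in> borel_measurable M" for t
    by (rule measurable_lamperti_clock[OF \<phi>])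
  also have "(\<lambda>x. lamperti_clock \<alpha> (?\<phi> x) t) = (\<lambda>x. lamperti_clock \<alpha> (\<lambda>s. \<xi> s x) t)" for t
    by (intro ext lamperti_clock_cong) simp
  finally have clk [measurable]: "(\<lambda>x. lamperti_clock \<alpha> (\<lambda>s. \<xi> s x) t) \<in> borel_measurable M" for t .
  have [measurable]: "(\<lambda>x. ?\<phi> x (max 0 (lamperti_clock \<alpha> (\<lambda>s. \<xi> s x) t))) \<in> borel_measurable M" for t
    by (rule measurable_path_eval[OF \<phi>]) measurable
  have "(\<lambda>x. \<lambda>t\<in>{0..}. if ennreal t < ennreal (exp_functional \<alpha> (\<lambda>s. \<xi> s x) (\<zeta> x))
      then ereal (\<epsilon> * exp (?\<phi> x (max 0 (lamperti_clock \<alpha> (\<lambda>s. \<xi> s x) t)))) else \<infinity>) \<in> M \<rightarrow>\<^sub>M traj_space"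
    by (rule measurable_restrict) measurable
  also have "(\<lambda>x. \<lambda>t\<in>{0..}. if ennreal t < ennreal (exp_functional \<alpha> (\<lambda>s. \<xi> s x) (\<zeta> x))
      then ereal (\<epsilon> * exp (?\<phi> x (max 0 (lamperti_clock \<alpha> (\<lambda>s. \<xi> s x) t)))) else \<infinity>) = lamperti_traj \<alpha> \<epsilon> \<xi> \<zeta>"
  proof (intro ext)
    fix x t
    have "0 \<le> lamperti_clock \<alpha> (\<lambda>s. \<xi> s x) t"
      if t: "0 \<le> t" and lt: "ennreal t < ennreal (exp_functional \<alpha> (\<lambda>s. \<xi> s x) (\<zeta> x))"
    proof (rule lamperti_clock_nonneg)
      show l: "t < exp_functional \<alpha> (\<lambda>s. \<xi> s x) (\<zeta> x)" using t lt by (simp add: ennreal_less_iff)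
      show "0 < \<zeta> x"
      proof (rule ccontr)
        assume "\<not> 0 < \<zeta> x"
        then have "max 0 (\<zeta> x) = 0" by simp
        then show False using exp_functional_max_0[of \<alpha> "\<lambda>s. \<xi> s x" "\<zeta> x"] l t by (simp add: exp_functional_0)
      qed
    qed
    then show "(\<lambda>t\<in>{0..}. if ennreal t < ennreal (exp_functional \<alpha> (\<lambda>s. \<xi> s x) (\<zeta> x))
      then ereal (\<epsilon> * exp (?\<phi> x (max 0 (lamperti_clock \<alpha> (\<lambda>s. \<xi> s x) t)))) else \<infinity>) t = lamperti_traj \<alpha> \<epsilon> \<xi> \<zeta> x t"
      by (auto simp: lamperti_traj_def killed_traj_def max_def)
  qed
  finally show ?thesis .
qed

lemma cadlag_freeze:
  assumes f: "cadlag f" and z: "0 \<le> z"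
  shows "cadlag (\<lambda>t. if t < z then f t else 0)"
  unfolding cadlag_def
proof (intro conjI allI impI)
  fix t :: real assume t: "0 \<le> t"
  show "((\<lambda>t. if t < z then f t else 0) \<longlongrightarrow> (if t < z then f t else 0)) (at_right t)"
  proof (cases "t < z")
    case True
    have "\<forall>\<^sub>F r in at_right t. f r = (if r < z then f r else 0)" using True by (intro eventually_at_rightI[of t z]) auto
    with cadlag_right[OF f t] have "((\<lambda>t. if t < z then f t else 0) \<longlongrightarrow> f t) (at_right t)" by (rule Lim_transform_eventually)
    then show ?thesis using True by simp
  next
    case False
    have "\<forall>\<^sub>F r in at_right t. (if r < z then f r else 0) = 0" using False by (intro eventually_at_rightI[of t "t+1"]) auto
    then show ?thesis using False by (simp add: tendsto_eventually)
  qed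
next
  fix t :: real assume t: "0 < t"
  show "\<exists>l. ((\<lambda>t. if t < z then f t else 0) \<longlongrightarrow> l) (at_left t)"
  proof (cases "t \<le> z")
    case True
    have "\<forall>\<^sub>F r in at_left t. f r = (if r < z then f r else 0)" using True t by (intro eventually_at_leftI[of 0 t]) auto
    with cadlag_left[OF f t] have "((\<lambda>t. if t < z then f t else 0) \<longlongrightarrow> left_lim f t) (at_left t)" by (rule Lim_transform_eventually)
    then show ?thesis ..
  next
    case False
    have "\<forall>\<^sub>F r in at_left t. (if r < z then f r else 0) = 0" using False by (intro eventually_at_leftI[of z t]) auto
    then have "((\<lambda>t. if t < z then f t else 0) \<longlongrightarrow> 0) (at_left t)" by (rule tendsto_eventually)
    then show ?thesis ..
  qed
qed

lemma exp_functional_cong_less: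
  assumes [measurable]: "g \<in> borel_measurable borel" "g' \<in> borel_measurable borel"
    and eq: "\<And>s. 0 \<le> s \<Longrightarrow> s < u \<Longrightarrow> g s = g' s"
  shows "exp_functional c g u = exp_functional c g' u"
  unfolding exp_functional_def
proof (rule set_lebesgue_integral_cong_AE)
  show "AE s\<in>{0..u} in lborel. exp (c * g s) = exp (c * g' s)"
    using AE_lborel_singleton[of u] by eventually_elim (use eq in auto)
qed auto

text \<open>Freezing changes the path from its lifetime on. The exponential functional up to the lifetime ignores
  that single time, and below its value the clock stays before the lifetime.\<close>

lemma lamperti_traj_killed_pair:
  assumes f: "cadlag (\<lambda>t. \<xi> t x)"
  shows "lamperti_traj \<alpha> \<epsilon> (\<lambda>t p. fst p t) snd (killed_pair \<xi> \<zeta> x) = lamperti_traj \<alpha> \<epsilon> \<xi> \<zeta> x"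
proof -
  define z where "z = max 0 (\<zeta> x)"
  define g where "g = (\<lambda>t\<in>{0..}. \<xi> t x)"
  define g' where "g' = (\<lambda>t\<in>{0..}. if t < \<zeta> x then \<xi> t x else 0)"
  have z: "0 \<le> z" by (simp add: z_def)
  have g: "g \<in> space path_space" using f by (auto simp: space_path_space g_def intro: cadlag_restrict)
  have g'_eq: "g' = (\<lambda>t\<in>{0..}. if t < z then \<xi> t x else 0)" by (auto simp: g'_def z_def fun_eq_iff)
  have g': "g' \<in> space path_space" using cadlag_freeze[OF f z]
    by (auto simp: space_path_space g'_eq intro: cadlag_restrict)
  have kp: "killed_pair \<xi> \<zeta> x = (g', z)" by (simp add: killed_pair_def g'_def z_def)
  have eq: "exp_functional \<alpha> g u = exp_functional \<alpha> g' u" if "u \<le> z" for u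
    by (rule exp_functional_cong_less[OF measurable_path_real[OF g] measurable_path_real[OF g']])
       (use that in \<open>auto simp: g_def g'_eq\<close>)
  have life: "exp_functional \<alpha> (\<lambda>s. \<xi> s x) (\<zeta> x) = exp_functional \<alpha> g z"
    unfolding z_def exp_functional_max_0 by (rule exp_functional_cong) (simp add: g_def)
  have clk: "lamperti_clock \<alpha> (\<lambda>s. \<xi> s x) t = lamperti_clock \<alpha> g t" for t
    by (rule lamperti_clock_cong) (simp add: g_def)
  have val: "g' (lamperti_clock \<alpha> g' t) = \<xi> (lamperti_clock \<alpha> g t) x"
    if t: "0 \<le> t" "t < exp_functional \<alpha> g z" for t
  proof -
    obtain G where G: "\<forall>s\<in>{0..z}. \<bar>g s\<bar> \<le> G" using cadlag_bounded[OF path_spaceD[OF g]] by blast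
    have "continuous_on {0..z} (exp_functional \<alpha> g)"
      by (rule exp_functional_continuous[OF measurable_path_real[OF g]]) (use G in blast)
    then have "\<exists>u\<ge>0. u \<le> z \<and> exp_functional \<alpha> g u = t"
      by (intro IVT') (use t z in \<open>auto simp: exp_functional_0\<close>)
    then obtain u where u: "0 \<le> u" "u \<le> z" "exp_functional \<alpha> g u = t" by blast
    have "u \<noteq> z" using u t by auto
    then have "u < z" using u by simp
    moreover have "lamperti_clock \<alpha> g t = u" by (rule lamperti_clock_eqI[OF g u(1,3)])
    moreover have "lamperti_clock \<alpha> g' t = u" by (rule lamperti_clock_eqI[OF g' u(1)]) (use eq[OF u(2)] u(3) in simp)
    ultimately show ?thesis using u by (simp add: g'_eq)
  qed
  show ?thesis
    unfolding lamperti_traj_def kp fst_conv snd_conv life clk killed_traj_def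
    using val eq[OF order_refl] by (auto simp: fun_eq_iff ennreal_less_iff)
qed

section \<open>The logarithm of a good path in its own clock\<close>

definition levy_path :: "real \<Rightarrow> real \<Rightarrow> (real \<Rightarrow> real) \<Rightarrow> real" where
  "levy_path \<alpha> s f = (if good_path f then log_path \<alpha> s f else 0)"

text \<open>Off the good paths the lifetime is an arbitrary positive number.\<close>

definition levy_life :: "real \<Rightarrow> (real \<Rightarrow> real) \<Rightarrow> real" where
  "levy_life \<alpha> f = (if good_path f then clock \<alpha> f (enn2real (exit_time f)) else 2)"

lemma measurable_levy_path: "0 \<le> s \<Longrightarrow> levy_path \<alpha> s \<in> borel_measurable path_space"
  using measurable_log_path[of s \<alpha>] unfolding levy_path_def[abs_def] by measurable

lemma measurable_levy_life [measurable]: "levy_life \<alpha> \<in> borel_measurable path_space"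
  unfolding levy_life_def[abs_def] by measurable

text \<open>Near \<open>I t\<close> the function \<open>\<xi>\<close> takes the values of \<open>g\<close> near \<open>t\<close>, on the same side, as \<open>I\<close> is an
  increasing homeomorphism.\<close>

lemma cadlag_time_change:
  fixes I :: "real \<Rightarrow> real"
  assumes g: "cadlag g" and h: "0 < h" and I0: "I 0 = 0"
    and mono: "\<And>x y. 0 \<le> x \<Longrightarrow> x < y \<Longrightarrow> y \<le> h \<Longrightarrow> I x < I y" and cont: "continuous_on {0..h} I"
    and eq: "\<And>t. 0 \<le> t \<Longrightarrow> t < h \<Longrightarrow> \<xi> (I t) = g t" and after: "\<And>s. I h \<le> s \<Longrightarrow> \<xi> s = c"
  shows "cadlag \<xi>"
proof -
  have inv: "\<exists>u. a \<le> u \<and> u \<le> b \<and> I u = s" if "0 \<le> a" "a \<le> b" "b \<le> h" "I a \<le> s" "s \<le> I b" for a b s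
    using IVT'[of I a s b] that continuous_on_subset[OF cont, of "{a..b}"] by force
  show ?thesis unfolding cadlag_def
  proof (intro conjI allI impI)
    fix s :: real assume s: "0 \<le> s"
    show "(\<xi> \<longlongrightarrow> \<xi> s) (at_right s)"
    proof (cases "s < I h")
      case True
      then obtain t where t: "0 \<le> t" "t \<le> h" "I t = s" using inv[of 0 h s] s h I0 by auto
      have th: "t < h" using t True by (cases "t = h") auto
      show ?thesis
      proof (rule tendstoI)
        fix e :: real assume "0 < e"
        then have "\<forall>\<^sub>F u in at_right t. dist (g u) (g t) < e" by (rule tendstoD[OF cadlag_right[OF g t(1)]])
        then obtain b where b: "t < b" "\<And>u. t < u \<Longrightarrow> u < b \<Longrightarrow> dist (g u) (g t) < e"
          by (auto simp: eventually_at_right[of t "t+1"])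
        define d where "d = (t + min b h) / 2"
        have d: "t < d" "d < b" "d < h" using b th by (auto simp: d_def)
        have "dist (\<xi> r) (\<xi> s) < e" if r: "s < r" "r < I d" for r
        proof -
          obtain u where u: "t \<le> u" "u \<le> d" "I u = r" using inv[of t d r] t d r by auto
          then have "t < u" using r t by (cases "u = t") auto
          then have "dist (g u) (g t) < e" using b(2) u d by simp
          then show ?thesis using eq[of u] eq[of t] u d t th by simp
        qed
        moreover have "s < I d" using mono[of t d] t d by simp
        ultimately show "\<forall>\<^sub>F r in at_right s. dist (\<xi> r) (\<xi> s) < e"
          by (intro eventually_at_rightI[of s "I d"]) auto
      qed
    next
      case False
      then have "\<forall>\<^sub>F r in at_right s. \<xi> r = \<xi> s" using after by (intro eventually_at_rightI[of s "s+1"]) auto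
      then show ?thesis by (rule tendsto_eventually)
    qed
  next
    fix s :: real assume s: "0 < s"
    show "\<exists>l. (\<xi> \<longlongrightarrow> l) (at_left s)"
    proof (cases "s \<le> I h")
      case True
      then obtain t where t: "0 \<le> t" "t \<le> h" "I t = s" using inv[of 0 h s] s h I0 by auto
      have t0: "0 < t" using t s I0 by (cases "t = 0") auto
      have "(\<xi> \<longlongrightarrow> left_lim g t) (at_left s)"
      proof (rule tendstoI)
        fix e :: real assume "0 < e"
        then have "\<forall>\<^sub>F u in at_left t. dist (g u) (left_lim g t) < e" by (rule tendstoD[OF cadlag_left[OF g t0]])
        then obtain a where a: "a < t" "\<And>u. a < u \<Longrightarrow> u < t \<Longrightarrow> dist (g u) (left_lim g t) < e"
          by (auto simp: eventually_at_left[of "t-1" t])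
        define d where "d = (max 0 a + t) / 2"
        have d: "0 \<le> d" "a < d" "d < t" using a t0 by (auto simp: d_def max_def field_simps)
        have "dist (\<xi> r) (left_lim g t) < e" if r: "I d < r" "r < s" for r
        proof -
          obtain u where u: "d \<le> u" "u \<le> t" "I u = r" using inv[of d t r] t d r by auto
          then have "u < t" using r t by (cases "u = t") auto
          then have "dist (g u) (left_lim g t) < e" using a(2) u d by simp
          then show ?thesis using eq[of u] u d t \<open>u < t\<close> by simp
        qed
        moreover have "I d < s" using mono[of d t] t d by simp
        ultimately show "\<forall>\<^sub>F r in at_left s. dist (\<xi> r) (left_lim g t) < e"
          by (intro eventually_at_leftI[of "I d" s]) auto
      qed
      then show ?thesis ..
    next
      case False
      then have "\<forall>\<^sub>F r in at_left s. \<xi> r = c" using after by (intro eventually_at_leftI[of "I h" s]) auto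
      then have "(\<xi> \<longlongrightarrow> c) (at_left s)" by (rule tendsto_eventually)
      then show ?thesis ..
    qed
  qed
qed

text \<open>The facts about one good path on which the passage to the Levy picture and back rests.\<close>

lemma good_path_clock:
  assumes f: "f \<in> space path_space" and good: "good_path f"
  defines "h \<equiv> enn2real (exit_time f)"
  shows "0 < h" "exit_time f = ennreal h"
    "\<And>x y. 0 \<le> x \<Longrightarrow> x < y \<Longrightarrow> y \<le> h \<Longrightarrow> clock \<alpha> f x < clock \<alpha> f y"
    "continuous_on {0..h} (clock \<alpha> f)"
    "levy_life \<alpha> f = clock \<alpha> f h" "0 < levy_life \<alpha> f"
    "\<And>t. 0 \<le> t \<Longrightarrow> t < h \<Longrightarrow> clock_hit \<alpha> (clock \<alpha> f t) f = ennreal t"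
    "\<And>t. 0 \<le> t \<Longrightarrow> t < h \<Longrightarrow> levy_path \<alpha> (clock \<alpha> f t) f = ln \<bar>f t\<bar>"
    "\<And>s. 0 \<le> s \<Longrightarrow> s < levy_life \<alpha> f \<longleftrightarrow> clock_hit \<alpha> s f < \<infinity>"
    "cadlag (\<lambda>s. if s < levy_life \<alpha> f then levy_path \<alpha> s f else 0)"
proof -
  have cad: "cadlag f" using f by (rule path_spaceD)
  show h: "0 < h" "exit_time f = ennreal h"
    unfolding h_def by (rule good_pathD(3)[OF good cad], rule good_pathD(2)[OF good cad])
  obtain G where G: "\<And>s. s \<in> {0..h} \<Longrightarrow> \<bar>ln \<bar>f s\<bar>\<bar> \<le> G"
    using ln_bounded_good[OF cad good] unfolding h_def by blast
  show mono: "\<And>x y. 0 \<le> x \<Longrightarrow> x < y \<Longrightarrow> y \<le> h \<Longrightarrow> clock \<alpha> f x < clock \<alpha> f y"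
    unfolding clock_def by (rule exp_functional_strict_mono[OF measurable_ln_path[OF f] G]) auto
  show cont: "continuous_on {0..h} (clock \<alpha> f)"
    unfolding clock_def[abs_def] by (rule exp_functional_continuous[OF measurable_ln_path[OF f] G])
  show life: "levy_life \<alpha> f = clock \<alpha> f h" using good by (simp add: levy_life_def h_def)
  show "0 < levy_life \<alpha> f" using mono[of 0 h] h(1) by (simp add: life clock_0)
  show hit: "clock_hit \<alpha> (clock \<alpha> f t) f = ennreal t" if "0 \<le> t" "t < h" for t
    by (rule clock_hit_eqI[OF f that(1) _ refl]) (use that h in \<open>simp add: ennreal_less_iff\<close>)
  show val: "levy_path \<alpha> (clock \<alpha> f t) f = ln \<bar>f t\<bar>" if "0 \<le> t" "t < h" for t
    using good that by (simp add: levy_path_def log_path_def hit)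
  show "s < levy_life \<alpha> f \<longleftrightarrow> clock_hit \<alpha> s f < \<infinity>" if s: "0 \<le> s" for s
  proof
    assume lt: "s < levy_life \<alpha> f"
    have "\<exists>u\<ge>0. u \<le> h \<and> clock \<alpha> f u = s"
      by (rule IVT') (use s lt h cont in \<open>auto simp: clock_0 life\<close>)
    then obtain u where u: "0 \<le> u" "u \<le> h" "clock \<alpha> f u = s" by blast
    then have "u < h" using lt life by (cases "u = h") auto
    then show "clock_hit \<alpha> s f < \<infinity>" using hit[of u] u by simp
  next
    assume "clock_hit \<alpha> s f < \<infinity>"
    then obtain m where m: "0 \<le> m" "ennreal m < exit_time f" "clock \<alpha> f m = s"
      by (rule clock_hit_finiteE[OF f s])
    then have "m < h" using h by (simp add: ennreal_less_iff)
    then show "s < levy_life \<alpha> f" using mono[of m h] m life by simp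
  qed
  show "cadlag (\<lambda>s. if s < levy_life \<alpha> f then levy_path \<alpha> s f else 0)"
  proof (rule cadlag_time_change[OF cadlag_ln_stopped_good[OF cad good] h(1), where I="clock \<alpha> f" and c=0])
    fix t assume t: "0 \<le> t" "t < h"
    show "(if clock \<alpha> f t < levy_life \<alpha> f then levy_path \<alpha> (clock \<alpha> f t) f else 0) =
      ln \<bar>stopped_path (enn2real (exit_time f)) f t\<bar>"
      using mono[OF t] t val[OF t] life by (simp add: stopped_path_eq h_def[symmetric])
  qed (use mono cont life in \<open>auto simp: clock_0\<close>)
qed

lemma killed_pair_levy_cadlag:
  assumes f: "f \<in> space path_space"
  shows "fst (killed_pair (levy_path \<alpha>) (levy_life \<alpha>) f) \<in> space path_space"
proof -
  have "cadlag (\<lambda>s. if s < levy_life \<alpha> f then levy_path \<alpha> s f else 0)"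
  proof (cases "good_path f")
    case True
    then show ?thesis by (rule good_path_clock(10)[OF f])
  next
    case False
    then have "(\<lambda>s. if s < levy_life \<alpha> f then levy_path \<alpha> s f else 0) = (\<lambda>_. 0)"
      by (auto simp: levy_path_def fun_eq_iff)
    then show ?thesis by (simp add: cadlag_const)
  qed
  then show ?thesis by (auto simp: space_path_space killed_pair_def intro: cadlag_restrict)
qed

text \<open>On a good path the clock and the exponential functional of the logarithm are inverse to each other, and
  the sign lost in the logarithm is constant before the exit.\<close>

lemma lamperti_traj_levy_path:
  assumes f: "f \<in> space path_space" and good: "good_path f" and \<epsilon>: "f 0 = \<epsilon>" "\<bar>\<epsilon>\<bar> = 1"
  shows "lamperti_traj \<alpha> \<epsilon> (\<lambda>t p. fst p t) snd (killed_pair (levy_path \<alpha>) (levy_life \<alpha>) f) = pre_exit_path f"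
proof -
  define h where "h = enn2real (exit_time f)"
  note h12 = good_path_clock(1,2)[OF f good, folded h_def]
  note gg = good_path_clock(3-10)[OF f good, where \<alpha>=\<alpha>, folded h_def]
  have cad: "cadlag f" using f by (rule path_spaceD)
  define \<xi> where "\<xi> = fst (killed_pair (levy_path \<alpha>) (levy_life \<alpha>) f)"
  define L where "L = levy_life \<alpha> f"
  have \<xi>: "\<xi> \<in> space path_space" unfolding \<xi>_def by (rule killed_pair_levy_cadlag[OF f])
  have kp: "killed_pair (levy_path \<alpha>) (levy_life \<alpha>) f = (\<xi>, L)"
    using gg(4) by (simp add: \<xi>_def L_def killed_pair_def)
  have \<xi>_eq: "\<xi> s = (if s < L then levy_path \<alpha> s f else 0)" if "0 \<le> s" for s
    using that by (simp add: \<xi>_def L_def killed_pair_def)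
  have clk0: "0 \<le> clock \<alpha> f t" if "0 \<le> t" "t \<le> h" for t
    using gg(1)[of 0 t] that by (cases "t = 0") (auto simp: clock_0)
  have L_eq: "L = clock \<alpha> f h" using gg(3) by (simp add: L_def)
  have \<xi>_clock: "\<xi> (clock \<alpha> f t) = ln \<bar>f t\<bar>" if "0 \<le> t" "t < h" for t
    using \<xi>_eq[OF clk0[of t]] gg(1)[of t h] gg(6)[of t] that by (simp add: L_eq)
  obtain G where G: "\<And>s. s \<in> {0..h} \<Longrightarrow> \<bar>ln \<bar>f s\<bar>\<bar> \<le> G"
    using ln_bounded_good[OF cad good] unfolding h_def by blast
  obtain G' where G': "\<And>s. s \<in> {0..L} \<Longrightarrow> \<bar>\<xi> s\<bar> \<le> G'"
    using cadlag_bounded[OF path_spaceD[OF \<xi>], of L] by blast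
  have nz: "f t \<noteq> 0" "0 < f 0 * f t" if "0 \<le> t" "t < h" for t
  proof -
    have "ennreal t < exit_time f" using that h12(2) by (simp add: ennreal_less_iff)
    then show "0 < f 0 * f t" by (rule less_exit_time_pos[OF cad that(1)])
    then show "f t \<noteq> 0" by auto
  qed
  have inverse: "exp_functional \<alpha> \<xi> (clock \<alpha> f t) = t" if t: "0 \<le> t" "t \<le> h" for t
  proof -
    have "exp_functional (- (- \<alpha>)) \<xi> (exp_functional (- \<alpha>) (\<lambda>u. ln \<bar>f u\<bar>) t) = t"
    proof (rule exp_functional_inverse[OF measurable_ln_path[OF f] G _ measurable_path_real[OF \<xi>] _ _ t])
      show "((\<lambda>u. ln \<bar>f u\<bar>) \<longlongrightarrow> ln \<bar>f t\<bar>) (at_right t)" if "0 \<le> t" "t < h" for t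
        by (intro tendsto_ln tendsto_rabs cadlag_right[OF cad that(1)]) (use nz that in auto)
      show "\<bar>\<xi> s\<bar> \<le> G'" if "s \<in> {0..exp_functional (- \<alpha>) (\<lambda>u. ln \<bar>f u\<bar>) h}" for s
        using that by (intro G') (simp add: L_eq clock_def)
      show "\<xi> (exp_functional (- \<alpha>) (\<lambda>u. ln \<bar>f u\<bar>) t) = ln \<bar>f t\<bar>" if "0 \<le> t" "t < h" for t
        using \<xi>_clock[OF that] by (simp add: clock_def)
    qed
    then show ?thesis by (simp add: clock_def)
  qed
  have life: "exp_functional \<alpha> \<xi> L = h" using inverse[of h] h12(1) L_eq by simp
  have val: "\<epsilon> * exp (\<xi> (lamperti_clock \<alpha> \<xi> t)) = f t" if t: "0 \<le> t" "t < h" for t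
  proof -
    have "lamperti_clock \<alpha> \<xi> t = clock \<alpha> f t"
      by (rule lamperti_clock_eqI[OF \<xi> clk0 inverse]) (use t in auto)
    then have "\<epsilon> * exp (\<xi> (lamperti_clock \<alpha> \<xi> t)) = \<epsilon> * \<bar>f t\<bar>" using \<xi>_clock[OF t] nz(1)[OF t] by simp
    also have "\<dots> = f t" using nz(2)[OF t] \<epsilon> by (auto simp: abs_if zero_less_mult_iff split: if_splits)
    finally show ?thesis .
  qed
  show ?thesis
    unfolding lamperti_traj_def kp fst_conv snd_conv life pre_exit_path_def h12(2) killed_traj_def
    using val by (auto simp: fun_eq_iff ennreal_less_iff)
qed

section \<open>The pieces are Lamperti transforms of killed Levy processes\<close>

lemma clock_hit_0: "f \<in> space path_space \<Longrightarrow> f 0 \<noteq> 0 \<Longrightarrow> clock_hit \<alpha> 0 f = 0"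
  using clock_hit_eqI[of f 0 \<alpha> 0] exit_time_pos[OF path_spaceD, of f] by (simp add: clock_0)

lemma log_path_0: "f \<in> space path_space \<Longrightarrow> \<bar>f 0\<bar> = 1 \<Longrightarrow> log_path \<alpha> 0 f = 0"
  using clock_hit_0[of f \<alpha>] by (auto simp: log_path_def)

context sign_changing_ssmp
begin

text \<open>Self-similarity and the strong Markov property at the times \<open>clock_hit\<close> make the increments of
  the logarithm stationary and independent as long as the path is alive.\<close>

lemma log_path_increments:
  fixes s :: "nat \<Rightarrow> real"
  assumes \<epsilon>: "\<bar>\<epsilon>\<bar> = 1" and s: "mono s" "s 0 = 0" and B: "\<And>i. B i \<in> sets borel"
  shows "emeasure (law \<epsilon>) {f\<in>space path_space. clock_hit \<alpha> (s n) f < \<infinity> \<and>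
      (\<forall>i<n. log_path \<alpha> (s (Suc i)) f - log_path \<alpha> (s i) f \<in> B i)} =
    (\<Prod>i<n. emeasure (law \<epsilon>) {f\<in>space path_space. clock_hit \<alpha> (s (Suc i) - s i) f < \<infinity> \<and>
      log_path \<alpha> (s (Suc i) - s i) f \<in> B i})"
  using s B
proof (induction n arbitrary: s B)
  case 0
  interpret prob_space "law \<epsilon>" by (rule prob_space_law)
  have "AE f in law \<epsilon>. clock_hit \<alpha> 0 f < \<infinity>"
    using AE_law_start[of \<epsilon>] AE_space by eventually_elim (use \<epsilon> in \<open>auto simp: space_law clock_hit_0\<close>)
  moreover have [measurable]: "clock_hit \<alpha> 0 \<in> borel_measurable path_space" by (rule measurable_clock_hit) simp
  ultimately have "emeasure (law \<epsilon>) {f\<in>space (law \<epsilon>). clock_hit \<alpha> 0 f < \<infinity>} = 1"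
    by (subst emeasure_eq_1_AE) (auto elim: eventually_mono)
  then show ?case using 0 by (simp add: space_law)
next
  case (Suc n)
  note B = Suc.prems(3)
  have mono: "s i \<le> s j" if "i \<le> j" for i j using Suc.prems(1) that by (simp add: monoD)
  have s0: "0 \<le> s i" for i using mono[of 0 i] Suc.prems by simp
  define d where "d = s (Suc 0)"
  define s' where "s' i = s (Suc i) - d" for i
  have d: "0 \<le> d" using s0 by (simp add: d_def)
  have s': "mono s'" "s' 0 = 0" using mono by (auto simp: mono_def s'_def d_def)
  have s'0: "0 \<le> s' i" for i using mono[of "Suc 0" "Suc i"] by (simp add: s'_def d_def)
  have sd: "s (Suc i) = d + s' i" for i by (simp add: s'_def)
  note [measurable] = B measurable_clock_hit[OF d] measurable_log_path[OF d] measurable_log_path[OF s0]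
    measurable_log_path[OF s'0] measurable_clock_hit[OF s0] measurable_clock_hit[OF s'0]
  define A where "A = {f\<in>space path_space. clock_hit \<alpha> d f < \<infinity> \<and> log_path \<alpha> d f \<in> B 0 \<and> f 0 = \<epsilon>}"
  define E where "E = {g\<in>space path_space. clock_hit \<alpha> (s' n) g < \<infinity> \<and>
    (\<forall>i<n. log_path \<alpha> (s' (Suc i)) g - log_path \<alpha> (s' i) g \<in> B (Suc i))}"
  have A_sets: "A \<in> sets path_space" unfolding A_def by measurable
  have E_sets: "E \<in> sets path_space" unfolding E_def by measurable
  let ?Z = "\<lambda>f. rshift f (enn2real (clock_hit \<alpha> d f))"
  have prior: "prior_event (clock_hit \<alpha> d) A"
    unfolding prior_event_def
  proof (intro conjI ballI allI impI A_sets)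
    fix f t assume f: "f \<in> space path_space" and t: "0 \<le> t" "clock_hit \<alpha> d f \<le> ennreal t"
    have eq: "clock_hit \<alpha> d (stopped_path t f) = clock_hit \<alpha> d f"
      by (rule path_stopping_time_stopped_path[where \<tau>="clock_hit \<alpha> d"])
         (use path_stopping_time_clock_hit[OF d] f t in auto)
    have "enn2real (clock_hit \<alpha> d f) \<le> t" using t by (simp add: enn2real_leI)
    then have "log_path \<alpha> d (stopped_path t f) = log_path \<alpha> d f"
      by (simp add: log_path_def eq stopped_path_eq)
    then show "f \<in> A \<longleftrightarrow> stopped_path t f \<in> A"
      using f stopped_path_in[OF f t(1)] t(1) by (simp add: A_def eq stopped_path_eq)
  qed
  have sgn: "sgn (f (enn2real (clock_hit \<alpha> d f))) = \<epsilon>" if f: "f \<in> A" for f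
  proof -
    have fS: "f \<in> space path_space" "clock_hit \<alpha> d f < \<infinity>" "f 0 = \<epsilon>" using f by (auto simp: A_def)
    obtain m where m: "0 \<le> m" "ennreal m < exit_time f" "clock_hit \<alpha> d f = ennreal m"
      using fS(2) by (rule clock_hit_finiteE[OF fS(1) d])
    have "0 < f 0 * f m" by (rule less_exit_time_pos[OF path_spaceD[OF fS(1)] m(1,2)])
    then show ?thesis using m \<epsilon> fS(3) by (auto simp: sgn_real_def zero_less_mult_iff abs_if split: if_splits)
  qed
  have "emeasure (law \<epsilon>) {f\<in>space path_space. clock_hit \<alpha> (s (Suc n)) f < \<infinity> \<and>
      (\<forall>i<Suc n. log_path \<alpha> (s (Suc i)) f - log_path \<alpha> (s i) f \<in> B i)} =
    emeasure (law \<epsilon>) {f\<in>A. ?Z f \<in> E}"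
  proof (rule emeasure_eq_AE)
    show "AE f in law \<epsilon>. f \<in> {f\<in>space path_space. clock_hit \<alpha> (s (Suc n)) f < \<infinity> \<and>
      (\<forall>i<Suc n. log_path \<alpha> (s (Suc i)) f - log_path \<alpha> (s i) f \<in> B i)} \<longleftrightarrow> f \<in> {f\<in>A. ?Z f \<in> E}"
      using AE_law_start[of \<epsilon>] AE_space
    proof eventually_elim
      case (elim f)
      then have f: "f \<in> space path_space" and f0: "f 0 = \<epsilon>" by (auto simp: space_law)
      have l0: "log_path \<alpha> 0 f = 0" using log_path_0[OF f] f0 \<epsilon> by simp
      have Z: "?Z f \<in> space path_space" using f by (intro rescaled_shift_in) auto
      show ?case
      proof (cases "clock_hit \<alpha> d f < \<infinity>")
        case False
        have "clock_hit \<alpha> d f \<le> clock_hit \<alpha> (s (Suc n)) f"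
          by (rule clock_hit_mono) (use s'0[of n] in \<open>simp add: sd\<close>)
        then have "\<not> clock_hit \<alpha> (s (Suc n)) f < \<infinity>" using False by (meson le_less_trans)
        then show ?thesis using False by (simp add: A_def)
      next
        case True
        have fin: "clock_hit \<alpha> (s (Suc n)) f < \<infinity> \<longleftrightarrow> clock_hit \<alpha> (s' n) (?Z f) < \<infinity>"
          unfolding sd by (rule log_path_add(1)[OF f d s'0 True])
        have "log_path \<alpha> (s (Suc i)) f = log_path \<alpha> d f + log_path \<alpha> (s' i) (?Z f)"
          if "clock_hit \<alpha> (s' n) (?Z f) < \<infinity>" "i \<le> n" for i
        proof -
          have "clock_hit \<alpha> (s' i) (?Z f) \<le> clock_hit \<alpha> (s' n) (?Z f)"
            by (rule clock_hit_mono) (use monoD[OF s'(1) that(2)] in simp)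
          then have "clock_hit \<alpha> (s' i) (?Z f) < \<infinity>" using that by (meson le_less_trans)
          then show ?thesis unfolding sd by (rule log_path_add(2)[OF f d s'0 True])
        qed
        then have incr: "(\<forall>i<n. log_path \<alpha> (s (Suc (Suc i))) f - log_path \<alpha> (s (Suc i)) f \<in> B (Suc i)) \<longleftrightarrow>
            (\<forall>i<n. log_path \<alpha> (s' (Suc i)) (?Z f) - log_path \<alpha> (s' i) (?Z f) \<in> B (Suc i))"
          if "clock_hit \<alpha> (s' n) (?Z f) < \<infinity>" using that by simp
        have "f \<in> {f\<in>space path_space. clock_hit \<alpha> (s (Suc n)) f < \<infinity> \<and>
            (\<forall>i<Suc n. log_path \<alpha> (s (Suc i)) f - log_path \<alpha> (s i) f \<in> B i)} \<longleftrightarrow>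
          clock_hit \<alpha> (s (Suc n)) f < \<infinity> \<and> log_path \<alpha> d f \<in> B 0 \<and>
            (\<forall>i<n. log_path \<alpha> (s (Suc (Suc i))) f - log_path \<alpha> (s (Suc i)) f \<in> B (Suc i))"
          using f l0 Suc.prems(2) unfolding All_less_Suc2 d_def by simp
        moreover have "f \<in> {f\<in>A. ?Z f \<in> E} \<longleftrightarrow> clock_hit \<alpha> (s' n) (?Z f) < \<infinity> \<and> log_path \<alpha> d f \<in> B 0 \<and>
            (\<forall>i<n. log_path \<alpha> (s' (Suc i)) (?Z f) - log_path \<alpha> (s' i) (?Z f) \<in> B (Suc i))"
          unfolding A_def E_def mem_Collect_eq using f f0 Z True by (simp only: simp_thms) blast
        ultimately show ?thesis using fin incr by blast
      qed
    qed
    have "{f\<in>space path_space. clock_hit \<alpha> (s (Suc n)) f < \<infinity> \<and>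
      (\<forall>i\<in>{..<Suc n}. log_path \<alpha> (s (Suc i)) f - log_path \<alpha> (s i) f \<in> B i)} \<in> sets path_space" by measurable
    then show "{f\<in>space path_space. clock_hit \<alpha> (s (Suc n)) f < \<infinity> \<and>
      (\<forall>i<Suc n. log_path \<alpha> (s (Suc i)) f - log_path \<alpha> (s i) f \<in> B i)} \<in> sets (law \<epsilon>)" by (simp add: sets_law Ball_def)
    have [measurable]: "?Z \<in> path_space \<rightarrow>\<^sub>M path_space" by (rule measurable_rescaled_shift) auto
    note [measurable] = A_sets E_sets
    have "{f\<in>A. ?Z f \<in> E} = {f\<in>space path_space. f \<in> A \<and> ?Z f \<in> E}" by (auto simp: A_def)
    then show "{f\<in>A. ?Z f \<in> E} \<in> sets (law \<epsilon>)" by (simp add: sets_law)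
  qed
  also have "\<dots> = emeasure (law \<epsilon>) A * emeasure (law \<epsilon>) E"
    by (rule strong_markov_rescaled[where \<tau>="clock_hit \<alpha> d"])
       (use path_stopping_time_clock_hit[OF d] prior E_sets sgn \<epsilon> in \<open>auto simp: A_def\<close>)
  also have "emeasure (law \<epsilon>) A = emeasure (law \<epsilon>) {f\<in>space path_space. clock_hit \<alpha> d f < \<infinity> \<and> log_path \<alpha> d f \<in> B 0}"
  proof (rule emeasure_eq_AE)
    show "AE f in law \<epsilon>. f \<in> A \<longleftrightarrow> f \<in> {f\<in>space path_space. clock_hit \<alpha> d f < \<infinity> \<and> log_path \<alpha> d f \<in> B 0}"
      using AE_law_start[of \<epsilon>] by eventually_elim (auto simp: A_def)
  qed (use A_sets in \<open>simp_all add: sets_law\<close>)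
  also have "emeasure (law \<epsilon>) E = (\<Prod>i<n. emeasure (law \<epsilon>) {f\<in>space path_space.
      clock_hit \<alpha> (s' (Suc i) - s' i) f < \<infinity> \<and> log_path \<alpha> (s' (Suc i) - s' i) f \<in> B (Suc i)})"
    unfolding E_def by (rule Suc.IH[OF s' B])
  finally show ?case
    unfolding prod.lessThan_Suc_shift by (simp add: s'_def d_def Suc.prems(2))
qed

text \<open>Good paths have full measure, and on them being alive at \<open>s\<close> means that the clock reaches \<open>s\<close> before
  the exit.\<close>

lemma killed_levy_law:
  assumes \<epsilon>: "\<bar>\<epsilon>\<bar> = 1"
  shows "killed_levy (law \<epsilon>) (levy_path \<alpha>) (levy_life \<alpha>)"
proof -
  interpret prob_space "law \<epsilon>" by (rule prob_space_law)
  have AE: "AE f in law \<epsilon>. good_path f \<and> f 0 = \<epsilon> \<and> f \<in> space path_space"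
    using AE_good[OF \<epsilon>] AE_law_start[of \<epsilon>] AE_space by eventually_elim (simp add: space_law)
  have alive: "AE f in law \<epsilon>. (r < levy_life \<alpha> f) = (clock_hit \<alpha> r f < \<infinity>)" if "0 \<le> r" for r
    using AE by eventually_elim (use good_path_clock(9)[OF _ _ that] in blast)
  show ?thesis
  proof
    fix t :: real assume "0 \<le> t"
    then show "levy_path \<alpha> t \<in> borel_measurable (law \<epsilon>)"
      using measurable_levy_path measurable_cong_sets[OF sets_law refl] by blast
  next
    show "levy_life \<alpha> \<in> borel_measurable (law \<epsilon>)" by measurable
  next
    fix f assume f: "f \<in> space (law \<epsilon>)" and l: "1 < levy_life \<alpha> f"
    have f': "f \<in> space path_space" using f by (simp add: space_law)
    show "cadlag (\<lambda>t. levy_path \<alpha> (min t 1) f)"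
    proof (cases "good_path f")
      case True
      have "cadlag (stopped_path 1 (\<lambda>s. if s < levy_life \<alpha> f then levy_path \<alpha> s f else 0))"
        by (rule cadlag_stopped_path[OF good_path_clock(10)[OF f' True]]) simp
      then show ?thesis by (rule cadlag_cong[rotated]) (use l in \<open>auto simp: stopped_path_def min_def\<close>)
    next
      case False
      then show ?thesis by (simp add: levy_path_def cadlag_const)
    qed
  next
    show "AE f in law \<epsilon>. levy_path \<alpha> 0 f = 0"
      using AE by eventually_elim (use \<epsilon> in \<open>simp add: levy_path_def log_path_0\<close>)
    show "AE f in law \<epsilon>. 0 < levy_life \<alpha> f"
      using AE by eventually_elim (use good_path_clock(6) in blast)
  next
    fix s :: "nat \<Rightarrow> real" and n and B :: "nat \<Rightarrow> real set"
    assume s: "mono s" "s 0 = 0" and B: "\<And>i. B i \<in> sets borel"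
    note [measurable] = B
    have mono: "s i \<le> s (Suc i)" for i using monoD[OF s(1), of i "Suc i"] by simp
    have s0: "0 \<le> s i" for i using monoD[OF s(1), of 0 i] s(2) by simp
    have s1: "0 \<le> s (Suc i) - s i" for i using mono[of i] by simp
    have m: "levy_path \<alpha> r \<in> borel_measurable (law \<epsilon>)" "log_path \<alpha> r \<in> borel_measurable (law \<epsilon>)"
      "clock_hit \<alpha> r \<in> borel_measurable (law \<epsilon>)" if "0 \<le> r" for r
      using measurable_levy_path[OF that] measurable_log_path[OF that] measurable_clock_hit[OF that]
        measurable_cong_sets[OF sets_law refl] by blast+
    note [measurable] = m[OF s0] m[OF s1]
    have "emeasure (law \<epsilon>) {f\<in>space (law \<epsilon>). s n < levy_life \<alpha> f \<and>
        (\<forall>i<n. levy_path \<alpha> (s (Suc i)) f - levy_path \<alpha> (s i) f \<in> B i)} =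
      emeasure (law \<epsilon>) {f\<in>space (law \<epsilon>). clock_hit \<alpha> (s n) f < \<infinity> \<and>
        (\<forall>i<n. log_path \<alpha> (s (Suc i)) f - log_path \<alpha> (s i) f \<in> B i)}"
    proof (rule emeasure_eq_AE)
      show "AE f in law \<epsilon>. f \<in> {f\<in>space (law \<epsilon>). s n < levy_life \<alpha> f \<and>
        (\<forall>i<n. levy_path \<alpha> (s (Suc i)) f - levy_path \<alpha> (s i) f \<in> B i)} \<longleftrightarrow>
        f \<in> {f\<in>space (law \<epsilon>). clock_hit \<alpha> (s n) f < \<infinity> \<and>
        (\<forall>i<n. log_path \<alpha> (s (Suc i)) f - log_path \<alpha> (s i) f \<in> B i)}"
        using AE alive[OF s0] by eventually_elim (auto simp: levy_path_def)
    qed measurable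
    also have "\<dots> = (\<Prod>i<n. emeasure (law \<epsilon>) {f\<in>space path_space. clock_hit \<alpha> (s (Suc i) - s i) f < \<infinity> \<and>
      log_path \<alpha> (s (Suc i) - s i) f \<in> B i})"
      unfolding space_law by (rule log_path_increments[OF \<epsilon> s B])
    also have "\<dots> = (\<Prod>i<n. emeasure (law \<epsilon>) {f\<in>space (law \<epsilon>). s (Suc i) - s i < levy_life \<alpha> f \<and>
      levy_path \<alpha> (s (Suc i) - s i) f \<in> B i})"
    proof (rule prod.cong[OF refl], rule emeasure_eq_AE)
      fix i
      show "AE f in law \<epsilon>. f \<in> {f\<in>space path_space. clock_hit \<alpha> (s (Suc i) - s i) f < \<infinity> \<and>
          log_path \<alpha> (s (Suc i) - s i) f \<in> B i} \<longleftrightarrow>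
        f \<in> {f\<in>space (law \<epsilon>). s (Suc i) - s i < levy_life \<alpha> f \<and> levy_path \<alpha> (s (Suc i) - s i) f \<in> B i}"
        using AE alive[OF s1] by eventually_elim (auto simp: levy_path_def space_law)
      show "{f\<in>space path_space. clock_hit \<alpha> (s (Suc i) - s i) f < \<infinity> \<and>
          log_path \<alpha> (s (Suc i) - s i) f \<in> B i} \<in> events"
        unfolding space_law[of \<epsilon>, symmetric] by measurable
    qed measurable
    finally show "prob {f\<in>space (law \<epsilon>). s n < levy_life \<alpha> f \<and>
        (\<forall>i<n. levy_path \<alpha> (s (Suc i)) f - levy_path \<alpha> (s i) f \<in> B i)} =
      (\<Prod>i<n. prob {f\<in>space (law \<epsilon>). s (Suc i) - s i < levy_life \<alpha> f \<and>
      levy_path \<alpha> (s (Suc i) - s i) f \<in> B i})"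
      unfolding emeasure_eq_measure prod_ennreal[OF measure_nonneg]
      by (subst (asm) ennreal_inj) (auto intro!: prod_nonneg)
  qed
qed

text \<open>Both sides are the image, under the Lamperti transform, of a killed path. The transform is measurable
  only on paths that are right-continuous with left limits, so the equality of the laws of the killed
  paths is first transferred to that subspace.\<close>

lemma pre_exit_path_lamperti:
  assumes \<epsilon>: "\<bar>\<epsilon>\<bar> = 1"
  shows "\<exists>(N :: ((real \<Rightarrow> real) \<times> real) measure) \<xi> \<zeta>.
    levy_process N \<xi> \<and> independent_exponential_time N \<xi> \<zeta> \<and>
    same_law (law \<epsilon>) pre_exit_path N (lamperti_traj \<alpha> \<epsilon> \<xi> \<zeta>) traj_space"
proof -
  interpret L: killed_levy "law \<epsilon>" "levy_path \<alpha>" "levy_life \<alpha>" by (rule killed_levy_law[OF \<epsilon>])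
  let ?N = "L.extension" and ?\<xi> = "\<lambda>t (p :: (real \<Rightarrow> real) \<times> real). fst p t"
  let ?\<Lambda> = "lamperti_traj \<alpha> \<epsilon> ?\<xi> snd"
  let ?\<kappa> = "killed_pair (levy_path \<alpha>) (levy_life \<alpha>)" and ?\<kappa>' = "killed_pair ?\<xi> snd"
  define R where "R = restrict_space killed_space {p. cadlag (fst p)}"
  have \<Lambda>R: "?\<Lambda> \<in> R \<rightarrow>\<^sub>M traj_space"
  proof (rule measurable_lamperti_traj)
    have "fst \<in> R \<rightarrow>\<^sub>M path_space" unfolding path_space_def
    proof (rule measurable_restrict_space2)
      show "fst \<in> R \<rightarrow>\<^sub>M traj_space" unfolding R_def by (intro measurable_restrict_space1 measurable_fst)
      show "fst \<in> space R \<rightarrow> {f. cadlag f}" by (auto simp: R_def space_restrict_space)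
    qed
    also have "?this \<longleftrightarrow> (\<lambda>p. \<lambda>t\<in>{0..}. fst p t) \<in> R \<rightarrow>\<^sub>M path_space"
      by (rule measurable_cong)
         (auto simp: R_def space_restrict_space space_pair_measure space_PiM PiE_def extensional_def fun_eq_iff)
    finally show "(\<lambda>p. \<lambda>t\<in>{0..}. fst p t) \<in> R \<rightarrow>\<^sub>M path_space" .
    show "snd \<in> borel_measurable R" unfolding R_def by (intro measurable_restrict_space1 measurable_snd)
  qed
  have \<kappa>K: "?\<kappa> \<in> law \<epsilon> \<rightarrow>\<^sub>M killed_space" by (rule measurable_killed_pair[OF L.Y_measurable L.life_measurable])
  have \<kappa>K': "?\<kappa>' \<in> ?N \<rightarrow>\<^sub>M killed_space"
    by (rule measurable_killed_pair[OF _ L.extension_snd]) (rule measurable_compose[OF L.extension_fst], measurable)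
  have cad: "cadlag (fst (?\<kappa> f))" if "f \<in> space (law \<epsilon>)" for f
    using killed_pair_levy_cadlag[of f \<alpha>] that by (simp add: space_law path_spaceD)
  have pcad: "cadlag (\<lambda>t. fst p t)" if "p \<in> space ?N" for p
    using that by (auto simp: L.space_extension path_spaceD)
  have cad': "cadlag (fst (?\<kappa>' p))" if p: "p \<in> space ?N" for p
  proof -
    have "cadlag (\<lambda>t. if t < max 0 (snd p) then fst p t else 0)" by (rule cadlag_freeze[OF pcad[OF p]]) simp
    then show ?thesis by (rule cadlag_cong[rotated]) (auto simp: killed_pair_def)
  qed
  have \<kappa>R: "?\<kappa> \<in> law \<epsilon> \<rightarrow>\<^sub>M R" "?\<kappa>' \<in> ?N \<rightarrow>\<^sub>M R"
    unfolding R_def using \<kappa>K \<kappa>K' cad cad' by (auto intro!: measurable_restrict_space2)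
  have eqR: "distr (law \<epsilon>) R ?\<kappa> = distr ?N R ?\<kappa>'"
  proof (rule measure_eqI)
    fix D assume "D \<in> sets (distr (law \<epsilon>) R ?\<kappa>)"
    then have D: "D \<in> sets R" by simp
    then obtain D' where D': "D' \<in> sets killed_space" "D = {p. cadlag (fst p)} \<inter> D'"
      by (auto simp: R_def sets_restrict_space)
    have "?\<kappa> -` D \<inter> space (law \<epsilon>) = ?\<kappa> -` D' \<inter> space (law \<epsilon>)" using D'(2) cad by auto
    moreover have "?\<kappa>' -` D \<inter> space ?N = ?\<kappa>' -` D' \<inter> space ?N" using D'(2) cad' by auto
    moreover have "emeasure (distr (law \<epsilon>) killed_space ?\<kappa>) D' = emeasure (distr ?N killed_space ?\<kappa>') D'"
      by (simp only: L.killed_pair_extension)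
    ultimately show "emeasure (distr (law \<epsilon>) R ?\<kappa>) D = emeasure (distr ?N R ?\<kappa>') D"
      using emeasure_distr[OF \<kappa>R(1) D] emeasure_distr[OF \<kappa>R(2) D]
        emeasure_distr[OF \<kappa>K D'(1)] emeasure_distr[OF \<kappa>K' D'(1)] by simp
  qed simp
  have eq': "?\<Lambda> (?\<kappa>' p) = ?\<Lambda> p" if p: "p \<in> space ?N" for p
    by (rule lamperti_traj_killed_pair[where \<xi>="?\<xi>" and x=p]) (rule pcad[OF p])
  have \<Lambda>N: "?\<Lambda> \<in> ?N \<rightarrow>\<^sub>M traj_space"
    using measurable_compose[OF \<kappa>R(2) \<Lambda>R] measurable_cong[of ?N "\<lambda>p. ?\<Lambda> (?\<kappa>' p)" ?\<Lambda>] eq' by blast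
  have pre: "pre_exit_path \<in> law \<epsilon> \<rightarrow>\<^sub>M traj_space"
    using measurable_pre_exit_path measurable_cong_sets[OF sets_law refl] by blast
  have "distr (law \<epsilon>) traj_space pre_exit_path = distr (law \<epsilon>) traj_space (\<lambda>f. ?\<Lambda> (?\<kappa> f))"
  proof (rule distr_cong_AE)
    show "AE f in law \<epsilon>. pre_exit_path f = ?\<Lambda> (?\<kappa> f)"
      using AE_good[OF \<epsilon>] AE_law_start[of \<epsilon>] AE_space
      by eventually_elim (use \<epsilon> in \<open>simp add: lamperti_traj_levy_path space_law\<close>)
  qed (use pre measurable_compose[OF \<kappa>R(1) \<Lambda>R] in auto)
  also have "\<dots> = distr (distr (law \<epsilon>) R ?\<kappa>) traj_space ?\<Lambda>"
    by (subst distr_distr[OF \<Lambda>R \<kappa>R(1)]) (simp add: comp_def)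
  also have "\<dots> = distr (distr ?N R ?\<kappa>') traj_space ?\<Lambda>" unfolding eqR ..
  also have "\<dots> = distr ?N traj_space (\<lambda>p. ?\<Lambda> (?\<kappa>' p))"
    by (subst distr_distr[OF \<Lambda>R \<kappa>R(2)]) (simp add: comp_def)
  also have "\<dots> = distr ?N traj_space ?\<Lambda>" by (rule distr_cong) (simp_all add: eq')
  finally have "same_law (law \<epsilon>) pre_exit_path ?N ?\<Lambda> traj_space"
    using pre \<Lambda>N by (simp add: same_law_def)
  then show ?thesis using L.levy_process_extension L.exponential_time_extension by blast
qed

section \<open>Independence of a piece and the jump that ends it\<close>

text \<open>The space factor of the rescaling cancels in the ratio.\<close>

lemma exit_ratio_rescaled_shift:
  assumes f: "f \<in> space path_space" and good: "good_path f" and t: "0 \<le> t" "ennreal t < exit_time f"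
  shows "exit_ratio (rshift f t) = exit_ratio f"
proof -
  let ?Z = "rshift f t" and ?a = "\<bar>f t\<bar> powr \<alpha>"
  have cad: "cadlag f" using f by (rule path_spaceD)
  have nz: "f t \<noteq> 0" using less_exit_time_pos[OF cad t] by auto
  then have a: "0 < ?a" by simp
  have ee: "exit_time f = ennreal t + ennreal ?a * exit_time ?Z" by (rule exit_time_rescaled_shift[OF cad t])
  have "exit_time f < \<infinity>" using good by (simp add: good_path_def)
  then have Zfin: "exit_time ?Z < \<infinity>"
    using a unfolding ee by (auto simp: less_top[symmetric] ennreal_mult_eq_top_iff)
  define z where "z = enn2real (exit_time ?Z)"
  have z: "exit_time ?Z = ennreal z" "0 \<le> z" using Zfin by (auto simp: z_def)
  have Z0: "?Z 0 \<noteq> 0" using nz by (simp add: rescaled_shift_0 sgn_real_def)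
  have z_pos: "0 < z"
    unfolding z_def by (rule real_exit_time_pos[OF cadlag_rescaled_shift[OF cad t(1)] Z0 Zfin])
  have e: "enn2real (exit_time f) = t + ?a * z"
    using t(1) z a by (simp add: ee ennreal_mult[symmetric] ennreal_plus[symmetric] del: ennreal_plus)
  have "left_lim ?Z z = left_lim (\<lambda>s. f (t + ?a * s) / \<bar>f t\<bar>) z"
    by (rule left_lim_cong) (simp add: rescaled_shift_eq)
  also have "\<dots> = left_lim f (t + ?a * z) / \<bar>f t\<bar>" by (rule left_lim_affine[OF cad t(1) a z_pos])
  finally show ?thesis
    using nz z(2) unfolding exit_ratio_def e z_def[symmetric] by (simp add: rescaled_shift_eq)
qed

text \<open>Whatever the path has done up to a time \<open>t\<close> before its exit, the ratio at the exit is that of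
  the rescaled path after \<open>t\<close>, hence independent of the past. The events of this kind generate the
  path up to its exit.\<close>

lemma alive_exit_ratio_indep:
  assumes \<epsilon>: "\<bar>\<epsilon>\<bar> = 1" and t: "0 \<le> t" and S: "finite S" "S \<subseteq> {0..t}" and B: "\<And>s. B s \<in> sets borel"
    and C: "C \<in> sets borel"
  shows "emeasure (law \<epsilon>) {f\<in>space path_space. t < enn2real (exit_time f) \<and> (\<forall>s\<in>S. f s \<in> B s) \<and> exit_ratio f \<in> C} =
    emeasure (law \<epsilon>) {f\<in>space path_space. t < enn2real (exit_time f) \<and> (\<forall>s\<in>S. f s \<in> B s)} *
    emeasure (law \<epsilon>) {f\<in>space path_space. exit_ratio f \<in> C}"
proof -
  note [measurable] = B C
  define A where "A = {f\<in>space path_space. (ennreal t < exit_time f \<and> f 0 = \<epsilon>) \<and> (\<forall>s\<in>S. f s \<in> B s)}"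
  define E where "E = {g\<in>space path_space. exit_ratio g \<in> C}"
  have SB: "{f\<in>space path_space. \<forall>s\<in>S. f s \<in> B s} \<in> sets path_space"
    by (intro sets.sets_Collect_finite_All S) measurable
  have A_sets: "A \<in> sets path_space" unfolding A_def
    by (intro sets.sets_Collect_conj SB) measurable
  have E_sets: "E \<in> sets path_space" unfolding E_def by measurable
  have Z: "(\<lambda>f. rshift f t) \<in> path_space \<rightarrow>\<^sub>M path_space" by (rule measurable_rescaled_shift) (use t in auto)
  have prior: "prior_event (\<lambda>_. ennreal t) A"
    unfolding prior_event_def
  proof (intro conjI ballI allI impI A_sets)
    fix f u assume f: "f \<in> space path_space" and u: "0 \<le> u" "ennreal t \<le> ennreal u"
    have tu: "t \<le> u" using u by (simp add: ennreal_le_iff)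
    have "stopped_path u f s = f s" if "s \<in> S" for s using that S tu by (intro stopped_path_eq) auto
    then show "f \<in> A \<longleftrightarrow> stopped_path u f \<in> A"
      using f stopped_path_in[OF f u(1)] exit_time_stopped_path_iff[OF path_spaceD[OF f] t tu] u(1)
      by (simp add: A_def stopped_path_eq)
  qed
  have AE: "AE f in law \<epsilon>. good_path f \<and> f 0 = \<epsilon> \<and> f \<in> space path_space"
    using AE_good[OF \<epsilon>] AE_law_start[of \<epsilon>] AE_space by eventually_elim (simp add: space_law)
  have lt: "t < enn2real (exit_time f) \<longleftrightarrow> ennreal t < exit_time f" if "good_path f" "f \<in> space path_space" for f
    using good_pathD(2)[OF that(1) path_spaceD[OF that(2)]] t
    by (metis ennreal_less_iff)
  have m1: "{f\<in>space path_space. t < enn2real (exit_time f) \<and> (\<forall>s\<in>S. f s \<in> B s) \<and> exit_ratio f \<in> C} \<in> sets path_space"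
    by (intro sets.sets_Collect_conj SB) measurable
  have m2: "{f\<in>space path_space. t < enn2real (exit_time f) \<and> (\<forall>s\<in>S. f s \<in> B s)} \<in> sets path_space"
    by (intro sets.sets_Collect_conj SB) measurable
  have m3: "{f\<in>A. rshift f t \<in> E} \<in> sets path_space"
  proof -
    have "{f\<in>A. rshift f t \<in> E} = A \<inter> ((\<lambda>f. rshift f t) -` E \<inter> space path_space)" by (auto simp: A_def)
    then show ?thesis using A_sets measurable_sets[OF Z E_sets] by simp
  qed
  have "emeasure (law \<epsilon>) {f\<in>space path_space. t < enn2real (exit_time f) \<and> (\<forall>s\<in>S. f s \<in> B s) \<and> exit_ratio f \<in> C} =
    emeasure (law \<epsilon>) {f\<in>A. rshift f t \<in> E}"
  proof (rule emeasure_eq_AE)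
    show "AE f in law \<epsilon>. f \<in> {f\<in>space path_space. t < enn2real (exit_time f) \<and> (\<forall>s\<in>S. f s \<in> B s) \<and> exit_ratio f \<in> C} \<longleftrightarrow>
      f \<in> {f\<in>A. rshift f t \<in> E}"
      using AE
    proof eventually_elim
      case (elim f)
      then show ?case
        using lt[of f] exit_ratio_rescaled_shift[of f t] rescaled_shift_in[of f t \<alpha>] t by (auto simp: A_def E_def)
    qed
  qed (use m1 m3 in \<open>simp_all add: sets_law\<close>)
  also have "\<dots> = emeasure (law \<epsilon>) A * emeasure (law \<epsilon>) E"
  proof -
    have "emeasure (law \<epsilon>) {f\<in>A. rshift f (enn2real (ennreal t)) \<in> E} = emeasure (law \<epsilon>) A * emeasure (law \<epsilon>) E"
    proof (rule strong_markov_rescaled[OF path_stopping_time_const prior E_sets])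
      fix f assume f: "f \<in> A"
      have "0 < f 0 * f t" using f by (intro less_exit_time_pos t) (auto simp: A_def path_spaceD)
      then show "sgn (f (enn2real (ennreal t))) = \<epsilon>"
        using f \<epsilon> t by (auto simp: A_def sgn_real_def zero_less_mult_iff abs_if split: if_splits)
    qed (use \<epsilon> in auto)
    then show ?thesis using t by simp
  qed
  also have "emeasure (law \<epsilon>) A = emeasure (law \<epsilon>) {f\<in>space path_space. t < enn2real (exit_time f) \<and> (\<forall>s\<in>S. f s \<in> B s)}"
  proof (rule emeasure_eq_AE)
    show "AE f in law \<epsilon>. f \<in> A \<longleftrightarrow> f \<in> {f\<in>space path_space. t < enn2real (exit_time f) \<and> (\<forall>s\<in>S. f s \<in> B s)}"
      using AE by eventually_elim (use lt in \<open>auto simp: A_def\<close>)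
  qed (use A_sets m2 in \<open>simp_all add: sets_law\<close>)
  finally show ?thesis unfolding E_def .
qed

text \<open>Conditioning on the value of the ratio does not change the probabilities of the generating events,
  hence not the law of the killed path.\<close>

lemma pre_exit_path_exit_ratio_indep:
  assumes \<epsilon>: "\<bar>\<epsilon>\<bar> = 1" and D: "D \<in> sets traj_space" and C: "C \<in> sets borel"
  shows "emeasure (law \<epsilon>) {f\<in>space path_space. pre_exit_path f \<in> D \<and> exit_ratio f \<in> C} =
    emeasure (law \<epsilon>) {f\<in>space path_space. pre_exit_path f \<in> D} *
    emeasure (law \<epsilon>) {f\<in>space path_space. exit_ratio f \<in> C}"
proof -
  interpret prob_space "law \<epsilon>" by (rule prob_space_law)
  note [measurable] = C D
  define E where "E = {f\<in>space path_space. exit_ratio f \<in> C}"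
  have E: "E \<in> sets (law \<epsilon>)" unfolding E_def by measurable
  have D_sets: "{f\<in>space path_space. pre_exit_path f \<in> D} \<in> sets (law \<epsilon>)" by measurable
  show ?thesis
  proof (cases "emeasure (law \<epsilon>) E = 0")
    case True
    have "emeasure (law \<epsilon>) {f\<in>space path_space. pre_exit_path f \<in> D \<and> exit_ratio f \<in> C} \<le> emeasure (law \<epsilon>) E"
      by (rule emeasure_mono[OF _ E]) (auto simp: E_def)
    then show ?thesis using True by (simp add: E_def)
  next
    case False
    define N where "N = uniform_measure (law \<epsilon>) E"
    have N: "prob_space N" unfolding N_def by (rule prob_space_uniform_measure[OF False]) simp
    have sets_N: "sets N = sets path_space" by (simp add: N_def sets_law)
    have space_N: "space N = space path_space" by (simp add: N_def space_law)
    have N_eq: "emeasure N V = emeasure (law \<epsilon>) (E \<inter> V) / emeasure (law \<epsilon>) E" if "V \<in> sets path_space" for V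
      unfolding N_def by (rule emeasure_uniform_measure[OF E]) (simp add: sets_law that)
    let ?e = "\<lambda>f. enn2real (exit_time f)"
    let ?\<kappa> = "killed_pair (\<lambda>t f. f t) ?e"
    have coord_m: "(\<lambda>f. f t) \<in> borel_measurable (law \<epsilon>)" "(\<lambda>f. f t) \<in> borel_measurable N" for t
      using measurable_path_space_coord measurable_cong_sets[OF sets_law refl] measurable_cong_sets[OF sets_N refl] by blast+
    have e_m: "?e \<in> borel_measurable (law \<epsilon>)" "?e \<in> borel_measurable N"
      using measurable_real_exit_time measurable_cong_sets[OF sets_law refl] measurable_cong_sets[OF sets_N refl] by blast+
    have eq: "distr (law \<epsilon>) killed_space ?\<kappa> = distr N killed_space ?\<kappa>"
    proof (rule killed_pair_law_eqI[OF prob_space_axioms N coord_m(1) coord_m(2) e_m])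
      fix t :: real and S and B :: "real \<Rightarrow> real set"
      assume t: "0 \<le> t" and S: "finite S" "S \<subseteq> {0..t}" and B: "\<And>s. B s \<in> sets borel"
      note [measurable] = B
      let ?V = "{f\<in>space path_space. t < ?e f \<and> (\<forall>s\<in>S. f s \<in> B s)}"
      have SB: "{f\<in>space path_space. \<forall>s\<in>S. f s \<in> B s} \<in> sets path_space"
        by (intro sets.sets_Collect_finite_All S) measurable
      have V: "?V \<in> sets path_space" by (intro sets.sets_Collect_conj SB) measurable
      have "E \<inter> ?V = {f\<in>space path_space. t < ?e f \<and> (\<forall>s\<in>S. f s \<in> B s) \<and> exit_ratio f \<in> C}"
        by (auto simp: E_def)
      then have "emeasure N ?V = emeasure (law \<epsilon>) ?V * emeasure (law \<epsilon>) E / emeasure (law \<epsilon>) E"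
        unfolding N_eq[OF V] using alive_exit_ratio_indep[OF \<epsilon> t S B C] by (simp add: E_def)
      also have "\<dots> = emeasure (law \<epsilon>) ?V"
        by (rule ennreal_mult_divide_eq[OF False]) simp
      finally show "emeasure (law \<epsilon>) {f\<in>space (law \<epsilon>). t < ?e f \<and> (\<forall>s\<in>S. f s \<in> B s)} =
        emeasure N {f\<in>space N. t < ?e f \<and> (\<forall>s\<in>S. f s \<in> B s)}" by (simp add: space_law space_N)
    qed
    define \<Theta> :: "(real \<Rightarrow> real) \<times> real \<Rightarrow> real \<Rightarrow> ereal" where "\<Theta> p = killed_traj (ennreal (snd p)) (fst p)" for p
    have \<Theta>: "\<Theta> \<in> killed_space \<rightarrow>\<^sub>M traj_space"
      unfolding \<Theta>_def[abs_def]
    proof (rule measurable_killed_traj)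
      show "(\<lambda>p. fst p t) \<in> borel_measurable (killed_space :: ((real \<Rightarrow> real) \<times> real) measure)" if "0 \<le> t" for t
        using that by (intro measurable_compose[OF measurable_fst] measurable_component_singleton) simp
    qed measurable
    have \<Theta>_eq: "\<Theta> (?\<kappa> f) = pre_exit_path f" if good: "good_path f" and f: "f \<in> space path_space" for f
    proof -
      obtain e where e: "exit_time f = ennreal e" "0 < e"
        using good_pathD(2,3)[OF good path_spaceD[OF f]] by metis
      then show ?thesis by (auto simp: \<Theta>_def killed_pair_def pre_exit_path_def killed_traj_def fun_eq_iff ennreal_less_iff)
    qed
    let ?W = "{f\<in>space path_space. ?\<kappa> f \<in> \<Theta> -` D \<inter> space killed_space}"
    have \<kappa>_m: "?\<kappa> \<in> path_space \<rightarrow>\<^sub>M killed_space" by (rule measurable_killed_pair) measurable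
    have \<Theta>D: "\<Theta> -` D \<inter> space killed_space \<in> sets killed_space" by (rule measurable_sets[OF \<Theta> D])
    have W: "?W \<in> sets path_space"
      using measurable_sets[OF \<kappa>_m \<Theta>D] by (simp add: vimage_def Int_def conj_commute conj_left_commute)
    have W_eq: "f \<in> ?W \<longleftrightarrow> pre_exit_path f \<in> D" if "good_path f" "f \<in> space path_space" for f
      using \<Theta>_eq[OF that] that measurable_space[OF \<kappa>_m] by auto
    have AE: "AE f in law \<epsilon>. good_path f \<and> f \<in> space path_space"
      using AE_good[OF \<epsilon>] AE_space by eventually_elim (simp add: space_law)
    have "emeasure (law \<epsilon>) ?W = emeasure N ?W"
    proof -
      have "?\<kappa> -` (\<Theta> -` D \<inter> space killed_space) \<inter> space path_space = ?W" by auto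
      then show ?thesis
        using arg_cong[OF eq, of "\<lambda>M. emeasure M (\<Theta> -` D \<inter> space killed_space)"]
          emeasure_distr[of ?\<kappa> "law \<epsilon>" killed_space "\<Theta> -` D \<inter> space killed_space"]
          emeasure_distr[of ?\<kappa> N killed_space "\<Theta> -` D \<inter> space killed_space"] \<Theta>D
          measurable_killed_pair[OF coord_m(1) e_m(1)] measurable_killed_pair[OF coord_m(2) e_m(2)]
        by (simp add: space_law space_N)
    qed
    also have "\<dots> = emeasure (law \<epsilon>) (E \<inter> ?W) / emeasure (law \<epsilon>) E" by (rule N_eq[OF W])
    finally have "emeasure (law \<epsilon>) ?W * emeasure (law \<epsilon>) E =
        emeasure (law \<epsilon>) E * (emeasure (law \<epsilon>) (E \<inter> ?W) / emeasure (law \<epsilon>) E)"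
      by (simp only: mult.commute)
    also have "\<dots> = emeasure (law \<epsilon>) (E \<inter> ?W) * emeasure (law \<epsilon>) E / emeasure (law \<epsilon>) E"
      unfolding ennreal_times_divide by (simp only: mult.commute)
    also have "\<dots> = emeasure (law \<epsilon>) (E \<inter> ?W)" by (rule ennreal_mult_divide_eq[OF False]) simp
    finally have "emeasure (law \<epsilon>) ?W * emeasure (law \<epsilon>) E = emeasure (law \<epsilon>) (E \<inter> ?W)" .
    moreover have "emeasure (law \<epsilon>) ?W = emeasure (law \<epsilon>) {f\<in>space path_space. pre_exit_path f \<in> D}"
    proof (rule emeasure_eq_AE)
      show "AE f in law \<epsilon>. f \<in> ?W \<longleftrightarrow> f \<in> {f\<in>space path_space. pre_exit_path f \<in> D}"
        using AE by eventually_elim (use W_eq in auto)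
    qed (use W D_sets in \<open>simp_all add: sets_law\<close>)
    moreover have "emeasure (law \<epsilon>) (E \<inter> ?W) = emeasure (law \<epsilon>) {f\<in>space path_space. pre_exit_path f \<in> D \<and> exit_ratio f \<in> C}"
    proof (rule emeasure_eq_AE)
      show "AE f in law \<epsilon>. f \<in> E \<inter> ?W \<longleftrightarrow> f \<in> {f\<in>space path_space. pre_exit_path f \<in> D \<and> exit_ratio f \<in> C}"
        using AE by eventually_elim (use W_eq in \<open>auto simp: E_def\<close>)
      show "E \<inter> ?W \<in> sets (law \<epsilon>)" using E W by (simp add: sets_law)
    qed measurable
    ultimately show ?thesis by (simp add: E_def)
  qed
qed

section \<open>From the laws on path space to the process\<close>

lemma piece_measurable: "piece \<alpha> X n \<in> P x \<rightarrow>\<^sub>M traj_space"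
  using measurable_compose[OF traj_measurable_P[of x] measurable_piece[of \<alpha> n]] by (simp add: piece_traj)

lemma jump_ratio_measurable: "jump_ratio X n \<in> borel_measurable (P x)"
  using measurable_compose[OF traj_measurable_P[of x] measurable_jump_ratio[of n]] by (simp add: jump_ratio_traj)

lemma AE_piece_jump_ratio:
  assumes x: "x \<noteq> 0"
  shows "AE \<omega> in P x. piece \<alpha> X n \<omega> = pre_exit_path (nth_path \<alpha> n (traj X \<omega>)) \<and>
    jump_ratio X n \<omega> = exit_ratio (nth_path \<alpha> n (traj X \<omega>))"
proof -
  have "AE \<omega> in P x. \<forall>k. good_path (nth_path \<alpha> k (traj X \<omega>))"
    using AE_nth_path_good[OF x] unfolding law_def by (subst (asm) AE_distr_iff) auto
  then show ?thesis using AE_space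
  proof eventually_elim
    case (elim \<omega>)
    then have "traj X \<omega> \<in> space path_space" by (simp add: traj_in space_P)
    from piece_jump_ratio_eq[OF this, of \<alpha> n] elim show ?case by (simp add: piece_traj jump_ratio_traj)
  qed
qed

lemma same_law_if_prob_eq:
  assumes Y: "Y \<in> M1 \<rightarrow>\<^sub>M S" and Z: "Z \<in> M2 \<rightarrow>\<^sub>M S"
    and eq: "\<And>C. C \<in> sets S \<Longrightarrow> emeasure M1 {\<omega>\<in>space M1. Y \<omega> \<in> C} = emeasure M2 {\<omega>\<in>space M2. Z \<omega> \<in> C}"
  shows "same_law M1 Y M2 Z S"
  unfolding same_law_def
proof (intro conjI Y Z measure_eqI)
  fix C assume "C \<in> sets (distr M1 S Y)"
  then have C: "C \<in> sets S" by simp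
  show "emeasure (distr M1 S Y) C = emeasure (distr M2 S Z) C"
    using eq[OF C] by (simp add: emeasure_distr[OF Y C] emeasure_distr[OF Z C] vimage_def Int_def conj_commute)
qed simp

lemma sgn_power_abs: "x \<noteq> 0 \<Longrightarrow> \<bar>sgn x * (-1) ^ n\<bar> = (1 :: real)"
  by (simp add: abs_mult)

lemma piece_law:
  assumes "x \<noteq> 0" "C \<in> sets traj_space"
  shows "emeasure (P x) {\<omega>\<in>space (P x). piece \<alpha> X n \<omega> \<in> C} =
    emeasure (law (sgn x * (-1) ^ n)) {f\<in>space path_space. pre_exit_path f \<in> C}"
  by (rule functional_law[OF assms(1) measurable_pre_exit_path piece_measurable _ assms(2)])
     (use AE_piece_jump_ratio[OF assms(1)] in \<open>auto elim: eventually_mono\<close>)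

lemma jump_ratio_law:
  assumes "x \<noteq> 0" "C \<in> sets borel"
  shows "emeasure (P x) {\<omega>\<in>space (P x). jump_ratio X n \<omega> \<in> C} =
    emeasure (law (sgn x * (-1) ^ n)) {f\<in>space path_space. exit_ratio f \<in> C}"
  by (rule functional_law[OF assms(1) measurable_exit_ratio jump_ratio_measurable _ assms(2)])
     (use AE_piece_jump_ratio[OF assms(1)] in \<open>auto elim: eventually_mono\<close>)

lemma pre_exit_path_stopped_path:
  assumes "f \<in> space path_space" "0 \<le> t" "exit_time f \<le> ennreal t"
  shows "pre_exit_path (stopped_path t f) = pre_exit_path f" "exit_ratio (stopped_path t f) = exit_ratio f"
proof -
  have "stopped_path t f s = f s" if "0 \<le> s" "ennreal s < exit_time f" for s
  proof -
    have "ennreal s < ennreal t" by (rule less_le_trans[OF that(2) assms(3)])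
    then show ?thesis using that by (intro stopped_path_eq) (auto simp: ennreal_less_iff)
  qed
  then show "pre_exit_path (stopped_path t f) = pre_exit_path f"
    unfolding pre_exit_path_def killed_traj_def good_path_stopped_path(1)[OF assms] by (auto simp: fun_eq_iff)
  show "exit_ratio (stopped_path t f) = exit_ratio f"
    unfolding exit_ratio_def good_path_stopped_path(1,2,3)[OF assms] ..
qed

lemma pieces_indep:
  assumes x: "x \<noteq> 0"
  shows "prob_space.indep_vars (P x) (\<lambda>_. traj_space) (piece \<alpha> X) UNIV"
  by (rule functional_indep[OF x measurable_pre_exit_path pre_exit_path_stopped_path(1) piece_measurable])
     (use AE_piece_jump_ratio[OF x] in \<open>auto elim: eventually_mono\<close>)

lemma jump_ratios_indep:
  assumes x: "x \<noteq> 0"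
  shows "prob_space.indep_vars (P x) (\<lambda>_. borel) (jump_ratio X) UNIV"
  by (rule functional_indep[OF x measurable_exit_ratio pre_exit_path_stopped_path(2) jump_ratio_measurable])
     (use AE_piece_jump_ratio[OF x] in \<open>auto elim: eventually_mono\<close>)

text \<open>A path started from \<open>1\<close> or \<open>-1\<close> is its own rescaled path at time \<open>0\<close>.\<close>

lemma AE_first_piece_eq:
  assumes \<epsilon>: "\<bar>\<epsilon>\<bar> = 1"
  shows "AE \<omega> in P \<epsilon>. killed_traj (sign_change_time X 1 \<omega>) (\<lambda>t. X t \<omega>) = pre_exit_path (traj X \<omega>)"
proof -
  have "AE \<omega> in P \<epsilon>. good_path (traj X \<omega>)"
    using AE_good[OF \<epsilon>] unfolding law_def by (subst (asm) AE_distr_iff) auto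
  then show ?thesis using start[of \<epsilon>] AE_space
  proof eventually_elim
    case (elim \<omega>)
    let ?f = "traj X \<omega>"
    have f: "?f \<in> space path_space" using elim by (simp add: traj_in space_P)
    have f0: "?f 0 = \<epsilon>" using elim by (simp add: traj_eq)
    have Z: "rshift ?f 0 = ?f" using f f0 \<epsilon>
      by (auto simp: rescaled_shift_def space_path_space extensional_def fun_eq_iff)
    have "sign_change_time coord (Suc 0) ?f = ennreal (0 + \<bar>?f 0\<bar> powr \<alpha> * enn2real (exit_time (rshift ?f 0)))"
      by (rule sign_change_time_rescaled[OF path_spaceD[OF f]]) (use elim f0 \<epsilon> Z in auto)
    also have "\<dots> = exit_time ?f"
      unfolding Z using f0 \<epsilon> good_pathD(2)[OF elim(1) path_spaceD[OF f]] by simp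
    finally have "sign_change_time X 1 \<omega> = exit_time ?f"
      unfolding sign_change_time_traj by simp
    then show ?case by (auto simp: pre_exit_path_def killed_traj_def traj_eq fun_eq_iff)
  qed
qed

lemma first_piece_measurable:
  "(\<lambda>\<omega>. killed_traj (sign_change_time X 1 \<omega>) (\<lambda>t. X t \<omega>)) \<in> P x \<rightarrow>\<^sub>M traj_space"
proof (rule measurable_killed_traj)
  have "(\<lambda>\<omega>. sign_change_time coord 1 (traj X \<omega>)) \<in> borel_measurable (P x)"
    by (rule measurable_compose[OF traj_measurable_P measurable_sign_change_time])
  then show "sign_change_time X 1 \<in> borel_measurable (P x)" by (simp only: sign_change_time_traj)
  show "X t \<in> borel_measurable (P x)" if "0 \<le> t" for t
    using X_measurable_M[OF that] measurable_cong_sets[OF sets_P refl] by blast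
qed

lemma piece_same_law_first:
  assumes x: "x \<noteq> 0"
  shows "same_law (P x) (piece \<alpha> X n) (P (sgn x * (-1) ^ n))
    (\<lambda>\<omega>. killed_traj (sign_change_time X 1 \<omega>) (\<lambda>t. X t \<omega>)) traj_space"
proof (rule same_law_if_prob_eq[OF piece_measurable first_piece_measurable])
  let ?\<epsilon> = "sgn x * (-1) ^ n"
  fix C :: "(real \<Rightarrow> ereal) set" assume C [measurable]: "C \<in> sets traj_space"
  have "emeasure (P ?\<epsilon>) {\<omega>\<in>space (P ?\<epsilon>). killed_traj (sign_change_time X 1 \<omega>) (\<lambda>t. X t \<omega>) \<in> C} =
    emeasure (law ?\<epsilon>) {f\<in>space path_space. pre_exit_path f \<in> C}"
  proof (rule measure_traj_eq)
    show "AE \<omega> in P ?\<epsilon>. (killed_traj (sign_change_time X 1 \<omega>) (\<lambda>t. X t \<omega>) \<in> C) = (pre_exit_path (traj X \<omega>) \<in> C)"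
      using AE_first_piece_eq[OF sgn_power_abs[OF x]] by eventually_elim simp
    show "{\<omega>\<in>space (P ?\<epsilon>). killed_traj (sign_change_time X 1 \<omega>) (\<lambda>t. X t \<omega>) \<in> C} \<in> sets (P ?\<epsilon>)"
      using measurable_sets[OF first_piece_measurable C] by (simp add: vimage_def Int_def conj_commute)
  qed measurable
  then show "emeasure (P x) {\<omega>\<in>space (P x). piece \<alpha> X n \<omega> \<in> C} =
    emeasure (P ?\<epsilon>) {\<omega>\<in>space (P ?\<epsilon>). killed_traj (sign_change_time X 1 \<omega>) (\<lambda>t. X t \<omega>) \<in> C}"
    using piece_law[OF x C] by simp
qed

lemma piece_same_law_lamperti:
  assumes x: "x \<noteq> 0"
  shows "\<exists>(N :: ((real \<Rightarrow> real) \<times> real) measure) \<xi> \<zeta>.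
    levy_process N \<xi> \<and> independent_exponential_time N \<xi> \<zeta> \<and>
    same_law (P x) (piece \<alpha> X n) N (lamperti_traj \<alpha> (sgn x * (-1) ^ n) \<xi> \<zeta>) traj_space"
proof -
  let ?\<epsilon> = "sgn x * (-1) ^ n"
  obtain N :: "((real \<Rightarrow> real) \<times> real) measure" and \<xi> \<zeta> where N: "levy_process N \<xi>" "independent_exponential_time N \<xi> \<zeta>"
    "same_law (law ?\<epsilon>) pre_exit_path N (lamperti_traj \<alpha> ?\<epsilon> \<xi> \<zeta>) traj_space"
    using pre_exit_path_lamperti[OF sgn_power_abs[OF x]] by blast
  have "same_law (P x) (piece \<alpha> X n) (law ?\<epsilon>) pre_exit_path traj_space"
  proof (rule same_law_if_prob_eq[OF piece_measurable])
    show "pre_exit_path \<in> law ?\<epsilon> \<rightarrow>\<^sub>M traj_space" using N(3) by (simp add: same_law_def)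
    fix C :: "(real \<Rightarrow> ereal) set" assume "C \<in> sets traj_space"
    from piece_law[OF x this, of n]
    show "emeasure (P x) {\<omega>\<in>space (P x). piece \<alpha> X n \<omega> \<in> C} =
      emeasure (law ?\<epsilon>) {f\<in>space (law ?\<epsilon>). pre_exit_path f \<in> C}" by (simp add: space_law)
  qed
  then have "same_law (P x) (piece \<alpha> X n) N (lamperti_traj \<alpha> ?\<epsilon> \<xi> \<zeta>) traj_space"
    using N(3) by (simp add: same_law_def)
  then show ?thesis using N by blast
qed

lemma jump_ratio_same_law:
  assumes x: "x \<noteq> 0"
  shows "same_law (P x) (jump_ratio X n) (P (sgn x * (-1) ^ n)) (jump_ratio X 0) borel"
proof (rule same_law_if_prob_eq[OF jump_ratio_measurable jump_ratio_measurable])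
  let ?\<epsilon> = "sgn x * (-1) ^ n"
  fix C :: "real set" assume C: "C \<in> sets borel"
  have \<epsilon>: "\<bar>?\<epsilon>\<bar> = 1" by (rule sgn_power_abs[OF x])
  then have "?\<epsilon> \<noteq> 0" by auto
  have "sgn ?\<epsilon> = ?\<epsilon>" using \<epsilon> by (cases "0 < ?\<epsilon>") (auto simp: sgn_real_def abs_if split: if_splits)
  then show "emeasure (P x) {\<omega>\<in>space (P x). jump_ratio X n \<omega> \<in> C} =
    emeasure (P ?\<epsilon>) {\<omega>\<in>space (P ?\<epsilon>). jump_ratio X 0 \<omega> \<in> C}"
    using jump_ratio_law[OF x C, of n] jump_ratio_law[OF \<open>?\<epsilon> \<noteq> 0\<close> C, of 0] by simp
qed

lemma piece_jump_ratio_indep: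
  assumes x: "x \<noteq> 0"
  shows "indep_rv (P x) traj_space (piece \<alpha> X n) borel (jump_ratio X n)"
proof -
  interpret prob_space "P x" by (rule prob)
  let ?\<epsilon> = "sgn x * (-1) ^ n"
  have \<epsilon>: "\<bar>?\<epsilon>\<bar> = 1" by (rule sgn_power_abs[OF x])
  show ?thesis
    unfolding indep_rv_def indep_sets2_eq
  proof (intro conjI piece_measurable jump_ratio_measurable ballI)
    show "{piece \<alpha> X n -` A \<inter> space (P x) |A. A \<in> sets traj_space} \<subseteq> events"
      using measurable_sets[OF piece_measurable] by blast
    show "{jump_ratio X n -` B \<inter> space (P x) |B. B \<in> sets borel} \<subseteq> events"
      using measurable_sets[OF jump_ratio_measurable] by blast
    fix a b assume "a \<in> {piece \<alpha> X n -` A \<inter> space (P x) |A. A \<in> sets traj_space}"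
      "b \<in> {jump_ratio X n -` B \<inter> space (P x) |B. B \<in> sets borel}"
    then obtain A B where A: "A \<in> sets traj_space" "a = piece \<alpha> X n -` A \<inter> space (P x)"
      and B: "B \<in> sets borel" "b = jump_ratio X n -` B \<inter> space (P x)" by blast
    note [measurable] = A(1) B(1) piece_measurable jump_ratio_measurable
    have a: "a = {\<omega>\<in>space (P x). piece \<alpha> X n \<omega> \<in> A}" and b: "b = {\<omega>\<in>space (P x). jump_ratio X n \<omega> \<in> B}"
      using A B by auto
    have "a \<inter> b = {\<omega>\<in>space (P x). (piece \<alpha> X n \<omega>, jump_ratio X n \<omega>) \<in> A \<times> B}" using a b by auto
    also have "emeasure (P x) \<dots> = emeasure (law ?\<epsilon>) {f\<in>space path_space. (pre_exit_path f, exit_ratio f) \<in> A \<times> B}"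
    proof (rule functional_law[OF x, where N="traj_space \<Otimes>\<^sub>M borel"])
      show "AE \<omega> in P x. (piece \<alpha> X n \<omega>, jump_ratio X n \<omega>) =
        (pre_exit_path (nth_path \<alpha> n (traj X \<omega>)), exit_ratio (nth_path \<alpha> n (traj X \<omega>)))"
        using AE_piece_jump_ratio[OF x] by eventually_elim simp
    qed measurable
    also have "\<dots> = emeasure (law ?\<epsilon>) {f\<in>space path_space. pre_exit_path f \<in> A \<and> exit_ratio f \<in> B}" by simp
    also have "\<dots> = emeasure (law ?\<epsilon>) {f\<in>space path_space. pre_exit_path f \<in> A} *
      emeasure (law ?\<epsilon>) {f\<in>space path_space. exit_ratio f \<in> B}"
      by (rule pre_exit_path_exit_ratio_indep[OF \<epsilon> A(1) B(1)])
    also have "\<dots> = emeasure (P x) a * emeasure (P x) b"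
      unfolding a b piece_law[OF x A(1)] jump_ratio_law[OF x B(1)] ..
    finally show "prob (a \<inter> b) = prob a * prob b"
      by (simp add: emeasure_eq_measure ennreal_mult[symmetric])
  qed
qed

end

theorem theorem4:
  fixes M :: "'w measure" and F :: "ennreal \<Rightarrow> 'w measure" and P :: "real \<Rightarrow> 'w measure"
    and X :: "real \<Rightarrow> 'w \<Rightarrow> real" and \<alpha> :: real
  assumes "real_ssmp_family M F P X \<alpha>"
    and "killed_at_zero M X"
    and "\<And>x. x \<noteq> 0 \<Longrightarrow> measure (P x) {\<omega>\<in>space (P x). sign_change_time X 1 \<omega> < \<infinity>} = 1"
  shows
    "(\<forall>x. x \<noteq> 0 \<longrightarrow>
        prob_space.indep_vars (P x) (\<lambda>_. traj_space) (piece \<alpha> X) UNIV \<and>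
        (\<forall>n. same_law (P x) (piece \<alpha> X n)
                (P (sgn x * (-1) ^ n))
                (\<lambda>\<omega>. killed_traj (sign_change_time X 1 \<omega>) (\<lambda>t. X t \<omega>)) traj_space) \<and>
        (\<forall>n. \<exists>(N :: ((real \<Rightarrow> real) \<times> real) measure) \<xi> \<zeta>.
            levy_process N \<xi> \<and> independent_exponential_time N \<xi> \<zeta> \<and>
            same_law (P x) (piece \<alpha> X n)
                N (lamperti_traj \<alpha> (sgn x * (-1) ^ n) \<xi> \<zeta>) traj_space))
   \<and> (\<forall>x. x \<noteq> 0 \<longrightarrow>
        prob_space.indep_vars (P x) (\<lambda>_. borel) (jump_ratio X) UNIV \<and>
        (\<forall>n. same_law (P x) (jump_ratio X n) (P (sgn x * (-1) ^ n)) (jump_ratio X 0) borel))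
   \<and> (\<forall>n x. x \<noteq> 0 \<longrightarrow>
        indep_rv (P x) traj_space (piece \<alpha> X n) borel (jump_ratio X n))"
proof -
  interpret sign_changing_ssmp M F P X \<alpha>
    using assms unfolding sign_changing_ssmp_def sign_changing_ssmp_axioms_def by blast
  show ?thesis
    using pieces_indep piece_same_law_first piece_same_law_lamperti jump_ratios_indep
      jump_ratio_same_law piece_jump_ratio_indep by blast
qed

end
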